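(* Assume the decay condition and the growth condition (both stated in the context) hold. Let $(s_0,\theta_0)\in\operatorname{int}\mathcal S$ and $y_0=K_0'(s_0;\theta_0)$ (equivalently, $(y_0,\theta_0)\in\mathcal Y^o$ and $s_0=\hat s_0(\theta_0,y_0)$). Suppose also that $$\nabla_\theta K_0(s_0;\theta_0)=0$$ and that $$H=\nabla_\theta^T\nabla_\theta K_0(s_0;\theta_0)-(\nabla_s\nabla_\theta K_0(s_0;\theta_0))^TK_0''(s_0;\theta_0)^{-1}(\nabla_s\nabla_\theta K_0(s_0;\theta_0))$$ is negative definite. Then there exist $n_0\in\mathbb N$ and neighbourhoods $U\subset\mathcal R$ of $\theta_0$ and $V\subset\mathbb R^{d\times1}$ of $y_0$ such that, for all $n\ge n_0$ and $y\in V$ (with $x=ny$), the functions $\theta\mapsto\hat L(\theta;x)$ and $\theta\mapsto L(\theta;x)$ have unique local maximisers in $U$. Moreover, writing these local maximisers as $\hat\theta_{\mathrm{MLE\,in\,}U}(x)$ and $\theta_{\mathrm{MLE\,in\,}U}(x)$, $$\left|\hat\theta_{\mathrm{MLE\,in\,}U}(x)-\theta_{\mathrm{MLE\,in\,}U}(x)\right|=O(1/n^2)\qquad\text{as }n\to\infty,$$ uniformly over $n\ge n_0$, $y\in V$.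
   Context: Setting. $d,p$ are positive integers and $\mathcal R\subset\mathbb R^{p\times1}$ is open. For each $\theta\in\mathcal R$, $Y_\theta$ is a random column vector in $\mathbb R^{d\times1}$ whose distribution does not depend on $n$, and for $n\in\mathbb N$, $X_\theta=\sum_{i=1}^nY^{(i)}$ where $Y^{(1)},Y^{(2)},\dots$ are i.i.d. copies of $Y_\theta$ (the dependence of $X_\theta$ on $n$ is suppressed). Let $\mathcal S_\theta=\{s\in\mathbb R^{1\times d}:\mathbb E(e^{sY_\theta})<\infty\}$, $\mathcal S=\{(s,\theta):\theta\in\mathcal R,\ s\in\mathcal S_\theta\}$, and let $\operatorname{int}\mathcal S$ be its interior in $\mathbb R^{1\times d}\times\mathbb R^{p\times 1}$. For complex row vectors $z$ with $\operatorname{Re}z\in\mathcal S_\theta$ put $M_0(z;\theta)=\mathbb E(e^{zY_\theta})$, and $K_0(s;\theta)=\log M_0(s;\theta)$ for real $s$. $K_0'=\nabla_sK_0$ is the $d\times1$ gradient and $K_0''$ the $d\times d$ Hessian with respect to $s$; $\nabla_\theta$ of a scalar is a $1\times p$ row vector, $\nabla_\theta^T\nabla_\theta K_0$ is the $p\times p$ Hessian in $\theta$, and $\nabla_s\nabla_\theta K_0$ is the $d\times p$ matrix with $i,j$ entry $\partial^2K_0/\partial s_i\partial\theta_j$. Throughout, $x\in\mathbb R^{d\times 1}$ and $y\in\mathbb R^{d\times 1}$ are related by $x=ny$. Decay condition: there is a continuous function $\delta:\operatorname{int}\mathcal S\to(0,\infty)$ such that $\left|\frac{M_0(s+\mathrm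 i\phi;\theta)}{M_0(s;\theta)}\right|\le(1+\delta(s,\theta)|\phi|^2)^{-\delta(s,\theta)}$ for all $\phi\in\mathbb R^{1\times d}$ and $(s,\theta)\in\operatorname{int}\mathcal S$. (This implies that $K_0''(s;\theta)$ is positive definite.) Growth condition: there is a continuous function $\gamma:\operatorname{int}\mathcal S\to(0,\infty)$ such that $\left|\frac{\partial^{k+\ell}M_0}{\partial\theta_{i_1}\cdots\partial\theta_{i_k}\partial s_{j_1}\cdots\partial s_{j_\ell}}(s+\mathrm i\phi;\theta)\right|\le\gamma(s,\theta)(1+|\phi|)^{\gamma(s,\theta)}$ for all $\phi\in\mathbb R^{1\times d}$ and $(s,\theta)\in\operatorname{int}\mathcal S$, for $k\in\{0,1\}$ with $1\le k+\ell\le6$ and for $k=2$ with $0\le\ell\le2$; and each of these partial derivatives exists and is continuous in all its variables. Saddlepoint. $\mathcal Y^o$ is the set of $(y,\theta)$ for which there is $s$ with $(s,\theta)\in\operatorname{int}\mathcal S$ and $K_0'(s;\theta)=y$; this $s$ is unique (strict convexity of $K_0$ in $s$) and is denoted $\hat s_0(\theta,y)$. Likelihoods. $L(\theta;x)$ is the value at $x$ of the continuous density of $X_\theta$ (which exists for $n$ large). For $(y,\theta)\in\mathcal Y^o$, the saddlepoint likelihood is, with $\hat s=\hat s_0(\theta,y)$, $$\hat L(\theta;x)=\frac{\exp\left(n[K_0(\hat s;\theta)-\hat sy]\right)}{\sqrt{\det(2\pi nK_0''(\hat s;\theta))}}.$$ *)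

theory Defs
  imports "HOL-Probability.Probability"
begin

text \<open>
  Row and column vectors of length \<open>d\<close> are both rendered as \<^typ>\<open>real ^ 'd\<close>, so the product of a
  row and a column vector is the inner product.  The model is a family of probability spaces
  \<open>P \<theta>\<close> carrying a random vector \<open>Y \<theta>\<close> and i.i.d. copies \<open>Ys \<theta> 1, Ys \<theta> 2, \<dots>\<close> of it.
\<close>

section \<open>Iterated partial derivatives\<close>

definition partial :: "'a::real_normed_vector \<Rightarrow> ('a \<Rightarrow> 'b::real_normed_vector) \<Rightarrow> 'a \<Rightarrow> 'b" where
  "partial v G q = vector_derivative (\<lambda>t::real. G (q + t *\<^sub>R v)) (at 0)"

definition partial_exists :: "'a::real_normed_vector \<Rightarrow> ('a \<Rightarrow> 'b::real_normed_vector) \<Rightarrow> 'a \<Rightarrow> bool" where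
  "partial_exists v G q \<longleftrightarrow> (\<lambda>t::real. G (q + t *\<^sub>R v)) differentiable (at 0)"

text \<open>As in the notation \<open>\<partial>\<^sup>k / \<partial>v\<^sub>1 \<dots> \<partial>v\<^sub>k\<close>, the last direction of the list is differentiated first.\<close>

fun partials :: "'a::real_normed_vector list \<Rightarrow> ('a \<Rightarrow> 'b::real_normed_vector) \<Rightarrow> 'a \<Rightarrow> 'b" where
  "partials [] G = G"
| "partials (v # vs) G = partial v (partials vs G)"

fun partials_exist_on ::
  "'a set \<Rightarrow> 'a::real_normed_vector list \<Rightarrow> ('a \<Rightarrow> 'b::real_normed_vector) \<Rightarrow> bool" where
  "partials_exist_on A [] G \<longleftrightarrow> True"
| "partials_exist_on A (v # vs) G \<longleftrightarrow>
     partials_exist_on A vs G \<and> (\<forall>q\<in>A. partial_exists v (partials vs G) q)"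

text \<open>
  Coordinate directions in a space of pairs \<open>(s, \<theta>)\<close>.  The first component may be real or complex;
  in the complex case \<open>s_dir j\<close> is the real direction of \<open>s\<^sub>j\<close> in \<open>z = s + \<i>\<phi>\<close>.
\<close>

definition s_dir :: "'d \<Rightarrow> ('a::real_normed_field ^ 'd) \<times> (real ^ 'p)" where
  "s_dir j = (axis j 1, 0)"

definition th_dir :: "'p \<Rightarrow> ('a::real_normed_field ^ 'd) \<times> (real ^ 'p)" where
  "th_dir i = (0, axis i 1)"

section \<open>Generating functions\<close>

definition cvec :: "real ^ 'd \<Rightarrow> real ^ 'd \<Rightarrow> complex ^ 'd" where
  "cvec s \<phi> = (\<chi> j. Complex (s $ j) (\<phi> $ j))"

definition Re_vec :: "complex ^ 'd \<Rightarrow> real ^ 'd" where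
  "Re_vec z = (\<chi> j. Re (z $ j))"

definition S_at ::
  "(real ^ 'p \<Rightarrow> 'w measure) \<Rightarrow> (real ^ 'p \<Rightarrow> 'w \<Rightarrow> real ^ 'd) \<Rightarrow> real ^ 'p \<Rightarrow> (real ^ 'd) set" where
  "S_at P Y \<theta> = {s. (\<integral>\<^sup>+\<omega>. ennreal (exp (s \<bullet> Y \<theta> \<omega>)) \<partial>P \<theta>) < \<infinity>}"

definition S_dom ::
  "(real ^ 'p) set \<Rightarrow> (real ^ 'p \<Rightarrow> 'w measure) \<Rightarrow> (real ^ 'p \<Rightarrow> 'w \<Rightarrow> real ^ 'd)
    \<Rightarrow> ((real ^ 'd) \<times> (real ^ 'p)) set" where
  "S_dom R P Y = {(s, \<theta>). \<theta> \<in> R \<and> s \<in> S_at P Y \<theta>}"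

definition M0 ::
  "(real ^ 'p \<Rightarrow> 'w measure) \<Rightarrow> (real ^ 'p \<Rightarrow> 'w \<Rightarrow> real ^ 'd)
    \<Rightarrow> (complex ^ 'd) \<times> (real ^ 'p) \<Rightarrow> complex" where
  "M0 P Y = (\<lambda>(z, \<theta>). \<integral>\<omega>. exp (\<Sum>j\<in>UNIV. z $ j * of_real (Y \<theta> \<omega> $ j)) \<partial>P \<theta>)"

definition K0 ::
  "(real ^ 'p \<Rightarrow> 'w measure) \<Rightarrow> (real ^ 'p \<Rightarrow> 'w \<Rightarrow> real ^ 'd)
    \<Rightarrow> (real ^ 'd) \<times> (real ^ 'p) \<Rightarrow> real" where
  "K0 P Y = (\<lambda>(s, \<theta>). ln (Re (M0 P Y (cvec s 0, \<theta>))))"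

definition grad_s :: "((real ^ 'd) \<times> (real ^ 'p) \<Rightarrow> real) \<Rightarrow> (real ^ 'd) \<times> (real ^ 'p) \<Rightarrow> real ^ 'd" where
  "grad_s K q = (\<chi> j. partial (s_dir j) K q)"

definition grad_th :: "((real ^ 'd) \<times> (real ^ 'p) \<Rightarrow> real) \<Rightarrow> (real ^ 'd) \<times> (real ^ 'p) \<Rightarrow> real ^ 'p" where
  "grad_th K q = (\<chi> i. partial (th_dir i) K q)"

definition hess_s :: "((real ^ 'd) \<times> (real ^ 'p) \<Rightarrow> real) \<Rightarrow> (real ^ 'd) \<times> (real ^ 'p) \<Rightarrow> real ^ 'd ^ 'd" where
  "hess_s K q = (\<chi> i j. partials [s_dir i, s_dir j] K q)"

definition hess_th :: "((real ^ 'd) \<times> (real ^ 'p) \<Rightarrow> real) \<Rightarrow> (real ^ 'd) \<times> (real ^ 'p) \<Rightarrow> real ^ 'p ^ 'p" where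
  "hess_th K q = (\<chi> i j. partials [th_dir i, th_dir j] K q)"

definition mixed_s_th :: "((real ^ 'd) \<times> (real ^ 'p) \<Rightarrow> real) \<Rightarrow> (real ^ 'd) \<times> (real ^ 'p) \<Rightarrow> real ^ 'p ^ 'd" where
  "mixed_s_th K q = (\<chi> i j. partials [s_dir i, th_dir j] K q)"

definition negative_definite :: "real ^ 'p ^ 'p \<Rightarrow> bool" where
  "negative_definite A \<longleftrightarrow> (\<forall>v. v \<noteq> 0 \<longrightarrow> v \<bullet> (A *v v) < 0)"

section \<open>Decay and growth conditions\<close>

definition decay_condition ::
  "(real ^ 'p) set \<Rightarrow> (real ^ 'p \<Rightarrow> 'w measure) \<Rightarrow> (real ^ 'p \<Rightarrow> 'w \<Rightarrow> real ^ 'd) \<Rightarrow> bool" where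
  "decay_condition R P Y \<longleftrightarrow>
    (\<exists>\<delta> :: (real ^ 'd) \<times> (real ^ 'p) \<Rightarrow> real.
      continuous_on (interior (S_dom R P Y)) \<delta> \<and>
      (\<forall>q \<in> interior (S_dom R P Y). \<delta> q > 0) \<and>
      (\<forall>s \<theta> \<phi>. (s, \<theta>) \<in> interior (S_dom R P Y) \<longrightarrow>
         norm (M0 P Y (cvec s \<phi>, \<theta>) / M0 P Y (cvec s 0, \<theta>))
           \<le> (1 + \<delta> (s, \<theta>) * (norm \<phi>)\<^sup>2) powr (- \<delta> (s, \<theta>))))"

definition complex_dom ::
  "(real ^ 'p) set \<Rightarrow> (real ^ 'p \<Rightarrow> 'w measure) \<Rightarrow> (real ^ 'p \<Rightarrow> 'w \<Rightarrow> real ^ 'd)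
    \<Rightarrow> ((complex ^ 'd) \<times> (real ^ 'p)) set" where
  "complex_dom R P Y = {(z, \<theta>). (Re_vec z, \<theta>) \<in> interior (S_dom R P Y)}"

definition growth_orders :: "(nat \<times> nat) set" where
  "growth_orders = {(k, l). (k \<le> 1 \<and> 1 \<le> k + l \<and> k + l \<le> 6) \<or> (k = 2 \<and> l \<le> 2)}"

definition growth_condition ::
  "(real ^ 'p) set \<Rightarrow> (real ^ 'p \<Rightarrow> 'w measure) \<Rightarrow> (real ^ 'p \<Rightarrow> 'w \<Rightarrow> real ^ 'd) \<Rightarrow> bool" where
  "growth_condition R P Y \<longleftrightarrow>
    (\<exists>\<gamma> :: (real ^ 'd) \<times> (real ^ 'p) \<Rightarrow> real.
      continuous_on (interior (S_dom R P Y)) \<gamma> \<and>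
      (\<forall>q \<in> interior (S_dom R P Y). \<gamma> q > 0) \<and>
      (\<forall>(is :: 'p list) (js :: 'd list). (length is, length js) \<in> growth_orders \<longrightarrow>
         (let vs = map th_dir is @ map s_dir js in
            partials_exist_on (complex_dom R P Y) vs (M0 P Y) \<and>
            continuous_on (complex_dom R P Y) (partials vs (M0 P Y)) \<and>
            (\<forall>s \<theta> \<phi>. (s, \<theta>) \<in> interior (S_dom R P Y) \<longrightarrow>
               norm (partials vs (M0 P Y) (cvec s \<phi>, \<theta>))
                 \<le> \<gamma> (s, \<theta>) * (1 + norm \<phi>) powr \<gamma> (s, \<theta>)))))"

section \<open>Saddlepoint and likelihoods\<close>

definition Y_dom ::
  "(real ^ 'p) set \<Rightarrow> (real ^ 'p \<Rightarrow> 'w measure) \<Rightarrow> (real ^ 'p \<Rightarrow> 'w \<Rightarrow> real ^ 'd)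
    \<Rightarrow> ((real ^ 'd) \<times> (real ^ 'p)) set" where
  "Y_dom R P Y = {(y, \<theta>). \<exists>s. (s, \<theta>) \<in> interior (S_dom R P Y) \<and> grad_s (K0 P Y) (s, \<theta>) = y}"

definition s_hat ::
  "(real ^ 'p) set \<Rightarrow> (real ^ 'p \<Rightarrow> 'w measure) \<Rightarrow> (real ^ 'p \<Rightarrow> 'w \<Rightarrow> real ^ 'd)
    \<Rightarrow> real ^ 'p \<Rightarrow> real ^ 'd \<Rightarrow> real ^ 'd" where
  "s_hat R P Y \<theta> y = (THE s. (s, \<theta>) \<in> interior (S_dom R P Y) \<and> grad_s (K0 P Y) (s, \<theta>) = y)"

definition L_hat ::
  "(real ^ 'p) set \<Rightarrow> (real ^ 'p \<Rightarrow> 'w measure) \<Rightarrow> (real ^ 'p \<Rightarrow> 'w \<Rightarrow> real ^ 'd)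
    \<Rightarrow> nat \<Rightarrow> real ^ 'p \<Rightarrow> real ^ 'd \<Rightarrow> real" where
  "L_hat R P Y n \<theta> x =
    (let y = x /\<^sub>R real n; s = s_hat R P Y \<theta> y in
       exp (real n * (K0 P Y (s, \<theta>) - s \<bullet> y))
         / sqrt (det ((2 * pi * real n) *\<^sub>R hess_s (K0 P Y) (s, \<theta>))))"

definition continuous_density_of_sum ::
  "(real ^ 'p \<Rightarrow> 'w measure) \<Rightarrow> (real ^ 'p \<Rightarrow> nat \<Rightarrow> 'w \<Rightarrow> real ^ 'd)
    \<Rightarrow> nat \<Rightarrow> real ^ 'p \<Rightarrow> (real ^ 'd \<Rightarrow> real) \<Rightarrow> bool" where
  "continuous_density_of_sum P Ys n \<theta> f \<longleftrightarrow>
    continuous_on UNIV f \<and> (\<forall>x. 0 \<le> f x) \<and>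
    distributed (P \<theta>) lborel (\<lambda>\<omega>. \<Sum>i\<in>{1..n}. Ys \<theta> i \<omega>) (\<lambda>x. ennreal (f x))"

text \<open>A continuous density is unique if it exists; otherwise the value of \<open>L\<close> is meaningless.\<close>

definition L ::
  "(real ^ 'p \<Rightarrow> 'w measure) \<Rightarrow> (real ^ 'p \<Rightarrow> nat \<Rightarrow> 'w \<Rightarrow> real ^ 'd)
    \<Rightarrow> nat \<Rightarrow> real ^ 'p \<Rightarrow> real ^ 'd \<Rightarrow> real" where
  "L P Ys n \<theta> x = (THE f. continuous_density_of_sum P Ys n \<theta> f) x"

section \<open>Local maximisers\<close>

definition local_maximiser_in :: "'a::topological_space set \<Rightarrow> ('a \<Rightarrow> real) \<Rightarrow> 'a \<Rightarrow> bool" where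
  "local_maximiser_in U f t \<longleftrightarrow> t \<in> U \<and> (\<forall>\<^sub>F t' in at t within U. f t' \<le> f t)"

definition the_local_maximiser_in :: "'a::topological_space set \<Rightarrow> ('a \<Rightarrow> real) \<Rightarrow> 'a" where
  "the_local_maximiser_in U f = (THE t. local_maximiser_in U f t)"

end

theory Submission
  imports Defs "HOL-Complex_Analysis.Conformal_Mappings"
begin

text \<open>
  For any tilt \<open>s\<close>, Fourier inversion writes the density at \<open>x = n y\<close> as an integral of \<open>M0 ^ n\<close> over the
  contour \<open>Re z = s\<close>.  With \<open>s\<close> the saddlepoint, Laplace's method shows that the gradients of
  \<open>ln L / n\<close> and \<open>ln L_hat / n\<close> with respect to the parameter are both \<open>g0 + e / n + O(1 / n^2)\<close>, where \<open>g0\<close> is the gradient of the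
  profile \<open>K0 (s_hat, \<theta>) - s_hat y\<close> and the error is small in the Lipschitz sense as well.  The derivative of the profile gradient
  at the base point is the Schur complement \<open>H\<close>, so near it both gradients are strongly monotone, uniformly
  in \<open>n\<close> and \<open>y\<close>.  Hence each has exactly one zero, which is the unique local maximiser, and the two zeros
  differ by at most a constant times the distance \<open>O(1 / n^2)\<close> of the gradients.
\<close>

section \<open>Calculus\<close>

text \<open>The conclusion is uniform in \<open>n\<close> and \<open>y\<close>, which shapes every
  estimate. The parameter is differentiated only once under the integral; whatever would call for
  another derivative is a Lipschitz estimate, obtained by running one Laplace expansion on the
  difference of two members of the family. Likewise the saddlepoint is never differentiated:
  \<open>s_hat\<close> is shown to be Lipschitz, and strict differentiability of the gradient of
  \<open>K\<close> at the base point, which compares two nearby points directly, does the rest. The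
  order 1/n^2 has two sources. The derivative integrand \<open>fq i\<close> vanishes at the
  saddlepoint and odd orders cancel by symmetry, so its integral has the form c/n + O(1/n^2) without
  a term of order n^(-1/2) or 1. And c/n, divided by the Gaussian factor, must be the gradient of
  the logarithm of that factor, because derivatives that converge uniformly converge to the
  derivative of the limit. For the same reason the Gaussian factor is kept as an integral and is
  compared with the determinant only up to a constant.\<close>

lemma Cauchy_coefficient_bound:
 fixes F :: "complex => complex"
 assumes hol: "F holomorphic_on ball 0 R" and R: "R > 0"
  and B: "!!t. norm t < R ==> norm (F t) <= B"
 shows "norm ((deriv ^^ k) F 0 / fact k) <= B / R ^ k"
proof -
 have B0: "B >= 0" using order_trans[OF norm_ge_zero B[of 0]] R by simp
 \<comment> \<open>\<open>F\<close> need not extend to the circle of radius \<open>R\<close>, so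
   Cauchy's inequality is used on smaller circles and \<open>r\<close> then tends to
   \<open>R\<close>.\<close>
 have *: "norm ((deriv ^^ k) F 0 / fact k) * r ^ k <= B" if r: "0 < r" "r < R" for r
 proof -
  have "norm ((deriv ^^ k) F 0) <= fact k * B / r ^ k"
  proof (rule Cauchy_inequality)
   show "F holomorphic_on ball 0 r" using hol r by (auto intro: holomorphic_on_subset)
   show "continuous_on (cball 0 r) F"
    using hol r by (intro holomorphic_on_imp_continuous_on) (auto intro: holomorphic_on_subset)
   show "norm (F x) <= B" if "norm (0 - x) = r" for x using B[of x] that r by simp
  qed (use r in auto)
  thus ?thesis using r by (simp add: norm_divide field_simps)
 qed
 have "norm ((deriv ^^ k) F 0 / fact k) * R ^ k <= B"
 proof (rule tendsto_le[OF _ tendsto_const])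
  show "((%r. norm ((deriv ^^ k) F 0 / fact k) * r ^ k) \<longlongrightarrow> norm ((deriv ^^ k) F 0 / fact k) * R ^ k) (at_left R)"
   by (intro tendsto_intros)
  show "\<forall>\<^sub>F r in at_left R. norm ((deriv ^^ k) F 0 / fact k) * r ^ k <= B"
   using eventually_at_left_real[OF R] by eventually_elim (use * in auto)
 qed simp
 thus ?thesis using R by (simp add: field_simps)
qed

text \<open>Keeping \<open>t\<close> in half the disc makes the tail of the power series geometric
  with ratio at most 1/2, whence the factor 2.\<close>

lemma holomorphic_taylor_bound:
 fixes F :: "complex => complex"
 assumes hol: "F holomorphic_on ball 0 R" and R: "R > 0"
  and B: "!!t. norm t < R ==> norm (F t) <= B" and t: "norm t <= R / 2"
 shows "norm (F t - (\<Sum>k<K. (deriv ^^ k) F 0 / fact k * t ^ k)) <= 2 * B * (norm t / R) ^ K"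
proof -
 define a where "a k = (deriv ^^ k) F 0 / fact k" for k
 have B0: "B >= 0" using order_trans[OF norm_ge_zero B[of 0]] R by simp
 have sums: "(%k. a k * t ^ k) sums F t"
  using holomorphic_power_series[OF hol, of t] t R by (simp add: a_def)
 have ab: "norm (a k * t ^ k) <= B * (norm t / R) ^ k" for k
  using mult_right_mono[OF Cauchy_coefficient_bound[OF hol R B, of k], of "norm t ^ k"]
  by (simp add: a_def norm_mult norm_power norm_divide power_divide)
 have tail: "norm (a (k + K) * t ^ (k + K)) <= B * (norm t / R) ^ K * (1/2) ^ k" for k
 proof -
  have "(norm t / R) ^ k <= (1/2) ^ k" using t R by (intro power_mono) (auto simp: field_simps)
  hence "B * (norm t / R) ^ K * (norm t / R) ^ k <= B * (norm t / R) ^ K * (1/2) ^ k"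
   using B0 R by (intro mult_left_mono) auto
  thus ?thesis using ab[of "k + K"] by (simp add: power_add mult_ac)
 qed
 have g: "(%k. B * (norm t / R) ^ K * (1/2) ^ k) sums (B * (norm t / R) ^ K * 2)"
  using geometric_sums[of "1/2 :: real"] by (intro sums_mult) simp
 have s: "(%k. a (k + K) * t ^ (k + K)) sums (F t - (\<Sum>k<K. a k * t ^ k))"
  by (rule sums_split_initial_segment[OF sums])
 have "norm (F t - (\<Sum>k<K. a k * t ^ k)) <= (\<Sum>k. B * (norm t / R) ^ K * (1/2) ^ k)"
  using norm_suminf_le[OF tail sums_summable[OF g]] sums_unique[OF s] by simp
 also have "... = 2 * B * (norm t / R) ^ K" using sums_unique[OF g] by (simp add: mult_ac)
 finally show ?thesis by (simp add: a_def)
qed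

text \<open>Strict differentiability: two arbitrary points near \<open>a\<close> are compared by the
  derivative at \<open>a\<close>. The path from \<open>x\<close> to \<open>y\<close> changes one
  coordinate at a time, and the mean value inequality is applied on each piece.\<close>

lemma strict_derivative_from_partials:
 fixes f :: "'a::euclidean_space => 'b::real_normed_vector"
 assumes D: "!!b z. b \<in> Basis ==> z \<in> ball a r ==>
   ((%t. f (z + t *\<^sub>R b)) has_vector_derivative D b z) (at 0)"
  and \<eta>: "!!b z. b \<in> Basis ==> z \<in> ball a r ==> norm (D b z - D b a) <= \<eta>"
  and x: "x \<in> ball a (r / 4)" and y: "y \<in> ball a (r / 4)"
 shows "norm (f y - f x - (SUM b:Basis. ((y - x) \<bullet> b) *\<^sub>R D b a)) <= \<eta> * (SUM b:Basis. \<bar>(y - x) \<bullet> b\<bar>)"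
proof -
 have r: "r > 0" using x zero_le_dist[of a x] by (simp add: mem_ball del: zero_le_dist)
 have yx: "norm (y - x) < r / 2"
  using x y dist_triangle[of y x a] by (simp add: dist_commute flip: dist_norm)
 define c where "c b = (y - x) \<bullet> b" for b
 \<comment> \<open>Corners and edges of the coordinate path all have this form: the offset from
   \<open>x\<close> is dominated by \<open>y - x\<close> in every coordinate, hence in norm.\<close>
 have inball: "x + v \<in> ball a r" if "!!b. b \<in> Basis ==> \<bar>v \<bullet> b\<bar> <= \<bar>c b\<bar>" for v
 proof -
  have "norm v <= norm (y - x)" using that by (intro norm_le_componentwise) (auto simp: c_def)
  moreover have "dist a (x + v) <= dist a x + norm v"
   using dist_triangle[of a "x + v" x] by (simp add: dist_norm)
  ultimately show ?thesis using x yx r by simp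
 qed
 have "norm (f (x + (SUM b:B. c b *\<^sub>R b)) - f x - (SUM b:B. c b *\<^sub>R D b a)) <= \<eta> * (SUM b:B. \<bar>c b\<bar>)"
  if "finite B" "B \<subseteq> Basis" for B using that
 proof (induction B rule: finite_induct)
  case (insert e B)
  define z where "z = x + (SUM b:B. c b *\<^sub>R b)"
  have seg: "z + t *\<^sub>R e \<in> ball a r" if t: "\<bar>t\<bar> <= \<bar>c e\<bar>" for t
  proof -
   have "\<bar>((SUM b:B. c b *\<^sub>R b) + t *\<^sub>R e) \<bullet> b\<bar> <= \<bar>c b\<bar>" if b: "b \<in> Basis" for b
   proof -
    have "(SUM b':B. c b' *\<^sub>R b') \<bullet> b = (SUM b':B. if b' = b then c b' else 0)"
     using insert.prems b by (auto simp: inner_sum_left inner_Basis intro!: sum.cong)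
    also have "... = (if b \<in> B then c b else 0)" using insert.hyps by (simp add: sum.delta)
    finally show ?thesis using t b insert by (auto simp: inner_add_left inner_Basis)
   qed
   thus ?thesis using inball[of "(SUM b:B. c b *\<^sub>R b) + t *\<^sub>R e"] by (simp add: z_def add.assoc)
  qed
  have eB: "e \<in> Basis" using insert.prems by auto
  have dg: "((%t. f (z + t *\<^sub>R e) - t *\<^sub>R D e a) has_derivative (%h. h *\<^sub>R (D e (z + t *\<^sub>R e) - D e a)))
    (at t within closed_segment 0 (c e))" if "t \<in> closed_segment 0 (c e)" for t
  proof -
   have "\<bar>t\<bar> <= \<bar>c e\<bar>" using that by (auto simp: closed_segment_eq_real_ivl split: if_splits)
   from D[OF eB seg[OF this]]
   have 1: "((%s. f (z + t *\<^sub>R e + s *\<^sub>R e)) has_vector_derivative D e (z + t *\<^sub>R e)) (at 0)" by simp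
   have 2: "((%s. s - t) has_vector_derivative 1) (at t)"
    by (auto intro!: derivative_eq_intros)
   have "((%s. f (z + t *\<^sub>R e + s *\<^sub>R e)) \<circ> (%s. s - t) has_vector_derivative (1::real) *\<^sub>R D e (z + t *\<^sub>R e)) (at t)"
    by (rule vector_diff_chain_at[OF 2]) (use 1 in simp)
   moreover have "(%s. f (z + t *\<^sub>R e + s *\<^sub>R e)) \<circ> (%s. s - t) = (%s. f (z + s *\<^sub>R e))"
    by (auto simp: algebra_simps)
   ultimately have "((%s. f (z + s *\<^sub>R e)) has_vector_derivative D e (z + t *\<^sub>R e)) (at t)" by simp
   hence "((%s. f (z + s *\<^sub>R e)) has_derivative (%h. h *\<^sub>R D e (z + t *\<^sub>R e))) (at t within closed_segment 0 (c e))"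
    unfolding has_vector_derivative_def by (rule has_derivative_at_withinI)
   thus ?thesis by (auto intro!: derivative_eq_intros simp: algebra_simps)
  qed
  have "norm ((f (z + c e *\<^sub>R e) - c e *\<^sub>R D e a) - (f (z + 0 *\<^sub>R e) - 0 *\<^sub>R D e a)) <= \<eta> * norm (c e - 0)"
  proof (rule differentiable_bound[OF convex_closed_segment dg])
   fix t assume "t \<in> closed_segment 0 (c e)"
   hence "\<bar>t\<bar> <= \<bar>c e\<bar>" by (auto simp: closed_segment_eq_real_ivl split: if_splits)
   from \<eta>[OF eB seg[OF this]] show "onorm (%h. h *\<^sub>R (D e (z + t *\<^sub>R e) - D e a)) <= \<eta>"
    by (intro onorm_le) (use mult_left_mono[OF \<eta>[OF eB seg[OF \<open>\<bar>t\<bar> <= \<bar>c e\<bar>\<close>]] abs_ge_zero] in \<open>simp add: mult.commute\<close>)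
  qed auto
  hence 1: "norm (f (z + c e *\<^sub>R e) - f z - c e *\<^sub>R D e a) <= \<eta> * \<bar>c e\<bar>" by (simp add: algebra_simps)
  have 2: "norm (f z - f x - (SUM b:B. c b *\<^sub>R D b a)) <= \<eta> * (SUM b:B. \<bar>c b\<bar>)"
   using insert unfolding z_def by auto
  have "f (x + (SUM b:insert e B. c b *\<^sub>R b)) - f x - (SUM b:insert e B. c b *\<^sub>R D b a)
    = (f (z + c e *\<^sub>R e) - f z - c e *\<^sub>R D e a) + (f z - f x - (SUM b:B. c b *\<^sub>R D b a))"
   using insert.hyps by (simp add: z_def algebra_simps)
  also have "norm ... <= \<eta> * \<bar>c e\<bar> + \<eta> * (SUM b:B. \<bar>c b\<bar>)" by (rule norm_triangle_mono[OF 1 2])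
  finally show ?case using insert.hyps by (simp add: algebra_simps)
 qed simp
 from this[OF finite_Basis order_refl] show ?thesis
  using euclidean_representation[of "y - x"] by (simp add: c_def)
qed

lemma sum_abs_inner_Basis_le: "(SUM b:Basis. \<bar>x \<bullet> b\<bar>) <= DIM('a) * norm (x::'a::euclidean_space)"
 using sum_bounded_above[of Basis "%b. \<bar>x \<bullet> b\<bar>" "norm x"] Basis_le_norm[of _ x] by simp

lemma strictly_differentiable_from_partials:
 fixes f :: "'a::euclidean_space => 'b::real_normed_vector"
 assumes A: "open A" "a \<in> A"
  and D: "!!b z. b \<in> Basis ==> z \<in> A ==>
   ((%t. f (z + t *\<^sub>R b)) has_vector_derivative D b z) (at 0)"
  and c: "!!b. b \<in> Basis ==> continuous_on A (D b)" and e: "e > 0"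
 shows "EX r>0. ALL x:ball a r. ALL y:ball a r.
  norm (f y - f x - (SUM b:Basis. ((y - x) \<bullet> b) *\<^sub>R D b a)) <= e * norm (y - x)"
proof -
 define \<eta> where "\<eta> = e / (DIM('a))"
 have \<eta>: "\<eta> > 0" using e by (simp add: \<eta>_def)
 have "\<forall>\<^sub>F z in nhds a. ALL b:Basis. norm (D b z - D b a) <= \<eta>"
 proof (intro eventually_ball_finite ballI)
  fix b :: 'a assume b: "b \<in> Basis"
  have "isCont (D b) a" using c[OF b] A by (simp add: continuous_on_eq_continuous_at)
  hence "((D b) \<longlongrightarrow> D b a) (nhds a)" by (simp add: continuous_at tendsto_at_iff_tendsto_nhds)
  from tendstoD[OF this \<eta>] show "\<forall>\<^sub>F z in nhds a. norm (D b z - D b a) <= \<eta>"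
   by eventually_elim (auto simp: dist_norm)
 qed auto
 moreover have "\<forall>\<^sub>F z in nhds a. z \<in> A" using A by (rule eventually_nhds_in_open)
 ultimately have "\<forall>\<^sub>F z in nhds a. z \<in> A & (ALL b:Basis. norm (D b z - D b a) <= \<eta>)" by eventually_elim auto
 then obtain r where r: "r > 0" "!!z. dist z a < r ==> z \<in> A & (ALL b:Basis. norm (D b z - D b a) <= \<eta>)"
  unfolding eventually_nhds_metric by auto
 show ?thesis
 proof (intro exI[of _ "r/4"] conjI ballI)
  fix x y assume xy: "x \<in> ball a (r/4)" "y \<in> ball a (r/4)"
  have "norm (f y - f x - (SUM b:Basis. ((y - x) \<bullet> b) *\<^sub>R D b a)) <= \<eta> * (SUM b:Basis. \<bar>(y - x) \<bullet> b\<bar>)"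
   using r(2) by (intro strict_derivative_from_partials[OF D _ xy]) (auto simp: dist_commute)
  also have "... <= \<eta> * (DIM('a) * norm (y - x))" using \<eta> by (intro mult_left_mono sum_abs_inner_Basis_le) auto
  also have "... = e * norm (y - x)" by (simp add: \<eta>_def)
  finally show "norm (f y - f x - (SUM b:Basis. ((y - x) \<bullet> b) *\<^sub>R D b a)) <= e * norm (y - x)" .
 qed (use r in auto)
qed

lemma has_derivative_from_partials:
 fixes f :: "'a::euclidean_space => 'b::real_normed_vector"
 assumes A: "open A" "a \<in> A"
  and D: "!!b z. b \<in> Basis ==> z \<in> A ==>
   ((%t. f (z + t *\<^sub>R b)) has_vector_derivative D b z) (at 0)"
  and c: "!!b. b \<in> Basis ==> continuous_on A (D b)"
 shows "(f has_derivative (%v. SUM b:Basis. (v \<bullet> b) *\<^sub>R D b a)) (at a)"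
 unfolding has_derivative_at_alt
proof (intro conjI allI impI)
 show "bounded_linear (%v. SUM b:Basis. (v \<bullet> b) *\<^sub>R D b a)"
  by (intro bounded_linear_sum bounded_linear_scaleR_const bounded_linear_inner_left)
 fix e :: real assume "e > 0"
 from strictly_differentiable_from_partials[OF A D c this] obtain r where
  r: "r > 0" "!!x y. x\<in>ball a r ==> y\<in>ball a r ==>
  norm (f y - f x - (SUM b:Basis. ((y - x) \<bullet> b) *\<^sub>R D b a)) <= e * norm (y - x)" by blast
 show "EX d>0. ALL y. norm (y - a) < d --> norm (f y - f a - (SUM b:Basis. ((y - a) \<bullet> b) *\<^sub>R D b a)) <= e * norm (y - a)"
  using r(1) r(2)[of a] by (intro exI[of _ r]) (auto simp: dist_norm norm_minus_commute)
qed

lemma has_real_derivative_shift: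
 fixes f :: "'a::real_normed_vector => real"
 assumes "((%s. f (x + t *\<^sub>R v + s *\<^sub>R v)) has_real_derivative D) (at 0)"
 shows "((%s. f (x + s *\<^sub>R v)) has_real_derivative D) (at t)"
proof -
 have "(%s. f (x + t *\<^sub>R v + s *\<^sub>R v)) = (%s. f (x + (s + t) *\<^sub>R v))"
  by (simp only: scaleR_left_distrib add.assoc add.commute[of "t *\<^sub>R v"])
 with assms show ?thesis using DERIV_shift[of "%s. f (x + s *\<^sub>R v)" D 0 t] by simp
qed

text \<open>The second mixed partial need not be assumed to exist: Schwarz's argument produces it.\<close>

lemma Schwarz_mixed_partial:
 fixes f Fv Fw Fvw :: "'a::real_normed_vector => real"
 assumes A: "open A" "q \<in> A"
  and v: "!!x. x \<in> A ==> ((%t. f (x + t *\<^sub>R v)) has_real_derivative Fv x) (at 0)"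
  and w: "!!x. x \<in> A ==> ((%t. f (x + t *\<^sub>R w)) has_real_derivative Fw x) (at 0)"
  and vw: "!!x. x \<in> A ==> ((%t. Fw (x + t *\<^sub>R v)) has_real_derivative Fvw x) (at 0)"
  and c: "continuous_on A Fvw"
 shows "((%t. Fv (q + t *\<^sub>R w)) has_real_derivative Fvw q) (at 0)"
proof -
 have "EX d>0. ALL k. k ~= 0 & norm (k - 0) < d --> norm ((Fv (q + k *\<^sub>R w) - Fv q) / k - Fvw q) < e" if e: "e > 0" for e
 proof -
  have "isCont Fvw q" using c A by (simp add: continuous_on_eq_continuous_at)
  then obtain d1 where d1: "d1 > 0" "!!x. norm (x - q) < d1 ==> norm (Fvw x - Fvw q) < e/2"
   unfolding continuous_at_eps_delta dist_norm using e by (metis half_gt_zero)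
  obtain d2 where d2: "d2 > 0" "ball q d2 \<subseteq> A" using A open_contains_ball by blast
  define d where "d = min d1 d2 / (1 + norm v + norm w)"
  have nvw: "1 + norm v + norm w > 0" by (smt (verit) norm_ge_zero)
  have dpos: "d > 0" using d1 d2 nvw by (simp add: d_def)
  have near: "norm (h *\<^sub>R v + k *\<^sub>R w) < min d1 d2" if "\<bar>h\<bar> < d" "\<bar>k\<bar> < d" for h k
  proof -
   have "norm (h *\<^sub>R v + k *\<^sub>R w) <= \<bar>h\<bar> * norm v + \<bar>k\<bar> * norm w" by (rule norm_triangle_le) simp
   also have "... <= d * norm v + d * norm w" using that by (intro add_mono mult_right_mono) auto
   also have "... < d * (1 + norm v + norm w)" using dpos by (simp add: algebra_simps)
   also have "... = min d1 d2" using nvw by (simp add: d_def)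
   finally show ?thesis .
  qed
  have inA: "q + h *\<^sub>R v + k *\<^sub>R w \<in> A" if "\<bar>h\<bar> < d" "\<bar>k\<bar> < d" for h k
   using near[OF that] d2 by (auto simp: dist_norm subset_iff add.assoc norm_minus_commute)
  have Dv: "((%t. f (q + k *\<^sub>R w + t *\<^sub>R v)) has_real_derivative Fv (q + k *\<^sub>R w + h *\<^sub>R v)) (at h)"
   if "\<bar>h\<bar> < d" "\<bar>k\<bar> < d" for h k
   using inA[OF that] by (intro has_real_derivative_shift[OF v]) (simp add: algebra_simps)
  have Dw: "((%t. f (q + h *\<^sub>R v + t *\<^sub>R w)) has_real_derivative Fw (q + h *\<^sub>R v + k *\<^sub>R w)) (at k)"
   if "\<bar>h\<bar> < d" "\<bar>k\<bar> < d" for h k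
   using inA[OF that] by (intro has_real_derivative_shift[OF w]) (simp add: algebra_simps)
  have Dvw: "((%t. Fw (q + k *\<^sub>R w + t *\<^sub>R v)) has_real_derivative Fvw (q + k *\<^sub>R w + h *\<^sub>R v)) (at h)"
   if "\<bar>h\<bar> < d" "\<bar>k\<bar> < d" for h k
   using inA[OF that] by (intro has_real_derivative_shift[OF vw]) (simp add: algebra_simps)
  have lin: "((%t. t * c) has_real_derivative c) (at x)" for c x :: real
   by (auto intro!: derivative_eq_intros)
  \<comment> \<open>The second difference is treated by the mean value inequality along
    \<open>w\<close> and then along \<open>v\<close>, which involves \<open>Fw\<close> and
    \<open>Fvw\<close> but no derivative of \<open>Fv\<close>.\<close>
  have main: "\<bar>f (q + h *\<^sub>R v + k *\<^sub>R w) - f (q + h *\<^sub>R v) - f (q + k *\<^sub>R w) + f q - h * k * Fvw q\<bar>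
    <= \<bar>h\<bar> * \<bar>k\<bar> * (e/2)" if h: "\<bar>h\<bar> < d" and k: "\<bar>k\<bar> < d" for h k
  proof -
   let ?g = "%t. f (q + h *\<^sub>R v + t *\<^sub>R w) - f (q + t *\<^sub>R w) - t * (h * Fvw q)"
   have kk: "\<bar>t\<bar> < d" if "t \<in> closed_segment 0 k" for t
    using that k by (auto simp: closed_segment_eq_real_ivl split: if_splits)
   have "norm (?g k - ?g 0) <= (\<bar>h\<bar> * (e/2)) * norm (k - 0)"
   proof (rule field_differentiable_bound[OF convex_closed_segment[of 0 k]])
    fix t assume t: "t \<in> closed_segment 0 k"
    show "(?g has_real_derivative Fw (q + h *\<^sub>R v + t *\<^sub>R w) - Fw (q + 0 *\<^sub>R v + t *\<^sub>R w) - h * Fvw q) (at t within closed_segment 0 k)"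
    proof (rule has_field_derivative_at_within)
     have "((%t. f (q + t *\<^sub>R w)) has_real_derivative Fw (q + 0 *\<^sub>R v + t *\<^sub>R w)) (at t)"
      using Dw[of 0, OF _ kk[OF t]] dpos by simp
     from DERIV_diff[OF DERIV_diff[OF Dw[OF h kk[OF t]] this] lin]
     show "(?g has_real_derivative Fw (q + h *\<^sub>R v + t *\<^sub>R w) - Fw (q + 0 *\<^sub>R v + t *\<^sub>R w) - h * Fvw q) (at t)" .
    qed
    have hh: "\<bar>u\<bar> < d" if "u \<in> closed_segment 0 h" for u
     using that h by (auto simp: closed_segment_eq_real_ivl split: if_splits)
    let ?k = "%u. Fw (q + t *\<^sub>R w + u *\<^sub>R v) - u * Fvw q"
    have "norm (?k h - ?k 0) <= (e/2) * norm (h - 0)"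
    proof (rule field_differentiable_bound[OF convex_closed_segment[of 0 h]])
     fix u assume u: "u \<in> closed_segment 0 h"
     show "(?k has_real_derivative Fvw (q + t *\<^sub>R w + u *\<^sub>R v) - Fvw q) (at u within closed_segment 0 h)"
      by (rule has_field_derivative_at_within[OF DERIV_diff[OF Dvw[OF hh[OF u] kk[OF t]] lin]])
     show "norm (Fvw (q + t *\<^sub>R w + u *\<^sub>R v) - Fvw q) <= e/2"
      using d1(2)[of "q + t *\<^sub>R w + u *\<^sub>R v"] near[OF hh[OF u] kk[OF t]] by (simp add: algebra_simps)
    qed auto
    thus "norm (Fw (q + h *\<^sub>R v + t *\<^sub>R w) - Fw (q + 0 *\<^sub>R v + t *\<^sub>R w) - h * Fvw q) <= \<bar>h\<bar> * (e/2)"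
     by (simp add: algebra_simps)
   qed auto
   thus ?thesis by (simp add: algebra_simps)
  qed
  have "\<bar>Fv (q + k *\<^sub>R w) - Fv q - k * Fvw q\<bar> <= \<bar>k\<bar> * (e/2)" if k: "\<bar>k\<bar> < d" for k
  proof -
   \<comment> \<open>Dividing by \<open>h\<close> and letting \<open>h\<close> tend to 0 with
     \<open>k\<close> fixed turns the second difference into a first difference of
     \<open>Fv\<close>.\<close>
   let ?G = "%h. f (q + k *\<^sub>R w + h *\<^sub>R v) - f (q + 0 *\<^sub>R w + h *\<^sub>R v) - h * (k * Fvw q)"
   have G: "(?G has_real_derivative (Fv (q + k *\<^sub>R w) - Fv q - k * Fvw q)) (at 0)"
    using DERIV_diff[OF DERIV_diff[OF Dv[of 0 k] Dv[of 0 0]] lin] k dpos by simp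
   hence "((%h. (?G h - ?G 0) / h) \<longlongrightarrow> (Fv (q + k *\<^sub>R w) - Fv q - k * Fvw q)) (at 0)"
    by (simp add: has_field_derivative_iff)
   hence "((%h. \<bar>(?G h - ?G 0) / h\<bar>) \<longlongrightarrow> \<bar>Fv (q + k *\<^sub>R w) - Fv q - k * Fvw q\<bar>) (at 0)"
    by (rule tendsto_rabs)
   thus ?thesis
   proof (rule tendsto_upperbound)
    show "\<forall>\<^sub>F h in at 0. \<bar>(?G h - ?G 0) / h\<bar> <= \<bar>k\<bar> * (e / 2)"
     unfolding eventually_at
    proof (intro exI[of _ d] conjI ballI impI dpos)
     fix h :: real assume "h ~= 0 & dist h 0 < d"
     hence h: "h ~= 0" "\<bar>h\<bar> < d" by auto
     have "\<bar>?G h - ?G 0\<bar> <= \<bar>h\<bar> * \<bar>k\<bar> * (e/2)" using main[OF h(2) k] by (simp add: algebra_simps)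
     thus "\<bar>(?G h - ?G 0) / h\<bar> <= \<bar>k\<bar> * (e / 2)" using h(1)
      by (simp add: abs_divide divide_le_eq mult.assoc mult.commute mult.left_commute)
    qed
   qed simp
  qed note est = this
  show ?thesis
  proof (intro exI[of _ d] conjI allI impI dpos)
   fix k :: real assume "k ~= 0 & norm (k - 0) < d"
   hence k: "k ~= 0" "\<bar>k\<bar> < d" by auto
   have "(Fv (q + k *\<^sub>R w) - Fv q) / k - Fvw q = (Fv (q + k *\<^sub>R w) - Fv q - k * Fvw q) / k"
    using k by (simp add: field_simps)
   also have "norm ... <= e/2" using est[OF k(2)] k by (simp add: abs_divide divide_le_eq mult.commute)
   finally show "norm ((Fv (q + k *\<^sub>R w) - Fv q) / k - Fvw q) < e" using e by linarith
  qed
 qed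
 thus ?thesis by (simp add: has_field_derivative_iff LIM_def dist_norm)
qed

text \<open>Compactness gives a maximum on the closed ball. On the sphere, monotonicity contributes
  a slope of at least \<open>k * r\<close> towards the centre, and \<open>G a\<close> is too small
  to cancel it, so the maximum is interior and \<open>G\<close> vanishes there.\<close>

lemma strongly_monotone_gradient_maximiser:
 fixes F :: "'a::euclidean_space => real" and G :: "'a => 'a"
 assumes r: "r > 0"
  and D: "!!x v. x \<in> cball a r ==> ((%t. F (x + t *\<^sub>R v)) has_real_derivative (G x \<bullet> v)) (at 0)"
  and cG: "continuous_on (cball a r) G"
  and mono: "!!x y. x \<in> cball a r ==> y \<in> cball a r ==> (G x - G y) \<bullet> (x - y) <= - k * (norm (x - y))\<^sup>2"
  and Ga: "norm (G a) < k * r"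
 shows "EX z:ball a r. G z = 0 & (ALL y:cball a r. F y <= F z)"
proof -
 have "compact (G ` cball a r)" by (intro compact_continuous_image cG compact_cball)
 then obtain B where B: "!!x. x \<in> cball a r ==> norm (G x) <= B"
  using compact_imp_bounded bounded_iff by (metis image_eqI)
 have inc: "x + t *\<^sub>R (y - x) \<in> cball a r" if "x \<in> cball a r" "y \<in> cball a r" "0 <= t" "t <= 1" for x y t
 proof -
  have "(1 - t) *\<^sub>R x + t *\<^sub>R y \<in> cball a r" using that by (intro convexD[OF convex_cball]) auto
  thus ?thesis by (simp add: algebra_simps)
 qed
 \<comment> \<open>Directional derivatives alone do not give continuity of \<open>F\<close>; it
   follows from the bound on the continuous field \<open>G\<close> over the compact ball.\<close>
 have lip: "\<bar>F y - F x\<bar> <= B * norm (y - x)" if xy: "x \<in> cball a r" "y \<in> cball a r" for x y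
 proof -
  have "norm ((%t. F (x + t *\<^sub>R (y - x))) 1 - (%t. F (x + t *\<^sub>R (y - x))) 0) <= (B * norm (y - x)) * norm (1 - 0 :: real)"
  proof (rule field_differentiable_bound[of "{0..1}"])
   fix t :: real assume t: "t \<in> {0..1}"
   have c: "x + t *\<^sub>R (y - x) \<in> cball a r" using inc[OF xy] t by simp
   show "((%t. F (x + t *\<^sub>R (y - x))) has_real_derivative G (x + t *\<^sub>R (y - x)) \<bullet> (y - x)) (at t within {0..1})"
    by (rule has_field_derivative_at_within[OF has_real_derivative_shift[OF D[OF c]]])
   show "norm (G (x + t *\<^sub>R (y - x)) \<bullet> (y - x)) <= B * norm (y - x)"
    using Cauchy_Schwarz_ineq2[of "G (x + t *\<^sub>R (y - x))" "y - x"] mult_right_mono[OF B[OF c] norm_ge_zero[of "y - x"]]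
    by simp
  qed auto
  thus ?thesis by simp
 qed
 have B0: "0 <= B" using order_trans[OF norm_ge_zero B[of a]] r by simp
 have "B-lipschitz_on (cball a r) F"
  using lip B0 by (intro lipschitz_onI) (auto simp: dist_norm)
 hence "continuous_on (cball a r) F" by (rule lipschitz_on_continuous_on)
 then obtain z where z: "z \<in> cball a r" "!!y. y \<in> cball a r ==> F y <= F z"
  using continuous_attains_sup[OF compact_cball[of a r], of F] r by (auto simp: Bex_def)
 have zball: "z \<in> ball a r"
 proof (rule ccontr)
  assume "z \<notin> ball a r"
  hence nz: "norm (z - a) = r" using z(1) by (simp add: dist_norm norm_minus_commute)
  have "G z \<bullet> (a - z) = - ((G z - G a) \<bullet> (z - a)) - G a \<bullet> (z - a)" by (simp add: algebra_simps inner_diff_left inner_diff_right)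
  moreover have "(G z - G a) \<bullet> (z - a) <= - k * r\<^sup>2" using mono[OF z(1), of a] r nz by simp
  moreover have "G a \<bullet> (z - a) <= norm (G a) * r" using norm_cauchy_schwarz[of "G a" "z - a"] nz by simp
  moreover have "norm (G a) * r < k * r * r" using Ga r by (rule mult_strict_right_mono)
  ultimately have pos: "0 < G z \<bullet> (a - z)" by (simp add: power2_eq_square)
  from DERIV_pos_inc_right[OF D[OF z(1)] pos] obtain d where
   d: "d > 0" "!!h. 0 < h ==> h < d ==> F z < F (z + h *\<^sub>R (a - z))" by auto
  define h where "h = min 1 (d / 2)"
  have "F z < F (z + h *\<^sub>R (a - z))" using d by (auto simp: h_def)
  moreover have "z + h *\<^sub>R (a - z) \<in> cball a r" using inc[OF z(1), of a h] r d by (auto simp: h_def)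
  ultimately show False using z(2) by fastforce
 qed
 have "G z \<bullet> G z = 0"
 proof (cases "G z = 0")
  case False
  obtain e where e: "e > 0" "ball z e \<subseteq> ball a r" using zball open_contains_ball by blast
  show ?thesis
  proof (rule DERIV_local_max[OF D[OF z(1)]])
   show "0 < e / norm (G z)" using e False by simp
   show "ALL t. \<bar>0 - t\<bar> < e / norm (G z) --> F (z + t *\<^sub>R G z) <= F (z + 0 *\<^sub>R G z)"
   proof (intro allI impI)
    fix t :: real assume "\<bar>0 - t\<bar> < e / norm (G z)"
    hence "z + t *\<^sub>R G z \<in> ball z e" using False by (simp add: dist_norm field_simps)
    thus "F (z + t *\<^sub>R G z) <= F (z + 0 *\<^sub>R G z)" using z(2) e(2) ball_subset_cball by auto
   qed
  qed
 qed simp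
 thus ?thesis using zball z(2) by auto
qed

lemma gradient_zero_at_local_maximum:
 fixes F :: "'a::real_inner => real"
 assumes D: "!!v. ((%t. F (x + t *\<^sub>R v)) has_real_derivative (g \<bullet> v)) (at 0)"
  and U: "open U" "x \<in> U" and mx: "\<forall>\<^sub>F y in at x within U. F y <= F x"
 shows "g = 0"
proof (rule ccontr)
 assume g: "g ~= 0"
 have "\<forall>\<^sub>F y in at x. F y <= F x" using mx unfolding at_within_open[OF U(2,1)] .
 then obtain e where e: "e > 0" "!!y. y ~= x ==> dist y x < e ==> F y <= F x"
  unfolding eventually_at by auto
 have "g \<bullet> g = 0"
 proof (rule DERIV_local_max[OF D])
  show "0 < e / norm g" using e g by simp
  show "ALL t. \<bar>0 - t\<bar> < e / norm g --> F (x + t *\<^sub>R g) <= F (x + 0 *\<^sub>R g)"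
  proof (intro allI impI)
   fix t :: real assume "\<bar>0 - t\<bar> < e / norm g"
   hence "dist (x + t *\<^sub>R g) x < e" using g by (simp add: dist_norm field_simps)
   thus "F (x + t *\<^sub>R g) <= F (x + 0 *\<^sub>R g)" using e(2)[of "x + t *\<^sub>R g"] by (cases "t = 0") (auto simp: g)
  qed
 qed
 thus False using g by simp
qed

section \<open>Differentiation under the integral sign\<close>

lemma has_real_derivative_integral:
 fixes F F' :: "real => 'a => real"
 assumes d: "d > 0"
  and int: "!!t. \<bar>t\<bar> < d ==> integrable M (F t)"
  and meas: "F' 0 \<in> borel_measurable M"
  and der: "!!t x. \<bar>t\<bar> < d ==> x \<in> space M ==> ((%t. F t x) has_real_derivative F' t x) (at t)"
  and bd: "!!t x. \<bar>t\<bar> < d ==> x \<in> space M ==> \<bar>F' t x\<bar> <= w x"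
  and w: "integrable M w"
 shows "((%t. \<integral>x. F t x \<partial>M) has_real_derivative (\<integral>x. F' 0 x \<partial>M)) (at 0)"
 unfolding DERIV_def tendsto_at_iff_sequentially
proof (intro allI impI)
 fix X :: "nat => real" assume X0: "ALL i. X i \<in> UNIV - {0}" and X: "X \<longlonglongrightarrow> 0"
 from tendstoD[OF X d] obtain N where N: "!!i. i >= N ==> \<bar>X i\<bar> < d"
  unfolding eventually_sequentially by (auto simp: dist_real_def)
 define Z where "Z i = X (i + N)" for i
 have Z: "Z i ~= 0" "\<bar>Z i\<bar> < d" for i using X0 N by (auto simp: Z_def)
 have Zlim: "Z \<longlonglongrightarrow> 0" unfolding Z_def by (rule LIMSEQ_ignore_initial_segment[OF X])
 have lim: "(%i. \<integral>x. (F (Z i) x - F 0 x) / Z i \<partial>M) \<longlonglongrightarrow> (\<integral>x. F' 0 x \<partial>M)"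
 proof (rule integral_dominated_convergence[where w=w])
  show "(%x. (F (Z i) x - F 0 x) / Z i) \<in> borel_measurable M" for i
   using int[OF Z(2), of i] int[of 0] d by (intro borel_measurable_divide borel_measurable_diff) auto
  show "AE x in M. (%i. (F (Z i) x - F 0 x) / Z i) \<longlonglongrightarrow> F' 0 x"
  proof (rule AE_I2)
   fix x assume x: "x \<in> space M"
   have "((%h. (F (0 + h) x - F 0 x) / h) \<longlongrightarrow> F' 0 x) (at 0)"
    using der[OF _ x, of 0] d by (simp add: DERIV_def)
   thus "(%i. (F (Z i) x - F 0 x) / Z i) \<longlonglongrightarrow> F' 0 x"
    unfolding tendsto_at_iff_sequentially using Z Zlim by (auto simp: o_def)
  qed
  show "AE x in M. norm ((F (Z i) x - F 0 x) / Z i) <= w x" for i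
  proof (rule AE_I2)
   fix x assume x: "x \<in> space M"
   have "norm (F (Z i) x - F 0 x) <= w x * norm (Z i - 0)"
   proof (rule field_differentiable_bound[of "{-d<..<d}"])
    fix t assume t: "t \<in> {-d<..<d}"
    hence t: "\<bar>t\<bar> < d" by auto
    show "((%t. F t x) has_real_derivative F' t x) (at t within {-d<..<d})"
     by (rule has_field_derivative_at_within[OF der[OF t x]])
    show "norm (F' t x) <= w x" using bd[OF t x] by simp
   qed (use Z[of i] d in \<open>auto simp: abs_less_iff\<close>)
   thus "norm ((F (Z i) x - F 0 x) / Z i) <= w x" using Z(1)[of i] by (simp add: abs_divide divide_le_eq)
  qed
 qed (use meas w in auto)
 have eq: "(\<integral>x. (F (Z i) x - F 0 x) / Z i \<partial>M) = ((\<integral>x. F (Z i) x \<partial>M) - (\<integral>x. F 0 x \<partial>M)) / Z i" for i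
  using Bochner_Integration.integral_diff[OF int[OF Z(2), of i] int[of 0]] d by simp
 from lim[unfolded eq] have "(%i. ((%h. ((\<integral>x. F (0 + h) x \<partial>M) - (\<integral>x. F 0 x \<partial>M)) / h) \<circ> X) (i + N)) \<longlonglongrightarrow> (\<integral>x. F' 0 x \<partial>M)"
  by (simp add: Z_def o_def)
 thus "((%h. ((\<integral>x. F (0 + h) x \<partial>M) - (\<integral>x. F 0 x \<partial>M)) / h) \<circ> X) \<longlonglongrightarrow> (\<integral>x. F' 0 x \<partial>M)"
  by (rule LIMSEQ_offset)
qed

section \<open>Integration over Euclidean space\<close>

lemma lborel_integral_scaleR:
 fixes f :: "'a::euclidean_space => 'b::{banach, second_countable_topology}"
 assumes c: "c > 0" and [measurable]: "f \<in> borel_measurable borel"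
 shows "(LINT x|lborel. f x) = c ^ DIM('a) *\<^sub>R (LINT x|lborel. f (c *\<^sub>R x))"
proof -
 have "(LINT x|lborel. f x) = (\<integral>x. f x \<partial>density (distr lborel borel (%x::'a. 0 + c *\<^sub>R x)) (%_. \<bar>c\<bar> ^ DIM('a)))"
  using c by (subst lborel_affine[of c 0]) auto
 also have "... = (\<integral>x. (c ^ DIM('a)) *\<^sub>R f x \<partial>distr lborel borel (%x::'a. 0 + c *\<^sub>R x))"
  using c by (subst integral_density) (auto simp: ennreal_power)
 also have "... = (LINT x|lborel. (c ^ DIM('a)) *\<^sub>R f (c *\<^sub>R x))"
  by (subst integral_distr) auto
 finally show ?thesis by simp
qed

lemma lborel_integrable_scaleR:
 fixes f :: "'a::euclidean_space => 'b::{banach, second_countable_topology}"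
 assumes c: "c > 0" and f: "integrable lborel f"
 shows "integrable lborel (%x. f (c *\<^sub>R x))"
proof -
 have [measurable]: "f \<in> borel_measurable borel" using f by auto
 have "integrable (density (distr lborel borel (%x::'a. 0 + c *\<^sub>R x)) (%_. ennreal (c ^ DIM('a)))) f"
  using f lborel_affine[of c "0::'a"] c by (simp add: ennreal_power)
 hence "integrable (distr lborel borel (%x::'a. 0 + c *\<^sub>R x)) (%x. (c ^ DIM('a)) *\<^sub>R f x)"
  using c by (subst (asm) integrable_density) auto
 hence "integrable lborel (%x. (c ^ DIM('a)) *\<^sub>R f (c *\<^sub>R x))"
  by (subst (asm) integrable_distr_eq) auto
 from integrable_scaleR_right[OF this, of "inverse (c ^ DIM('a))"] show ?thesis using c by simp
qed

lemma lborel_integral_translate: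
 fixes f :: "'a::euclidean_space => 'b::{banach, second_countable_topology}"
 assumes [measurable]: "f \<in> borel_measurable borel"
 shows "(LINT x|lborel. f (x + c)) = (LINT x|lborel. f x)"
proof -
 have "(LINT x|lborel. f x) = (\<integral>x. f x \<partial>distr lborel borel ((+) c))" by (simp add: lborel_distr_plus)
 also have "... = (LINT x|lborel. f (c + x))" by (subst integral_distr) auto
 finally show ?thesis by (simp add: add.commute)
qed

lemma lborel_prod_Basis:
 fixes h :: "'a::euclidean_space => real => 'b::{real_normed_field,banach,second_countable_topology}"
 assumes h: "!!b. b \<in> Basis ==> integrable lborel (h b)"
 shows "integrable lborel (%x::'a. \<Prod>b\<in>Basis. h b (x \<bullet> b))"
  and "(\<integral>x. (\<Prod>b\<in>Basis. h b (x \<bullet> b)) \<partial>(lborel :: 'a measure)) = (\<Prod>b\<in>Basis. \<integral>x. h b x \<partial>lborel)"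
proof -
 interpret product_sigma_finite "%_::'a. lborel :: real measure" by standard
 have [measurable]: "h b \<in> borel_measurable borel" if "b \<in> Basis" for b using h[OF that] by auto
 have L: "lborel = distr (\<Pi>\<^sub>M b\<in>(Basis::'a set). lborel) borel (%f. SUM b:Basis. f b *\<^sub>R b)"
  by (subst lborel_def) (simp add: lborel_eq_real)
 have e: "(SUM b:Basis. f b *\<^sub>R b) \<bullet> c = f c" if "c \<in> Basis" for f :: "'a => real" and c
  using that by (simp add: inner_sum_left inner_Basis if_distrib sum.delta cong: if_cong)
 have p: "(%f. \<Prod>c\<in>Basis. h c ((SUM b:Basis. f b *\<^sub>R b) \<bullet> c)) = (%f. \<Prod>c\<in>Basis. h c (f c))"
  by (intro ext prod.cong refl) (simp add: e)
 have T: "(%f. SUM b:Basis. f b *\<^sub>R b) \<in> measurable (\<Pi>\<^sub>M b\<in>(Basis::'a set). lborel) borel"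
  by measurable
 have m: "(%x::'a. \<Prod>b\<in>Basis. h b (x \<bullet> b)) \<in> borel_measurable borel" by measurable
 show "integrable lborel (%x::'a. \<Prod>b\<in>Basis. h b (x \<bullet> b))"
  by (subst L, subst integrable_distr_eq[OF T m]) (unfold p, intro product_integrable_prod h, auto)
 show "(\<integral>x. (\<Prod>b\<in>Basis. h b (x \<bullet> b)) \<partial>(lborel :: 'a measure)) = (\<Prod>b\<in>Basis. \<integral>x. h b x \<partial>lborel)"
  by (subst L, subst integral_distr[OF T m]) (unfold p, intro product_integral_prod h, auto)
qed

text \<open>One factor of the power is spent on each coordinate: the function is dominated by a
  product of one-dimensional functions 1 / (1 + x^2).\<close>

lemma integrable_inverse_power_Basis:
 "integrable lborel (%x::'a::euclidean_space. 1 / (1 + (norm x)\<^sup>2) ^ DIM('a))"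
proof -
 have "integrable lborel (%x::real. inverse (1 + x\<^sup>2))"
  using integrable_inverse_1_plus_square by (simp add: set_integrable_def)
 hence "integrable lborel (%x::'a. \<Prod>b\<in>Basis. inverse (1 + (x \<bullet> b)\<^sup>2))"
  using lborel_prod_Basis(1)[of "%_ x. inverse (1 + x\<^sup>2)"] by simp
 thus ?thesis
 proof (rule Bochner_Integration.integrable_bound)
  show "AE x::'a in lborel. norm (1 / (1 + (norm x)\<^sup>2) ^ DIM('a)) <= norm (\<Prod>b\<in>Basis. inverse (1 + (x \<bullet> b)\<^sup>2))"
  proof (intro AE_I2)
   fix x :: 'a
   have "(\<Prod>b\<in>(Basis::'a set). inverse (1 + (norm x)\<^sup>2)) <= (\<Prod>b\<in>Basis. inverse (1 + (x \<bullet> b)\<^sup>2))"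
   proof (rule prod_mono)
    fix b :: 'a assume b: "b \<in> Basis"
    have "\<bar>x \<bullet> b\<bar>\<^sup>2 <= (norm x)\<^sup>2" by (rule power_mono[OF Basis_le_norm[OF b]]) simp
    moreover have "0 < 1 + (x \<bullet> b)\<^sup>2" by (simp add: add_pos_nonneg)
    ultimately have "inverse (1 + (norm x)\<^sup>2) <= inverse (1 + (x \<bullet> b)\<^sup>2)"
     by (intro le_imp_inverse_le) auto
    thus "0 <= inverse (1 + (norm x)\<^sup>2) & inverse (1 + (norm x)\<^sup>2) <= inverse (1 + (x \<bullet> b)\<^sup>2)" by simp
   qed
   thus "norm (1 / (1 + (norm x)\<^sup>2) ^ DIM('a)) <= norm (\<Prod>b\<in>Basis. inverse (1 + (x \<bullet> b)\<^sup>2))"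
    by (simp add: inverse_eq_divide power_one_over abs_prod)
  qed
 qed measurable
qed

text \<open>The exponential beats every power through (1 + z/N)^N <= exp z; \<open>N\<close> is
  taken above the total degree and nonzero.\<close>

lemma poly_exp_bound:
 fixes k :: real
 assumes k: "k > 0"
 shows "EX C. ALL x>=0. (1 + x) ^ m * exp (- k * x\<^sup>2) <= C / (1 + x\<^sup>2) ^ D"
proof -
 define N where "N = Suc (m + D)"
 define C where "C = 2 ^ m * exp k * (real N / k) ^ N"
 have "(1 + x) ^ m * exp (- k * x\<^sup>2) <= C / (1 + x\<^sup>2) ^ D" if x: "x >= 0" for x :: real
 proof -
  define y where "y = 1 + x\<^sup>2"
  have y: "y >= 1" by (simp add: y_def)
  have "0 <= 1 - 2 * x + x\<^sup>2" using zero_le_power2[of "x - 1"] by (simp add: power2_diff)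
  moreover have "0 <= x\<^sup>2" by simp
  ultimately have "1 + x <= 2 * y" unfolding y_def by argo
  hence a: "(1 + x) ^ m <= (2 * y) ^ m" using x by (intro power_mono) auto
  have "(k * y / N) ^ N <= (1 + k * y / N) ^ N" using k y by (intro power_mono) auto
  also have "... <= exp (k * y)"
  proof (rule exp_ge_one_plus_x_over_n_power_n)
   have "0 <= k * y" using k y by simp
   thus "- real N <= k * y" by linarith
  qed (simp add: N_def)
  finally have b: "(k * y / N) ^ N <= exp (k * y)" .
  have "y ^ (m + D) <= y ^ N" using y by (intro power_increasing) (auto simp: N_def)
  also have "... = (k * y / N) ^ N * (N / k) ^ N"
   using k by (simp add: N_def flip: power_mult_distrib)
  also have "... <= exp (k * y) * (N / k) ^ N" using b k by (intro mult_right_mono) auto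
  finally have c: "y ^ (m + D) <= exp (k * y) * (N / k) ^ N" .
  have "exp (- k * x\<^sup>2) = exp k * exp (- (k * y))"
   by (simp add: y_def algebra_simps flip: exp_add)
  hence "(1 + x) ^ m * exp (- k * x\<^sup>2) * y ^ D = (1 + x) ^ m * exp k * (exp (- (k * y)) * y ^ D)"
   by simp
  also have "... <= (2 * y) ^ m * exp k * (exp (- (k * y)) * y ^ D)"
   using a y by (intro mult_right_mono) auto
  also have "... = 2 ^ m * exp k * exp (- (k * y)) * y ^ (m + D)"
   by (simp add: power_mult_distrib power_add)
  also have "... <= 2 ^ m * exp k * exp (- (k * y)) * (exp (k * y) * (N / k) ^ N)"
   using c by (intro mult_left_mono) auto
  also have "... = C" by (simp add: C_def exp_minus field_simps)
  finally have "(1 + x) ^ m * exp (- k * x\<^sup>2) * y ^ D <= C" .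
  moreover have "y ^ D > 0" using y by simp
  ultimately show ?thesis unfolding y_def[symmetric] by (subst pos_le_divide_eq)
 qed
 thus ?thesis by blast
qed

lemma integrable_poly_gaussian:
 assumes k: "k > 0"
 shows "integrable lborel (%x::'a::euclidean_space. (1 + norm x) ^ m * exp (- k * (norm x)\<^sup>2))"
proof -
 obtain C where C: "!!x. x >= 0 ==> (1 + x) ^ m * exp (- k * x\<^sup>2) <= C / (1 + x\<^sup>2) ^ DIM('a)"
  using poly_exp_bound[OF k] by blast
 have "integrable lborel (%x::'a. C * (1 / (1 + (norm x)\<^sup>2) ^ DIM('a)))"
  by (intro integrable_mult_right integrable_inverse_power_Basis)
 thus ?thesis
 proof (rule Bochner_Integration.integrable_bound)
  show "AE x in lborel. norm ((1 + norm (x::'a)) ^ m * exp (- k * (norm x)\<^sup>2)) <= norm (C * (1 / (1 + (norm x)\<^sup>2) ^ DIM('a)))"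
  proof (intro AE_I2)
   fix x :: 'a
   have "norm ((1 + norm x) ^ m * exp (- k * (norm x)\<^sup>2)) = (1 + norm x) ^ m * exp (- k * (norm x)\<^sup>2)"
    by (simp add: abs_mult)
   also have "... <= C * (1 / (1 + (norm x)\<^sup>2) ^ DIM('a))" using C[OF norm_ge_zero[of x]] by simp
   also have "... <= norm (C * (1 / (1 + (norm x)\<^sup>2) ^ DIM('a)))" unfolding real_norm_def by (rule abs_ge_self)
   finally show "norm ((1 + norm x) ^ m * exp (- k * (norm x)\<^sup>2)) <= norm (C * (1 / (1 + (norm x)\<^sup>2) ^ DIM('a)))" .
  qed
 qed measurable
qed

section \<open>Gaussian integrals\<close>

text \<open>In the Leibniz formula a permutation other than the identity moves at least two indices,
  so its product keeps a zero factor after one factor has been differentiated.\<close>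

lemma det_one_plus_derivative:
 fixes C :: "real ^ 'n ^ 'n"
 shows "((%t. det (mat 1 + t *\<^sub>R C)) has_real_derivative trace C) (at 0)"
proof -
 let ?U = "UNIV :: 'n set"
 let ?I = "mat 1 :: real ^ 'n ^ 'n"
 have "((%t. SUM p:{p. p permutes ?U}. of_int (sign p) * (\<Prod>i\<in>?U. (?I + t *\<^sub>R C) $ i $ p i))
   has_real_derivative (SUM p:{p. p permutes ?U}. of_int (sign p) *
    (SUM i:?U. C $ i $ p i * (\<Prod>j\<in>?U - {i}. (?I + 0 *\<^sub>R C) $ j $ p j)))) (at 0)"
  by (intro DERIV_sum DERIV_cmult has_field_derivative_prod) (auto intro!: derivative_eq_intros)
 moreover have "(SUM p:{p. p permutes ?U}. of_int (sign p) *
    (SUM i:?U. C $ i $ p i * (\<Prod>j\<in>?U - {i}. (?I + 0 *\<^sub>R C) $ j $ p j)))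
   = (SUM p:{p. p permutes ?U}. if p = id then trace C else 0)"
 proof (intro sum.cong refl)
  fix p assume "p \<in> {p. p permutes ?U}"
  hence p: "p permutes ?U" by simp
  show "of_int (sign p) * (SUM i:?U. C $ i $ p i * (\<Prod>j\<in>?U - {i}. (?I + 0 *\<^sub>R C) $ j $ p j))
    = (if p = id then trace C else 0)"
  proof (cases "p = id")
   case True
   thus ?thesis by (simp add: trace_def mat_def sign_id)
  next
   case False
   have "(\<Prod>j\<in>?U - {i}. (?I + 0 *\<^sub>R C) $ j $ p j) = 0" for i
   proof -
    obtain a where a: "p a ~= a" using False by (auto simp: fun_eq_iff)
    have "p (p a) ~= p a" using a permutes_inj[OF p] by (auto dest: injD)
    then obtain j where "p j ~= j" "j ~= i" using a by (cases "a = i") auto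
    thus ?thesis by (intro prod_zero bexI[of _ j]) (auto simp: mat_def)
   qed
   thus ?thesis using False by (simp only: mult_zero_right sum.neutral_const if_False)
  qed
 qed
 moreover have "id permutes ?U" by (rule permutes_id)
 ultimately show ?thesis by (simp add: det_def sum.delta)
qed

text \<open>Jacobi's formula. A right inverse \<open>A'\<close> is enough, since it factors
  \<open>A + t *\<^sub>R B\<close> as \<open>A\<close> times a perturbation of the identity.\<close>

lemma det_directional_derivative:
 fixes A B A' :: "real ^ 'n ^ 'n"
 assumes A: "A ** A' = mat 1"
 shows "((%t. det (A + t *\<^sub>R B)) has_real_derivative det A * trace (A' ** B)) (at 0)"
proof -
 have "A + t *\<^sub>R B = A ** (mat 1 + t *\<^sub>R (A' ** B))" for t
 proof -
  have "A ** (t *\<^sub>R (A' ** B)) = t *\<^sub>R (A ** (A' ** B))"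
   by (simp add: vec_eq_iff matrix_matrix_mult_def sum_distrib_left mult.left_commute)
  thus ?thesis by (simp add: matrix_add_ldistrib matrix_mul_assoc A)
 qed
 hence "(%t. det (A + t *\<^sub>R B)) = (%t. det A * det (mat 1 + t *\<^sub>R (A' ** B)))"
  by (simp add: det_mul)
 thus ?thesis using DERIV_cmult[OF det_one_plus_derivative] by simp
qed

definition gauss :: "real ^ 'n ^ 'n => real ^ 'n => real" where
 "gauss K u = exp (- (u \<bullet> (K *v u)) / 2)"

definition gauss_integral :: "real ^ 'n ^ 'n => real" where
 "gauss_integral K = (LINT u|lborel. gauss K u)"

lemma continuous_on_quadratic_form: "continuous_on UNIV (%u. u \<bullet> (K *v (u::real^'n)))"
 by (intro continuous_intros linear_continuous_on matrix_vector_mul_bounded_linear)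

lemma gauss_measurable [measurable]: "gauss K \<in> borel_measurable borel"
 unfolding gauss_def[abs_def]
 by (intro borel_measurable_continuous_onI continuous_intros continuous_on_quadratic_form) auto

lemma matrix_vector_norm_bound: "EX c>=0. ALL u. norm ((K::real^'n^'n) *v u) <= c * norm u"
 using onorm[OF matrix_vector_mul_bounded_linear[of K]] onorm_pos_le[OF matrix_vector_mul_bounded_linear[of K]]
 by (intro exI[of _ "onorm ((*v) K)"]) auto

lemma gauss_le:
 assumes "!!u. u \<bullet> (K *v u) >= k * (norm u)\<^sup>2"
 shows "gauss K u <= exp (- (k/2) * (norm u)\<^sup>2)"
 using assms[of u] by (simp add: gauss_def)

lemma gauss_poly_integrable:
 fixes K :: "real ^ 'n ^ 'n" and p :: "real ^ 'n => real"
 assumes k: "k > 0" "!!u. u \<bullet> (K *v u) >= k * (norm u)\<^sup>2"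
  and [measurable]: "p \<in> borel_measurable borel" and p: "!!u. \<bar>p u\<bar> <= C * (1 + norm u) ^ m"
 shows "integrable lborel (%u. p u * gauss K u)"
proof (rule Bochner_Integration.integrable_bound)
 show "integrable lborel (%u::real^'n. C * ((1 + norm u) ^ m * exp (- (k/2) * (norm u)\<^sup>2)))"
  using k by (intro integrable_mult_right integrable_poly_gaussian) auto
 show "AE u in lborel. norm (p u * gauss K u) <= norm (C * ((1 + norm u) ^ m * exp (- (k/2) * (norm u)\<^sup>2)))"
 proof (intro AE_I2)
  fix u :: "real ^ 'n"
  have "norm (p u * gauss K u) = \<bar>p u\<bar> * gauss K u" by (simp add: abs_mult gauss_def)
  also have "... <= (C * (1 + norm u) ^ m) * exp (- (k/2) * (norm u)\<^sup>2)"
   using p[of u] gauss_le[OF k(2), of u] by (intro mult_mono) (auto simp: gauss_def intro: order_trans[OF abs_ge_zero])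
  finally show "norm (p u * gauss K u) <= norm (C * ((1 + norm u) ^ m * exp (- (k/2) * (norm u)\<^sup>2)))"
   by (simp add: mult.assoc)
 qed
qed measurable

text \<open>Integration by parts, in the form that the integral of a translated function is constant.\<close>

lemma gauss_second_moment:
 fixes K :: "real ^ 'n ^ 'n"
 assumes k: "k > 0" "!!u. u \<bullet> (K *v u) >= k * (norm u)\<^sup>2" and sym: "transpose K = K"
 shows "(LINT u|lborel. u $ b * (K *v u) $ a * gauss K u) = (if a = b then gauss_integral K else 0)"
proof -
 obtain c where c: "c >= 0" "!!u. norm (K *v u) <= c * norm u" using matrix_vector_norm_bound by blast
 let ?e = "axis a 1 :: real ^ 'n"
 let ?F = "%t u. (u + t *\<^sub>R ?e) $ b * gauss K (u + t *\<^sub>R ?e)"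
 let ?F' = "%t u. ((if a = b then 1 else 0) - (u + t *\<^sub>R ?e) $ b * (K *v (u + t *\<^sub>R ?e)) $ a) * gauss K (u + t *\<^sub>R ?e)"
 have cont: "continuous_on UNIV (%u. u $ b)" "continuous_on UNIV (%u. (K *v u) $ a)"
  by (intro continuous_intros linear_continuous_on matrix_vector_mul_bounded_linear)+
 have [measurable]: "(%u. u $ b) \<in> borel_measurable borel" "(%u. (K *v u) $ a) \<in> borel_measurable borel"
  using cont by (auto intro: borel_measurable_continuous_onI)
 have symi: "u \<bullet> (K *v v) = v \<bullet> (K *v u)" for u v
  by (metis dot_lmul_matrix inner_commute sym transpose_matrix_vector)
 have int1: "integrable lborel (%u. u $ b * gauss K u)"
  by (rule gauss_poly_integrable[OF k, where C=1 and m=1]) (auto intro: order_trans[OF component_le_norm_cart])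
 have int2: "integrable lborel (%u. u $ b * (K *v u) $ a * gauss K u)"
 proof (rule gauss_poly_integrable[OF k, where C=c and m=2])
  fix u
  have "\<bar>u $ b * (K *v u) $ a\<bar> <= norm u * (c * norm u)"
   unfolding abs_mult by (intro mult_mono component_le_norm_cart order_trans[OF component_le_norm_cart c(2)]) auto
  also have "... <= c * (1 + norm u) ^ 2" using c(1)
   by (simp add: power2_eq_square algebra_simps mult_left_mono)
  finally show "\<bar>u $ b * (K *v u) $ a\<bar> <= c * (1 + norm u) ^ 2" .
 qed measurable
 have int3: "integrable lborel (gauss K)"
  using gauss_poly_integrable[OF k, of "%_. 1" 1 0] by simp
 have "((%t. \<integral>u. ?F t u \<partial>lborel) has_real_derivative (LINT u|lborel. ?F' 0 u)) (at 0)"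
 proof (rule has_real_derivative_integral[where F="?F" and F'="?F'" and d=1 and w="%u. (1 + c) * exp (k/2) * ((2 + norm u) ^ 2 * exp (- (k/4) * (norm u)\<^sup>2))"])
  show "integrable lborel (?F t)" for t
  proof -
   have "integrable lborel (%u. (%u. u $ b * gauss K u) (t *\<^sub>R ?e + u))"
    using int1 by (subst integrable_distr_eq[of "%u. t *\<^sub>R ?e + u" lborel borel, symmetric]) (auto simp: lborel_distr_plus)
   thus ?thesis by (simp add: add.commute)
  qed
  show "((%t. ?F t u) has_real_derivative ?F' t u) (at t)" for t u
  proof -
   let ?v = "u + t *\<^sub>R ?e"
   have "((%s. (?v + s *\<^sub>R ?e) \<bullet> (K *v (?v + s *\<^sub>R ?e))) has_real_derivative 2 * (K *v ?v) $ a) (at 0)"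
   proof -
    have "(%s. (?v + s *\<^sub>R ?e) \<bullet> (K *v (?v + s *\<^sub>R ?e)))
      = (%s. ?v \<bullet> (K *v ?v) + s * (2 * (?e \<bullet> (K *v ?v))) + s\<^sup>2 * (?e \<bullet> (K *v ?e)))"
     using symi[of ?v ?e]
     by (simp add: fun_eq_iff matrix_vector_right_distrib matrix_vector_mult_scaleR inner_add_left inner_add_right
       power2_eq_square algebra_simps)
    moreover have "?e \<bullet> (K *v ?v) = (K *v ?v) $ a" by (simp add: inner_axis')
    ultimately show ?thesis by (auto intro!: derivative_eq_intros)
   qed
   from has_real_derivative_shift[where f="%u. u \<bullet> (K *v u)" and x=u and t=t and v="?e", OF this]
   have "((%s. (u + s *\<^sub>R ?e) \<bullet> (K *v (u + s *\<^sub>R ?e))) has_real_derivative 2 * (K *v ?v) $ a) (at t)" .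
   note g = this
   have "((%s. gauss K (u + s *\<^sub>R ?e)) has_real_derivative - (K *v ?v) $ a * gauss K ?v) (at t)"
    unfolding gauss_def by (rule derivative_eq_intros g refl)+ auto
   moreover have "((%s. (u + s *\<^sub>R ?e) $ b) has_real_derivative (if a = b then 1 else 0)) (at t)"
    by (auto simp: axis_def intro!: derivative_eq_intros)
   ultimately show ?thesis
    by (rule DERIV_cong[OF DERIV_mult[rotated]]) (auto simp: algebra_simps)
  qed
  show "\<bar>?F' t u\<bar> <= (1 + c) * exp (k/2) * ((2 + norm u) ^ 2 * exp (- (k/4) * (norm u)\<^sup>2))" if t: "\<bar>t\<bar> < 1" for t u
  proof -
   let ?v = "u + t *\<^sub>R ?e"
   have nv: "norm ?v <= 1 + norm u" using norm_triangle_ineq[of u "t *\<^sub>R ?e"] t by simp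
   have nu: "norm u <= norm ?v + 1" using norm_triangle_ineq4[of ?v "t *\<^sub>R ?e"] t by simp
   \<comment> \<open>A shift of length at most one costs half of the Gaussian exponent, by (a + 1)^2
     <= 2 a^2 + 2; this gives the \<open>k/4\<close> and the factor \<open>exp (k/2)\<close> of the
     majorant.\<close>
   have "(norm u)\<^sup>2 <= (norm ?v + 1)\<^sup>2" using nu by (intro power_mono) auto
   also have "... <= 2 * (norm ?v)\<^sup>2 + 2" using zero_le_power2[of "norm ?v - 1"]
    by (simp add: power2_eq_square algebra_simps)
   finally have "k * (norm u)\<^sup>2 <= k * (2 * (norm ?v)\<^sup>2 + 2)" using k(1) by (intro mult_left_mono) auto
   hence "- (k/2) * (norm ?v)\<^sup>2 <= k/2 + - (k/4) * (norm u)\<^sup>2" by (simp add: algebra_simps)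
   hence "exp (- (k/2) * (norm ?v)\<^sup>2) <= exp (k/2) * exp (- (k/4) * (norm u)\<^sup>2)"
    by (simp only: exp_le_cancel_iff flip: exp_add)
   with gauss_le[OF k(2), of ?v]
   have g: "gauss K ?v <= exp (k/2) * exp (- (k/4) * (norm u)\<^sup>2)" by (rule order_trans)
   have "\<bar>?v $ b * (K *v ?v) $ a\<bar> <= (1 + norm u) * (c * (1 + norm u))"
    unfolding abs_mult using nv c mult_left_mono[OF nv c(1)]
    by (intro mult_mono order_trans[OF component_le_norm_cart] order_trans[OF component_le_norm_cart order_trans[OF c(2)]]) auto
   hence "\<bar>(if a = b then 1 else 0) - ?v $ b * (K *v ?v) $ a\<bar> <= 1 + c * (1 + norm u)\<^sup>2"
    by (auto simp: power2_eq_square algebra_simps abs_le_iff)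
   also have "... <= (1 + c) * (2 + norm u)\<^sup>2"
   proof -
    have "1 <= (2 + norm u)\<^sup>2" by (rule one_le_power) simp
    moreover have "c * (1 + norm u)\<^sup>2 <= c * (2 + norm u)\<^sup>2"
     by (intro mult_left_mono power_mono c) auto
    ultimately show ?thesis unfolding distrib_right by linarith
   qed
   finally have "\<bar>(if a = b then 1 else 0) - ?v $ b * (K *v ?v) $ a\<bar> <= (1 + c) * (2 + norm u)\<^sup>2" .
   from mult_mono[OF this g] show ?thesis using c(1) by (simp add: abs_mult gauss_def mult_ac)
  qed
  show "integrable lborel (%u::real^'n. (1 + c) * exp (k/2) * ((2 + norm u) ^ 2 * exp (- (k/4) * (norm u)\<^sup>2)))"
  proof (rule integrable_mult_right, rule Bochner_Integration.integrable_bound)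
   show "integrable lborel (%u::real^'n. 4 * ((1 + norm u) ^ 2 * exp (- (k/4) * (norm u)\<^sup>2)))"
    using k by (intro integrable_mult_right integrable_poly_gaussian) auto
   show "AE u in lborel. norm ((2 + norm (u::real^'n))\<^sup>2 * exp (- (k/4) * (norm u)\<^sup>2)) <= norm (4 * ((1 + norm u) ^ 2 * exp (- (k/4) * (norm u)\<^sup>2)))"
   proof (intro AE_I2)
    fix u :: "real ^ 'n"
    have "(2 + norm u)\<^sup>2 <= (2 * (1 + norm u))\<^sup>2" by (intro power_mono) auto
    also have "... = 4 * (1 + norm u)\<^sup>2" by (subst power_mult_distrib) simp
    finally have e: "(2 + norm u)\<^sup>2 <= 4 * (1 + norm u)\<^sup>2" .
    show "norm ((2 + norm u)\<^sup>2 * exp (- (k/4) * (norm u)\<^sup>2)) <= norm (4 * ((1 + norm u) ^ 2 * exp (- (k/4) * (norm u)\<^sup>2)))"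
     by (simp add: abs_mult e)
   qed
  qed measurable
  show "?F' 0 \<in> borel_measurable lborel" by (simp, measurable)
 qed simp
 moreover have "(%t. \<integral>u. ?F t u \<partial>lborel) = (%t. \<integral>u. u $ b * gauss K u \<partial>lborel)"
  by (intro ext lborel_integral_translate[of "%u. u $ b * gauss K u"]) measurable
 ultimately have "((%t::real. \<integral>u. u $ b * gauss K u \<partial>lborel) has_real_derivative (LINT u|lborel. ?F' 0 u)) (at 0)"
  by simp
 from DERIV_unique[OF this DERIV_const] have "(LINT u|lborel. ?F' 0 u) = 0" .
 moreover have "(LINT u|lborel. ?F' 0 u) = (LINT u|lborel. (if a = b then 1 else 0) * gauss K u - u $ b * (K *v u) $ a * gauss K u)"
  by (intro Bochner_Integration.integral_cong) (auto simp: algebra_simps)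
 moreover have "... = (if a = b then 1 else 0) * gauss_integral K - (LINT u|lborel. u $ b * (K *v u) $ a * gauss K u)"
  unfolding gauss_integral_def using int2 int3 by (subst Bochner_Integration.integral_diff) auto
 ultimately show ?thesis by (cases "a = b") auto
qed

lemma gauss_integral_pos:
 fixes K :: "real ^ 'n ^ 'n"
 assumes k: "k > 0" "!!u. u \<bullet> (K *v u) >= k * (norm u)\<^sup>2"
 shows "gauss_integral K > 0"
proof -
 have int: "integrable lborel (gauss K)"
  using gauss_poly_integrable[OF k, of "%_. 1" 1 0] by simp
 have "gauss_integral K ~= 0"
 proof
  assume "gauss_integral K = 0"
  hence "AE u in lborel. gauss K u = 0"
   unfolding gauss_integral_def using int by (subst (asm) integral_nonneg_eq_0_iff_AE) (auto simp: gauss_def)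
  hence "AE u in (lborel :: (real^'n) measure). False" by (auto simp: gauss_def)
  hence "emeasure (lborel :: (real^'n) measure) UNIV = 0"
   by (subst (asm) AE_iff_measurable[OF _ refl]) auto
  thus False by (simp add: emeasure_lborel_UNIV)
 qed
 moreover have "gauss_integral K >= 0" unfolding gauss_integral_def by (intro integral_nonneg_AE) (auto simp: gauss_def)
 ultimately show ?thesis by simp
qed

text \<open>The Gaussian integral has derivative \<open>- X / 2\<close>, where \<open>X\<close> is
  the second moment of \<open>B\<close>. The second moments also give
  \<open>A ** S = g *\<^sub>R mat 1\<close>, so \<open>S\<close> divided by \<open>g\<close> inverts
  \<open>A\<close> and Jacobi's formula gives the determinant the logarithmic derivative
  \<open>X / g\<close>. The two contributions cancel.\<close>

lemma gauss_integral_line_derivative: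
 fixes A B :: "real ^ 'n ^ 'n"
 assumes A: "transpose A = A" and k: "k > 0" and d: "d > 0"
  and q: "!!h u. \<bar>h\<bar> < d ==> u \<bullet> ((A + h *\<^sub>R B) *v u) >= k * (norm u)\<^sup>2"
 shows "((%h. (gauss_integral (A + h *\<^sub>R B))\<^sup>2 * det (A + h *\<^sub>R B)) has_real_derivative 0) (at 0)"
proof -
 have qA: "u \<bullet> (A *v u) >= k * (norm u)\<^sup>2" for u using q[of 0 u] d by simp
 obtain c where c: "c >= 0" "!!u. norm (B *v u) <= c * norm u" using matrix_vector_norm_bound by blast
 have uBu: "\<bar>u \<bullet> (B *v u)\<bar> <= c * (1 + norm u) ^ 2" for u
 proof -
  have "\<bar>u \<bullet> (B *v u)\<bar> <= norm u * (c * norm u)"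
   by (rule order_trans[OF Cauchy_Schwarz_ineq2 mult_left_mono[OF c(2)]]) simp
  also have "... = c * norm u ^ 2" by (simp add: power2_eq_square)
  also have "... <= c * (1 + norm u) ^ 2" by (intro mult_left_mono power_mono c) auto
  finally show ?thesis .
 qed
 have [measurable]: "(%u. u \<bullet> (B *v u)) \<in> borel_measurable borel"
  by (intro borel_measurable_continuous_onI continuous_on_quadratic_form)
 define X where "X = (LINT u|lborel. u \<bullet> (B *v u) * gauss A u)"
 define g where "g = gauss_integral A"
 have g: "g > 0" unfolding g_def by (rule gauss_integral_pos[OF k qA])
 have uu: "integrable lborel (%u. u $ i * u $ j * gauss A u)" for i j
 proof (rule gauss_poly_integrable[OF k qA, where C=1 and m=2])
  fix u :: "real ^ 'n"
  have "\<bar>u $ i * u $ j\<bar> <= norm u * norm u"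
   unfolding abs_mult by (intro mult_mono component_le_norm_cart) auto
  also have "... <= 1 * (1 + norm u) ^ 2" by (simp add: power2_eq_square mult_mono)
  finally show "\<bar>u $ i * u $ j\<bar> <= 1 * (1 + norm u) ^ 2" .
 qed measurable
 have d1: "((%h. gauss_integral (A + h *\<^sub>R B)) has_real_derivative - X / 2) (at 0)"
 proof -
  let ?F' = "%h u. - (u \<bullet> (B *v u)) / 2 * gauss (A + h *\<^sub>R B) u"
  have "((%h. \<integral>u. gauss (A + h *\<^sub>R B) u \<partial>lborel) has_real_derivative (LINT u|lborel. ?F' 0 u)) (at 0)"
  proof (rule has_real_derivative_integral[where F="%h. gauss (A + h *\<^sub>R B)" and F'="?F'" and d=d
    and w="%u. c * ((1 + norm u) ^ 2 * exp (- (k/2) * (norm u)\<^sup>2))"])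
   show "integrable lborel (gauss (A + h *\<^sub>R B))" if "\<bar>h\<bar> < d" for h
    using gauss_poly_integrable[OF k q[OF that], of "%_. 1" 1 0] by simp
   show "integrable lborel (%u::real^'n. c * ((1 + norm u) ^ 2 * exp (- (k/2) * (norm u)\<^sup>2)))"
    using k by (intro integrable_mult_right integrable_poly_gaussian) auto
   show "((%h. gauss (A + h *\<^sub>R B) u) has_real_derivative ?F' h u) (at h)" for h u
   proof -
    have e: "(%h. u \<bullet> ((A + h *\<^sub>R B) *v u)) = (%h. u \<bullet> (A *v u) + h * (u \<bullet> (B *v u)))"
     by (simp add: fun_eq_iff matrix_vector_mult_add_rdistrib inner_add_right flip: scaleR_matrix_vector_assoc)
    have "((%h. u \<bullet> ((A + h *\<^sub>R B) *v u)) has_real_derivative u \<bullet> (B *v u)) (at h)"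
     unfolding e by (auto intro!: derivative_eq_intros)
    note dd = this
    show ?thesis unfolding gauss_def by (rule derivative_eq_intros dd refl)+ auto
   qed
   show "\<bar>?F' h u\<bar> <= c * ((1 + norm u) ^ 2 * exp (- (k/2) * (norm u)\<^sup>2))" if "\<bar>h\<bar> < d" for h u
   proof -
    have "\<bar>?F' h u\<bar> = \<bar>u \<bullet> (B *v u)\<bar> / 2 * gauss (A + h *\<^sub>R B) u" by (simp add: abs_mult gauss_def)
    also have "... <= (c * (1 + norm u) ^ 2) * exp (- (k/2) * (norm u)\<^sup>2)"
     using uBu[of u] gauss_le[OF q[OF that], of u] c(1) by (intro mult_mono) (auto simp: gauss_def)
    finally show ?thesis by (simp add: mult.assoc)
   qed
   show "?F' 0 \<in> borel_measurable lborel" by measurable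
  qed (rule d)
  moreover have "(LINT u|lborel. ?F' 0 u) = - X / 2"
  proof -
   have "(LINT u|lborel. ?F' 0 u) = (LINT u|lborel. (- 1 / 2) * (u \<bullet> (B *v u) * gauss A u))"
    by (intro Bochner_Integration.integral_cong) auto
   thus ?thesis unfolding X_def by (subst (asm) integral_mult_right_zero) simp
  qed
  ultimately show ?thesis unfolding gauss_integral_def by simp
 qed
 define S :: "real ^ 'n ^ 'n" where "S = (\<chi> i j. \<integral>u. u $ i * u $ j * gauss A u \<partial>lborel)"
 have AS: "A ** S = g *\<^sub>R mat 1"
 proof -
  have "(SUM c:UNIV. A $ a $ c * (LINT u|lborel. u $ c * u $ b * gauss A u)) = (if a = b then g else 0)" for a b
  proof -
   have "(SUM c:UNIV. A $ a $ c * (LINT u|lborel. u $ c * u $ b * gauss A u))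
     = (LINT u|lborel. (SUM c:UNIV. A $ a $ c * (u $ c * u $ b * gauss A u)))"
    using uu by (subst Bochner_Integration.integral_sum) auto
   also have "... = (LINT u|lborel. u $ b * (A *v u) $ a * gauss A u)"
    by (intro Bochner_Integration.integral_cong refl)
      (simp add: matrix_vector_mult_def sum_distrib_left sum_distrib_right mult_ac)
   finally show ?thesis using gauss_second_moment[OF k qA A, of b a] by (simp add: g_def)
  qed
  thus ?thesis by (simp add: vec_eq_iff matrix_matrix_mult_def S_def mat_def)
 qed
 define A' where "A' = (1 / g) *\<^sub>R S"
 have AA': "A ** A' = mat 1"
 proof -
  have "A ** A' = (1 / g) *\<^sub>R (A ** S)"
   by (simp add: A'_def vec_eq_iff matrix_matrix_mult_def sum_divide_distrib)
  thus ?thesis using g by (simp add: AS)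
 qed
 have tr: "trace (A' ** B) = X / g"
 proof -
  have "X = (LINT u|lborel. (SUM i:UNIV. SUM j:UNIV. B $ j $ i * (u $ i * u $ j * gauss A u)))"
   unfolding X_def
  proof (intro Bochner_Integration.integral_cong refl)
   fix u
   have "u \<bullet> (B *v u) * gauss A u = (SUM j:UNIV. SUM i:UNIV. B $ j $ i * (u $ i * u $ j * gauss A u))"
    by (simp add: inner_vec_def matrix_vector_mult_def sum_distrib_left sum_distrib_right mult_ac)
   also have "... = (SUM i:UNIV. SUM j:UNIV. B $ j $ i * (u $ i * u $ j * gauss A u))" by (rule sum.swap)
   finally show "u \<bullet> (B *v u) * gauss A u = ..." .
  qed
  also have "... = (SUM i:UNIV. SUM j:UNIV. B $ j $ i * S $ i $ j)"
   using uu by (simp add: S_def Bochner_Integration.integral_sum)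
  finally show ?thesis
   by (simp add: trace_def matrix_matrix_mult_def A'_def sum_divide_distrib mult.commute)
 qed
 have d2: "((%h. det (A + h *\<^sub>R B)) has_real_derivative det A * (X / g)) (at 0)"
  using det_directional_derivative[OF AA', of B] by (simp add: tr)
 have "((%h. (gauss_integral (A + h *\<^sub>R B))\<^sup>2 * det (A + h *\<^sub>R B)) has_real_derivative
   2 * g * (- X / 2) * det A + g\<^sup>2 * (det A * (X / g))) (at 0)"
  by (rule derivative_eq_intros d1 d2 refl)+ (simp add: g_def)
 thus ?thesis using g by (simp add: power2_eq_square)
qed

text \<open>The square of the integral times the determinant is constant along the segment from
  \<open>mat 1\<close> to \<open>K\<close>, which replaces a diagonalisation and also forces the
  sign of the determinant. The value at \<open>mat 1\<close> stays unevaluated: it does not depend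
  on the parameter and disappears from the gradients.\<close>

lemma gauss_integral_det:
 fixes K :: "real ^ 'n ^ 'n"
 assumes k: "k > 0" "!!u. u \<bullet> (K *v u) >= k * (norm u)\<^sup>2" and sym: "transpose K = K"
 shows "det K > 0" and "gauss_integral K = gauss_integral (mat 1 :: real ^ 'n ^ 'n) / sqrt (det K)"
proof -
 define B where "B = K - mat 1"
 define k' where "k' = min 1 k"
 have k': "k' > 0" "k' <= 1" "k' <= k" using k by (auto simp: k'_def)
 obtain c where c: "c >= 0" "!!u. norm (B *v u) <= c * norm u" using matrix_vector_norm_bound by blast
 \<comment> \<open>The two-sided derivative is also taken at the ends of the segment. This
   \<open>d\<close> makes \<open>d * c\<close> at most \<open>k' / 2\<close>, so overshooting by
   \<open>d\<close> keeps half of the lower bound \<open>k'\<close>.\<close>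
 define d where "d = k' / (2 * (c + 1))"
 have d: "d > 0" using k' c by (simp add: d_def)
 define f where "f t = (gauss_integral (mat 1 + t *\<^sub>R B))\<^sup>2 * det (mat 1 + t *\<^sub>R B)" for t
 have "(f has_real_derivative 0) (at t within {0..1})" if t: "t \<in> {0..1}" for t
 proof -
  have symt: "transpose (mat 1 + t *\<^sub>R B) = mat 1 + t *\<^sub>R B"
   using sym by (auto simp: B_def transpose_def vec_eq_iff mat_def)
  have "u \<bullet> ((mat 1 + t *\<^sub>R B + h *\<^sub>R B) *v u) >= (k'/2) * (norm u)\<^sup>2" if h: "\<bar>h\<bar> < d" for h u
  proof -
   have "u \<bullet> ((mat 1 + t *\<^sub>R B + h *\<^sub>R B) *v u) = (norm u)\<^sup>2 + t * (u \<bullet> (B *v u)) + h * (u \<bullet> (B *v u))"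
    by (simp add: matrix_vector_mult_add_rdistrib inner_add_right power2_norm_eq_inner flip: scaleR_matrix_vector_assoc)
   also have "... = (1 - t) * (norm u)\<^sup>2 + t * (u \<bullet> (K *v u)) + h * (u \<bullet> (B *v u))"
    by (simp add: B_def matrix_vector_mult_diff_rdistrib inner_diff_right power2_norm_eq_inner algebra_simps)
   also have "... >= (1 - t) * (k' * (norm u)\<^sup>2) + t * (k' * (norm u)\<^sup>2) - d * (c * (norm u)\<^sup>2)"
   proof -
    have "k' * (norm u)\<^sup>2 <= 1 * (norm u)\<^sup>2" by (intro mult_right_mono k') auto
    hence a: "(1 - t) * (k' * (norm u)\<^sup>2) <= (1 - t) * (norm u)\<^sup>2" using t by (intro mult_left_mono) auto
    have "k' * (norm u)\<^sup>2 <= k * (norm u)\<^sup>2" by (intro mult_right_mono k') auto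
    hence b: "t * (k' * (norm u)\<^sup>2) <= t * (u \<bullet> (K *v u))" using k(2)[of u] t by (intro mult_left_mono) auto
    have "\<bar>u \<bullet> (B *v u)\<bar> <= norm u * (c * norm u)"
     by (rule order_trans[OF Cauchy_Schwarz_ineq2 mult_left_mono[OF c(2)]]) simp
    hence "\<bar>h\<bar> * \<bar>u \<bullet> (B *v u)\<bar> <= d * (c * (norm u)\<^sup>2)"
     using h by (intro mult_mono) (auto simp: power2_eq_square mult_ac)
    hence "- (d * (c * (norm u)\<^sup>2)) <= h * (u \<bullet> (B *v u))" unfolding abs_mult[symmetric] by linarith
    with a b show ?thesis by linarith
   qed
   moreover have "d * c <= k' / 2" using k' c by (simp add: d_def field_simps)
   hence "d * (c * (norm u)\<^sup>2) <= k' / 2 * (norm u)\<^sup>2"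
    unfolding mult.assoc[symmetric] by (intro mult_right_mono) auto
   ultimately show ?thesis by (simp add: algebra_simps)
  qed
  from gauss_integral_line_derivative[OF symt _ d this] k'
  have "((%h. f (h + t)) has_real_derivative 0) (at 0)"
   by (simp add: f_def scaleR_left_distrib ac_simps)
  hence "(f has_real_derivative 0) (at t)" using DERIV_shift[of f 0 0 t] by simp
  thus ?thesis by (rule has_field_derivative_at_within)
 qed
 hence "EX c. ALL t:{0..1}. f t = c"
  by (intro has_field_derivative_zero_constant) auto
 hence "f 1 = f 0" by fastforce
 hence eq: "(gauss_integral K)\<^sup>2 * det K = (gauss_integral (mat 1 :: real ^ 'n ^ 'n))\<^sup>2"
  by (simp add: f_def B_def)
 have pos: "gauss_integral K > 0" by (rule gauss_integral_pos[OF k])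
 have pos1: "gauss_integral (mat 1 :: real ^ 'n ^ 'n) > 0"
  by (rule gauss_integral_pos[of 1]) (auto simp: power2_norm_eq_inner)
 show det: "det K > 0"
 proof (rule ccontr)
  assume "\<not> det K > 0"
  hence "(gauss_integral K)\<^sup>2 * det K <= 0" by (intro mult_nonneg_nonpos) auto
  thus False using eq pos1 by simp
 qed
 have "(gauss_integral K * sqrt (det K))\<^sup>2 = (gauss_integral (mat 1 :: real ^ 'n ^ 'n))\<^sup>2"
  using eq det by (simp add: power_mult_distrib)
 hence "gauss_integral K * sqrt (det K) = gauss_integral (mat 1 :: real ^ 'n ^ 'n)"
  using pos pos1 det by (elim power2_eq_imp_eq) auto
 thus "gauss_integral K = gauss_integral (mat 1 :: real ^ 'n ^ 'n) / sqrt (det K)"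
  using det by (simp add: field_simps)
qed

section \<open>Laplace expansions\<close>

lemma lborel_integral_uminus:
 fixes f :: "'a::euclidean_space => 'b::{banach, second_countable_topology}"
 assumes [measurable]: "f \<in> borel_measurable borel"
 shows "(LINT x|lborel. f (- x)) = (LINT x|lborel. f x)"
proof -
 have "(lborel :: 'a measure) = distr lborel borel uminus"
  using lborel_affine[of "-1" "0::'a"] by (simp add: density_1)
 hence "(LINT x|lborel. f x) = (\<integral>x. f x \<partial>distr lborel borel uminus)" by simp
 also have "... = (LINT x|lborel. f (- x))" by (subst integral_distr) auto
 finally show ?thesis by simp
qed

lemma lborel_integrable_uminus:
 fixes f :: "'a::euclidean_space => 'b::{banach, second_countable_topology}"
 assumes "integrable lborel f"
 shows "integrable lborel (%x. f (- x))"
proof -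
 have [measurable]: "f \<in> borel_measurable borel" using assms by auto
 have "(lborel :: 'a measure) = distr lborel borel uminus"
  using lborel_affine[of "-1" "0::'a"] by (simp add: density_1)
 hence "integrable (distr lborel borel uminus) f" using assms by simp
 thus ?thesis by (subst (asm) integrable_distr_eq) auto
qed

text \<open>\<open>X n u\<close> is a rescaled integrand and \<open>\<Phi> u t\<close> its
  holomorphic extension along the line through \<open>u\<close>, with \<open>t\<close> in place of
  1/sqrt n. The number \<open>j\<close> (0 or 1 in use) is the power of 1/n at which the expansion
  starts. The disc of radius \<open>r / norm u\<close> shrinks as \<open>u\<close> grows, so large
  \<open>u\<close> are left to \<open>tail\<close>.\<close>

locale even_expansion =
 fixes \<Phi> :: "real ^ 'd => complex => complex" and X :: "nat => real ^ 'd => complex"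
  and r \<kappa> A :: real and j N :: nat
 assumes r: "r > 0" and \<kappa>: "\<kappa> > 0" and A: "A >= 0" and N: "N >= 1"
  and hol: "!!u. u ~= 0 ==> \<Phi> u holomorphic_on ball 0 (r / norm u)"
  and bound: "!!u t. u ~= 0 ==> norm t * norm u < r ==>
    norm (\<Phi> u t) <= A * ((1 + norm u)\<^sup>2 * exp (- \<kappa> * (norm u)\<^sup>2))"
  and lower: "!!u k. u ~= 0 ==> even k ==> k < 2 * j ==> (deriv ^^ k) (\<Phi> u) 0 = 0"
  and int: "!!n. n >= N ==> integrable lborel (X n)"
  and X: "!!n u. n >= N ==> u ~= 0 ==> norm u <= r * sqrt n / 2 ==> X n u = \<Phi> u (of_real (1 / sqrt n))"
  and X': "!!n u. n >= N ==> u ~= 0 ==> norm u <= r * sqrt n / 2 ==> X n (- u) = \<Phi> u (- of_real (1 / sqrt n))"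
  and tail: "!!n. n >= N ==> (LINT u|lborel. norm (X n u) * indicator {u. norm u > r * sqrt n / 2} u) <= A / real n ^ (j + 1)"
begin

text \<open>The coefficient of \<open>t ^ (2 * j)\<close>. The line through \<open>u = 0\<close> is
  degenerate and a point is a null set, so the value there is set to 0.\<close>

definition a where "a u = (if u = 0 then 0 else (deriv ^^ (2 * j)) (\<Phi> u) 0 / fact (2 * j))"
text \<open>The Taylor remainder of order \<open>2 * j + 2\<close> on a disc of radius
  \<open>r / norm u\<close> costs \<open>2 * j + 2\<close> powers of \<open>norm u\<close>; together
  with the square in \<open>w\<close> they make up the exponent.\<close>

definition om :: "real ^ 'd => real" where "om u = (1 + norm u) ^ (2 * j + 4) * exp (- \<kappa> * (norm u)\<^sup>2)"
definition w :: "real ^ 'd => real" where "w u = (1 + norm u)\<^sup>2 * exp (- \<kappa> * (norm u)\<^sup>2)"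

lemma om_integrable: "integrable lborel om"
 unfolding om_def using \<kappa> by (intro integrable_poly_gaussian)

lemma w_nonneg: "w u >= 0" by (simp add: w_def)

lemma w_le_om: "k <= 2 * j + 2 ==> w u * (norm u / r) ^ k <= om u / r ^ k"
proof -
 assume k: "k <= 2 * j + 2"
 have "norm u ^ k <= (1 + norm u) ^ k" by (intro power_mono) auto
 also have "... <= (1 + norm u) ^ (2 * j + 2)" using k by (intro power_increasing) auto
 finally have "w u * norm u ^ k <= w u * (1 + norm u) ^ (2 * j + 2)" by (intro mult_left_mono w_nonneg)
 also have "... = ((1 + norm u)\<^sup>2 * (1 + norm u) ^ (2 * j + 2)) * exp (- \<kappa> * (norm u)\<^sup>2)" by (simp add: w_def)
 also have "(1 + norm u)\<^sup>2 * (1 + norm u) ^ (2 * j + 2) = (1 + norm u) ^ (2 * j + 4)"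
  unfolding power_add[symmetric] by (rule arg_cong[where f="power (1 + norm u)"]) simp
 also have "... * exp (- \<kappa> * (norm u)\<^sup>2) = om u" by (simp add: om_def)
 finally show ?thesis using r by (simp add: power_divide divide_right_mono)
qed

lemma a_bound: "norm (a u) <= A * (w u * (norm u / r) ^ (2 * j))"
proof (cases "u = 0")
 case False
 hence "norm ((deriv ^^ (2 * j)) (\<Phi> u) 0 / fact (2 * j)) <= A * w u / (r / norm u) ^ (2 * j)"
  using r bound[OF False] unfolding w_def by (intro Cauchy_coefficient_bound[OF hol]) (auto simp: field_simps)
 thus ?thesis using False r by (simp add: a_def power_divide)
qed (auto simp: a_def A w_nonneg r less_imp_le)

text \<open>In the sum over \<open>u\<close> and \<open>- u\<close> odd powers of \<open>t\<close>
  cancel, even powers below \<open>2 * j\<close> vanish by \<open>lower\<close>, and the remainder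
  carries \<open>t ^ (2 * j + 2)\<close>, which is 1/n^(j + 1).\<close>

lemma local_expansion:
 assumes n: "n >= N" and u: "u ~= 0" and le: "norm u <= r * sqrt n / 2"
 shows "norm (X n u + X n (- u) - 2 * a u / of_nat n ^ j) <= 4 * A * (w u * (norm u / r) ^ (2 * j + 2)) / real n ^ (j + 1)"
proof -
 have n0: "n > 0" using n N by simp
 define t where "t = complex_of_real (1 / sqrt n)"
 define c where "c k = (deriv ^^ k) (\<Phi> u) 0 / fact k" for k
 have nt: "norm t = 1 / sqrt n" using n0 by (simp add: t_def norm_divide)
 have t2: "t\<^sup>2 = 1 / of_nat n" using n0
 proof -
  have "(1 / sqrt n)\<^sup>2 = 1 / real n" by (simp add: power_divide)
  thus ?thesis unfolding t_def of_real_power[symmetric] by simp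
 qed
 have ntR: "norm t <= r / norm u / 2" "norm (- t) <= r / norm u / 2"
  using le u n0 by (auto simp: nt field_simps)
 have E: "norm (\<Phi> u s - (\<Sum>k<2 * j + 2. c k * s ^ k)) <= 2 * (A * w u) * (norm s / (r / norm u)) ^ (2 * j + 2)"
  if "norm s <= r / norm u / 2" for s
  unfolding c_def using r u bound[OF u] that unfolding w_def
  by (intro holomorphic_taylor_bound[OF hol[OF u]]) (auto simp: field_simps)
 have "norm ((\<Phi> u t - (\<Sum>k<2 * j + 2. c k * t ^ k)) + (\<Phi> u (- t) - (\<Sum>k<2 * j + 2. c k * (- t) ^ k)))
   <= 2 * (A * w u) * (norm t / (r / norm u)) ^ (2 * j + 2) + 2 * (A * w u) * (norm t / (r / norm u)) ^ (2 * j + 2)"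
  using norm_triangle_mono[OF E[OF ntR(1)] E[OF ntR(2)]] by simp
 also have "... = 4 * A * (w u * (norm u / r) ^ (2 * j + 2)) / real n ^ (j + 1)"
 proof -
  have "(norm t)\<^sup>2 = 1 / n" using n0 by (simp add: nt power_divide)
  hence "(norm t) ^ (2 * j + 2) = 1 / real n ^ (j + 1)"
   using power_mult[of "norm t" 2 "j + 1"] by (simp add: power_divide)
  note e = this
  have "(norm t / (r / norm u)) ^ M = norm t ^ M * (norm u / r) ^ M" for M :: nat
   by (simp add: power_mult_distrib power_divide)
  note e' = this[of "2 * j + 2"]
  show ?thesis unfolding e' e by (simp add: mult_ac)
 qed
 also have "(\<Phi> u t - (\<Sum>k<2 * j + 2. c k * t ^ k)) + (\<Phi> u (- t) - (\<Sum>k<2 * j + 2. c k * (- t) ^ k))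
   = \<Phi> u t + \<Phi> u (- t) - (\<Sum>k<2 * j + 2. c k * (t ^ k + (- t) ^ k))"
  by (simp add: sum.distrib algebra_simps)
 also have "(\<Sum>k<2 * j + 2. c k * (t ^ k + (- t) ^ k)) = (SUM k:{2 * j}. c k * (t ^ k + (- t) ^ k))"
 proof (intro sum.mono_neutral_right ballI)
  fix k assume k: "k \<in> {..<2 * j + 2} - {2 * j}"
  show "c k * (t ^ k + (- t) ^ k) = 0"
  proof (cases "even k")
   case True
   hence "k < 2 * j" using k by (cases "k = 2 * j + 1") auto
   thus ?thesis using lower[OF u True] by (simp add: c_def)
  qed simp
 qed auto
 also have "... = 2 * a u / of_nat n ^ j"
  using u t2 by (simp add: a_def c_def power_mult power_one_over)
 finally show ?thesis using X[OF n u le] X'[OF n u le] by (simp add: t_def)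
qed

text \<open>The symmetrised integrand, cut off where 1/sqrt n leaves the half disc in which the
  Taylor estimate is valid.\<close>

definition S where "S n u = indicator {u. norm u <= r * sqrt n / 2} u *\<^sub>R (X n u + X n (- u))"

lemma S_expansion:
 assumes n: "n >= N" and u: "u ~= 0"
 shows "norm (S n u - 2 * a u / of_nat n ^ j) <= (8 * A / r ^ (2 * j + 2) / real n ^ (j + 1)) * om u"
proof -
 have n0: "n > 0" using n N by simp
 have "norm (S n u - 2 * a u / of_nat n ^ j) <= 8 * A * (w u * (norm u / r) ^ (2 * j + 2)) / real n ^ (j + 1)"
 proof (cases "norm u <= r * sqrt n / 2")
  case True
  have "4 * A * (w u * (norm u / r) ^ (2 * j + 2)) / real n ^ (j + 1) <= 8 * A * (w u * (norm u / r) ^ (2 * j + 2)) / real n ^ (j + 1)"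
   using A w_nonneg[of u] r by (intro divide_right_mono mult_right_mono) auto
  with local_expansion[OF n u True] show ?thesis using True by (simp add: S_def)
 next
  case False
  \<comment> \<open>Beyond the cut-off \<open>S n u\<close> is 0 and the coefficient term itself
    must be small; there \<open>4 * (norm u / r)\<^sup>2 / n\<close> is at least 1 and supplies the
    missing factor 1/n.\<close>
  have "(r * sqrt n / 2)\<^sup>2 <= (norm u)\<^sup>2" using False r by (intro power_mono) auto
  hence "1 <= 4 * (norm u / r)\<^sup>2 / n" using r n0 by (simp add: power_mult_distrib power_divide field_simps)
  hence "2 * (A * (w u * (norm u / r) ^ (2 * j))) / real n ^ j * 1
    <= 2 * (A * (w u * (norm u / r) ^ (2 * j))) / real n ^ j * (4 * (norm u / r)\<^sup>2 / n)"
   using A w_nonneg[of u] r by (intro mult_left_mono) auto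
  also have "... = 8 * A * (w u * (norm u / r) ^ (2 * j + 2)) / real n ^ (j + 1)"
  proof -
   have "2 * (A * (W * x ^ (2 * j))) / M ^ j * (4 * x\<^sup>2 / M) = 8 * A * (W * x ^ (2 * j + 2)) / M ^ (j + 1)" for W x M :: real
    by (simp add: power_add power2_eq_square mult_ac)
   thus ?thesis by this
  qed
  finally have "2 * (A * (w u * (norm u / r) ^ (2 * j))) / real n ^ j <= 8 * A * (w u * (norm u / r) ^ (2 * j + 2)) / real n ^ (j + 1)" by simp
  moreover have "norm (S n u - 2 * a u / of_nat n ^ j) <= 2 * (A * (w u * (norm u / r) ^ (2 * j))) / real n ^ j"
   using False a_bound[of u] n0 by (simp add: S_def norm_divide norm_mult norm_power divide_right_mono)
  ultimately show ?thesis by linarith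
 qed
 also have "... <= 8 * A * (om u / r ^ (2 * j + 2)) / real n ^ (j + 1)"
  using A w_le_om[of "2 * j + 2" u] by (intro divide_right_mono mult_left_mono) auto
 finally show ?thesis by (simp add: mult_ac)
qed

lemma X_measurable: "n >= N ==> X n \<in> borel_measurable borel"
 using int by auto

lemma S_measurable: "n >= N ==> S n \<in> borel_measurable borel"
proof -
 assume "n >= N"
 note [measurable] = X_measurable[OF this]
 show ?thesis unfolding S_def[abs_def] by measurable
qed

text \<open>The hypotheses on \<open>\<Phi>\<close> concern each line separately and say nothing
  about dependence on \<open>u\<close>. Measurability of the coefficient comes from writing it as a
  pointwise limit of the measurable integrands, rescaled.\<close>

lemma a_measurable: "a \<in> borel_measurable borel"
proof (rule borel_measurable_LIMSEQ_metric)
 fix i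
 note [measurable] = S_measurable[of "i + N", OF le_add2]
 show "(%u. if u = 0 then 0 else of_nat (i + N) ^ j * S (i + N) u / 2) \<in> borel_measurable borel" by measurable
next
 fix u :: "real ^ 'd"
 show "(%i. if u = 0 then 0 else of_nat (i + N) ^ j * S (i + N) u / 2) \<longlonglongrightarrow> a u"
 proof (cases "u = 0")
  case False
  have "(%i. of_nat (i + N) ^ j * S (i + N) u / 2 - a u) \<longlonglongrightarrow> 0"
  proof (rule Lim_null_comparison)
   show "\<forall>\<^sub>F i in sequentially. norm (of_nat (i + N) ^ j * S (i + N) u / 2 - a u) <= (4 * A / r ^ (2 * j + 2) * om u) * (1 / of_nat (i + N))"
   proof (intro always_eventually allI)
    fix i
    have n0: "real (i + N) > 0" using N by simp
    have nj: "real (i + N) ^ j > 0" using n0 by simp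
    have nc: "(of_nat (i + N) :: complex) ~= 0" using N by (simp del: of_nat_add)
    have "of_nat (i + N) ^ j * S (i + N) u / 2 - a u = (of_nat (i + N) ^ j / 2) * (S (i + N) u - 2 * a u / of_nat (i + N) ^ j)"
    proof -
     have "c ^ j * s / 2 - b = (c ^ j / 2) * (s - 2 * b / c ^ j)" if "c ~= 0" for c s b :: complex
      using that by (simp add: field_simps)
     from this[OF nc] show ?thesis .
    qed
    also have "norm ... = real (i + N) ^ j / 2 * norm (S (i + N) u - 2 * a u / of_nat (i + N) ^ j)"
     by (simp only: norm_mult norm_divide norm_power norm_of_nat) simp
    also have "... <= real (i + N) ^ j / 2 * ((8 * A / r ^ (2 * j + 2) / real (i + N) ^ (j + 1)) * om u)"
     by (rule mult_left_mono[OF S_expansion[OF le_add2 False]]) simp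
    also have "... = (4 * A / r ^ (2 * j + 2) * om u) * (real (i + N) ^ j / (real (i + N) ^ j * real (i + N)))"
     by (simp add: field_simps del: of_nat_add)
    also have "... = (4 * A / r ^ (2 * j + 2) * om u) * (1 / of_nat (i + N))" using nj by simp
    finally show "norm (of_nat (i + N) ^ j * S (i + N) u / 2 - a u) <= (4 * A / r ^ (2 * j + 2) * om u) * (1 / of_nat (i + N))" .
   qed
   have "(%i. 1 / real (i + N)) \<longlonglongrightarrow> 0" by (rule LIMSEQ_ignore_initial_segment[OF lim_1_over_n])
   thus "(%i. (4 * A / r ^ (2 * j + 2) * om u) * (1 / real (i + N))) \<longlonglongrightarrow> 0"
    by (rule tendsto_mult_right_zero)
  qed
  thus ?thesis using False by (simp add: LIM_zero_iff)
 qed (simp add: a_def)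
qed

lemma a_bound': "norm (a u) <= A / r ^ (2 * j) * om u"
 using order_trans[OF a_bound mult_left_mono[OF w_le_om[of "2 * j" u] A]] by simp

lemma a_integrable: "integrable lborel a"
proof (rule Bochner_Integration.integrable_bound[OF integrable_mult_right[OF om_integrable, of "A / r ^ (2 * j)"]])
 show "AE u in lborel. norm (a u) <= norm (A / r ^ (2 * j) * om u)"
  unfolding real_norm_def by (intro AE_I2 order_trans[OF a_bound' abs_ge_self])
qed (use a_measurable in simp)

lemma a_integral_bound: "norm (LINT u|lborel. a u) <= A / r ^ (2 * j) * (LINT u|lborel. om u)"
proof -
 have "norm (LINT u|lborel. a u) <= (LINT u|lborel. A / r ^ (2 * j) * om u)"
  by (rule order_trans[OF integral_norm_bound integral_mono[OF integrable_norm[OF a_integrable] integrable_mult_right[OF om_integrable] a_bound']])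
 thus ?thesis by simp
qed

text \<open>Reflection invariance makes the integral of \<open>S n\<close> twice the integral of
  \<open>X n\<close> over the cut-off ball; what lies outside the ball is
  \<open>tail\<close>.\<close>

lemma expansion:
 assumes n: "n >= N"
 shows "norm ((LINT u|lborel. X n u) - (LINT u|lborel. a u) / of_nat n ^ j)
   <= (1 + 4 * (LINT u|lborel. om u) / r ^ (2 * j + 2)) * A / real n ^ (j + 1)"
proof -
 let ?B = "{u::real^'d. norm u <= r * sqrt n / 2}"
 have n0: "n > 0" using n N by simp
 note [measurable] = X_measurable[OF n]
 have B[measurable]: "?B \<in> sets borel" by measurable
 define Xi where "Xi u = indicator ?B u *\<^sub>R X n u" for u
 have iXi: "integrable lborel Xi" unfolding Xi_def
  by (rule integrable_mult_indicator[OF _ int[OF n]]) (use B in simp)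
 have iXo: "integrable lborel (%u. indicator (- ?B) u *\<^sub>R X n u)"
  by (rule integrable_mult_indicator[OF _ int[OF n]]) (use B in simp)
 have S_eq: "S n = (%u. Xi u + Xi (- u))" by (auto simp: S_def Xi_def fun_eq_iff indicator_def)
 have iS: "integrable lborel (S n)"
  unfolding S_eq by (intro Bochner_Integration.integrable_add iXi lborel_integrable_uminus)
 have "(LINT u|lborel. S n u) = (LINT u|lborel. Xi u) + (LINT u|lborel. Xi (- u))"
  unfolding S_eq by (intro Bochner_Integration.integral_add iXi lborel_integrable_uminus)
 also have "(LINT u|lborel. Xi (- u)) = (LINT u|lborel. Xi u)"
  using iXi by (intro lborel_integral_uminus) auto
 finally have Seq: "(LINT u|lborel. S n u) = 2 * (LINT u|lborel. Xi u)" by simp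
 have "norm (LINT u|lborel. S n u - 2 * a u / of_nat n ^ j) <= (LINT u|lborel. norm (S n u - 2 * a u / of_nat n ^ j))"
  by (rule integral_norm_bound)
 also have "... <= (LINT u|lborel. (8 * A / r ^ (2 * j + 2) / real n ^ (j + 1)) * om u)"
 proof (rule integral_mono_AE)
  show "AE u in lborel. norm (S n u - 2 * a u / of_nat n ^ j) <= (8 * A / r ^ (2 * j + 2) / real n ^ (j + 1)) * om u"
   using AE_lborel_singleton[of "0::real^'d"] by eventually_elim (rule S_expansion[OF n])
 qed (use iS a_integrable om_integrable in auto)
 finally have "norm ((LINT u|lborel. S n u) - 2 * (LINT u|lborel. a u) / of_nat n ^ j) <= (8 * A / r ^ (2 * j + 2) / real n ^ (j + 1)) * (LINT u|lborel. om u)"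
  using iS a_integrable by simp
 moreover have "(LINT u|lborel. S n u) - 2 * (LINT u|lborel. a u) / of_nat n ^ j = 2 * ((LINT u|lborel. Xi u) - (LINT u|lborel. a u) / of_nat n ^ j)"
  by (simp add: Seq algebra_simps)
 ultimately have 1: "norm ((LINT u|lborel. Xi u) - (LINT u|lborel. a u) / of_nat n ^ j) <= (4 * A / r ^ (2 * j + 2) / real n ^ (j + 1)) * (LINT u|lborel. om u)"
  by (simp only: norm_mult norm_numeral)
 have "(LINT u|lborel. X n u) = (LINT u|lborel. Xi u + indicator (- ?B) u *\<^sub>R X n u)"
  by (intro Bochner_Integration.integral_cong) (auto simp: Xi_def indicator_def)
 also have "... = (LINT u|lborel. Xi u) + (LINT u|lborel. indicator (- ?B) u *\<^sub>R X n u)"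
  by (rule Bochner_Integration.integral_add[OF iXi iXo])
 finally have 2: "(LINT u|lborel. X n u) = (LINT u|lborel. Xi u) + (LINT u|lborel. indicator (- ?B) u *\<^sub>R X n u)" .
 have "norm (LINT u|lborel. indicator (- ?B) u *\<^sub>R X n u) <= (LINT u|lborel. norm (indicator (- ?B) u *\<^sub>R X n u))"
  by (rule integral_norm_bound)
 also have "... = (LINT u|lborel. norm (X n u) * indicator {u. norm u > r * sqrt n / 2} u)"
  by (intro Bochner_Integration.integral_cong) (auto simp: indicator_def)
 also have "... <= A / real n ^ (j + 1)" by (rule tail[OF n])
 finally have 3: "norm (LINT u|lborel. indicator (- ?B) u *\<^sub>R X n u) <= A / real n ^ (j + 1)" .
 have "norm ((LINT u|lborel. X n u) - (LINT u|lborel. a u) / of_nat n ^ j)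
   <= norm ((LINT u|lborel. Xi u) - (LINT u|lborel. a u) / of_nat n ^ j) + norm (LINT u|lborel. indicator (- ?B) u *\<^sub>R X n u)"
  unfolding 2 by (rule order_trans[OF _ norm_triangle_ineq]) (simp add: algebra_simps)
 also have "... <= (4 * A / r ^ (2 * j + 2) / real n ^ (j + 1)) * (LINT u|lborel. om u) + A / real n ^ (j + 1)"
  by (rule add_mono[OF 1 3])
 also have "... = (1 + 4 * (LINT u|lborel. om u) / r ^ (2 * j + 2)) * A / real n ^ (j + 1)"
  by (simp add: add_divide_distrib distrib_left distrib_right mult_ac)
 finally show ?thesis .
qed

end

section \<open>Tails of the inversion integrals\<close>

lemma poly_geometric_bounded:
 fixes \<eta> :: real
 assumes "0 < \<eta>" "\<eta> < 1"
 shows "EX K>=0. \<forall>n::nat. real n ^ k * \<eta> ^ n <= K"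
proof -
 define l where "l = - ln \<eta>"
 have l: "l > 0" using assms by (simp add: l_def)
 have "real n ^ k * \<eta> ^ n <= (real (Suc k) / l) ^ Suc k" if n: "n >= 1" for n
 proof -
  have "\<eta> = exp (- l)" using assms by (simp add: l_def)
  hence e: "\<eta> ^ n = exp (- (l * real n))" by (simp add: mult.commute flip: exp_of_nat_mult)
  have "0 <= l * real n" using l by simp
  hence "(1 + l * real n / real (Suc k)) ^ Suc k <= exp (l * real n)"
   by (intro exp_ge_one_plus_x_over_n_power_n) linarith+
  moreover have "(l * real n / real (Suc k)) ^ Suc k <= (1 + l * real n / real (Suc k)) ^ Suc k"
   using l by (intro power_mono) auto
  ultimately have "(l * real n / real (Suc k)) ^ Suc k * (real (Suc k) / l) ^ Suc k <= exp (l * real n) * (real (Suc k) / l) ^ Suc k"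
   using l by (intro mult_right_mono) auto
  hence a: "real n ^ Suc k <= exp (l * real n) * (real (Suc k) / l) ^ Suc k"
   using l unfolding power_mult_distrib[symmetric] by simp
  have "real n ^ k <= real n ^ Suc k" using n by (intro power_increasing) auto
  hence "real n ^ k * \<eta> ^ n <= exp (l * real n) * (real (Suc k) / l) ^ Suc k * exp (- (l * real n))"
   unfolding e using a by (intro mult_right_mono) auto
  also have "... = (real (Suc k) / l) ^ Suc k" by (simp add: exp_minus field_simps del: power_Suc)
  finally show ?thesis .
 qed
 note h = this
 define B where "B = (real (Suc k) / l) ^ Suc k"
 have B: "B >= 0" using l by (simp add: B_def)
 have "real n ^ k * \<eta> ^ n <= 1 + B" for n :: nat
 proof (cases "n = 0")
  case True
  thus ?thesis using B by (cases k) auto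
 next
  case False
  thus ?thesis using h[of n] by (simp add: B_def del: power_Suc)
 qed
 thus ?thesis using B by (intro exI[of _ "1 + B"]) auto
qed

text \<open>A fixed number \<open>k\<close> of envelope factors beats the polynomial and leaves an
  integrable function; the remaining \<open>n - 2 - k\<close> factors are bounded off a ball by
  powers of \<open>\<eta>\<close> < 1, which beat every power of \<open>n\<close>. The exponent
  \<open>n - 2\<close> leaves room for a difference of two powers with exponent
  \<open>n - 1\<close>.\<close>

lemma decay_tail:
 fixes \<delta> \<rho> :: real and p :: nat
 assumes \<delta>: "\<delta> > 0" and \<rho>: "\<rho> > 0"
 shows "EX n0>=1. EX K>=0. ALL n>=n0. ALL A>=0. \<forall>G::real ^ 'd => complex. G \<in> borel_measurable borel -->
   (ALL \<phi>. norm (G \<phi>) <= A * real n * (1 + norm \<phi>) ^ p * ((1 + \<delta> * (norm \<phi>)\<^sup>2) powr (- \<delta>)) ^ (n - 2)) -->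
   integrable lborel G & integrable lborel (%u. G (u /\<^sub>R sqrt n)) &
   (LINT u|lborel. norm (G (u /\<^sub>R sqrt n)) * indicator {u. norm u > \<rho> * sqrt n} u) <= K * A / (real n)\<^sup>2"
proof -
 define d where "d = DIM(real ^ 'd)"
 define e where "e \<phi> = (1 + \<delta> * (norm \<phi>)\<^sup>2) powr (- \<delta>)" for \<phi> :: "real ^ 'd"
 define \<delta>' where "\<delta>' = min 1 \<delta>"
 have \<delta>': "\<delta>' > 0" "\<delta>' <= 1" "\<delta>' <= \<delta>" using \<delta> by (auto simp: \<delta>'_def)
 have one: "1 <= 1 + \<delta> * (norm \<phi>)\<^sup>2" for \<phi> :: "real ^ 'd" using \<delta> by simp
 have e01: "0 < e \<phi>" "e \<phi> <= 1" for \<phi> :: "real ^ 'd"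
 proof -
  have x: "1 + \<delta> * (norm \<phi>)\<^sup>2 > 0" by (rule less_le_trans[OF zero_less_one one])
  thus "0 < e \<phi>" by (simp add: e_def)
  have "1 <= (1 + \<delta> * (norm \<phi>)\<^sup>2) powr \<delta>" by (intro ge_one_powr_ge_zero one less_imp_le[OF \<delta>])
  from le_imp_inverse_le[OF this] show "e \<phi> <= 1" by (simp add: e_def powr_minus)
 qed
 \<comment> \<open>With \<open>\<delta> * k\<close> at least \<open>p + d\<close>, the power
   \<open>p\<close> cancels the polynomial factor and \<open>d\<close> copies of 1/(1 + |\<phi>|^2)
   remain, which is integrable.\<close>
 define k where "k = nat \<lceil>(p + d) / \<delta>\<rceil>"
 have "(p + d) / \<delta> <= k" unfolding k_def by (rule real_nat_ceiling_ge)
 hence k: "\<delta> * k >= p + d" using \<delta> by (simp add: pos_divide_le_eq mult.commute)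
 define C1 where "C1 = 2 ^ p * \<delta>' powr (- (\<delta> * k))"
 have C1: "C1 >= 0" by (simp add: C1_def)
 have ek: "(1 + norm \<phi>) ^ p * e \<phi> ^ k <= C1 * (1 / (1 + (norm \<phi>)\<^sup>2) ^ d)" for \<phi> :: "real ^ 'd"
 proof -
  define y where "y = 1 + (norm \<phi>)\<^sup>2"
  have y: "y >= 1" by (simp add: y_def)
  have "\<delta>' * y <= 1 + \<delta> * (norm \<phi>)\<^sup>2" using \<delta>' by (simp add: y_def distrib_left add_mono mult_right_mono)
  hence "(1 + \<delta> * (norm \<phi>)\<^sup>2) powr (- (\<delta> * k)) <= (\<delta>' * y) powr (- (\<delta> * k))"
   using \<delta> \<delta>' y by (intro powr_mono2') auto
  moreover have "e \<phi> ^ k = (1 + \<delta> * (norm \<phi>)\<^sup>2) powr (- (\<delta> * k))"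
   using e01(1)[of \<phi>] by (simp add: e_def powr_powr flip: powr_realpow)
  ultimately have "e \<phi> ^ k <= \<delta>' powr (- (\<delta> * k)) * y powr (- (\<delta> * k))"
   using \<delta>' y by (simp add: powr_mult)
  also have "... <= \<delta>' powr (- (\<delta> * k)) * y powr (- real (p + d))"
   using y k by (intro mult_left_mono powr_mono) auto
  finally have 1: "e \<phi> ^ k <= \<delta>' powr (- (\<delta> * k)) * y powr (- real (p + d))" .
  have "0 <= 1 - 2 * norm \<phi> + (norm \<phi>)\<^sup>2" using zero_le_power2[of "norm \<phi> - 1"] by (simp add: power2_diff)
  moreover have "0 <= (norm \<phi>)\<^sup>2" by simp
  ultimately have "1 + norm \<phi> <= 2 * y" unfolding y_def by argo
  hence 2: "(1 + norm \<phi>) ^ p <= (2 * y) ^ p" by (intro power_mono) auto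
  have "(1 + norm \<phi>) ^ p * e \<phi> ^ k <= (2 * y) ^ p * (\<delta>' powr (- (\<delta> * k)) * y powr (- real (p + d)))"
   using y e01(1)[of \<phi>] by (intro mult_mono 1 2) auto
  also have "y powr (- real (p + d)) = 1 / (y ^ p * y ^ d)"
   unfolding powr_minus_divide power_add[symmetric] by (subst powr_realpow) (use y in auto)
  also have "(2 * y) ^ p * (\<delta>' powr (- (\<delta> * k)) * (1 / (y ^ p * y ^ d))) = C1 * (1 / y ^ d)"
   using y by (simp add: C1_def power_mult_distrib)
  finally show ?thesis by (simp add: y_def)
 qed
 define \<eta> where "\<eta> = (1 + \<delta> * \<rho>\<^sup>2) powr (- \<delta>)"
 have "1 < 1 + \<delta> * \<rho>\<^sup>2" using \<delta> \<rho> by simp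
 hence \<eta>: "0 < \<eta>" "\<eta> < 1" using \<delta> powr_less_mono[of "- \<delta>" 0 "1 + \<delta> * \<rho>\<^sup>2"] by (auto simp: \<eta>_def)
 have e\<eta>: "e \<phi> <= \<eta>" if "norm \<phi> > \<rho>" for \<phi> :: "real ^ 'd"
 proof -
  have "\<rho>\<^sup>2 <= (norm \<phi>)\<^sup>2" using that \<rho> by (intro power_mono) auto
  hence "\<delta> * \<rho>\<^sup>2 <= \<delta> * (norm \<phi>)\<^sup>2" using \<delta> by (intro mult_left_mono) auto
  thus ?thesis unfolding e_def \<eta>_def using \<delta> by (intro powr_mono2') (auto intro: add_pos_nonneg)
 qed
 \<comment> \<open>The exponent \<open>d + 3\<close> covers the change of variables
   (\<open>sqrt n ^ d\<close>, bounded by \<open>n ^ d\<close>), the factor \<open>n\<close> in the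
   hypothesis on \<open>G\<close>, and the target 1/n^2.\<close>
 obtain K1 where K1: "K1 >= 0" "!!n::nat. real n ^ (d + 3) * \<eta> ^ n <= K1" using poly_geometric_bounded[OF \<eta>] by blast
 define I where "I = (\<integral>\<phi>. 1 / (1 + (norm \<phi>)\<^sup>2) ^ d \<partial>(lborel :: (real ^ 'd) measure))"
 have I: "I >= 0" unfolding I_def by (intro integral_nonneg_AE) auto
 have Ii: "integrable lborel (%\<phi>::real^'d. 1 / (1 + (norm \<phi>)\<^sup>2) ^ d)"
  unfolding d_def by (rule integrable_inverse_power_Basis)
 define K where "K = C1 * I * K1 / \<eta> ^ (k + 2)"
 have K: "K >= 0" using C1 I K1 \<eta> by (simp add: K_def)
 show ?thesis
 proof (rule exI[of _ "k + 2"], rule conjI, simp, rule exI[of _ K], intro conjI K allI impI)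
  fix n A and G :: "real ^ 'd => complex"
  assume n: "n >= k + 2" and A: "0 <= A" and G[measurable]: "G \<in> borel_measurable borel"
   and Gb': "ALL \<phi>. norm (G \<phi>) <= A * real n * (1 + norm \<phi>) ^ p * ((1 + \<delta> * (norm \<phi>)\<^sup>2) powr (- \<delta>)) ^ (n - 2)"
  have n0: "n > 0" using n by simp
  have Gb: "norm (G \<phi>) <= (A * real n * C1 * e \<phi> ^ (n - 2 - k)) * (1 / (1 + (norm \<phi>)\<^sup>2) ^ d)" for \<phi>
  proof -
   have "norm (G \<phi>) <= A * real n * ((1 + norm \<phi>) ^ p * e \<phi> ^ (k + (n - 2 - k)))"
    using Gb'[rule_format, of \<phi>] n by (simp add: e_def mult_ac)
   also have "... = A * real n * e \<phi> ^ (n - 2 - k) * ((1 + norm \<phi>) ^ p * e \<phi> ^ k)"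
    by (simp add: power_add mult_ac)
   also have "... <= A * real n * e \<phi> ^ (n - 2 - k) * (C1 * (1 / (1 + (norm \<phi>)\<^sup>2) ^ d))"
    using A e01(1)[of \<phi>] by (intro mult_left_mono ek) auto
   finally show ?thesis by (simp add: mult_ac)
  qed
  show int: "integrable lborel G"
  proof (rule Bochner_Integration.integrable_bound[OF integrable_mult_right[OF Ii, of "A * real n * C1"]])
   show "AE \<phi> in lborel. norm (G \<phi>) <= norm (A * real n * C1 * (1 / (1 + (norm \<phi>)\<^sup>2) ^ d))"
   proof (intro AE_I2)
    fix \<phi> :: "real ^ 'd"
    have "e \<phi> ^ (n - 2 - k) <= 1" using e01[of \<phi>] by (intro power_le_one) auto
    hence "(A * real n * C1 * e \<phi> ^ (n - 2 - k)) * (1 / (1 + (norm \<phi>)\<^sup>2) ^ d) <= (A * real n * C1 * 1) * (1 / (1 + (norm \<phi>)\<^sup>2) ^ d)"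
     using A C1 by (intro mult_right_mono mult_left_mono) auto
    with Gb[of \<phi>] show "norm (G \<phi>) <= norm (A * real n * C1 * (1 / (1 + (norm \<phi>)\<^sup>2) ^ d))"
     by (simp add: abs_mult A C1)
   qed
  qed simp
  have sc: "inverse (sqrt n) > 0" using n0 by simp
  show "integrable lborel (%u. G (u /\<^sub>R sqrt n))"
   by (rule lborel_integrable_scaleR[OF sc int])
  define Z where "Z = {\<phi>::real^'d. norm \<phi> > \<rho>}"
  have Zm[measurable]: "Z \<in> sets borel" unfolding Z_def by measurable
  have "(LINT u|lborel. norm (G (u /\<^sub>R sqrt n)) * indicator {u. norm u > \<rho> * sqrt n} u)
    = (LINT u|lborel. norm (G (u /\<^sub>R sqrt n)) * indicator Z (u /\<^sub>R sqrt n))"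
   using n0 by (intro Bochner_Integration.integral_cong refl) (auto simp: indicator_def Z_def field_simps)
  also have "... = sqrt n ^ d * (LINT \<phi>|lborel. norm (G \<phi>) * indicator Z \<phi>)"
   using lborel_integral_scaleR[OF sc, of "%\<phi>. norm (G \<phi>) * indicator Z \<phi>"] n0
   by (simp add: d_def power_inverse)
  also have "... <= sqrt n ^ d * (\<integral>\<phi>. (A * real n * C1 * \<eta> ^ (n - 2 - k)) * (1 / (1 + (norm \<phi>)\<^sup>2) ^ d) \<partial>(lborel :: (real ^ 'd) measure))"
  proof (intro mult_left_mono integral_mono)
   show "integrable lborel (%\<phi>. norm (G \<phi>) * indicator Z \<phi>)"
    using integrable_real_mult_indicator[OF _ integrable_norm[OF int], of Z] by simp
   show "integrable lborel (%\<phi>::real^'d. (A * real n * C1 * \<eta> ^ (n - 2 - k)) * (1 / (1 + (norm \<phi>)\<^sup>2) ^ d))"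
    by (rule integrable_mult_right[OF Ii])
   fix \<phi> :: "real ^ 'd"
   show "norm (G \<phi>) * indicator Z \<phi> <= (A * real n * C1 * \<eta> ^ (n - 2 - k)) * (1 / (1 + (norm \<phi>)\<^sup>2) ^ d)"
   proof (cases "\<phi> \<in> Z")
    case True
    hence "e \<phi> ^ (n - 2 - k) <= \<eta> ^ (n - 2 - k)"
     using e\<eta>[of \<phi>] e01(1)[of \<phi>] by (intro power_mono) (auto simp: Z_def)
    hence "(A * real n * C1 * e \<phi> ^ (n - 2 - k)) * (1 / (1 + (norm \<phi>)\<^sup>2) ^ d) <= (A * real n * C1 * \<eta> ^ (n - 2 - k)) * (1 / (1 + (norm \<phi>)\<^sup>2) ^ d)"
     using A C1 by (intro mult_right_mono mult_left_mono) auto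
    thus ?thesis using Gb[of \<phi>] True by simp
   next
    case False
    thus ?thesis using A C1 \<eta> by simp
   qed
  qed simp
  also have "... = sqrt n ^ d * (A * real n * C1 * \<eta> ^ (n - 2 - k) * I)"
   unfolding I_def by (subst integral_mult_right_zero) (rule refl)
  also have "... <= real n ^ d * (A * real n * C1 * \<eta> ^ (n - 2 - k) * I)"
  proof (intro mult_right_mono power_mono)
   have "sqrt (real n) <= sqrt (real n * real n)" using n0 by (intro real_sqrt_le_mono) simp
   thus "sqrt (real n) <= real n" by simp
  qed (use A C1 \<eta> I in auto)
  also have "... = A * C1 * I * (real n ^ (d + 3) * \<eta> ^ n) / \<eta> ^ (k + 2) / (real n)\<^sup>2"
  proof -
   have "n - 2 - k + (k + 2) = n" using n by simp
   hence "\<eta> ^ n = \<eta> ^ (n - 2 - k) * \<eta> ^ (k + 2)" unfolding power_add[symmetric] by (simp only:)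
   thus ?thesis using n0 \<eta> by (simp add: power_add power2_eq_square power3_eq_cube)
  qed
  also have "... <= A * C1 * I * K1 / \<eta> ^ (k + 2) / (real n)\<^sup>2"
   using A C1 I \<eta> by (intro divide_right_mono mult_left_mono K1) auto
  also have "... = K * A / (real n)\<^sup>2" by (simp add: K_def)
  finally show "(LINT u|lborel. norm (G (u /\<^sub>R sqrt n)) * indicator {u. norm u > \<rho> * sqrt n} u) <= K * A / (real n)\<^sup>2" .
 qed
qed

text \<open>The complex line spanned by a real vector; \<open>cline 1\<close> embeds the real
  vectors and hence parametrises the inversion contour.\<close>

definition cline :: "complex => real ^ 'd => complex ^ 'd" where
 "cline t u = (\<chi> j. t * of_real (u $ j))"

lemma norm_cline: "norm (cline t u) = norm t * norm u"
 unfolding norm_vec_def cline_def by (simp add: norm_mult L2_set_right_distrib)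

lemma cline_0 [simp]: "cline 0 u = 0" "cline t 0 = 0"
 by (simp_all add: cline_def vec_eq_iff)

lemma cline_scaleR: "cline t (c *\<^sub>R u) = cline (t * of_real c) u"
 by (simp add: cline_def vec_eq_iff mult_ac)

section \<open>Lipschitz estimates for exponentials, logarithms and powers\<close>

lemma cmod_exp_diff_le:
 assumes "Re a <= c" "Re b <= c"
 shows "norm (exp a - exp b) <= exp c * norm (a - b)"
proof (rule field_differentiable_bound[of "{z. Re z <= c}"])
 show "convex {z. Re z <= c}" by (rule convex_halfspace_Re_le)
 show "(exp has_field_derivative exp z) (at z within {z. Re z <= c})" for z :: complex
  by (auto intro!: derivative_eq_intros)
qed (use assms in auto)

lemma Ln_near_one_lipschitz:
 assumes "norm (a - 1) <= 1/2" "norm (b - 1) <= 1/2"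
 shows "norm (Ln a - Ln b) <= 2 * norm (a - b)"
proof (rule field_differentiable_bound[of "cball 1 (1/2)"])
 fix z :: complex assume "z \<in> cball 1 (1/2)"
 hence z: "norm (1 - z) <= 1/2" by (simp add: dist_norm)
 have "1 - norm z <= 1/2" using norm_triangle_ineq2[of 1 z] z by simp
 hence nz: "norm z >= 1/2" by simp
 have "Re z > 0" using abs_Re_le_cmod[of "1 - z"] z by simp
 hence "z \<notin> \<real>\<^sub>\<le>\<^sub>0" by (auto simp: complex_nonpos_Reals_iff)
 thus "(Ln has_field_derivative inverse z) (at z within cball 1 (1/2))"
  by (rule has_field_derivative_at_within[OF has_field_derivative_Ln])
 show "norm (inverse z) <= 2" using le_imp_inverse_le[OF nz] by (simp add: norm_inverse)
qed (use assms in \<open>auto simp: dist_norm norm_minus_commute\<close>)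

lemma norm_power_diff_le:
 fixes a b :: "'a::real_normed_field"
 assumes "norm a <= e" "norm b <= e"
 shows "norm (a ^ k - b ^ k) <= real k * norm (a - b) * e ^ (k - 1)"
proof (induction k)
 case (Suc k)
 have e: "e >= 0" using assms(1) norm_ge_zero order_trans by blast
 have "a ^ Suc k - b ^ Suc k = a * (a ^ k - b ^ k) + (a - b) * b ^ k" by (simp add: algebra_simps)
 also have "norm ... <= e * (real k * norm (a - b) * e ^ (k - 1)) + norm (a - b) * e ^ k"
 proof (rule norm_triangle_mono)
  show "norm (a * (a ^ k - b ^ k)) <= e * (real k * norm (a - b) * e ^ (k - 1))"
   unfolding norm_mult by (rule mult_mono[OF assms(1) Suc.IH e norm_ge_zero])
  show "norm ((a - b) * b ^ k) <= norm (a - b) * e ^ k"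
   unfolding norm_mult norm_power by (intro mult_left_mono power_mono assms) auto
 qed
 also have "... = real (Suc k) * norm (a - b) * e ^ (Suc k - 1)"
  by (cases k) (auto simp: algebra_simps)
 finally show ?case .
qed simp

text \<open>
 The integrals are expanded along complex lines through the origin: \<open>t = 1 / sqrt n\<close> becomes a complex
 variable, the odd terms cancel between \<open>u\<close> and \<open>-u\<close>, and Cauchy's estimates bound the remainder.
 The same expansion applied to the difference of two members of the family gives Lipschitz bounds in the parameter.
\<close>

locale laplace_family =
 fixes Q :: "'q::metric_space set" and m :: "'q => complex ^ 'd => complex"
  and \<sigma> :: "'q => real ^ 'd => real" and r \<kappa> \<delta> C :: real and g :: nat
 assumes r: "r > 0" and \<kappa>: "\<kappa> > 0" and \<delta>: "\<delta> > 0" and C: "C >= 0"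
  and m_hol: "!!q u. q \<in> Q ==> u ~= 0 ==> (%t. m q (cline t u)) holomorphic_on ball 0 (r / norm u)"
  and m_near: "!!q \<zeta>. q \<in> Q ==> norm \<zeta> < r ==> norm (m q \<zeta> - 1) <= 1/4"
  and m_lim: "!!q u. q \<in> Q ==> ((%t. (m q (cline t u) - 1) / t\<^sup>2) \<longlongrightarrow> - of_real (\<sigma> q u) / 2) (at 0)"
  and \<sigma>: "!!q u. q \<in> Q ==> \<sigma> q u >= 4 * \<kappa> * (norm u)\<^sup>2"
  and m_decay: "!!q \<phi>. q \<in> Q ==> norm (m q (cline 1 \<phi>)) <= (1 + \<delta> * (norm \<phi>)\<^sup>2) powr (- \<delta>)"
  and m_meas: "!!q. q \<in> Q ==> (%\<phi>. m q (cline 1 \<phi>)) \<in> borel_measurable borel"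
  and m_lip: "!!q1 q2 \<zeta>. q1 \<in> Q ==> q2 \<in> Q ==> \<zeta> \<in> ball 0 r \<union> range (cline 1) ==>
    norm (m q1 \<zeta> - m q2 \<zeta>) <= C * (1 + norm \<zeta>) ^ g * dist q1 q2"
begin

text \<open>Growth and Lipschitz constants are those of the family itself, so that the expansion
  holds with constants common to all amplitudes; it is applied to \<open>mq\<close> and to every
  \<open>fq i\<close>.\<close>

definition amplitude :: "('q => complex ^ 'd => complex) => bool" where
 "amplitude f \<longleftrightarrow>
  (ALL q:Q. ALL u. u ~= 0 --> (%t. f q (cline t u)) holomorphic_on ball 0 (r / norm u)) &
  (ALL q:Q. (%\<phi>. f q (cline 1 \<phi>)) \<in> borel_measurable borel) &
  (ALL q:Q. ALL \<zeta>:ball 0 r \<union> range (cline 1). norm (f q \<zeta>) <= C * (1 + norm \<zeta>) ^ g) &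
  (ALL q1:Q. ALL q2:Q. ALL \<zeta>:ball 0 r \<union> range (cline 1). norm (f q1 \<zeta> - f q2 \<zeta>) <= C * (1 + norm \<zeta>) ^ g * dist q1 q2)"

text \<open>The exponent \<open>n - 1\<close> is what a parameter derivative of \<open>m ^ n\<close>
  leaves behind; the choice \<open>f = m\<close> recovers \<open>m ^ n\<close>.\<close>

definition integrand :: "('q => complex ^ 'd => complex) => nat => 'q => real ^ 'd => complex" where
 "integrand f n q \<phi> = f q (cline 1 \<phi>) * m q (cline 1 \<phi>) ^ (n - 1)"

definition J :: "('q => complex ^ 'd => complex) => nat => 'q => complex" where
 "J f n q = (LINT u|lborel. integrand f n q (u /\<^sub>R sqrt n))"

definition \<Gamma> :: "'q => real" where "\<Gamma> q = (LINT u|lborel. exp (- \<sigma> q u / 2))"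

text \<open>The bound \<open>r / 2\<close> keeps the Taylor estimate of \<open>H\<close> valid, and
  \<open>\<kappa> * r ^ 3\<close> keeps its cubic remainder below
  \<open>\<kappa> * (norm u)\<^sup>2\<close>, half of the decay of the quadratic term.\<close>

definition \<rho> where "\<rho> = min (r / 2) (\<kappa> * r ^ 3)"
definition K\<^sub>0 where "K\<^sub>0 = C * (1 + r) ^ g"

lemma \<rho>: "\<rho> > 0" "\<rho> <= r / 2" "\<rho> <= \<kappa> * r ^ 3" "\<rho> < r"
 using r \<kappa> by (auto simp: \<rho>_def)

lemma K\<^sub>0: "K\<^sub>0 >= 0" using C r by (simp add: K\<^sub>0_def)

text \<open>On the ball of radius \<open>r\<close> the values of \<open>m\<close> stay within 1/4 of
  1, so the principal logarithm is holomorphic and small.\<close>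

definition H where "H q u t = Ln (m q (cline t u))"

lemma in_r: "norm t < r / norm u ==> u ~= 0 ==> norm (cline t u) < r"
 by (simp add: norm_cline field_simps)

lemma m_nonpos: "q \<in> Q ==> norm \<zeta> < r ==> m q \<zeta> \<notin> \<real>\<^sub>\<le>\<^sub>0"
 using m_near[of q \<zeta>] abs_Re_le_cmod[of "m q \<zeta> - 1"] by (auto simp: complex_nonpos_Reals_iff)

lemma m_nz: "q \<in> Q ==> norm \<zeta> < r ==> m q \<zeta> ~= 0"
 using m_nonpos by fastforce

lemma m_lower: "q \<in> Q ==> norm \<zeta> < r ==> norm (m q \<zeta>) >= 1/2"
 using m_near[of q \<zeta>] norm_triangle_ineq2[of 1 "m q \<zeta>"] by (simp add: norm_minus_commute)

lemma H_hol: "q \<in> Q ==> u ~= 0 ==> H q u holomorphic_on ball 0 (r / norm u)"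
 unfolding H_def by (intro holomorphic_on_Ln' m_hol m_nonpos in_r) auto

lemma H_bound: "q \<in> Q ==> u ~= 0 ==> norm t < r / norm u ==> norm (H q u t) <= 1/2"
 using norm_Ln_le[of "m q (cline t u) - 1"] m_near[OF _ in_r, of q t u] by (simp add: H_def)

text \<open>A finite limit of \<open>(m - 1) / t\<^sup>2\<close> along one nondegenerate line
  already forces the value 1 at the origin.\<close>

lemma m_0: assumes "q \<in> Q" shows "m q 0 = 1"
proof -
 define u :: "real ^ 'd" where "u = axis undefined 1"
 have u: "u ~= 0" by (simp add: u_def axis_eq_0_iff)
 have R: "r / norm u > 0" using r u by simp
 have "isCont (%t. m q (cline t u)) 0"
  using holomorphic_on_imp_continuous_on[OF m_hol[OF assms u]] R
  by (simp add: continuous_on_eq_continuous_at)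
 hence 1: "((%t. m q (cline t u) - 1) \<longlongrightarrow> m q 0 - 1) (at 0)"
  by (intro tendsto_intros) (simp add: isCont_def)
 have "((%t. (m q (cline t u) - 1) / t\<^sup>2 * t\<^sup>2) \<longlongrightarrow> - of_real (\<sigma> q u) / 2 * 0\<^sup>2) (at 0)"
  by (intro tendsto_mult m_lim assms tendsto_intros)
 hence "((%t. (m q (cline t u) - 1) / t\<^sup>2 * t\<^sup>2) \<longlongrightarrow> 0) (at 0)" by simp
 hence "((%t. m q (cline t u) - 1) \<longlongrightarrow> 0) (at 0)"
  by (rule Lim_transform_eventually) (auto simp: eventually_at_filter)
 from LIM_unique[OF 1 this] show ?thesis by simp
qed

lemma H_lim:
 assumes q: "q \<in> Q" and u: "u ~= 0"
 shows "((%t. H q u t / t\<^sup>2) \<longlongrightarrow> - of_real (\<sigma> q u) / 2) (at 0)"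
proof -
 have R: "r / norm u > 0" using r u by simp
 \<comment> \<open>\<open>L\<close> extends \<open>Ln z / (z - 1)\<close> continuously across 1, so
   the logarithm can replace \<open>m - 1\<close> in the limit even where \<open>m\<close> takes the
   value 1.\<close>
 define L where "L z = (if z = 1 then 1 else Ln z / (z - 1))" for z :: complex
 have "((%z. Ln z / (z - 1)) \<longlongrightarrow> 1) (at (1::complex))"
  using has_field_derivative_Ln[of 1] unfolding has_field_derivative_iff by simp
 hence "(L \<longlongrightarrow> 1) (at 1)"
  by (rule Lim_transform_eventually) (auto simp: L_def eventually_at_filter)
 hence "isCont L 1" by (simp add: isCont_def L_def)
 moreover have "isCont (%t. m q (cline t u)) 0"
  using holomorphic_on_imp_continuous_on[OF m_hol[OF q u]] R
  by (simp add: continuous_on_eq_continuous_at)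
 ultimately have "isCont (%t. L (m q (cline t u))) 0"
  using isCont_o2[of 0 "%t. m q (cline t u)" L] by (simp add: m_0[OF q])
 hence "((%t. L (m q (cline t u))) \<longlongrightarrow> 1) (at 0)" by (simp add: isCont_def m_0[OF q] L_def)
 from tendsto_mult[OF this m_lim[OF q, of u]]
 have "((%t. L (m q (cline t u)) * ((m q (cline t u) - 1) / t\<^sup>2)) \<longlongrightarrow> - of_real (\<sigma> q u) / 2) (at 0)" by simp
 moreover have e: "(%t. L (m q (cline t u)) * ((m q (cline t u) - 1) / t\<^sup>2)) = (%t. H q u t / t\<^sup>2)"
  by (auto simp: L_def H_def fun_eq_iff)
 ultimately show ?thesis unfolding e by blast
qed

lemma H_derivs:
 assumes q: "q \<in> Q" and u: "u ~= 0"
 shows "H q u 0 = 0" "deriv (H q u) 0 = 0"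
proof -
 show H0: "H q u 0 = 0" by (simp add: H_def m_0[OF q])
 have "((%t. t * (H q u t / t\<^sup>2)) \<longlongrightarrow> 0 * (- of_real (\<sigma> q u) / 2)) (at 0)"
  by (intro tendsto_mult H_lim q u tendsto_ident_at)
 moreover have "t * (H q u t / t\<^sup>2) = (H q u t - H q u 0) / (t - 0)" for t
  by (cases "t = 0") (auto simp: H0 power2_eq_square)
 ultimately have "((%t. (H q u t - H q u 0) / (t - 0)) \<longlongrightarrow> 0) (at 0)" by simp
 hence "(H q u has_field_derivative 0) (at 0)" by (simp add: has_field_derivative_iff H0)
 thus "deriv (H q u) 0 = 0" by (rule DERIV_imp_deriv)
qed

text \<open>The quadratic coefficient of \<open>H\<close> is \<open>- \<sigma> / 2\<close>, at most
  \<open>-2 * \<kappa> * (norm u)\<^sup>2\<close>; inside radius \<open>\<rho>\<close> the cubic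
  remainder spends at most half of it.\<close>

lemma H_quadratic:
 assumes q: "q \<in> Q" and u: "u ~= 0" and t: "t ~= 0" "norm t * norm u < \<rho>"
 shows "Re (H q u t / t\<^sup>2) <= - \<kappa> * (norm u)\<^sup>2"
proof -
 define R where "R = r / norm u"
 have R: "R > 0" using r u by (simp add: R_def)
 define c where "c = (deriv ^^ 2) (H q u) 0 / 2"
 have E: "norm (H q u s - c * s\<^sup>2) <= (norm s / R) ^ 3" if "norm s <= R / 2" for s
 proof -
  have "norm (H q u s - (\<Sum>k<3. (deriv ^^ k) (H q u) 0 / fact k * s ^ k)) <= 2 * (1/2) * (norm s / R) ^ 3"
   using H_bound[OF q u] H_hol[OF q u] R that unfolding R_def by (intro holomorphic_taylor_bound) auto
  thus ?thesis by (simp add: eval_nat_numeral H_derivs[OF q u] c_def)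
 qed
 have E2: "norm (H q u s / s\<^sup>2 - c) <= norm s / R ^ 3" if s: "s ~= 0" "norm s <= R / 2" for s
 proof -
  have "H q u s / s\<^sup>2 - c = (H q u s - c * s\<^sup>2) / s\<^sup>2" using s by (simp add: field_simps)
  also have "norm ... <= (norm s / R) ^ 3 / (norm s)\<^sup>2"
   using E[OF s(2)] by (simp add: norm_divide norm_power divide_right_mono)
  also have "... = norm s / R ^ 3" using s by (simp add: power3_eq_cube power2_eq_square)
  finally show ?thesis .
 qed
 have "((%s. H q u s / s\<^sup>2 - c) \<longlongrightarrow> 0) (at 0)"
 proof (rule Lim_null_comparison)
  have "\<forall>\<^sub>F s in at 0. s ~= 0 & norm s <= R / 2"
   unfolding eventually_at using R by (intro exI[of _ "R/2"]) (auto simp: dist_norm)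
  thus "\<forall>\<^sub>F s in at 0. norm (H q u s / s\<^sup>2 - c) <= norm s / R ^ 3"
   by eventually_elim (use E2 in auto)
  show "((%s::complex. norm s / R ^ 3) \<longlongrightarrow> 0) (at 0)"
   by (rule tendsto_eq_intros tendsto_ident_at refl | simp add: R less_imp_neq[symmetric])+
 qed
 hence "((%s. H q u s / s\<^sup>2) \<longlongrightarrow> c) (at 0)" by (simp add: LIM_zero_iff)
 from LIM_unique[OF this H_lim[OF q u]] have c: "c = - of_real (\<sigma> q u) / 2" .
 have "norm t <= R / 2" using t \<rho> u by (simp add: R_def field_simps)
 from E2[OF t(1) this] have "norm (H q u t / t\<^sup>2 - c) <= (norm t * norm u) * (norm u)\<^sup>2 / r ^ 3"
  using u r by (simp add: R_def power_divide power3_eq_cube power2_eq_square mult_ac)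
 also have "... <= (\<kappa> * r ^ 3) * (norm u)\<^sup>2 / r ^ 3"
  using t \<rho> r by (intro divide_right_mono mult_right_mono) auto
 also have "... = \<kappa> * (norm u)\<^sup>2" using r by simp
 finally have "Re (H q u t / t\<^sup>2 - c) <= \<kappa> * (norm u)\<^sup>2" using complex_Re_le_cmod order_trans by blast
 moreover have "Re c <= - 2 * \<kappa> * (norm u)\<^sup>2" using \<sigma>[OF q, of u] by (simp add: c)
 ultimately show ?thesis by simp
qed

text \<open>The difference of two logarithms vanishes to second order at 0 and is bounded by the
  Lipschitz estimate for \<open>m\<close>; Cauchy's estimate applied to it absorbs the division by
  \<open>t\<^sup>2\<close>.\<close>

lemma H_lipschitz:
 assumes q: "q1 \<in> Q" "q2 \<in> Q" and u: "u ~= 0" and t: "t ~= 0" "norm t * norm u < \<rho>"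
 shows "norm (H q1 u t / t\<^sup>2 - H q2 u t / t\<^sup>2) <= 4 * K\<^sub>0 * dist q1 q2 * (norm u)\<^sup>2 / r\<^sup>2"
proof -
 define R where "R = r / norm u"
 have R: "R > 0" using r u by (simp add: R_def)
 have tR: "norm t <= R / 2" using t \<rho> u by (simp add: R_def field_simps)
 let ?D = "%t. H q1 u t - H q2 u t"
 have hol: "?D holomorphic_on ball 0 R" unfolding R_def by (intro holomorphic_intros H_hol q u)
 have d: "deriv ?D 0 = 0"
 proof -
  have "H q u field_differentiable at 0" if "q \<in> Q" for q
   using holomorphic_on_imp_differentiable_at[OF H_hol[OF that u]] R by (simp add: R_def)
  thus ?thesis using q by (simp add: H_derivs[OF _ u])
 qed
 have "norm (?D t - (\<Sum>k<2. (deriv ^^ k) ?D 0 / fact k * t ^ k)) <= 2 * (2 * (K\<^sub>0 * dist q1 q2)) * (norm t / R) ^ 2"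
 proof (rule holomorphic_taylor_bound[OF hol R _ tR])
  fix s :: complex assume "norm s < R"
  hence s: "norm (cline s u) < r" using in_r u by (simp add: R_def)
  have "norm (?D s) <= 2 * norm (m q1 (cline s u) - m q2 (cline s u))"
   unfolding H_def using m_near[OF q(1) s] m_near[OF q(2) s] by (intro Ln_near_one_lipschitz) auto
  also have "norm (m q1 (cline s u) - m q2 (cline s u)) <= C * (1 + norm (cline s u)) ^ g * dist q1 q2"
   using s by (intro m_lip q) auto
  also have "... <= K\<^sub>0 * dist q1 q2" unfolding K\<^sub>0_def using s C
   by (intro mult_right_mono mult_left_mono power_mono) auto
  finally show "norm (?D s) <= 2 * (K\<^sub>0 * dist q1 q2)" by simp
 qed
 hence "norm (?D t) <= 4 * K\<^sub>0 * dist q1 q2 * (norm t / R)\<^sup>2"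
  by (simp add: eval_nat_numeral d H_derivs[OF _ u] q)
 hence "norm (?D t) / (norm t)\<^sup>2 <= 4 * K\<^sub>0 * dist q1 q2 * (norm t / R)\<^sup>2 / (norm t)\<^sup>2"
  by (rule divide_right_mono) simp
 also have "... = 4 * K\<^sub>0 * dist q1 q2 * (norm u)\<^sup>2 / r\<^sup>2" using t r u by (simp add: R_def power_divide power_mult_distrib)
 finally show ?thesis using t by (simp add: norm_divide norm_power flip: diff_divide_distrib)
qed

text \<open>For \<open>t\<close> = 1/sqrt n this is the rescaled integrand:
  \<open>f * m ^ (n - 1)\<close> equals \<open>f / m\<close> times \<open>exp (n * H)\<close>, and
  \<open>n\<close> is 1/t^2. The value at 0 is the Gaussian limit.\<close>

definition \<Phi> where
 "\<Phi> f q u t = (if t = 0 then f q 0 * exp (- of_real (\<sigma> q u) / 2)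
   else f q (cline t u) / m q (cline t u) * exp (H q u t / t\<^sup>2))"

lemma \<rho>_ball: "u ~= 0 ==> norm t * norm u < \<rho> ==> norm t < r / norm u"
 using \<rho>(4) by (simp add: field_simps)

lemma amplitudeD:
 assumes "amplitude f" "q \<in> Q"
 shows "u ~= 0 ==> (%t. f q (cline t u)) holomorphic_on ball 0 (r / norm u)"
  "(%\<phi>. f q (cline 1 \<phi>)) \<in> borel_measurable borel"
  "\<zeta> \<in> ball 0 r \<union> range (cline 1) ==> norm (f q \<zeta>) <= C * (1 + norm \<zeta>) ^ g"
  "q' \<in> Q ==> \<zeta> \<in> ball 0 r \<union> range (cline 1) ==> norm (f q \<zeta> - f q' \<zeta>) <= C * (1 + norm \<zeta>) ^ g * dist q q'"
 using assms unfolding amplitude_def by auto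

lemma amplitude_local:
 assumes "amplitude f" "q \<in> Q" "norm \<zeta> < r"
 shows "norm (f q \<zeta>) <= K\<^sub>0"
  and "q' \<in> Q ==> norm (f q \<zeta> - f q' \<zeta>) <= K\<^sub>0 * dist q q'"
proof -
 have b: "C * (1 + norm \<zeta>) ^ g <= K\<^sub>0" unfolding K\<^sub>0_def using assms C
  by (intro mult_left_mono power_mono) auto
 thus "norm (f q \<zeta>) <= K\<^sub>0" using amplitudeD(3)[OF assms(1,2), of \<zeta>] assms(3) by auto
 show "norm (f q \<zeta> - f q' \<zeta>) <= K\<^sub>0 * dist q q'" if "q' \<in> Q"
  using amplitudeD(4)[OF assms(1,2) that, of \<zeta>] assms(3) mult_right_mono[OF b zero_le_dist[of q q']] by auto
qed

lemma m_local_lip: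
 assumes "q1 \<in> Q" "q2 \<in> Q" "norm \<zeta> < r"
 shows "norm (m q1 \<zeta> - m q2 \<zeta>) <= K\<^sub>0 * dist q1 q2"
proof -
 have b: "C * (1 + norm \<zeta>) ^ g <= K\<^sub>0" unfolding K\<^sub>0_def using assms C
  by (intro mult_left_mono power_mono) auto
 show ?thesis using m_lip[OF assms(1,2), of \<zeta>] assms(3) mult_right_mono[OF b zero_le_dist[of q1 q2]] by auto
qed

lemma \<Phi>_lim:
 assumes f: "amplitude f" and q: "q \<in> Q" and u: "u ~= 0"
 shows "(\<Phi> f q u \<longlongrightarrow> \<Phi> f q u 0) (at 0)"
proof -
 have R: "r / norm u > 0" using r u by simp
 have "isCont (%t. f q (cline t u)) 0" "isCont (%t. m q (cline t u)) 0"
  using holomorphic_on_imp_continuous_on[OF m_hol[OF q u]] holomorphic_on_imp_continuous_on[OF amplitudeD(1)[OF f q u]] R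
  by (simp_all add: continuous_on_eq_continuous_at)
 hence "((%t. f q (cline t u)) \<longlongrightarrow> f q 0) (at 0)" "((%t. m q (cline t u)) \<longlongrightarrow> 1) (at 0)"
  by (simp_all add: isCont_def m_0[OF q])
 hence "((%t. f q (cline t u) / m q (cline t u) * exp (H q u t / t\<^sup>2)) \<longlongrightarrow> f q 0 / 1 * exp (- of_real (\<sigma> q u) / 2)) (at 0)"
  by (intro tendsto_mult tendsto_divide tendsto_exp H_lim q u) auto
 hence "(\<Phi> f q u \<longlongrightarrow> f q 0 / 1 * exp (- of_real (\<sigma> q u) / 2)) (at 0)"
  by (rule Lim_transform_eventually) (auto simp: \<Phi>_def eventually_at_filter)
 thus ?thesis by (simp add: \<Phi>_def)
qed

lemma \<Phi>_bound:
 assumes f: "amplitude f" and q: "q \<in> Q" and u: "u ~= 0" and t: "norm t * norm u < \<rho>"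
 shows "norm (\<Phi> f q u t) <= 2 * K\<^sub>0 * exp (- \<kappa> * (norm u)\<^sup>2)"
proof (cases "t = 0")
 case True
 have 1: "norm (f q 0) <= 2 * K\<^sub>0" using amplitude_local(1)[OF f q, of 0] r K\<^sub>0 by simp
 have "- \<sigma> q u / 2 <= - \<kappa> * (norm u)\<^sup>2" using \<sigma>[OF q, of u] mult_nonneg_nonneg[OF less_imp_le[OF \<kappa>] zero_le_power2[of "norm u"]]
  by simp
 hence 2: "norm (exp (- complex_of_real (\<sigma> q u) / 2)) <= exp (- \<kappa> * (norm u)\<^sup>2)" by simp
 show ?thesis using mult_mono[OF 1 2] K\<^sub>0 True by (simp add: \<Phi>_def norm_mult)
next
 case False
 have z: "norm (cline t u) < r" by (rule in_r[OF \<rho>_ball[OF u t] u])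
 have a: "norm (f q (cline t u) / m q (cline t u)) <= K\<^sub>0 / (1/2)"
  unfolding norm_divide using amplitude_local(1)[OF f q z] m_lower[OF q z] K\<^sub>0 by (intro frac_le) auto
 have b: "norm (exp (H q u t / t\<^sup>2)) <= exp (- \<kappa> * (norm u)\<^sup>2)"
  using H_quadratic[OF q u False t] by simp
 have "norm (\<Phi> f q u t) = norm (f q (cline t u) / m q (cline t u)) * norm (exp (H q u t / t\<^sup>2))"
  by (simp only: \<Phi>_def False if_False norm_mult)
 also have "... <= (K\<^sub>0 / (1/2)) * exp (- \<kappa> * (norm u)\<^sup>2)" using K\<^sub>0 by (intro mult_mono a b) auto
 finally show ?thesis by simp
qed

text \<open>By \<open>\<Phi>_lim\<close> the function is continuous at 0, so the singularity of
  \<open>H / t\<^sup>2\<close> in the exponent is removable.\<close>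

lemma \<Phi>_hol:
 assumes f: "amplitude f" and q: "q \<in> Q" and u: "u ~= 0"
 shows "\<Phi> f q u holomorphic_on ball 0 (\<rho> / norm u)"
proof -
 define R where "R = \<rho> / norm u"
 have R: "R > 0" using \<rho> u by (simp add: R_def)
 have sub: "ball 0 R - {0} \<subseteq> ball 0 (r / norm u)"
  using \<rho> u by (auto simp: R_def field_simps)
 have nz: "m q (cline t u) ~= 0" if "t \<in> ball 0 R - {0}" for t
  using subsetD[OF sub that] by (intro m_nz q in_r u) auto
 have "(%t. f q (cline t u) / m q (cline t u) * exp (H q u t / t\<^sup>2)) holomorphic_on ball 0 R - {0}"
  by (intro holomorphic_intros holomorphic_on_subset[OF amplitudeD(1)[OF f q u] sub]
    holomorphic_on_subset[OF m_hol[OF q u] sub] holomorphic_on_subset[OF H_hol[OF q u] sub] nz) auto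
 hence hol: "\<Phi> f q u holomorphic_on ball 0 R - {0}"
  by (rule holomorphic_transform) (auto simp: \<Phi>_def)
 have "continuous_on (ball 0 R) (\<Phi> f q u)"
  unfolding continuous_on_eq_continuous_at[OF open_ball]
 proof
  fix t :: complex assume t: "t \<in> ball 0 R"
  show "isCont (\<Phi> f q u) t"
  proof (cases "t = 0")
   case True
   thus ?thesis using \<Phi>_lim[OF f q u] by (simp add: isCont_def)
  next
   case False
   have "open (ball 0 R - {0::complex})" by (simp add: open_Diff)
   thus ?thesis using holomorphic_on_imp_continuous_on[OF hol] t False
    by (auto simp: continuous_on_eq_continuous_at)
  qed
 qed
 from no_isolated_singularity[OF this hol] show ?thesis by (simp add: R_def)
qed

text \<open>The summands account for the change of \<open>f\<close>, of the denominator
  \<open>m\<close> (at least 1/2 in norm) and of the exponent, in this order; the first also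
  dominates the plain bound of \<open>\<Phi>\<close>.\<close>

definition K\<^sub>1 where "K\<^sub>1 = 2 * K\<^sub>0 + 4 * K\<^sub>0 * K\<^sub>0 + 8 * K\<^sub>0 * K\<^sub>0 / r\<^sup>2"

lemma K\<^sub>1: "K\<^sub>1 >= 0" "2 * K\<^sub>0 <= K\<^sub>1" using K\<^sub>0 r by (auto simp: K\<^sub>1_def)

text \<open>A product rule for the prefactor \<open>f / m\<close> and the exponential. The factor
  \<open>(1 + norm u)\<^sup>2\<close> absorbs the square of \<open>norm u\<close> produced by the
  change of the exponent.\<close>

lemma \<Phi>_lipschitz:
 assumes f: "amplitude f" and q: "q1 \<in> Q" "q2 \<in> Q" and u: "u ~= 0" and t: "norm t * norm u < \<rho>"
 shows "norm (\<Phi> f q1 u t - \<Phi> f q2 u t) <= K\<^sub>1 * dist q1 q2 * ((1 + norm u)\<^sup>2 * exp (- \<kappa> * (norm u)\<^sup>2))"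
proof -
 let ?D = "dist q1 q2" and ?E = "exp (- \<kappa> * (norm u)\<^sup>2)"
 have *: "norm (\<Phi> f q1 u t - \<Phi> f q2 u t) <= K\<^sub>1 * ?D * ((1 + norm u)\<^sup>2 * ?E)"
  if t: "norm t * norm u < \<rho>" and t0: "t ~= 0" for t
 proof -
  have z: "norm (cline t u) < r" by (rule in_r[OF \<rho>_ball[OF u t] u])
  let ?z = "cline t u"
  define a1 a2 e1 e2 where "a1 = f q1 ?z / m q1 ?z" and "a2 = f q2 ?z / m q2 ?z"
   and "e1 = exp (H q1 u t / t\<^sup>2)" and "e2 = exp (H q2 u t / t\<^sup>2)"
  have "a1 - a2 = (f q1 ?z - f q2 ?z) / m q1 ?z + f q2 ?z * (m q2 ?z - m q1 ?z) / (m q1 ?z * m q2 ?z)"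
   using m_nz[OF q(1) z] m_nz[OF q(2) z] by (simp add: a1_def a2_def field_simps)
  also have "norm ... <= K\<^sub>0 * ?D / (1/2) + K\<^sub>0 * (K\<^sub>0 * ?D) / (1/2 * (1/2))"
   unfolding norm_divide norm_mult
  proof (rule norm_triangle_mono)
   show "norm ((f q1 ?z - f q2 ?z) / m q1 ?z) <= K\<^sub>0 * ?D / (1/2)"
    unfolding norm_divide using m_lower[OF q(1) z] K\<^sub>0 by (intro frac_le amplitude_local(2)[OF f q(1) z q(2)]) auto
   show "norm (f q2 ?z * (m q2 ?z - m q1 ?z) / (m q1 ?z * m q2 ?z)) <= K\<^sub>0 * (K\<^sub>0 * ?D) / (1/2 * (1/2))"
    unfolding norm_divide norm_mult using m_lower[OF q(1) z] m_lower[OF q(2) z] K\<^sub>0 m_local_lip[OF q z]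
    by (intro frac_le mult_mono amplitude_local(1)[OF f q(2) z]) (auto simp: norm_minus_commute)
  qed
  finally have a12: "norm (a1 - a2) <= (2 * K\<^sub>0 + 4 * K\<^sub>0 * K\<^sub>0) * ?D" by (simp add: algebra_simps)
  have e1: "norm e1 <= ?E" using H_quadratic[OF q(1) u t0 t] by (simp add: e1_def)
  have a2: "norm a2 <= K\<^sub>0 / (1/2)"
   unfolding a2_def norm_divide using amplitude_local(1)[OF f q(2) z] m_lower[OF q(2) z] K\<^sub>0 by (intro frac_le) auto
  have "norm (e1 - e2) <= ?E * norm (H q1 u t / t\<^sup>2 - H q2 u t / t\<^sup>2)"
   unfolding e1_def e2_def by (intro cmod_exp_diff_le H_quadratic q u t0 t)
  also have "... <= ?E * (4 * K\<^sub>0 * ?D * (norm u)\<^sup>2 / r\<^sup>2)"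
   by (intro mult_left_mono H_lipschitz q u t0 t) simp
  finally have e12: "norm (e1 - e2) <= ?E * (4 * K\<^sub>0 * ?D * (norm u)\<^sup>2 / r\<^sup>2)" .
  have "\<Phi> f q1 u t - \<Phi> f q2 u t = (a1 - a2) * e1 + a2 * (e1 - e2)"
   using t0 by (simp add: \<Phi>_def a1_def a2_def e1_def e2_def algebra_simps)
  also have "norm ... <= ((2 * K\<^sub>0 + 4 * K\<^sub>0 * K\<^sub>0) * ?D) * ?E + (K\<^sub>0 / (1/2)) * (?E * (4 * K\<^sub>0 * ?D * (norm u)\<^sup>2 / r\<^sup>2))"
   unfolding norm_mult
   by (rule norm_triangle_mono; unfold norm_mult; intro mult_mono a12 e1 a2 e12) (use K\<^sub>0 in auto)
  also have "... <= K\<^sub>1 * ?D * ((1 + norm u)\<^sup>2 * ?E)"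
  proof -
   have gen: "((2 * x + 4 * x * x) * d) * e + (x / (1/2)) * (e * (4 * x * d * U / s)) <= (2 * x + 4 * x * x + 8 * x * x / s) * d * (V * e)"
    if "x >= 0" "d >= 0" "e >= 0" "s > 0" "U <= V" "1 <= V" for x d e s U V :: real
   proof -
    have "((2 * x + 4 * x * x) * (d * e)) * 1 + (8 * x * x / s * (d * e)) * U
      <= ((2 * x + 4 * x * x) * (d * e)) * V + (8 * x * x / s * (d * e)) * V"
     using that by (intro add_mono mult_left_mono) auto
    thus ?thesis by (simp add: distrib_left distrib_right mult_ac)
   qed
   show ?thesis unfolding K\<^sub>1_def
    by (rule gen) (use K\<^sub>0 r in \<open>auto intro!: power_mono one_le_power\<close>)
  qed
  finally show ?thesis .
 qed
 show ?thesis
 proof (cases "t = 0")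
  case True
  \<comment> \<open>The exponent is undefined at 0; the estimate there is inherited as a
    limit.\<close>
  have "((%t. \<Phi> f q1 u t - \<Phi> f q2 u t) \<longlongrightarrow> \<Phi> f q1 u 0 - \<Phi> f q2 u 0) (at 0)"
   by (intro tendsto_diff \<Phi>_lim f q u)
  hence "norm (\<Phi> f q1 u 0 - \<Phi> f q2 u 0) <= K\<^sub>1 * ?D * ((1 + norm u)\<^sup>2 * ?E)"
  proof (rule Lim_norm_ubound[rotated])
   have "\<forall>\<^sub>F t in at 0. t ~= 0 & norm (t::complex) * norm u < \<rho>"
    unfolding eventually_at using \<rho> u by (intro exI[of _ "\<rho> / norm u"]) (auto simp: dist_norm field_simps)
   thus "\<forall>\<^sub>F t in at 0. norm (\<Phi> f q1 u t - \<Phi> f q2 u t) <= K\<^sub>1 * ?D * ((1 + norm u)\<^sup>2 * ?E)"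
    by eventually_elim (rule *, auto)
  qed simp
  thus ?thesis using True by simp
 qed (use * t in auto)
qed

lemma envelope:
 fixes \<phi> :: "real ^ 'd"
 shows "0 < (1 + \<delta> * (norm \<phi>)\<^sup>2) powr (- \<delta>)" "(1 + \<delta> * (norm \<phi>)\<^sup>2) powr (- \<delta>) <= 1"
proof -
 have one: "1 <= 1 + \<delta> * (norm \<phi>)\<^sup>2" using \<delta> by simp
 have "1 + \<delta> * (norm \<phi>)\<^sup>2 > 0" by (rule less_le_trans[OF zero_less_one one])
 thus "0 < (1 + \<delta> * (norm \<phi>)\<^sup>2) powr (- \<delta>)" by simp
 have "1 <= (1 + \<delta> * (norm \<phi>)\<^sup>2) powr \<delta>" by (intro ge_one_powr_ge_zero one less_imp_le[OF \<delta>])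
 from le_imp_inverse_le[OF this] show "(1 + \<delta> * (norm \<phi>)\<^sup>2) powr (- \<delta>) <= 1" by (simp add: powr_minus)
qed

lemma integrand_measurable: "amplitude f ==> q \<in> Q ==> integrand f n q \<in> borel_measurable borel"
 unfolding integrand_def[abs_def] using m_meas amplitudeD(2)
 by (intro borel_measurable_times borel_measurable_power) auto

text \<open>Weakened by a factor \<open>n\<close>, a larger polynomial exponent and one envelope
  factor, so that it has the shape of \<open>integrand_diff_bound\<close> and
  \<open>decay_tail\<close> serves both.\<close>

lemma integrand_bound:
 assumes f: "amplitude f" and q: "q \<in> Q" and n: "n >= 2"
 shows "norm (integrand f n q \<phi>) <= C * real n * (1 + norm \<phi>) ^ (2 * g) * ((1 + \<delta> * (norm \<phi>)\<^sup>2) powr (- \<delta>)) ^ (n - 2)"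
proof -
 let ?e = "(1 + \<delta> * (norm \<phi>)\<^sup>2) powr (- \<delta>)"
 have g: "(1 + norm \<phi>) ^ g <= (1 + norm \<phi>) ^ (2 * g)" by (intro power_increasing) auto
 have "norm (f q (cline 1 \<phi>)) <= C * (1 + norm \<phi>) ^ g"
  using amplitudeD(3)[OF f q, of "cline 1 \<phi>"] by (simp add: norm_cline)
 also have "... <= (C * real n) * (1 + norm \<phi>) ^ (2 * g)"
  using n C by (intro mult_mono g) (auto simp: mult_left_le mult_le_cancel_left1)
 finally have 1: "norm (f q (cline 1 \<phi>)) <= C * real n * (1 + norm \<phi>) ^ (2 * g)" .
 have "norm (m q (cline 1 \<phi>)) ^ (n - 1) <= ?e ^ (n - 1)" by (intro power_mono m_decay q) auto
 also have "... <= ?e ^ (n - 2)" using envelope[of \<phi>] by (intro power_decreasing) auto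
 finally have 2: "norm (m q (cline 1 \<phi>)) ^ (n - 1) <= ?e ^ (n - 2)" .
 show ?thesis unfolding integrand_def norm_mult norm_power
  using C by (intro mult_mono[OF 1 2]) auto
qed

text \<open>The difference of two powers with exponent \<open>n - 1\<close> produces the factor
  \<open>n\<close> and leaves \<open>n - 2\<close> envelope factors; two Lipschitz bounds multiply,
  hence the exponent \<open>2 * g\<close>.\<close>

lemma integrand_diff_bound:
 assumes f: "amplitude f" and q: "q1 \<in> Q" "q2 \<in> Q" and n: "n >= 2"
 shows "norm (integrand f n q1 \<phi> - integrand f n q2 \<phi>)
  <= ((C + C * C) * dist q1 q2) * real n * (1 + norm \<phi>) ^ (2 * g) * ((1 + \<delta> * (norm \<phi>)\<^sup>2) powr (- \<delta>)) ^ (n - 2)"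
proof -
 let ?e = "(1 + \<delta> * (norm \<phi>)\<^sup>2) powr (- \<delta>)" and ?D = "dist q1 q2" and ?x = "(1 + norm \<phi>) ^ g"
 let ?f1 = "f q1 (cline 1 \<phi>)" and ?f2 = "f q2 (cline 1 \<phi>)" and ?m1 = "m q1 (cline 1 \<phi>)" and ?m2 = "m q2 (cline 1 \<phi>)"
 have x1: "?x >= 1" by (intro one_le_power) simp
 have e: "0 < ?e" "?e <= 1" by (rule envelope)+
 have f12: "norm (?f1 - ?f2) <= C * ?x * ?D"
  using amplitudeD(4)[OF f q(1) q(2), of "cline 1 \<phi>"] by (simp add: norm_cline)
 have f2: "norm ?f2 <= C * ?x" using amplitudeD(3)[OF f q(2), of "cline 1 \<phi>"] by (simp add: norm_cline)
 have m12: "norm (?m1 - ?m2) <= C * ?x * ?D" using m_lip[OF q, of "cline 1 \<phi>"] by (simp add: norm_cline)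
 have p1: "norm (?m1 ^ (n - 1)) <= ?e ^ (n - 2)"
 proof -
  have "norm (?m1 ^ (n - 1)) <= ?e ^ (n - 1)" unfolding norm_power by (intro power_mono m_decay q) auto
  also have "... <= ?e ^ (n - 2)" using e by (intro power_decreasing) auto
  finally show ?thesis .
 qed
 have p12: "norm (?m1 ^ (n - 1) - ?m2 ^ (n - 1)) <= real n * (C * ?x * ?D) * ?e ^ (n - 2)"
 proof -
  have "norm (?m1 ^ (n - 1) - ?m2 ^ (n - 1)) <= real (n - 1) * norm (?m1 - ?m2) * ?e ^ (n - 1 - 1)"
   by (intro norm_power_diff_le m_decay q)
  also have "... <= real n * (C * ?x * ?D) * ?e ^ (n - 1 - 1)"
   using m12 C by (intro mult_right_mono mult_mono) auto
  also have "n - 1 - 1 = n - 2" by simp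
  finally show ?thesis .
 qed
 have "integrand f n q1 \<phi> - integrand f n q2 \<phi> = (?f1 - ?f2) * ?m1 ^ (n - 1) + ?f2 * (?m1 ^ (n - 1) - ?m2 ^ (n - 1))"
  by (simp add: integrand_def algebra_simps)
 also have "norm ... <= (C * ?x * ?D) * ?e ^ (n - 2) + (C * ?x) * (real n * (C * ?x * ?D) * ?e ^ (n - 2))"
 proof (rule norm_triangle_mono; unfold norm_mult)
  show "norm (?f1 - ?f2) * norm (?m1 ^ (n - 1)) <= (C * ?x * ?D) * ?e ^ (n - 2)"
   using C by (intro mult_mono[OF f12 p1]) auto
  show "norm ?f2 * norm (?m1 ^ (n - 1) - ?m2 ^ (n - 1)) <= (C * ?x) * (real n * (C * ?x * ?D) * ?e ^ (n - 2))"
   using C by (intro mult_mono[OF f2 p12]) auto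
 qed
 also have "... <= ((C + C * C) * ?D) * real n * (?x * ?x) * ?e ^ (n - 2)"
 proof -
  have gen: "(C * x * d) * e + (C * x) * (y * (C * x * d) * e) <= ((C + C * C) * d) * y * (x * x) * e"
   if "x >= 1" "d >= 0" "e >= 0" "y >= 1" for x d e y :: real
  proof -
   have "1 * x <= y * (x * x)" using that by (intro mult_mono) auto
   hence "(C * d * e) * x <= (C * d * e) * (y * (x * x))" using C that by (intro mult_left_mono) auto
   thus ?thesis by (simp add: distrib_left distrib_right mult_ac)
  qed
  show ?thesis by (rule gen) (use x1 n in auto)
 qed
 also have "?x * ?x = (1 + norm \<phi>) ^ (2 * g)" by (simp add: mult_2 power_add)
 finally show ?thesis .
qed

lemma integrand_eq_\<Phi>:
 assumes q: "q \<in> Q" and n: "n >= 1" and u: "u ~= 0" and le: "norm u <= \<rho> * sqrt n / 2"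
 shows "integrand f n q (u /\<^sub>R sqrt n) = \<Phi> f q u (of_real (1 / sqrt n))"
  and "integrand f n q ((- u) /\<^sub>R sqrt n) = \<Phi> f q u (- of_real (1 / sqrt n))"
proof -
 have *: "f q (cline s u) * m q (cline s u) ^ (n - 1) = \<Phi> f q u s"
  if s: "s\<^sup>2 = 1 / of_nat n" "norm s = 1 / sqrt n" for s
 proof -
  have s0: "s ~= 0" using s n by auto
  have "norm u / sqrt n <= \<rho> / 2" using le n by (simp add: pos_divide_le_eq)
  hence "norm s * norm u <= \<rho> / 2" by (simp add: s)
  hence "norm s * norm u < \<rho>" using \<rho> by linarith
  hence z: "norm (cline s u) < r" by (intro in_r[OF \<rho>_ball] u)
  have "exp (H q u s / s\<^sup>2) = exp (of_nat n * Ln (m q (cline s u)))"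
   using n by (simp add: s H_def mult.commute)
  also have "... = m q (cline s u) ^ n"
   using m_nz[OF q z] by (simp add: exp_of_nat_mult)
  finally have e: "exp (H q u s / s\<^sup>2) = m q (cline s u) ^ n" .
  have "m q (cline s u) ^ n = m q (cline s u) * m q (cline s u) ^ (n - 1)"
   using n by (cases n) auto
  thus ?thesis unfolding \<Phi>_def e using s0 m_nz[OF q z] by simp
 qed
 have t2: "(complex_of_real (1 / sqrt n))\<^sup>2 = 1 / of_nat n"
 proof -
  have "(1 / sqrt n)\<^sup>2 = 1 / real n" by (simp add: power_divide)
  thus ?thesis unfolding of_real_power[symmetric] by simp
 qed
 have nt: "norm (complex_of_real (1 / sqrt n)) = 1 / sqrt n" by (simp add: norm_divide)
 show "integrand f n q (u /\<^sub>R sqrt n) = \<Phi> f q u (of_real (1 / sqrt n))"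
  using *[OF t2 nt] by (simp add: integrand_def cline_scaleR inverse_eq_divide)
 have t2': "(- complex_of_real (1 / sqrt n))\<^sup>2 = 1 / of_nat n" unfolding power2_minus by (rule t2)
 have nt': "norm (- complex_of_real (1 / sqrt n)) = 1 / sqrt n" unfolding norm_minus_cancel by (rule nt)
 have "(- u) /\<^sub>R sqrt n = (- (1 / sqrt n)) *\<^sub>R u" by (simp add: inverse_eq_divide)
 thus "integrand f n q ((- u) /\<^sub>R sqrt n) = \<Phi> f q u (- of_real (1 / sqrt n))"
  using *[OF t2' nt'] by (simp only: integrand_def cline_scaleR) simp
qed

lemma Gaussian_integral_eq:
 "(LINT u|lborel. (if u = 0 then 0 else \<Phi> f q u 0)) = f q 0 * of_real (\<Gamma> q)"
proof (cases "integrable lborel (%u. exp (- \<sigma> q u / 2))")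
 case True
 hence [measurable]: "(%u. exp (- \<sigma> q u / 2)) \<in> borel_measurable borel" by auto
 have "(LINT u|lborel. (if u = 0 then 0 else \<Phi> f q u 0)) = (LINT u|lborel. (if u = 0 then 0 else f q 0 * complex_of_real (exp (- \<sigma> q u / 2))))"
  by (intro Bochner_Integration.integral_cong refl) (simp add: \<Phi>_def flip: exp_of_real)
 also have "... = (LINT u|lborel. f q 0 * complex_of_real (exp (- \<sigma> q u / 2)))"
 proof (rule integral_cong_AE)
  show "AE u in lborel. (if u = 0 then 0 else f q 0 * complex_of_real (exp (- \<sigma> q u / 2))) = f q 0 * complex_of_real (exp (- \<sigma> q u / 2))"
   using AE_lborel_singleton[of "0::real^'d"] by eventually_elim auto
 qed measurable
 also have "... = f q 0 * of_real (\<Gamma> q)"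
  unfolding \<Gamma>_def integral_mult_right_zero integral_complex_of_real ..
 finally show ?thesis .
next
 case False
 show ?thesis
 proof (cases "f q 0 = 0")
  case False': False
  \<comment> \<open>Bochner integrals of non-integrable functions are 0 by convention, so both sides
    have to be seen to fail together unless \<open>f q 0\<close> is 0.\<close>
  have "\<not> integrable lborel (%u. (if u = 0 then 0 else \<Phi> f q u 0))"
  proof
   assume i: "integrable lborel (%u. (if u = 0 then 0 else \<Phi> f q u 0))"
   hence "integrable lborel (%u. Re ((if u = 0 then 0 else \<Phi> f q u 0) / f q 0) + indicator {0} u * exp (- \<sigma> q 0 / 2))"
    by (intro Bochner_Integration.integrable_add integrable_Re integrable_divide integrable_mult_left) auto
   moreover have "(%u. Re ((if u = 0 then 0 else \<Phi> f q u 0) / f q 0) + indicator {0} u * exp (- \<sigma> q 0 / 2)) = (%u. exp (- \<sigma> q u / 2))"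
   proof
    fix u
    have "exp (- complex_of_real (\<sigma> q u) / 2) = of_real (exp (- \<sigma> q u / 2))" by (simp flip: exp_of_real)
    thus "Re ((if u = 0 then 0 else \<Phi> f q u 0) / f q 0) + indicator {0} u * exp (- \<sigma> q 0 / 2) = exp (- \<sigma> q u / 2)"
     using False' by (simp add: \<Phi>_def indicator_def)
   qed
   ultimately show False using False by simp
  qed
  thus ?thesis using False by (simp add: \<Gamma>_def not_integrable_integral_eq)
 qed (simp add: \<Phi>_def cong: if_cong)
qed

text \<open>Three uses of \<open>even_expansion\<close>: one family member with
  \<open>j = 0\<close>, the difference of two members with \<open>j = 0\<close>, and one member with
  \<open>j = 1\<close> when the amplitude vanishes at the origin. The constants are chosen before
  \<open>f\<close>.\<close>

theorem laplace:
 "EX K>=0. EX n0>=1. ALL f. amplitude f -->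
  (ALL n>=n0.
   (ALL q:Q. integrable lborel (integrand f n q) & norm (J f n q - f q 0 * of_real (\<Gamma> q)) <= K / real n) &
   (ALL q1:Q. ALL q2:Q. norm (J f n q1 - J f n q2) <= K * dist q1 q2 &
    ((ALL q:Q. f q 0 = 0) --> norm (J f n q1 - J f n q2) <= K * dist q1 q2 / real n))) &
  ((ALL q:Q. f q 0 = 0) --> (EX c. ALL n>=n0. ALL q:Q. norm (J f n q - c q / of_nat n) <= K / (real n)\<^sup>2))"
proof -
 have \<rho>2: "\<rho> / 2 > 0" using \<rho> by simp
 obtain n1 Kt where n1: "n1 >= 1" and Kt: "Kt >= 0" and
  tail0: "ALL n>=n1. ALL A>=0. \<forall>G::real ^ 'd => complex. G \<in> borel_measurable borel -->
   (ALL \<phi>. norm (G \<phi>) <= A * real n * (1 + norm \<phi>) ^ (2 * g) * ((1 + \<delta> * (norm \<phi>)\<^sup>2) powr (- \<delta>)) ^ (n - 2)) -->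
   integrable lborel G & integrable lborel (%u. G (u /\<^sub>R sqrt n)) &
   (LINT u|lborel. norm (G (u /\<^sub>R sqrt n)) * indicator {u. norm u > \<rho> / 2 * sqrt n} u) <= Kt * A / (real n)\<^sup>2"
  using decay_tail[OF \<delta> \<rho>2, of "2 * g", where ?'d = 'd] by (elim exE conjE) (rule that)
 have tail: "integrable lborel G & integrable lborel (%u. G (u /\<^sub>R sqrt n)) &
   (LINT u|lborel. norm (G (u /\<^sub>R sqrt n)) * indicator {u. norm u > \<rho> / 2 * sqrt n} u) <= Kt * A / (real n)\<^sup>2"
  if "n >= n1" "A >= 0" "G \<in> borel_measurable borel"
   "!!\<phi>. norm (G \<phi>) <= A * real n * (1 + norm \<phi>) ^ (2 * g) * ((1 + \<delta> * (norm \<phi>)\<^sup>2) powr (- \<delta>)) ^ (n - 2)"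
  for n A and G :: "real ^ 'd => complex"
  using tail0[rule_format, OF that(1,2,3)] that(4) by blast
 \<comment> \<open>At least 2, so that \<open>n - 2\<close> in the envelope exponents is a genuine
   difference.\<close>
 define n0 where "n0 = max n1 2"
 have n0: "n0 >= 1" "n0 >= 2" "n0 >= n1" by (auto simp: n0_def)
 \<comment> \<open>One constant for the local bounds of \<open>\<Phi>\<close> and for the tails of a
   single integrand and of a difference.\<close>
 define A0 where "A0 = K\<^sub>1 + Kt * (C + C * C)"
 have A0: "A0 >= 0" "K\<^sub>1 <= A0" "Kt * (C + C * C) <= A0" "Kt * C <= A0"
  using K\<^sub>1 Kt C by (auto simp: A0_def distrib_left intro!: add_nonneg_nonneg mult_nonneg_nonneg)
 define W where "W j = (\<integral>u. (1 + norm u) ^ (2 * j + 4) * exp (- \<kappa> * (norm u)\<^sup>2) \<partial>(lborel :: (real ^ 'd) measure))" for j :: nat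
 have W: "W j >= 0" for j unfolding W_def by (intro integral_nonneg_AE) auto
 define B where "B j = 1 + 4 * W j / \<rho> ^ (2 * j + 2)" for j
 have B: "B j >= 0" for j using W[of j] \<rho> by (simp add: B_def)
 define K where "K = (B 0 + W 0 + B 1) * A0"
 have K: "K >= 0" "B 0 * A0 <= K" "B 1 * A0 <= K" "(B 0 + W 0) * A0 <= K"
  using B[of 0] B[of 1] W[of 0] A0 by (auto simp: K_def distrib_right intro!: add_nonneg_nonneg mult_nonneg_nonneg)
 have n2: "Kt * A / (real n)\<^sup>2 <= A' / real n ^ (j + 1)" if "n >= n0" "j <= 1" "Kt * A <= A'" "A' >= 0" for n j A A'
 proof -
  have "Kt * A / (real n)\<^sup>2 <= A' / (real n)\<^sup>2" using that by (intro divide_right_mono) auto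
  also have "... <= A' / real n ^ (j + 1)"
   using that n0 by (intro divide_left_mono power_increasing mult_pos_pos zero_less_power) auto
  finally show ?thesis .
 qed
 have single: "even_expansion (\<Phi> f q) (%n u. integrand f n q (u /\<^sub>R sqrt n)) \<rho> \<kappa> A0 j n0"
  if f: "amplitude f" and q: "q \<in> Q" and j: "j = 0 \<or> j = 1 & f q 0 = 0" for f q j
 proof
  fix u :: "real ^ 'd" and t :: complex assume u: "u ~= 0" and t: "norm t * norm u < \<rho>"
  have "norm (\<Phi> f q u t) <= 2 * K\<^sub>0 * exp (- \<kappa> * (norm u)\<^sup>2)" by (rule \<Phi>_bound[OF f q u t])
  also have "... <= A0 * ((1 + norm u)\<^sup>2 * exp (- \<kappa> * (norm u)\<^sup>2))"
  proof -
   have "(2 * K\<^sub>0) * (1 * exp (- \<kappa> * (norm u)\<^sup>2)) <= A0 * ((1 + norm u)\<^sup>2 * exp (- \<kappa> * (norm u)\<^sup>2))"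
    using K\<^sub>1 K\<^sub>0 A0 by (intro mult_mono mult_right_mono one_le_power) auto
   thus ?thesis by simp
  qed
  finally show "norm (\<Phi> f q u t) <= A0 * ((1 + norm u)\<^sup>2 * exp (- \<kappa> * (norm u)\<^sup>2))" .
 next
  fix u :: "real ^ 'd" and k :: nat assume "u ~= 0" "even k" "k < 2 * j"
  hence "j = 1" "k = 0" using j by (auto elim!: evenE)
  thus "(deriv ^^ k) (\<Phi> f q u) 0 = 0" using j by (simp add: \<Phi>_def)
 next
  fix n :: nat assume n: "n >= n0"
  note T = tail[OF le_trans[OF n0(3) n] C integrand_measurable[OF f q] integrand_bound[OF f q le_trans[OF n0(2) n]]]
  show "integrable lborel (%u. integrand f n q (u /\<^sub>R sqrt n))" using T by simp
  have "(LINT u|lborel. norm (integrand f n q (u /\<^sub>R sqrt n)) * indicator {u. norm u > \<rho> * sqrt n / 2} u) <= Kt * C / (real n)\<^sup>2"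
   using T by simp
  also have "... <= A0 / real n ^ (j + 1)" using j by (intro n2 n A0) auto
  finally show "(LINT u|lborel. norm (integrand f n q (u /\<^sub>R sqrt n)) * indicator {u. norm u > \<rho> * sqrt n / 2} u) <= A0 / real n ^ (j + 1)" .
 next
  fix n :: nat and u :: "real ^ 'd" assume n: "n >= n0" and u: "u ~= 0" and le: "norm u <= \<rho> * sqrt n / 2"
  show "integrand f n q (u /\<^sub>R sqrt n) = \<Phi> f q u (of_real (1 / sqrt n))"
   by (rule integrand_eq_\<Phi>(1)[OF q le_trans[OF n0(1) n] u le])
  show "integrand f n q ((- u) /\<^sub>R sqrt n) = \<Phi> f q u (- of_real (1 / sqrt n))"
   by (rule integrand_eq_\<Phi>(2)[OF q le_trans[OF n0(1) n] u le])
 qed (use \<rho> \<kappa> A0 n0 \<Phi>_hol[OF f q] in auto)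
 \<comment> \<open>The difference of two members is again an even expansion, with all bounds
   proportional to the distance; this is how Lipschitz estimates of the integrals arise.\<close>
 have pair: "even_expansion (%u t. \<Phi> f q1 u t - \<Phi> f q2 u t)
   (%n u. integrand f n q1 (u /\<^sub>R sqrt n) - integrand f n q2 (u /\<^sub>R sqrt n)) \<rho> \<kappa> (A0 * dist q1 q2) 0 n0"
  if f: "amplitude f" and q: "q1 \<in> Q" "q2 \<in> Q" for f q1 q2
 proof
  fix u :: "real ^ 'd" assume u: "u ~= 0"
  show "(%t. \<Phi> f q1 u t - \<Phi> f q2 u t) holomorphic_on ball 0 (\<rho> / norm u)"
   by (intro holomorphic_on_diff \<Phi>_hol f q u)
 next
  fix u :: "real ^ 'd" and t :: complex assume u: "u ~= 0" and t: "norm t * norm u < \<rho>"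
  have "norm (\<Phi> f q1 u t - \<Phi> f q2 u t) <= K\<^sub>1 * dist q1 q2 * ((1 + norm u)\<^sup>2 * exp (- \<kappa> * (norm u)\<^sup>2))"
   by (rule \<Phi>_lipschitz[OF f q u t])
  also have "... <= A0 * dist q1 q2 * ((1 + norm u)\<^sup>2 * exp (- \<kappa> * (norm u)\<^sup>2))"
   using A0 by (intro mult_right_mono) auto
  finally show "norm (\<Phi> f q1 u t - \<Phi> f q2 u t) <= A0 * dist q1 q2 * ((1 + norm u)\<^sup>2 * exp (- \<kappa> * (norm u)\<^sup>2))" .
 next
  fix n :: nat assume n: "n >= n0"
  have CC: "(C + C * C) * dist q1 q2 >= 0" using C by simp
  note T = tail[OF le_trans[OF n0(3) n] CC borel_measurable_diff[OF integrand_measurable[OF f q(1)] integrand_measurable[OF f q(2)]]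
    integrand_diff_bound[OF f q le_trans[OF n0(2) n]]]
  show "integrable lborel (%u. integrand f n q1 (u /\<^sub>R sqrt n) - integrand f n q2 (u /\<^sub>R sqrt n))" using T by simp
  have "(LINT u|lborel. norm (integrand f n q1 (u /\<^sub>R sqrt n) - integrand f n q2 (u /\<^sub>R sqrt n)) * indicator {u. norm u > \<rho> * sqrt n / 2} u)
    <= Kt * ((C + C * C) * dist q1 q2) / (real n)\<^sup>2"
   using T by simp
  also have "... <= (A0 * dist q1 q2) / real n ^ (0 + 1)"
   using A0 mult_right_mono[OF A0(3) zero_le_dist[of q1 q2]] by (intro n2 n) (auto simp: mult.assoc)
  finally show "(LINT u|lborel. norm (integrand f n q1 (u /\<^sub>R sqrt n) - integrand f n q2 (u /\<^sub>R sqrt n)) * indicator {u. norm u > \<rho> * sqrt n / 2} u)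
    <= (A0 * dist q1 q2) / real n ^ (0 + 1)" .
 next
  fix n :: nat and u :: "real ^ 'd" assume n: "n >= n0" and u: "u ~= 0" and le: "norm u <= \<rho> * sqrt n / 2"
  show "integrand f n q1 (u /\<^sub>R sqrt n) - integrand f n q2 (u /\<^sub>R sqrt n) = \<Phi> f q1 u (of_real (1 / sqrt n)) - \<Phi> f q2 u (of_real (1 / sqrt n))"
   by (simp only: integrand_eq_\<Phi>(1)[OF _ le_trans[OF n0(1) n] u le] q)
  show "integrand f n q1 ((- u) /\<^sub>R sqrt n) - integrand f n q2 ((- u) /\<^sub>R sqrt n) = \<Phi> f q1 u (- of_real (1 / sqrt n)) - \<Phi> f q2 u (- of_real (1 / sqrt n))"
   by (simp only: integrand_eq_\<Phi>(2)[OF _ le_trans[OF n0(1) n] u le] q)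
 qed (use \<rho> \<kappa> A0 n0 in auto)
 show ?thesis
 proof (intro exI[of _ K] exI[of _ n0] conjI allI impI ballI K n0)
  fix f n q assume f: "amplitude f" and n: "n >= n0" and q: "q \<in> Q"
  show "integrable lborel (integrand f n q)"
   using tail[OF le_trans[OF n0(3) n] C integrand_measurable[OF f q] integrand_bound[OF f q le_trans[OF n0(2) n]]] by simp
  interpret even_expansion "\<Phi> f q" "%n u. integrand f n q (u /\<^sub>R sqrt n)" \<rho> \<kappa> A0 0 n0
   by (rule single[OF f q]) simp
  have a: "a = (%u. if u = 0 then 0 else \<Phi> f q u 0)" by (simp add: a_def fun_eq_iff)
  have "norm (J f n q - f q 0 * of_real (\<Gamma> q)) <= B 0 * A0 / real n"
   using expansion[OF n] by (simp add: a Gaussian_integral_eq J_def B_def W_def om_def)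
  also have "... <= K / real n" by (intro divide_right_mono K) simp
  finally show "norm (J f n q - f q 0 * of_real (\<Gamma> q)) <= K / real n" .
 next
  fix f n q1 q2 assume f: "amplitude f" and n: "n >= n0" and q: "q1 \<in> Q" "q2 \<in> Q"
  interpret even_expansion "%u t. \<Phi> f q1 u t - \<Phi> f q2 u t"
   "%n u. integrand f n q1 (u /\<^sub>R sqrt n) - integrand f n q2 (u /\<^sub>R sqrt n)" \<rho> \<kappa> "A0 * dist q1 q2" 0 n0
   by (rule pair[OF f q])
  have "(LINT u|lborel. integrand f n q1 (u /\<^sub>R sqrt n) - integrand f n q2 (u /\<^sub>R sqrt n)) = J f n q1 - J f n q2"
   unfolding J_def using even_expansion.int[OF single[OF f q(1), of 0] n] even_expansion.int[OF single[OF f q(2), of 0] n]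
   by (intro Bochner_Integration.integral_diff) auto
  hence E: "norm (J f n q1 - J f n q2 - (LINT u|lborel. a u)) <= B 0 * (A0 * dist q1 q2) / real n"
   using expansion[OF n] by (simp add: B_def W_def om_def)
  have "B 0 * (A0 * dist q1 q2) / real n <= B 0 * (A0 * dist q1 q2) / 1"
   using n n0 B[of 0] A0 by (intro divide_left_mono) auto
  moreover have "norm (LINT u|lborel. a u) <= (A0 * dist q1 q2) * W 0"
   using a_integral_bound by (simp add: W_def om_def)
  moreover have "norm (J f n q1 - J f n q2) <= norm (J f n q1 - J f n q2 - (LINT u|lborel. a u)) + norm (LINT u|lborel. a u)"
   using norm_triangle_ineq[of "J f n q1 - J f n q2 - (LINT u|lborel. a u)" "\<integral>u. a u \<partial>lborel"] by simp
  ultimately have "norm (J f n q1 - J f n q2) <= B 0 * (A0 * dist q1 q2) + (A0 * dist q1 q2) * W 0"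
   using E by linarith
  also have "... = ((B 0 + W 0) * A0) * dist q1 q2" by (simp add: algebra_simps)
  also have "... <= K * dist q1 q2" by (intro mult_right_mono K) simp
  finally show "norm (J f n q1 - J f n q2) <= K * dist q1 q2" .
  \<comment> \<open>For an amplitude vanishing at the origin the leading coefficient of the
    difference is 0, and only the remainder with its factor 1/n survives.\<close>
  assume z: "ALL q:Q. f q 0 = 0"
  have \<Phi>0: "\<Phi> f q1 u 0 = 0" "\<Phi> f q2 u 0 = 0" for u
   using z q by (simp_all add: \<Phi>_def)
  have "a = (%u. 0)" by (intro ext) (simp add: a_def \<Phi>0)
  hence "norm (J f n q1 - J f n q2) <= (B 0 * A0) * dist q1 q2 / real n" using E by (simp add: mult.assoc)
  also have "... <= K * dist q1 q2 / real n" by (intro divide_right_mono mult_right_mono K) auto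
  finally show "norm (J f n q1 - J f n q2) <= K * dist q1 q2 / real n" .
 next
  fix f assume f: "amplitude f" and z: "ALL q:Q. f q 0 = 0"
  have "EX c. ALL n>=n0. norm (J f n q - c / of_nat n) <= K / (real n)\<^sup>2" if q: "q \<in> Q" for q
  proof -
   interpret even_expansion "\<Phi> f q" "%n u. integrand f n q (u /\<^sub>R sqrt n)" \<rho> \<kappa> A0 1 n0
    by (rule single[OF f q]) (use z q in simp)
   show ?thesis
   proof (intro exI[of _ "\<integral>u. a u \<partial>lborel"] allI impI)
    fix n :: nat assume n: "n >= n0"
    have "norm (J f n q - (LINT u|lborel. a u) / of_nat n) <= B 1 * A0 / (real n)\<^sup>2"
     using expansion[OF n] unfolding J_def B_def W_def om_def by (simp add: eval_nat_numeral)
    also have "... <= K / (real n)\<^sup>2" by (intro divide_right_mono K) simp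
    finally show "norm (J f n q - (LINT u|lborel. a u) / of_nat n) <= K / (real n)\<^sup>2" .
   qed
  qed
  hence "ALL q:Q. EX c. ALL n>=n0. norm (J f n q - c / of_nat n) <= K / (real n)\<^sup>2" by blast
  from bchoice[OF this] show "EX c. ALL n>=n0. ALL q:Q. norm (J f n q - c q / of_nat n) <= K / (real n)\<^sup>2" by blast
 qed
qed

end

section \<open>Fourier inversion\<close>

lemma cis_measurable [measurable]: "cis \<in> borel_measurable borel"
 by (intro borel_measurable_continuous_onI continuous_intros)

text \<open>The characteristic function of the standard normal law, rescaled by
  \<open>eps\<close>.\<close>

lemma gaussian_fourier_1:
 fixes v eps :: real
 assumes eps: "eps > 0"
 shows "integrable lborel (%t. cis (t * v) * of_real (exp (- (eps * t)\<^sup>2 / 2)))"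
  and "(LINT t|lborel. cis (t * v) * of_real (exp (- (eps * t)\<^sup>2 / 2))) = of_real (sqrt (2 * pi) / eps * exp (- v\<^sup>2 / (2 * eps\<^sup>2)))"
proof -
 have i0: "integrable lborel std_normal_density"
  by (rule integrable_normal_density) simp
 have n: "integrable lborel (%x. complex_of_real (std_normal_density x) * cis (x * (v / eps)))"
 proof (rule Bochner_Integration.integrable_bound[OF i0])
  show "AE x in lborel. norm (complex_of_real (std_normal_density x) * cis (x * (v / eps))) <= norm (std_normal_density x)"
   by (intro AE_I2) (simp add: norm_mult)
 qed measurable
 have c: "(LINT x|lborel. complex_of_real (std_normal_density x) * cis (x * (v / eps))) = of_real (exp (- (v / eps)\<^sup>2 / 2))"
 proof -
  have "char std_normal_distribution (v / eps) = (LINT x|lborel. std_normal_density x *\<^sub>R iexp ((v / eps) * x))"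
   unfolding char_def by (subst integral_density) (auto simp: normal_density_nonneg)
  also have "... = (LINT x|lborel. complex_of_real (std_normal_density x) * cis (x * (v / eps)))"
   by (intro Bochner_Integration.integral_cong refl) (simp add: cis_conv_exp scaleR_conv_of_real mult.commute)
  finally show ?thesis using char_std_normal_distribution by (simp add: fun_eq_iff)
 qed
 have e: "complex_of_real (std_normal_density (eps * t)) * cis ((eps * t) * (v / eps))
   = of_real (1 / sqrt (2 * pi)) * (cis (t * v) * of_real (exp (- (eps * t)\<^sup>2 / 2)))" for t
  using eps by (simp add: std_normal_density_def)
 have "integrable lborel (%t. complex_of_real (std_normal_density (eps *\<^sub>R t)) * cis ((eps *\<^sub>R t) * (v / eps)))"
  by (rule lborel_integrable_scaleR[OF eps n])
 hence "integrable lborel (%t. of_real (sqrt (2 * pi)) * (of_real (1 / sqrt (2 * pi)) * (cis (t * v) * complex_of_real (exp (- (eps * t)\<^sup>2 / 2)))))"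
  unfolding real_scaleR_def e by (rule integrable_mult_right)
 thus "integrable lborel (%t. cis (t * v) * of_real (exp (- (eps * t)\<^sup>2 / 2)))"
  by (simp add: mult.assoc[symmetric] flip: of_real_mult)
 have "of_real (exp (- (v / eps)\<^sup>2 / 2)) = eps ^ DIM(real) *\<^sub>R (LINT t|lborel. complex_of_real (std_normal_density (eps *\<^sub>R t)) * cis ((eps *\<^sub>R t) * (v / eps)))"
  unfolding c[symmetric] using n by (intro lborel_integral_scaleR eps) auto
 also have "... = of_real eps * (of_real (1 / sqrt (2 * pi)) * (LINT t|lborel. cis (t * v) * of_real (exp (- (eps * t)\<^sup>2 / 2))))"
  unfolding real_scaleR_def e integral_mult_right_zero by (simp add: scaleR_conv_of_real)
 finally have "of_real (sqrt (2 * pi) / eps) * complex_of_real (exp (- (v / eps)\<^sup>2 / 2)) =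
   (of_real (sqrt (2 * pi) / eps) * (of_real eps * of_real (1 / sqrt (2 * pi)))) * (LINT t|lborel. cis (t * v) * of_real (exp (- (eps * t)\<^sup>2 / 2)))"
  by (simp only: mult.assoc)
 also have "of_real (sqrt (2 * pi) / eps) * (of_real eps * of_real (1 / sqrt (2 * pi))) = (1 :: complex)"
  using eps by (simp flip: of_real_mult)
 finally show "(LINT t|lborel. cis (t * v) * of_real (exp (- (eps * t)\<^sup>2 / 2))) = of_real (sqrt (2 * pi) / eps * exp (- v\<^sup>2 / (2 * eps\<^sup>2)))"
  by (simp add: power_divide mult.commute)
qed

lemma gaussian_fourier:
 fixes v :: "'a::euclidean_space"
 assumes eps: "eps > 0"
 shows "integrable lborel (%t. cis (t \<bullet> v) * of_real (exp (- (eps * norm t)\<^sup>2 / 2)))" (is ?I)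
  and "(LINT t|lborel. cis (t \<bullet> v) * of_real (exp (- (eps * norm t)\<^sup>2 / 2)))
   = of_real ((sqrt (2 * pi) / eps) ^ DIM('a) * exp (- (norm v)\<^sup>2 / (2 * eps\<^sup>2)))" (is ?E)
proof -
 have n2: "(norm x)\<^sup>2 = (SUM b:Basis. (x \<bullet> b)\<^sup>2)" for x :: 'a
  unfolding power2_norm_eq_inner by (subst euclidean_inner) (simp add: power2_eq_square)
 have cis_sum: "cis (SUM b:B. h b) = (\<Prod>b\<in>B. cis (h b))" if "finite B" for B :: "'a set" and h
  using that by (induction B rule: finite_induct) (auto simp: cis_mult[symmetric])
 have p: "cis (t \<bullet> v) * of_real (exp (- (eps * norm t)\<^sup>2 / 2))
   = (\<Prod>b\<in>Basis. cis ((t \<bullet> b) * (v \<bullet> b)) * complex_of_real (exp (- (eps * (t \<bullet> b))\<^sup>2 / 2)))" for t :: 'a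
 proof -
  have "- (eps * norm t)\<^sup>2 / 2 = (SUM b:Basis. - (eps * (t \<bullet> b))\<^sup>2 / 2)"
   by (simp add: power_mult_distrib n2 sum_distrib_left sum_negf sum_divide_distrib)
  hence 1: "exp (- (eps * norm t)\<^sup>2 / 2) = (\<Prod>b\<in>Basis. exp (- (eps * (t \<bullet> b))\<^sup>2 / 2))"
   by (simp add: exp_sum)
  have 2: "cis (t \<bullet> v) = (\<Prod>b\<in>Basis. cis ((t \<bullet> b) * (v \<bullet> b)))"
   by (subst euclidean_inner) (rule cis_sum[OF finite_Basis])
  show ?thesis unfolding 1 2 of_real_prod prod.distrib ..
 qed
 note L = lborel_prod_Basis[of "%b x. cis (x * (v \<bullet> b)) * complex_of_real (exp (- (eps * x)\<^sup>2 / 2))", OF gaussian_fourier_1(1)[OF eps]]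
 show ?I unfolding p by (rule L(1))
 have "(\<Prod>b\<in>Basis. complex_of_real (sqrt (2 * pi) / eps * exp (- (v \<bullet> b)\<^sup>2 / (2 * eps\<^sup>2))))
   = of_real ((sqrt (2 * pi) / eps) ^ DIM('a) * exp (- (norm v)\<^sup>2 / (2 * eps\<^sup>2)))"
 proof -
  have "- (norm v)\<^sup>2 / (2 * eps\<^sup>2) = (SUM b:Basis. - (v \<bullet> b)\<^sup>2 / (2 * eps\<^sup>2))"
   by (simp add: n2 sum_negf sum_divide_distrib)
  hence e: "exp (- (norm v)\<^sup>2 / (2 * eps\<^sup>2)) = (\<Prod>b\<in>Basis. exp (- (v \<bullet> b)\<^sup>2 / (2 * eps\<^sup>2)))"
   by (simp add: exp_sum)
  show ?thesis unfolding e of_real_prod[symmetric] by (simp only: prod.distrib prod_constant)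
 qed
 thus ?E unfolding p L(2) by (simp only: gaussian_fourier_1(2)[OF eps])
qed

text \<open>Applied below with \<open>\<nu>\<close> the exponentially tilted law of the sum, whose
  transform is a power of \<open>M\<close> along the contour.\<close>

locale integrable_fourier = finite_measure \<nu> for \<nu> :: "'a::euclidean_space measure" +
 fixes \<psi> :: "'a => complex"
 assumes sets_\<nu>: "sets \<nu> = sets borel"
  and \<psi>: "!!t. \<psi> t = (\<integral>w. cis (t \<bullet> w) \<partial>\<nu>)"
  and int_\<psi>: "integrable lborel \<psi>"
begin

definition F :: "'a => complex" where "F x = (LINT t|lborel. \<psi> t * cis (- (t \<bullet> x)))"

definition k :: "real => 'a => real" where "k eps t = exp (- (eps * norm t)\<^sup>2 / 2)"

text \<open>The Fourier transform of \<open>k eps\<close>: a centred Gaussian density with standard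
  deviation \<open>eps\<close> in each coordinate, times (2 pi)^d.\<close>

definition G :: "real => 'a => real" where
 "G eps v = (sqrt (2 * pi) / eps) ^ DIM('a) * exp (- (norm v)\<^sup>2 / (2 * eps\<^sup>2))"

definition f where "f eps x = (\<integral>w. G eps (w - x) \<partial>\<nu>)"

lemmas [measurable_cong] = sets_\<nu>

lemma space_\<nu>: "space \<nu> = UNIV" using sets_eq_imp_space_eq[OF sets_\<nu>] by simp

lemma \<psi>_measurable [measurable]: "\<psi> \<in> borel_measurable borel" using int_\<psi> by auto
lemma k_measurable [measurable]: "k eps \<in> borel_measurable borel" unfolding k_def[abs_def] by measurable
lemma G_measurable [measurable]: "G eps \<in> borel_measurable borel" unfolding G_def[abs_def] by measurable

lemma k: "0 < k eps t" "k eps t <= 1" by (auto simp: k_def)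

lemma k_integrable: "eps > 0 ==> integrable lborel (k eps)"
 using integrable_norm[OF gaussian_fourier(1)[of eps "0::'a"]] by (simp add: k_def[abs_def] norm_mult)

lemma G_nonneg: "eps > 0 ==> 0 <= G eps v" by (simp add: G_def)

lemma G_le: "eps > 0 ==> G eps v <= (sqrt (2 * pi) / eps) ^ DIM('a)"
 unfolding G_def by (intro mult_left_le) auto

text \<open>The Gaussian mollification of the measure has a density given by the damped inversion integral.\<close>

lemma f_eq:
 assumes eps: "eps > 0"
 shows "(LINT t|lborel. \<psi> t * cis (- (t \<bullet> x)) * of_real (k eps t)) = of_real (f eps x)"
proof -
 interpret pair_sigma_finite \<nu> "lborel :: 'a measure" ..
 let ?h = "%w t. cis (t \<bullet> (w - x)) * complex_of_real (k eps t)"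
 have int: "integrable (\<nu> \<Otimes>\<^sub>M lborel) (case_prod ?h)"
 proof (rule Fubini_integrable)
  show "case_prod ?h \<in> borel_measurable (\<nu> \<Otimes>\<^sub>M lborel)" by measurable
  have "(LINT t|lborel. norm (?h w t)) = (LINT t|lborel. k eps t)" for w
   using k(1)[of eps] by (intro Bochner_Integration.integral_cong refl) (simp add: norm_mult less_imp_le)
  thus "integrable \<nu> (%w. \<integral>t. norm (case (w, t) of (w, t) => ?h w t) \<partial>lborel)" by simp
  show "AE w in \<nu>. integrable lborel (%t. case (w, t) of (w, t) => ?h w t)"
  proof (intro AE_I2)
   fix w
   show "integrable lborel (%t. case (w, t) of (w, t) => ?h w t)"
    using gaussian_fourier(1)[OF eps, of "w - x"] by (simp add: k_def)
  qed
 qed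
 have "(LINT t|lborel. \<psi> t * cis (- (t \<bullet> x)) * of_real (k eps t)) = (\<integral>t. (\<integral>w. ?h w t \<partial>\<nu>) \<partial>lborel)"
 proof (intro Bochner_Integration.integral_cong refl)
  fix t
  have e: "?h w t = cis (t \<bullet> w) * (cis (- (t \<bullet> x)) * of_real (k eps t))" for w
   by (simp add: inner_diff_right cis_mult mult.assoc[symmetric])
  show "\<psi> t * cis (- (t \<bullet> x)) * of_real (k eps t) = (\<integral>w. ?h w t \<partial>\<nu>)"
   unfolding e \<psi> integral_mult_left_zero by (rule mult.assoc)
 qed
 also have "... = (\<integral>w. (LINT t|lborel. ?h w t) \<partial>\<nu>)" by (rule Fubini_integral[OF int])
 also have "... = (\<integral>w. complex_of_real (G eps (w - x)) \<partial>\<nu>)"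
  unfolding k_def G_def by (intro Bochner_Integration.integral_cong refl gaussian_fourier(2)[OF eps])
 also have "... = of_real (f eps x)" unfolding f_def by (rule integral_complex_of_real)
 finally show ?thesis .
qed

lemma f_lim: "(%n. complex_of_real (f (1 / real (Suc n)) x)) \<longlonglongrightarrow> F x"
proof -
 have "(%n. \<integral>t. \<psi> t * cis (- (t \<bullet> x)) * of_real (k (1 / real (Suc n)) t) \<partial>lborel) \<longlonglongrightarrow> F x"
  unfolding F_def
 proof (rule integral_dominated_convergence[where w="%t. norm (\<psi> t)"])
  show "AE t in lborel. (%n. \<psi> t * cis (- (t \<bullet> x)) * of_real (k (1 / real (Suc n)) t)) \<longlonglongrightarrow> \<psi> t * cis (- (t \<bullet> x))"
  proof (intro AE_I2)
   fix t :: 'a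
   have "(%n. k (1 / real (Suc n)) t) \<longlonglongrightarrow> exp (- (0 * norm t)\<^sup>2 / 2)"
    unfolding k_def by (intro tendsto_intros LIMSEQ_Suc[OF lim_1_over_n]) simp
   hence "(%n. \<psi> t * cis (- (t \<bullet> x)) * of_real (k (1 / real (Suc n)) t)) \<longlonglongrightarrow> \<psi> t * cis (- (t \<bullet> x)) * of_real 1"
    by (intro tendsto_mult tendsto_const tendsto_of_real) simp
   thus "(%n. \<psi> t * cis (- (t \<bullet> x)) * of_real (k (1 / real (Suc n)) t)) \<longlonglongrightarrow> \<psi> t * cis (- (t \<bullet> x))" by simp
  qed
  show "AE t in lborel. norm (\<psi> t * cis (- (t \<bullet> x)) * of_real (k (1 / real (Suc n)) t)) <= norm (\<psi> t)" for n
   using k by (intro AE_I2) (simp add: norm_mult mult_left_le less_imp_le)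
  show "integrable lborel (%t. norm (\<psi> t))" by (rule integrable_norm[OF int_\<psi>])
 qed measurable
 thus ?thesis by (simp add: f_eq)
qed

lemma f_lim_Re: "(%n. f (1 / real (Suc n)) x) \<longlonglongrightarrow> Re (F x)"
 using tendsto_Re[OF f_lim[of x]] by simp

lemma f_nonneg: "eps > 0 ==> f eps x >= 0"
 unfolding f_def by (intro integral_nonneg_AE) (auto simp: G_nonneg)

lemma F_nonneg: "Re (F x) >= 0"
 by (rule tendsto_lowerbound[OF f_lim_Re]) (auto simp: f_nonneg)

lemma F_bound: "norm (F x) <= (LINT t|lborel. norm (\<psi> t))"
 unfolding F_def by (rule order_trans[OF integral_norm_bound]) (simp add: norm_mult)

lemma f_bound: "eps > 0 ==> \<bar>f eps x\<bar> <= (LINT t|lborel. norm (\<psi> t))"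
proof -
 assume eps: "eps > 0"
 have "norm (complex_of_real (f eps x)) <= (LINT t|lborel. norm (\<psi> t * cis (- (t \<bullet> x)) * of_real (k eps t)))"
  unfolding f_eq[OF eps, symmetric] by (rule integral_norm_bound)
 also have "... <= (LINT t|lborel. norm (\<psi> t))"
 proof (rule integral_mono)
  show "integrable lborel (%t. norm (\<psi> t * cis (- (t \<bullet> x)) * of_real (k eps t)))"
  proof (rule Bochner_Integration.integrable_bound[OF int_\<psi>])
   show "AE t in lborel. norm (norm (\<psi> t * cis (- (t \<bullet> x)) * of_real (k eps t))) <= norm (\<psi> t)"
    using k by (intro AE_I2) (simp add: norm_mult mult_left_le less_imp_le)
  qed measurable
 qed (use k int_\<psi> in \<open>auto simp: norm_mult mult_left_le less_imp_le\<close>)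
 finally show ?thesis by simp
qed

lemma F_continuous: "continuous_on UNIV F"
 unfolding continuous_on_sequentially
proof (intro allI ballI impI, elim conjE)
 fix X :: "nat => 'a" and a assume X: "X \<longlonglongrightarrow> a"
 show "(F \<circ> X) \<longlonglongrightarrow> F a"
  unfolding F_def o_def
 proof (rule integral_dominated_convergence[where w="%t. norm (\<psi> t)"])
  show "AE t in lborel. (%n. \<psi> t * cis (- (t \<bullet> X n))) \<longlonglongrightarrow> \<psi> t * cis (- (t \<bullet> a))"
  proof (intro AE_I2)
   fix t
   have "isCont cis (- (t \<bullet> a))" using continuous_on_cis[OF continuous_on_id, of UNIV] by (simp add: continuous_on_eq_continuous_at)
   hence "(%n. cis (- (t \<bullet> X n))) \<longlonglongrightarrow> cis (- (t \<bullet> a))"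
    by (rule isCont_tendsto_compose) (intro tendsto_intros X)
   thus "(%n. \<psi> t * cis (- (t \<bullet> X n))) \<longlonglongrightarrow> \<psi> t * cis (- (t \<bullet> a))" by (intro tendsto_mult tendsto_const)
  qed
  show "integrable lborel (%t. norm (\<psi> t))" by (rule integrable_norm[OF int_\<psi>])
 qed (auto simp: norm_mult)
qed

lemma F_measurable [measurable]: "F \<in> borel_measurable borel"
 by (rule borel_measurable_continuous_onI[OF F_continuous])

lemma f_measurable: "eps > 0 ==> f eps \<in> borel_measurable borel"
proof -
 assume "eps > 0"
 interpret sigma_finite_measure \<nu> by (rule finite_measure.axioms) unfold_locales
 have "(%x. \<integral>w. G eps (w - x) \<partial>\<nu>) \<in> borel_measurable borel" by measurable
 thus ?thesis by (simp add: f_def[abs_def])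
qed

text \<open>The mollified measures are tested against \<open>g\<close> in two ways. Fubini and
  continuity of \<open>g\<close> give the integral over \<open>\<nu>\<close>; the uniform bound and
  pointwise convergence of the mollified densities give the integral of \<open>g\<close> against
  \<open>F\<close>.\<close>

lemma test_function:
 fixes g :: "'a => real"
 assumes gc: "continuous_on UNIV g" and gb: "!!x. \<bar>g x\<bar> <= 1" and gi: "integrable lborel g"
 shows "(LINT x|lborel. g x * Re (F x)) = (2 * pi) ^ DIM('a) * (\<integral>w. g w \<partial>\<nu>)"
proof -
 note [measurable] = borel_measurable_continuous_onI[OF gc]
 define \<gamma> where "\<gamma> v = (sqrt (2 * pi)) ^ DIM('a) * exp (- (norm v)\<^sup>2 / 2)" for v :: 'a
 have \<gamma>i: "integrable lborel \<gamma>"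
  using k_integrable[of 1] unfolding \<gamma>_def k_def[abs_def] by (intro integrable_mult_right) simp
 have \<gamma>0: "\<gamma> v >= 0" for v by (simp add: \<gamma>_def)
 have [measurable]: "\<gamma> \<in> borel_measurable borel" using \<gamma>i by auto
 have \<gamma>int: "(LINT v|lborel. \<gamma> v) = (2 * pi) ^ DIM('a)"
 proof -
  have "complex_of_real (LINT v|lborel. exp (- (norm (v::'a))\<^sup>2 / 2)) = of_real (sqrt (2 * pi) ^ DIM('a))"
   using gaussian_fourier(2)[of 1 "0::'a"] by (simp flip: integral_complex_of_real)
  hence "(LINT v|lborel. exp (- (norm (v::'a))\<^sup>2 / 2)) = sqrt (2 * pi) ^ DIM('a)" using of_real_eq_iff by blast
  hence "(LINT v|lborel. \<gamma> v) = sqrt (2 * pi) ^ DIM('a) * sqrt (2 * pi) ^ DIM('a)"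
   unfolding \<gamma>_def by simp
  also have "... = (sqrt (2 * pi) * sqrt (2 * pi)) ^ DIM('a)" by (rule power_mult_distrib[symmetric])
  finally show ?thesis by simp
 qed
 \<comment> \<open>Fubini moves the mollifier from the measure onto \<open>g\<close>, and the
   substitution x = w + eps v frees the kernel of \<open>eps\<close>.\<close>
 have swap: "(LINT x|lborel. g x * f eps x) = (\<integral>w. (LINT v|lborel. g (w + eps *\<^sub>R v) * \<gamma> v) \<partial>\<nu>)" if eps: "eps > 0" for eps
 proof -
  interpret P: pair_sigma_finite \<nu> "lborel :: 'a measure" ..
  let ?h = "%w x. g x * G eps (w - x)"
  let ?c = "(sqrt (2 * pi) / eps) ^ DIM('a)"
  have hb: "\<bar>?h w x\<bar> <= ?c * \<bar>g x\<bar>" for w x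
   using G_nonneg[OF eps] G_le[OF eps] by (simp add: abs_mult mult.commute mult_left_mono)
  have hi: "integrable lborel (?h w)" for w
  proof (rule Bochner_Integration.integrable_bound[OF integrable_mult_right[OF integrable_abs[OF gi], of ?c]])
   show "AE x in lborel. norm (?h w x) <= norm (?c * \<bar>g x\<bar>)"
    using hb eps by (intro AE_I2) (simp add: abs_mult)
  qed measurable
  have int: "integrable (\<nu> \<Otimes>\<^sub>M lborel) (case_prod ?h)"
  proof (rule P.Fubini_integrable)
   show "case_prod ?h \<in> borel_measurable (\<nu> \<Otimes>\<^sub>M lborel)" by measurable
   show "integrable \<nu> (%w. \<integral>x. norm (case (w, x) of (w, x) => ?h w x) \<partial>lborel)"
   proof (rule integrable_const_bound[where B="\<integral>x. ?c * \<bar>g x\<bar> \<partial>lborel"])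
    show "AE w in \<nu>. norm (LINT x|lborel. norm (case (w, x) of (w, x) => ?h w x)) <= (LINT x|lborel. ?c * \<bar>g x\<bar>)"
    proof (intro AE_I2)
     fix w
     have "(LINT x|lborel. norm (?h w x)) <= (LINT x|lborel. ?c * \<bar>g x\<bar>)"
      by (rule integral_mono[OF integrable_norm[OF hi] integrable_mult_right[OF integrable_abs[OF gi]]])
       (simp only: real_norm_def hb)
     thus "norm (LINT x|lborel. norm (case (w, x) of (w, x) => ?h w x)) <= (LINT x|lborel. ?c * \<bar>g x\<bar>)"
      by (simp add: integral_nonneg_AE abs_of_nonneg)
    qed
   qed measurable
   show "AE w in \<nu>. integrable lborel (%x. case (w, x) of (w, x) => ?h w x)" using hi by simp
  qed
  have "(LINT x|lborel. g x * f eps x) = (\<integral>x. (\<integral>w. ?h w x \<partial>\<nu>) \<partial>lborel)" by (simp add: f_def)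
  also have "... = (\<integral>w. (LINT x|lborel. ?h w x) \<partial>\<nu>)" by (rule P.Fubini_integral[OF int])
  also have "... = (\<integral>w. (LINT v|lborel. g (w + eps *\<^sub>R v) * \<gamma> v) \<partial>\<nu>)"
  proof (rule Bochner_Integration.integral_cong[OF refl])
   fix w
   have "(LINT x|lborel. ?h w x) = (LINT x|lborel. ?h w (x + w))"
    by (rule lborel_integral_translate[symmetric]) measurable
   also have "... = eps ^ DIM('a) *\<^sub>R (LINT v|lborel. ?h w (eps *\<^sub>R v + w))"
    by (rule lborel_integral_scaleR[OF eps]) measurable
   also have "... = (LINT v|lborel. eps ^ DIM('a) * ?h w (eps *\<^sub>R v + w))" by simp
   also have "... = (LINT v|lborel. g (w + eps *\<^sub>R v) * \<gamma> v)"
    using eps by (intro Bochner_Integration.integral_cong refl)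
     (simp add: G_def \<gamma>_def power_divide power_mult_distrib add.commute)
   finally show "(LINT x|lborel. ?h w x) = (LINT v|lborel. g (w + eps *\<^sub>R v) * \<gamma> v)" .
  qed
  finally show ?thesis .
 qed
 have inner: "(%n. \<integral>v. g (w + (1 / real (Suc n)) *\<^sub>R v) * \<gamma> v \<partial>lborel) \<longlonglongrightarrow> (LINT v|lborel. g w * \<gamma> v)" for w
 proof (rule integral_dominated_convergence[where w=\<gamma>])
  show "AE v in lborel. (%n. g (w + (1 / real (Suc n)) *\<^sub>R v) * \<gamma> v) \<longlonglongrightarrow> g w * \<gamma> v"
  proof (intro AE_I2 tendsto_mult tendsto_const)
   fix v
   have "(%n. w + (1 / real (Suc n)) *\<^sub>R v) \<longlonglongrightarrow> w + 0 *\<^sub>R v"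
    by (intro tendsto_intros LIMSEQ_Suc[OF lim_1_over_n])
   moreover have "isCont g w" using gc by (simp add: continuous_on_eq_continuous_at)
   ultimately show "(%n. g (w + (1 / real (Suc n)) *\<^sub>R v)) \<longlonglongrightarrow> g w"
    using isCont_tendsto_compose[of w g] by simp
  qed
  show "AE v in lborel. norm (g (w + (1 / real (Suc n)) *\<^sub>R v) * \<gamma> v) <= \<gamma> v" for n
   using gb \<gamma>0 by (intro AE_I2) (simp add: abs_mult mult_left_le_one_le)
 qed (use \<gamma>i in measurable)
 have "(%n. \<integral>w. (LINT v|lborel. g (w + (1 / real (Suc n)) *\<^sub>R v) * \<gamma> v) \<partial>\<nu>) \<longlonglongrightarrow> (\<integral>w. (LINT v|lborel. g w * \<gamma> v) \<partial>\<nu>)"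
 proof (rule integral_dominated_convergence[where w="%_. \<integral>v. \<gamma> v \<partial>lborel"])
  show "AE w in \<nu>. norm (LINT v|lborel. g (w + (1 / real (Suc n)) *\<^sub>R v) * \<gamma> v) <= (LINT v|lborel. \<gamma> v)" for n
  proof (intro AE_I2)
   fix w
   have "integrable lborel (%v. g (w + (1 / real (Suc n)) *\<^sub>R v) * \<gamma> v)"
   proof (rule Bochner_Integration.integrable_bound[OF \<gamma>i])
    show "AE v in lborel. norm (g (w + (1 / real (Suc n)) *\<^sub>R v) * \<gamma> v) <= norm (\<gamma> v)"
     using gb \<gamma>0 by (intro AE_I2) (simp add: abs_mult mult_left_le_one_le)
   qed measurable
   thus "norm (LINT v|lborel. g (w + (1 / real (Suc n)) *\<^sub>R v) * \<gamma> v) <= (LINT v|lborel. \<gamma> v)"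
    using gb \<gamma>0 \<gamma>i by (intro order_trans[OF integral_norm_bound] integral_mono integrable_norm)
     (auto simp: abs_mult mult_left_le_one_le)
  qed
 qed (use inner in auto)
 hence A: "(%n. \<integral>x. g x * f (1 / real (Suc n)) x \<partial>lborel) \<longlonglongrightarrow> (2 * pi) ^ DIM('a) * (\<integral>w. g w \<partial>\<nu>)"
  by (simp add: swap \<gamma>int mult.commute)
 have B: "(%n. \<integral>x. g x * f (1 / real (Suc n)) x \<partial>lborel) \<longlonglongrightarrow> (LINT x|lborel. g x * Re (F x))"
 proof (rule integral_dominated_convergence[where w="%x. (LINT t|lborel. norm (\<psi> t)) * \<bar>g x\<bar>"])
  show "(%x. g x * f (1 / real (Suc n)) x) \<in> borel_measurable lborel" for n
   using f_measurable[of "1 / real (Suc n)"] by measurable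
  show "AE x in lborel. norm (g x * f (1 / real (Suc n)) x) <= (LINT t|lborel. norm (\<psi> t)) * \<bar>g x\<bar>" for n
   using f_bound[of "1 / real (Suc n)"] by (intro AE_I2) (simp add: abs_mult mult.commute mult_left_mono)
  show "integrable lborel (%x. (LINT t|lborel. norm (\<psi> t)) * \<bar>g x\<bar>)"
   by (intro integrable_mult_right integrable_abs gi)
  show "AE x in lborel. (%n. g x * f (1 / real (Suc n)) x) \<longlonglongrightarrow> g x * Re (F x)"
   by (intro AE_I2 tendsto_mult tendsto_const f_lim_Re)
 qed measurable
 from LIMSEQ_unique[OF B A] show ?thesis .
qed

text \<open>The indicator of an open box is the limit of the continuous functions min 1 (n times the
  distance to the complement), to which \<open>test_function\<close> applies.\<close>

lemma box_measure:
 "(LINT x|lborel. indicator (box a b) x * Re (F x)) = (2 * pi) ^ DIM('a) * measure \<nu> (box a b)"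
proof -
 \<comment> \<open>The distance to the empty set is 0 by convention, so the approximation requires a
   nonempty complement.\<close>
 have ne: "- box a b ~= {}"
 proof
  assume "- box a b = {}"
  hence "- (- box a b) = - {}" by (rule arg_cong)
  hence "box a b = UNIV" by (simp only: double_complement Compl_empty_eq)
  thus False using bounded_box[of a b] by simp
 qed
 define g where "g n x = min 1 (real n * infdist x (- box a b))" for n x
 have gc: "continuous_on UNIV (g n)" for n unfolding g_def by (intro continuous_intros)
 have g01: "0 <= g n x" "g n x <= 1" for n x by (auto simp: g_def infdist_nonneg)
 have g0: "g n x = 0" if "x \<notin> box a b" for n x using that by (simp add: g_def infdist_zero)
 have g_le: "g n x <= indicator (box a b) x" for n x using g01[of n x] g0[of x n] by (auto simp: indicator_def)
 have ibox: "integrable lborel (indicator (box a b) :: 'a => real)"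
  using emeasure_lborel_box_finite[of a b] by (intro integrable_real_indicator) auto
 have [measurable]: "g n \<in> borel_measurable borel" for n by (rule borel_measurable_continuous_onI[OF gc])
 have lim: "(%n. g n x) \<longlonglongrightarrow> indicator (box a b) x" for x
 proof (cases "x \<in> box a b")
  case True
  have "infdist x (- box a b) > 0"
   using True ne in_closed_iff_infdist_zero[of "- box a b" x] infdist_nonneg[of x "- box a b"] open_box[of a b]
   by (fastforce simp: closed_Compl less_le)
  then obtain N :: nat where N: "1 < real N * infdist x (- box a b)"
   using ex_less_of_nat_mult[of "infdist x (- box a b)" 1] by auto
  have "\<forall>\<^sub>F n in sequentially. g n x = indicator (box a b) x"
   unfolding eventually_sequentially
  proof (intro exI[of _ N] allI impI)
   fix n assume "N <= n"
   hence "real N * infdist x (- box a b) <= real n * infdist x (- box a b)"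
    by (intro mult_right_mono infdist_nonneg) auto
   thus "g n x = indicator (box a b) x" using N True by (simp add: g_def)
  qed
  thus ?thesis by (rule tendsto_eventually)
 qed (simp add: g0)
 have gi: "integrable lborel (g n)" for n
 proof (rule Bochner_Integration.integrable_bound[OF ibox])
  show "AE x in lborel. norm (g n x) <= norm (indicator (box a b) x :: real)" using g01 g_le by (intro AE_I2) (simp add: abs_of_nonneg)
 qed measurable
 have "(%n. \<integral>x. g n x * Re (F x) \<partial>lborel) \<longlonglongrightarrow> (LINT x|lborel. indicator (box a b) x * Re (F x))"
 proof (rule integral_dominated_convergence[where w="%x. (LINT t|lborel. norm (\<psi> t)) * indicator (box a b) x"])
  show "AE x in lborel. norm (g n x * Re (F x)) <= (LINT t|lborel. norm (\<psi> t)) * indicator (box a b) x" for n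
  proof (intro AE_I2)
   fix x
   have "norm (g n x * Re (F x)) = \<bar>Re (F x)\<bar> * g n x" using g01[of n x] by (simp add: abs_mult)
   also have "... <= (LINT t|lborel. norm (\<psi> t)) * indicator (box a b) x"
    using order_trans[OF abs_Re_le_cmod F_bound] g01[of n x] g_le[of n x]
    by (intro mult_mono) (auto intro: integral_nonneg_AE)
   finally show "norm (g n x * Re (F x)) <= (LINT t|lborel. norm (\<psi> t)) * indicator (box a b) x" .
  qed
  show "integrable lborel (%x. (LINT t|lborel. norm (\<psi> t)) * indicator (box a b) x)" by (intro integrable_mult_right ibox)
 qed (auto intro!: tendsto_mult lim)
 moreover have "(%n. \<integral>x. g n x * Re (F x) \<partial>lborel) \<longlonglongrightarrow> (2 * pi) ^ DIM('a) * measure \<nu> (box a b)"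
 proof -
  have "(%n. \<integral>w. g n w \<partial>\<nu>) \<longlonglongrightarrow> (\<integral>w. indicator (box a b) w \<partial>\<nu>)"
   by (rule integral_dominated_convergence[where w="%_. 1"]) (use lim g01 in auto)
  hence "(%n. (2 * pi) ^ DIM('a) * (\<integral>w. g n w \<partial>\<nu>)) \<longlonglongrightarrow> (2 * pi) ^ DIM('a) * (\<integral>w. indicator (box a b) w \<partial>\<nu>)"
   by (intro tendsto_mult tendsto_const)
  thus ?thesis using g01 by (simp add: test_function[OF gc _ gi] space_\<nu>)
 qed
 ultimately show ?thesis by (rule LIMSEQ_unique)
qed

theorem inversion: "\<nu> = density lborel (%x. ennreal (Re (F x) / (2 * pi) ^ DIM('a)))"
proof (rule measure_eqI_generator_eq[where \<Omega>=UNIV and E="range (%(a, b). box a b)" and A="%n::nat. box (- real n *\<^sub>R One) (real n *\<^sub>R One)"])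
 show "Int_stable (range (%(a, b). box a b :: 'a set))"
  by (auto simp: Int_stable_def box_Int_box)
 show "sets \<nu> = sigma_sets UNIV (range (%(a, b). box a b))"
  unfolding sets_\<nu> borel_eq_box by simp
 show "sets (density lborel (%x. ennreal (Re (F x) / (2 * pi) ^ DIM('a)))) = sigma_sets UNIV (range (%(a, b). box a b))"
  unfolding sets_density sets_lborel borel_eq_box by simp
 show "(\<Union>i::nat. box (- real i *\<^sub>R One) (real i *\<^sub>R One)) = (UNIV :: 'a set)"
  using UN_box_eq_UNIV by simp
 show "emeasure \<nu> (box (- real i *\<^sub>R One) (real i *\<^sub>R One)) ~= \<infinity>" for i :: nat
  using emeasure_finite by simp
 show "emeasure \<nu> X = emeasure (density lborel (%x. ennreal (Re (F x) / (2 * pi) ^ DIM('a)))) X"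
  if X: "X \<in> range (%(a, b). box a b :: 'a set)" for X
 proof -
  from X obtain a b where X: "X = box a b" by auto
  have i: "integrable lborel (%x. indicator (box a b) x * Re (F x))"
  proof (rule Bochner_Integration.integrable_bound[where f="%x. (LINT t|lborel. norm (\<psi> t)) * indicator (box a b) x"])
   show "integrable lborel (%x::'a. (LINT t|lborel. norm (\<psi> t)) * indicator (box a b) x)"
    using emeasure_lborel_box_finite[of a b] by (intro integrable_mult_right integrable_real_indicator) auto
   show "AE x in lborel. norm (indicator (box a b) x * Re (F x)) <= norm ((LINT t|lborel. norm (\<psi> t)) * indicator (box a b) x)"
    using order_trans[OF abs_Re_le_cmod F_bound] order_trans[OF order_trans[OF abs_Re_le_cmod F_bound] abs_ge_self]
    by (intro AE_I2) (auto simp: indicator_def)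
  qed measurable
  have "emeasure (density lborel (%x. ennreal (Re (F x) / (2 * pi) ^ DIM('a)))) X
    = (\<integral>\<^sup>+x. ennreal (indicator (box a b) x * Re (F x) / (2 * pi) ^ DIM('a)) \<partial>lborel)"
   unfolding X by (subst emeasure_density) (auto intro!: nn_integral_cong simp: indicator_def)
  also have "... = ennreal (LINT x|lborel. indicator (box a b) x * Re (F x) / (2 * pi) ^ DIM('a))"
   using i F_nonneg by (intro nn_integral_eq_integral) (auto intro!: AE_I2 divide_nonneg_nonneg mult_nonneg_nonneg)
  also have "... = ennreal (measure \<nu> X)" by (simp add: box_measure X)
  finally show ?thesis by (simp add: emeasure_eq_measure)
 qed
qed auto

end

section \<open>Holomorphy of the moment generating function\<close>

text \<open>The complex derivative is read off from the second-order Taylor remainder of exp under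
  the integral; the exponential moment of \<open>W\<close> absorbs its square.\<close>

lemma exp_integral_has_field_derivative:
 fixes a W :: "'w => complex"
 assumes [measurable]: "a \<in> borel_measurable N" "W \<in> borel_measurable N"
  and \<tau>: "\<tau> > 0" and int: "integrable N (%om. norm (exp (a om)) * exp (\<tau> * norm (W om)))"
 shows "((%h. \<integral>om. exp (a om + h * W om) \<partial>N) has_field_derivative (\<integral>om. W om * exp (a om) \<partial>N)) (at 0)"
proof -
 have le1: "norm (W om) <= exp (\<tau> * norm (W om)) / \<tau>" for om
 proof -
  have "\<tau> * norm (W om) <= exp (\<tau> * norm (W om))" using exp_ge_add_one_self[of "\<tau> * norm (W om)"] by linarith
  thus ?thesis using \<tau> by (simp add: pos_le_divide_eq mult.commute)
 qed
 \<comment> \<open>Half of \<open>\<tau>\<close> pays for the increment \<open>h\<close>. The other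
   half, as the square of exp with exponent \<open>\<tau> / 4\<close>, pays for the square of
   \<open>W\<close> and yields the constant 16.\<close>
 have sq: "norm (W om) ^ 2 * exp (\<tau> / 2 * norm (W om)) <= 16 / \<tau>\<^sup>2 * exp (\<tau> * norm (W om))" for om
 proof -
  have "\<tau> / 4 * norm (W om) <= exp (\<tau> / 4 * norm (W om))" using exp_ge_add_one_self[of "\<tau> / 4 * norm (W om)"] by linarith
  hence "(\<tau> / 4 * norm (W om))\<^sup>2 <= (exp (\<tau> / 4 * norm (W om)))\<^sup>2" using \<tau> by (intro power_mono) auto
  also have "(exp (\<tau> / 4 * norm (W om)))\<^sup>2 = exp (\<tau> / 2 * norm (W om))" by (simp flip: exp_double)
  finally have "norm (W om) ^ 2 <= 16 / \<tau>\<^sup>2 * exp (\<tau> / 2 * norm (W om))"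
   using \<tau> by (simp add: power_mult_distrib power_divide field_simps)
  hence "norm (W om) ^ 2 * exp (\<tau> / 2 * norm (W om)) <= (16 / \<tau>\<^sup>2 * exp (\<tau> / 2 * norm (W om))) * exp (\<tau> / 2 * norm (W om))"
   by (rule mult_right_mono) simp
  also have "... = 16 / \<tau>\<^sup>2 * exp (\<tau> * norm (W om))" by (simp add: mult.assoc flip: exp_add)
  finally show ?thesis .
 qed
 have i0: "integrable N (%om. exp (a om + h * W om))" if h: "norm h <= \<tau>" for h
 proof (rule Bochner_Integration.integrable_bound[OF int])
  show "AE om in N. norm (exp (a om + h * W om)) <= norm (norm (exp (a om)) * exp (\<tau> * norm (W om)))"
  proof (intro AE_I2)
   fix om
   have "norm (exp (h * W om)) <= exp (norm (h * W om))" by (rule norm_exp)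
   also have "... <= exp (\<tau> * norm (W om))" using h by (simp add: norm_mult mult_right_mono)
   finally show "norm (exp (a om + h * W om)) <= norm (norm (exp (a om)) * exp (\<tau> * norm (W om)))"
    by (simp add: exp_add norm_mult mult_left_mono)
  qed
 qed measurable
 have i1: "integrable N (%om. W om * exp (a om))"
 proof (rule Bochner_Integration.integrable_bound[OF integrable_mult_right[OF int, of "1 / \<tau>"]])
  show "AE om in N. norm (W om * exp (a om)) <= norm (1 / \<tau> * (norm (exp (a om)) * exp (\<tau> * norm (W om))))"
  proof (intro AE_I2)
   fix om
   have "norm (W om) * norm (exp (a om)) <= (exp (\<tau> * norm (W om)) / \<tau>) * norm (exp (a om))"
    by (intro mult_right_mono le1) simp
   thus "norm (W om * exp (a om)) <= norm (1 / \<tau> * (norm (exp (a om)) * exp (\<tau> * norm (W om))))"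
    using \<tau> by (simp add: norm_mult abs_mult mult_ac)
  qed
 qed measurable
 let ?F = "%h. \<integral>om. exp (a om + h * W om) \<partial>N" and ?D = "\<integral>om. W om * exp (a om) \<partial>N"
 define B where "B = (\<integral>om. 16 / \<tau>\<^sup>2 * (norm (exp (a om)) * exp (\<tau> * norm (W om))) \<partial>N)"
 have est: "norm (?F h - ?F 0 - h * ?D) <= norm h ^ 2 * B" if h: "norm h <= \<tau> / 2" for h
 proof -
  have h': "norm h <= \<tau>" using h \<tau> by simp
  have "?F h - ?F 0 - h * ?D = (\<integral>om. exp (a om + h * W om) - exp (a om + 0 * W om) - h * (W om * exp (a om)) \<partial>N)"
   using i0[OF h'] i0[of 0] i1 \<tau> by simp
  also have "norm ... <= (\<integral>om. norm h ^ 2 * (16 / \<tau>\<^sup>2 * (norm (exp (a om)) * exp (\<tau> * norm (W om)))) \<partial>N)"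
  proof (rule order_trans[OF integral_norm_bound integral_mono])
   show "integrable N (%om. norm (exp (a om + h * W om) - exp (a om + 0 * W om) - h * (W om * exp (a om))))"
    using i0[OF h'] i0[of 0] i1 \<tau> by (intro integrable_norm Bochner_Integration.integrable_diff integrable_mult_right) auto
   show "integrable N (%om. norm h ^ 2 * (16 / \<tau>\<^sup>2 * (norm (exp (a om)) * exp (\<tau> * norm (W om)))))"
    by (intro integrable_mult_right int)
   fix om
   let ?w = "W om"
   have e: "exp (a om + h * ?w) - exp (a om + 0 * ?w) - h * (?w * exp (a om)) = exp (a om) * (exp (h * ?w) - (\<Sum>k\<le>1. (h * ?w) ^ k / fact k))"
    by (simp add: exp_add algebra_simps)
   have "norm (exp (h * ?w) - (\<Sum>k\<le>1. (h * ?w) ^ k / fact k)) <= exp \<bar>Re (h * ?w)\<bar> * norm (h * ?w) ^ Suc 1 / fact 1"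
    by (rule Taylor_exp)
   also have "... = norm h ^ 2 * (norm ?w ^ 2 * exp \<bar>Re (h * ?w)\<bar>)" by (simp add: norm_mult power_mult_distrib power2_eq_square mult_ac)
   also have "... <= norm h ^ 2 * (norm ?w ^ 2 * exp (\<tau> / 2 * norm ?w))"
   proof (intro mult_left_mono)
    have "\<bar>Re (h * ?w)\<bar> <= norm h * norm ?w" using abs_Re_le_cmod[of "h * ?w"] by (simp add: norm_mult)
    also have "... <= \<tau> / 2 * norm ?w" using h by (rule mult_right_mono) simp
    finally show "exp \<bar>Re (h * ?w)\<bar> <= exp (\<tau> / 2 * norm ?w)" by simp
   qed auto
   also have "... <= norm h ^ 2 * (16 / \<tau>\<^sup>2 * exp (\<tau> * norm ?w))" by (intro mult_left_mono sq) simp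
   finally have "norm (exp (h * ?w) - (\<Sum>k\<le>1. (h * ?w) ^ k / fact k)) <= norm h ^ 2 * (16 / \<tau>\<^sup>2 * exp (\<tau> * norm ?w))" .
   from mult_left_mono[OF this norm_ge_zero[of "exp (a om)"]]
   show "norm (exp (a om + h * ?w) - exp (a om + 0 * ?w) - h * (?w * exp (a om))) <= norm h ^ 2 * (16 / \<tau>\<^sup>2 * (norm (exp (a om)) * exp (\<tau> * norm ?w)))"
    unfolding e norm_mult by (simp only: mult_ac)
  qed
  also have "... = norm h ^ 2 * B" unfolding B_def by (rule integral_mult_right_zero)
  finally show ?thesis .
 qed
 show ?thesis
  unfolding has_field_derivative_iff
 proof (rule LIM_zero_cancel, rule Lim_null_comparison)
  show "\<forall>\<^sub>F h in at 0. norm ((?F h - ?F 0) / (h - 0) - ?D) <= norm h * B"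
   unfolding eventually_at
  proof (intro exI[of _ "\<tau> / 2"] conjI ballI impI)
   fix h :: complex assume "h ~= 0 & dist h 0 < \<tau> / 2"
   hence h: "h ~= 0" "norm h <= \<tau> / 2" by auto
   have "(?F h - ?F 0) / (h - 0) - ?D = (?F h - ?F 0 - h * ?D) / h" using h by (simp add: field_simps)
   also have "norm ... <= norm h ^ 2 * B / norm h" unfolding norm_divide by (intro divide_right_mono est h) simp
   also have "... = norm h * B" using h by (simp add: power2_eq_square)
   finally show "norm ((?F h - ?F 0) / (h - 0) - ?D) <= norm h * B" .
  qed (use \<tau> in simp)
  show "((%h::complex. norm h * B) \<longlongrightarrow> 0) (at 0)"
   using tendsto_mult_left_zero[OF tendsto_norm_zero[OF tendsto_ident_at[of "0::complex" UNIV]], of B] by simp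
 qed
qed

text \<open>Bilinear, without conjugation, so that it depends holomorphically on
  \<open>z\<close>.\<close>

definition zdot :: "complex ^ 'd => real ^ 'd => complex" where
 "zdot z y = (SUM j:UNIV. z $ j * of_real (y $ j))"

lemma zdot_add: "zdot (z + w) y = zdot z y + zdot w y"
 by (simp add: zdot_def sum.distrib distrib_right)

lemma zdot_scale: "zdot (t *s w) y = t * zdot w y"
 by (simp add: zdot_def sum_distrib_left mult_ac)

lemma Re_zdot: "Re (zdot z y) = Re_vec z \<bullet> y"
 by (simp add: zdot_def Re_vec_def inner_vec_def)

lemma norm_zdot_le: "norm (zdot z y) <= (SUM j:UNIV. norm (z $ j)) * norm y"
 unfolding zdot_def sum_distrib_right
 by (rule order_trans[OF norm_sum sum_mono]) (simp add: norm_mult component_le_norm_cart mult_left_mono)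

lemma continuous_on_zdot: "continuous_on UNIV (zdot z)"
 unfolding zdot_def[abs_def] by (intro continuous_intros)

lemma zdot_measurable [measurable]: "zdot z \<in> borel_measurable borel"
 by (rule borel_measurable_continuous_onI[OF continuous_on_zdot])

lemma Re_vec_add: "Re_vec (z + w) = Re_vec z + Re_vec w"
 by (simp add: Re_vec_def vec_eq_iff)

lemma Re_vec_cvec [simp]: "Re_vec (cvec s \<phi>) = s"
 by (simp add: Re_vec_def cvec_def vec_eq_iff)

text \<open>The largest coordinate of \<open>y\<close> is at least the norm divided by the
  dimension, and a shift along that axis with the matching sign picks it out. Finitely many
  exponential moments thus control exp of a multiple of the norm.\<close>

lemma exp_norm_le_sum:
 fixes y :: "real ^ 'd"
 assumes \<rho>: "\<rho> >= 0"
 shows "exp (s \<bullet> y + \<rho> / real CARD('d) * norm y) <= (SUM j:UNIV. exp ((s + axis j \<rho>) \<bullet> y) + exp ((s - axis j \<rho>) \<bullet> y))"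
proof -
 have fin: "finite (range (%j. \<bar>y $ j\<bar>))" by simp
 have "Max (range (%j. \<bar>y $ j\<bar>)) \<in> range (%j. \<bar>y $ j\<bar>)" by (rule Max_in[OF fin]) simp
 then obtain i where "Max (range (%j. \<bar>y $ j\<bar>)) = \<bar>y $ i\<bar>" by (elim imageE)
 hence i: "\<bar>y $ j\<bar> <= \<bar>y $ i\<bar>" for j
  using Max_ge[OF fin rangeI[of "%j. \<bar>y $ j\<bar>" j]] by simp
 have "norm y <= (SUM j:UNIV. \<bar>y $ j\<bar>)" by (rule norm_le_l1_cart)
 also have "... <= of_nat (card (UNIV :: 'd set)) * \<bar>y $ i\<bar>" using i by (intro sum_bounded_above) auto
 finally have "\<rho> / real CARD('d) * norm y <= \<rho> / real CARD('d) * (real CARD('d) * \<bar>y $ i\<bar>)"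
  using \<rho> by (intro mult_left_mono) auto
 hence "\<rho> / real CARD('d) * norm y <= \<rho> * \<bar>y $ i\<bar>" by simp
 hence "exp (s \<bullet> y + \<rho> / real CARD('d) * norm y) <= exp (s \<bullet> y + \<rho> * \<bar>y $ i\<bar>)" by simp
 also have "... <= exp ((s + axis i \<rho>) \<bullet> y) + exp ((s - axis i \<rho>) \<bullet> y)"
  by (cases "y $ i >= 0") (auto simp: inner_add_left inner_diff_left inner_axis' add_increasing add_increasing2)
 also have "... <= (SUM j:UNIV. exp ((s + axis j \<rho>) \<bullet> y) + exp ((s - axis j \<rho>) \<bullet> y))"
  by (rule member_le_sum) (auto intro: add_nonneg_nonneg)
 finally show ?thesis .
qed

lemma integrable_exp_ball:
 fixes Y :: "'w => real ^ 'd"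
 assumes [measurable]: "Y \<in> borel_measurable N" and \<rho>: "\<rho> >= 0"
  and int: "!!s'. s' \<in> cball s \<rho> ==> integrable N (%om. exp (s' \<bullet> Y om))"
 shows "integrable N (%om. exp (s \<bullet> Y om + \<rho> / real CARD('d) * norm (Y om)))"
proof (rule Bochner_Integration.integrable_bound)
 have "norm (axis j \<rho> :: real ^ 'd) = \<rho>" for j
 proof -
  have "axis j \<rho> = \<rho> *\<^sub>R (axis j 1 :: real ^ 'd)" by (simp add: axis_def vec_eq_iff)
  thus ?thesis using \<rho> by simp
 qed
 thus "integrable N (%om. SUM j:UNIV. exp ((s + axis j \<rho>) \<bullet> Y om) + exp ((s - axis j \<rho>) \<bullet> Y om))"
  by (intro Bochner_Integration.integrable_sum Bochner_Integration.integrable_add int) (auto simp: dist_norm)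
 show "AE om in N. norm (exp (s \<bullet> Y om + \<rho> / real CARD('d) * norm (Y om)))
   <= norm (SUM j:UNIV. exp ((s + axis j \<rho>) \<bullet> Y om) + exp ((s - axis j \<rho>) \<bullet> Y om))"
  using exp_norm_le_sum[OF \<rho>] by (intro AE_I2) (auto intro: order_trans[OF _ abs_ge_self])
qed measurable

lemma exp_zdot_slice_derivative:
 fixes Y :: "'w => real ^ 'd"
 assumes Y[measurable]: "Y \<in> borel_measurable N" and \<rho>: "\<rho> > 0"
  and int: "!!s'. s' \<in> cball (Re_vec z) \<rho> ==> integrable N (%om. exp (s' \<bullet> Y om))"
 shows "EX D. ((%h. \<integral>om. exp (zdot (z + h *s w) (Y om)) \<partial>N) has_field_derivative D) (at 0)"
proof -
 \<comment> \<open>The summand 1 keeps \<open>l\<close> positive when \<open>w\<close> is 0.\<close>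
 define l where "l = 1 + (SUM j:UNIV. norm (w $ j))"
 have l: "l > 0" by (simp add: l_def add_pos_nonneg sum_nonneg)
 define \<tau> where "\<tau> = \<rho> / real CARD('d) / l"
 have \<tau>: "\<tau> > 0" using \<rho> l by (simp add: \<tau>_def)
 have "integrable N (%om. norm (exp (zdot z (Y om))) * exp (\<tau> * norm (zdot w (Y om))))"
 proof (rule Bochner_Integration.integrable_bound[OF integrable_exp_ball[OF Y less_imp_le[OF \<rho>] int]])
  show "AE om in N. norm (norm (exp (zdot z (Y om))) * exp (\<tau> * norm (zdot w (Y om))))
    <= norm (exp (Re_vec z \<bullet> Y om + \<rho> / real CARD('d) * norm (Y om)))"
  proof (intro AE_I2)
   fix om
   have "norm (zdot w (Y om)) <= l * norm (Y om)"
    by (rule order_trans[OF norm_zdot_le]) (simp add: l_def mult_right_mono)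
   hence "\<tau> * norm (zdot w (Y om)) <= \<tau> * (l * norm (Y om))" using \<tau> by (intro mult_left_mono) auto
   also have "... = \<rho> / real CARD('d) * norm (Y om)" using l by (simp add: \<tau>_def)
   finally have "exp (Re_vec z \<bullet> Y om) * exp (\<tau> * norm (zdot w (Y om))) <= exp (Re_vec z \<bullet> Y om) * exp (\<rho> / real CARD('d) * norm (Y om))"
    by (intro mult_left_mono) auto
   thus "norm (norm (exp (zdot z (Y om))) * exp (\<tau> * norm (zdot w (Y om))))
    <= norm (exp (Re_vec z \<bullet> Y om + \<rho> / real CARD('d) * norm (Y om)))"
    by (simp add: Re_zdot exp_add abs_mult)
  qed
 qed measurable
 from exp_integral_has_field_derivative[OF _ _ \<tau> this]
 have "((%h. \<integral>om. exp (zdot z (Y om) + h * zdot w (Y om)) \<partial>N) has_field_derivative (\<integral>om. zdot w (Y om) * exp (zdot z (Y om)) \<partial>N)) (at 0)"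
  by measurable
 thus ?thesis by (auto simp: zdot_add zdot_scale)
qed

text \<open>The difference quotients in the real parameter converge locally uniformly.\<close>

lemma parameter_derivative_holomorphic:
 fixes F D :: "complex => real => complex"
 assumes S: "open S" and d: "d > 0"
  and hol: "!!h. \<bar>h\<bar> < d ==> (%t. F t h) holomorphic_on S"
  and der: "!!t h. t \<in> S ==> \<bar>h\<bar> < d ==> ((%h. F t h) has_vector_derivative D t h) (at h)"
  and cont: "continuous_on (S \<times> {-d<..<d}) (%(t, h). D t h)"
 shows "(%t. D t 0) holomorphic_on S"
proof -
 \<comment> \<open>The index \<open>n + 2\<close> keeps the increments in the compact interval up to
   \<open>d / 2\<close>, where the derivative is uniformly continuous.\<close>
 define q where "q n t = (F t (d / real (n + 2)) - F t 0) / of_real (d / real (n + 2))" for n t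
 have hn: "\<bar>d / real (n + 2)\<bar> < d" "d / real (n + 2) > 0" for n
 proof -
  have "d * 1 < d * real (n + 2)" using d by (intro mult_strict_left_mono) auto
  thus "\<bar>d / real (n + 2)\<bar> < d" using d by (simp add: divide_less_eq)
  show "d / real (n + 2) > 0" using d by simp
 qed
 show ?thesis
 proof (rule holomorphic_uniform_sequence[OF S])
  show "q n holomorphic_on S" for n
   unfolding q_def using hn[of n] d by (intro holomorphic_intros hol) auto
  fix x assume "x \<in> S"
  then obtain e where e: "e > 0" "cball x e \<subseteq> S" using S open_contains_cball by blast
  have "uniform_limit (cball x e) q (%t. D t 0) sequentially"
  proof (rule uniform_limitI)
   fix eps :: real assume eps: "eps > 0"
   have "compact (cball x e \<times> {-d/2..d/2})" by (intro compact_Times compact_cball compact_Icc)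
   moreover have "continuous_on (cball x e \<times> {-d/2..d/2}) (%(t, h). D t h)"
    using e d by (intro continuous_on_subset[OF cont]) auto
   ultimately have "uniformly_continuous_on (cball x e \<times> {-d/2..d/2}) (%(t, h). D t h)"
    by (rule compact_uniformly_continuous[rotated])
   then obtain \<eta> where \<eta>: "\<eta> > 0" and uc: "!!p p'. p \<in> cball x e \<times> {-d/2..d/2} ==> p' \<in> cball x e \<times> {-d/2..d/2} ==>
     dist p' p < \<eta> ==> dist (case p' of (t, h) => D t h) (case p of (t, h) => D t h) < eps / 2"
    unfolding uniformly_continuous_on_def using eps by (meson half_gt_zero)
   have "(%n. d * (1 / real (n + 2))) \<longlonglongrightarrow> d * 0"
    by (intro tendsto_mult tendsto_const LIMSEQ_ignore_initial_segment[OF lim_1_over_n])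
   hence "\<forall>\<^sub>F n in sequentially. d / real (n + 2) < \<eta>"
    using \<eta> by (intro order_tendstoD(2)[of _ "d * 0"]) auto
   thus "\<forall>\<^sub>F n in sequentially. ALL t:cball x e. dist (q n t) (D t 0) < eps"
   proof eventually_elim
    case (elim n)
    show ?case
    proof
     fix t assume t: "t \<in> cball x e"
     define h where "h = d / real (n + 2)"
     have h: "h > 0" "h <= d / 2" "h < \<eta>" using d elim by (auto simp: h_def field_simps)
     have "norm (F t h - F t 0 - (h - 0) *\<^sub>R D t 0) <= norm (h - 0) * (eps / 2)"
     proof (rule vector_differentiable_bound_linearization[of "{0..h}"])
      fix s assume s: "s \<in> {0..h}"
      show "((%h. F t h) has_vector_derivative D t s) (at s within {0..h})"
       using s h d t e by (intro has_vector_derivative_at_within[OF der]) auto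
      show "norm (D t s - D t 0) <= eps / 2"
       using uc[of "(t, 0)" "(t, s)"] s h d t by (auto simp: dist_norm dist_Pair_Pair)
     qed (use h in \<open>auto simp: closed_segment_eq_real_ivl\<close>)
     moreover have "q n t - D t 0 = (F t h - F t 0 - (h - 0) *\<^sub>R D t 0) / of_real h"
     proof -
      have "q n t = (F t h - F t 0) / of_real h" unfolding q_def h_def ..
      thus ?thesis using h by (simp add: scaleR_conv_of_real diff_divide_distrib)
     qed
     ultimately have "norm (q n t - D t 0) <= h * (eps / 2) / h"
      using h by (simp add: norm_divide pos_divide_le_eq mult.commute)
     thus "dist (q n t) (D t 0) < eps" using h eps by (simp add: dist_norm)
    qed
   qed
  qed
  thus "EX e>0. cball x e \<subseteq> S & uniform_limit (cball x e) q (%t. D t 0) sequentially" using e by blast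
 qed
qed

text \<open>For \<open>R\<close> at least 2 this is the Taylor bound of order one; for smaller
  \<open>R\<close> the trivial bound \<open>2 * B\<close> is already below \<open>4 * B / R\<close>.
  Since \<open>R\<close> may be less than 1, the value at 1 has its own bound.\<close>

lemma holomorphic_segment_lipschitz:
 fixes F :: "complex => complex"
 assumes hol: "F holomorphic_on ball 0 R" and R: "R > 1 / 2" and B: "!!t. norm t < R ==> norm (F t) <= B"
  and B1: "norm (F 1) <= B"
 shows "norm (F 1 - F 0) <= 4 * B / R"
proof -
 have B0: "B >= 0" using order_trans[OF norm_ge_zero B1] .
 show ?thesis
 proof (cases "R >= 2")
  case True
  have "norm (F 1 - (\<Sum>k<1. (deriv ^^ k) F 0 / fact k * 1 ^ k)) <= 2 * B * (norm (1::complex) / R) ^ 1"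
   using True by (intro holomorphic_taylor_bound[OF hol _ B]) auto
  hence "norm (F 1 - F 0) <= 2 * B / R" by simp
  also have "... <= 4 * B / R" using B0 R by (intro divide_right_mono) auto
  finally show ?thesis .
 next
  case False
  have "norm (F 1 - F 0) <= B + B" using B1 B[of 0] R by (intro norm_triangle_le_diff add_mono) auto
  also have "... <= 4 * B / R" using False R B0 by (simp add: field_simps mult_left_mono)
  finally show ?thesis .
 qed
qed

section \<open>The cumulant generating function\<close>

text \<open>The sum type indexes tilt and parameter coordinates together, so that both are handled
  by one calculus.\<close>

definition dir :: "'d + 'p => ('a::real_normed_field ^ 'd) \<times> (real ^ 'p)" where
 "dir x = (case x of Inl j => s_dir j | Inr i => th_dir i)"

lemma dir_simps [simp]: "dir (Inl j) = s_dir j" "dir (Inr i) = th_dir i"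
 by (simp_all add: dir_def)

lemma inner_dir [simp]: "v \<bullet> dir (Inl j) = fst v $ j" "v \<bullet> dir (Inr i) = snd v $ i"
 by (cases v; simp add: s_dir_def th_dir_def inner_axis)+

lemma inner_s_th_dir [simp]: "v \<bullet> s_dir j = fst v $ j" "v \<bullet> th_dir i = snd v $ i"
 using inner_dir[of v] by simp_all

lemma bij_dir: "bij_betw (dir :: 'd + 'p => (real ^ 'd) \<times> (real ^ 'p)) UNIV Basis"
proof (rule bij_betwI')
 fix x y :: "'d + 'p"
 show "(dir x :: (real ^ 'd) \<times> (real ^ 'p)) = dir y \<longleftrightarrow> x = y"
  by (cases x; cases y) (auto simp: s_dir_def th_dir_def axis_eq_axis axis_eq_0_iff)
 show "(dir x :: (real ^ 'd) \<times> (real ^ 'p)) \<in> Basis"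
  by (cases x) (auto simp: s_dir_def th_dir_def Basis_prod_def Basis_vec_def)
 fix b :: "(real ^ 'd) \<times> (real ^ 'p)" assume "b \<in> Basis"
 then consider j where "b = (axis j 1, 0)" | i where "b = (0, axis i 1)"
  by (auto simp: Basis_prod_def Basis_vec_def)
 thus "EX x:UNIV. b = dir x"
 proof cases
  case (1 j) thus ?thesis by (intro bexI[of _ "Inl j"]) (auto simp: s_dir_def)
 next
  case (2 i) thus ?thesis by (intro bexI[of _ "Inr i"]) (auto simp: th_dir_def)
 qed
qed

lemma sum_Basis_dir:
 "(SUM b:(Basis :: ((real ^ 'd) \<times> (real ^ 'p)) set). h b) = (SUM x:UNIV. h (dir x))"
 by (rule sum.reindex_bij_betw[OF bij_dir, symmetric])

lemma sum_UNIV_Plus: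
 "(SUM x:(UNIV :: ('d::finite + 'p::finite) set). h x) = (SUM j:UNIV. h (Inl j)) + (SUM i:UNIV. h (Inr i))"
 unfolding UNIV_Plus_UNIV[symmetric] by (subst sum.Plus) auto

lemma partial_works:
 "partial_exists v G q ==> ((%t. G (q + t *\<^sub>R v)) has_vector_derivative partial v G q) (at 0)"
 unfolding partial_exists_def partial_def by (simp add: vector_derivative_works)

lemma partial_eqI:
 "((%t. G (q + t *\<^sub>R v)) has_vector_derivative D) (at 0) ==> partial v G q = D"
 unfolding partial_def by (rule vector_derivative_at)

lemma eventually_line_in_open:
 fixes q v :: "'a::real_normed_vector"
 assumes "open A" "q \<in> A"
 shows "\<forall>\<^sub>F t in nhds (0::real). q + t *\<^sub>R v \<in> A"
proof -
 have "((%t::real. q + t *\<^sub>R v) \<longlongrightarrow> q + 0 *\<^sub>R v) (nhds 0)" by (intro tendsto_intros filterlim_ident)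
 thus ?thesis using assms by (intro topological_tendstoD) auto
qed

lemma has_real_derivative_line_cong:
 fixes f g :: "'a::real_normed_vector => real"
 assumes "open A" "q \<in> A" "!!x. x \<in> A ==> f x = g x"
 shows "((%t. f (q + t *\<^sub>R v)) has_real_derivative D) (at 0) \<longleftrightarrow> ((%t. g (q + t *\<^sub>R v)) has_real_derivative D) (at 0)"
proof (rule DERIV_cong_ev)
 show "\<forall>\<^sub>F t in nhds 0. f (q + t *\<^sub>R v) = g (q + t *\<^sub>R v)"
  using eventually_line_in_open[OF assms(1,2), of v] by eventually_elim (use assms(3) in auto)
qed auto

section \<open>Smoothness of the moment and cumulant generating functions\<close>

locale cgf_model =
 fixes R :: "(real ^ 'p) set" and P :: "real ^ 'p => 'w measure" and Y :: "real ^ 'p => 'w => real ^ 'd"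
 assumes R: "open R"
  and prob: "!!th. th \<in> R ==> prob_space (P th)"
  and Y_meas: "!!th. th \<in> R ==> Y th \<in> borel_measurable (P th)"
  and decay: "decay_condition R P Y" and growth: "growth_condition R P Y"
begin

abbreviation S where "S \<equiv> interior (S_dom R P Y)"
abbreviation CD where "CD \<equiv> complex_dom R P Y"
abbreviation M where "M \<equiv> M0 P Y"

definition Mr :: "(real ^ 'd) \<times> (real ^ 'p) => real" where
 "Mr q = (\<integral>om. exp (fst q \<bullet> Y (snd q) om) \<partial>P (snd q))"

definition emb :: "(real ^ 'd) \<times> (real ^ 'p) => (complex ^ 'd) \<times> (real ^ 'p)" where
 "emb q = (cvec (fst q) 0, snd q)"

lemma in_CD_iff: "(z, th) \<in> CD \<longleftrightarrow> (Re_vec z, th) \<in> S"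
 by (simp add: complex_dom_def)

lemma emb_in_CD: "emb q \<in> CD \<longleftrightarrow> q \<in> S"
 by (simp add: emb_def in_CD_iff)

lemma emb_add: "emb (q + t *\<^sub>R dir x) = emb q + t *\<^sub>R dir x"
 by (cases q; cases x) (auto simp: emb_def s_dir_def th_dir_def cvec_def vec_eq_iff axis_def complex_eq_iff)

lemma open_S: "open S" by simp

lemma continuous_on_Re_vec: "continuous_on UNIV (Re_vec :: complex ^ 'd => _)"
 unfolding Re_vec_def[abs_def] by (intro continuous_intros)

lemma open_CD: "open CD"
proof -
 have "continuous_on UNIV (%p :: (complex ^ 'd) \<times> (real ^ 'p). (Re_vec (fst p), snd p))"
  by (intro continuous_on_Pair continuous_on_compose2[OF continuous_on_Re_vec] continuous_on_fst continuous_on_snd continuous_on_id) auto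
 hence "open ((%p :: (complex ^ 'd) \<times> (real ^ 'p). (Re_vec (fst p), snd p)) -` S)"
  by (intro open_vimage) auto
 moreover have "(%p :: (complex ^ 'd) \<times> (real ^ 'p). (Re_vec (fst p), snd p)) -` S = CD"
  by (auto simp: complex_dom_def)
 ultimately show ?thesis by simp
qed

lemma S_D:
 assumes "(s, th) \<in> S"
 shows "th \<in> R" "integrable (P th) (%om. exp (s \<bullet> Y th om))"
proof -
 have 1: "(s, th) \<in> S_dom R P Y" using assms interior_subset by blast
 thus th: "th \<in> R" by (simp add: S_dom_def)
 note [measurable] = Y_meas[OF th]
 show "integrable (P th) (%om. exp (s \<bullet> Y th om))"
  using 1 by (intro integrableI_nonneg) (auto simp: S_dom_def S_at_def)
qed

lemma M_eq: "M (z, th) = (\<integral>om. exp (zdot z (Y th om)) \<partial>P th)"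
 by (simp add: M0_def zdot_def)

lemma zdot_real: "zdot (cvec s 0) y = of_real (s \<bullet> y)"
 by (simp add: zdot_def cvec_def inner_vec_def complex_of_real_def[symmetric])

lemma M_emb: "M (emb q) = of_real (Mr q)"
 unfolding emb_def M_eq zdot_real Mr_def by (simp only: exp_of_real integral_complex_of_real)

lemma Mr_pos: assumes "q \<in> S" shows "Mr q > 0"
proof -
 obtain s th where q: "q = (s, th)" by (cases q)
 interpret prob_space "P th" using S_D(1) assms q by (intro prob) auto
 have int: "integrable (P th) (%om. exp (s \<bullet> Y th om))" using S_D(2) assms q by auto
 have ne: "(\<integral>om. exp (s \<bullet> Y th om) \<partial>P th) ~= 0"
 proof
  assume "(\<integral>om. exp (s \<bullet> Y th om) \<partial>P th) = 0"
  hence "AE om in P th. exp (s \<bullet> Y th om) = 0"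
   by (subst (asm) integral_nonneg_eq_0_iff_AE[OF int]) auto
  hence "AE om in P th. False" by simp
  thus False by simp
 qed
 have "(\<integral>om. exp (s \<bullet> Y th om) \<partial>P th) >= 0" by (intro integral_nonneg_AE) auto
 from le_neq_trans[OF this ne[symmetric]] show ?thesis by (simp add: Mr_def q)
qed

lemma M_norm_le: "norm (M (z, th)) <= Mr (Re_vec z, th)"
 unfolding M_eq Mr_def by (rule order_trans[OF integral_norm_bound]) (simp add: Re_zdot)

text \<open>Holomorphy is stated along complex lines of one variable, the form in which Cauchy's
  estimates are applied. Each point has a ball of finite exponential moments because
  \<open>S\<close> is open.\<close>

lemma M_slice_holomorphic: "(%t. M (z0 + t *s w, th)) holomorphic_on {t. (z0 + t *s w, th) \<in> CD}"
 unfolding holomorphic_on_def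
proof
 fix t1 assume "t1 \<in> {t. (z0 + t *s w, th) \<in> CD}"
 define z1 where "z1 = z0 + t1 *s w"
 have z1: "(Re_vec z1, th) \<in> S" using \<open>t1 \<in> _\<close> by (simp add: z1_def in_CD_iff)
 obtain \<rho> where \<rho>: "\<rho> > 0" "ball (Re_vec z1, th) \<rho> \<subseteq> S" using z1 open_S open_contains_ball by blast
 have "EX D. ((%h. \<integral>om. exp (zdot (z1 + h *s w) (Y th om)) \<partial>P th) has_field_derivative D) (at 0)"
 proof (rule exp_zdot_slice_derivative)
  show "Y th \<in> borel_measurable (P th)" using S_D(1)[OF z1] by (rule Y_meas)
  show "\<rho> / 2 > 0" using \<rho> by simp
  fix s' assume "s' \<in> cball (Re_vec z1) (\<rho> / 2)"
  hence "(s', th) \<in> ball (Re_vec z1, th) \<rho>" using \<rho> by (simp add: dist_Pair_Pair)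
  thus "integrable (P th) (%om. exp (s' \<bullet> Y th om))" using \<rho> by (intro S_D(2)) auto
 qed
 then obtain D where "((%h. M (z1 + h *s w, th)) has_field_derivative D) (at 0)" by (auto simp: M_eq)
 moreover have "(%h. M (z1 + h *s w, th)) = (%h. M (z0 + (h + t1) *s w, th))"
  by (simp add: z1_def vector_sadd_rdistrib add.assoc add.commute add.left_commute)
 ultimately have "((%t. M (z0 + t *s w, th)) has_field_derivative D) (at t1)"
  using DERIV_shift[of "%t. M (z0 + t *s w, th)" D 0 t1] by simp
 thus "(%t. M (z0 + t *s w, th)) field_differentiable at t1 within {t. (z0 + t *s w, th) \<in> CD}"
  using field_differentiable_at_within field_differentiable_def by blast
qed

lemma growth_D:
 assumes "(length is, length js) \<in> growth_orders"
 shows "partials_exist_on CD (map th_dir is @ map s_dir js) M"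
  "continuous_on CD (partials (map th_dir is @ map s_dir js) M)"
 using growth assms unfolding growth_condition_def Let_def by blast+

lemma growth_bound:
 obtains \<gamma> where "continuous_on S \<gamma>" "!!q. q \<in> S ==> \<gamma> q > 0"
  "!!is js s th \<phi>. (length is, length js) \<in> growth_orders ==> (s, th) \<in> S ==>
   norm (partials (map th_dir is @ map s_dir js) M (cvec s \<phi>, th)) <= \<gamma> (s, th) * (1 + norm \<phi>) powr \<gamma> (s, th)"
 using growth unfolding growth_condition_def Let_def by blast

lemma M_partial:
 assumes "q \<in> CD"
 shows "((%t. M (q + t *\<^sub>R dir x)) has_vector_derivative partial (dir x) M q) (at 0)"
proof (cases x)
 case (Inl j)
 show ?thesis using growth_D(1)[of "[]" "[j]"] assms Inl
  by (intro partial_works) (simp add: growth_orders_def)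
next
 case (Inr i)
 show ?thesis using growth_D(1)[of "[i]" "[]"] assms Inr
  by (intro partial_works) (simp add: growth_orders_def)
qed

lemma M_partial_cont: "continuous_on CD (partial (dir x) M)"
proof (cases x)
 case (Inl j)
 show ?thesis using growth_D(2)[of "[]" "[j]"] Inl by (simp add: growth_orders_def)
next
 case (Inr i)
 show ?thesis using growth_D(2)[of "[i]" "[]"] Inr by (simp add: growth_orders_def)
qed

text \<open>The growth condition takes \<open>s\<close>-derivatives before parameter derivatives.
  This marks the opposite order, whose existence has to be derived.\<close>

definition mixed_order :: "'d + 'p => 'd + 'p => bool" where
 "mixed_order x y \<longleftrightarrow> (EX i j. x = Inl i & y = Inr j)"

lemma M_partial2:
 assumes "\<not> mixed_order x y"
 shows "q \<in> CD ==> ((%t. partial (dir y) M (q + t *\<^sub>R dir x)) has_vector_derivative partial (dir x) (partial (dir y) M) q) (at 0)"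
  and "continuous_on CD (partial (dir x) (partial (dir y) M))"
proof -
 have o: "EX is js. (length is, length js) \<in> growth_orders & map th_dir is @ map s_dir js = [dir x, dir y :: (complex ^ 'd) \<times> (real ^ 'p)]"
  using assms
 proof (cases x; cases y)
  fix i j assume "x = Inl i" "y = Inl j"
  thus ?thesis by (intro exI[of _ "[]"] exI[of _ "[i, j]"]) (simp add: growth_orders_def)
 next
  fix i j assume "x = Inr i" "y = Inl j"
  thus ?thesis by (intro exI[of _ "[i]"] exI[of _ "[j]"]) (simp add: growth_orders_def)
 next
  fix i j assume "x = Inr i" "y = Inr j"
  thus ?thesis by (intro exI[of _ "[i, j]"] exI[of _ "[]"]) (simp add: growth_orders_def)
 qed (auto simp: mixed_order_def)
 then obtain "is" js where o: "(length is, length js) \<in> growth_orders" "map th_dir is @ map s_dir js = [dir x, dir y :: (complex ^ 'd) \<times> (real ^ 'p)]"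
  by blast
 show "continuous_on CD (partial (dir x) (partial (dir y) M))" using growth_D(2)[OF o(1)] unfolding o(2) by simp
 show "((%t. partial (dir y) M (q + t *\<^sub>R dir x)) has_vector_derivative partial (dir x) (partial (dir y) M) q) (at 0)" if "q \<in> CD"
  using growth_D(1)[OF o(1)] that unfolding o(2) by (intro partial_works) simp
qed

definition D1 where "D1 x q = Re (partial (dir x) M (emb q))"
definition D2 where
 "D2 x y q = (if mixed_order x y then Re (partial (dir y) (partial (dir x) M) (emb q)) else Re (partial (dir x) (partial (dir y) M) (emb q)))"

lemma emb_continuous: "continuous_on A emb"
 unfolding emb_def[abs_def] cvec_def Complex_eq
 by (intro continuous_intros)

lemma Mr_eq: "Mr q = Re (M (emb q))" by (simp add: M_emb)

lemma Mr_partial: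
 assumes "q \<in> S"
 shows "((%t. Mr (q + t *\<^sub>R dir x)) has_real_derivative D1 x q) (at 0)"
proof -
 have "((%t. M (emb (q + t *\<^sub>R dir x))) has_vector_derivative partial (dir x) M (emb q)) (at 0)"
  unfolding emb_add using assms by (intro M_partial) (simp add: emb_in_CD)
 from bounded_linear.has_vector_derivative[OF bounded_linear_Re this] show ?thesis
  by (simp add: Mr_eq D1_def has_real_derivative_iff_has_vector_derivative)
qed

lemma D1_cont: "continuous_on S (D1 x)"
 unfolding D1_def[abs_def]
 by (intro continuous_on_Re continuous_on_compose2[OF M_partial_cont emb_continuous]) (auto simp: emb_in_CD)

lemma D2_cont: "continuous_on S (D2 x y)"
proof (cases "mixed_order x y")
 case True
 hence "\<not> mixed_order y x" by (auto simp: mixed_order_def)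
 thus ?thesis unfolding D2_def[abs_def] using True
  by (simp, intro continuous_on_Re continuous_on_compose2[OF M_partial2(2) emb_continuous]) (auto simp: emb_in_CD)
next
 case False
 thus ?thesis unfolding D2_def[abs_def]
  by (simp, intro continuous_on_Re continuous_on_compose2[OF M_partial2(2) emb_continuous]) (auto simp: emb_in_CD)
qed

lemma D1_partial_unmixed:
 assumes "q \<in> S" "\<not> mixed_order x y"
 shows "((%t. D1 y (q + t *\<^sub>R dir x)) has_real_derivative D2 x y q) (at 0)"
proof -
 have "((%t. partial (dir y) M (emb (q + t *\<^sub>R dir x))) has_vector_derivative partial (dir x) (partial (dir y) M) (emb q)) (at 0)"
  unfolding emb_add using assms by (intro M_partial2) (auto simp: emb_in_CD)
 from bounded_linear.has_vector_derivative[OF bounded_linear_Re this] show ?thesis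
  using assms by (simp add: D1_def D2_def has_real_derivative_iff_has_vector_derivative)
qed

text \<open>When the parameter derivative comes first, \<open>Schwarz_mixed_partial\<close> supplies
  the derivative in \<open>s\<close> from the order covered by the growth condition.\<close>

lemma D1_partial:
 assumes q: "q \<in> S"
 shows "((%t. D1 y (q + t *\<^sub>R dir x)) has_real_derivative D2 x y q) (at 0)"
proof (cases "mixed_order x y")
 case True
 hence m: "\<not> mixed_order y x" by (auto simp: mixed_order_def)
 have "((%t. D1 y (q + t *\<^sub>R dir x)) has_real_derivative D2 y x q) (at 0)"
  by (rule Schwarz_mixed_partial[OF open_S q, of Mr "dir y" "D1 y" "dir x" "D1 x" "D2 y x"])
    (rule Mr_partial D1_partial_unmixed[OF _ m] D2_cont | assumption)+
 moreover have "D2 y x = D2 x y" using True m by (simp add: D2_def fun_eq_iff)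
 ultimately show ?thesis by simp
next
 case False
 thus ?thesis by (rule D1_partial_unmixed[OF q])
qed

lemma D2_sym:
 assumes q: "q \<in> S"
 shows "D2 x y q = D2 y x q"
proof -
 have "((%t. D1 y (q + t *\<^sub>R dir x)) has_real_derivative D2 y x q) (at 0)"
  by (rule Schwarz_mixed_partial[OF open_S q, of Mr "dir y" "D1 y" "dir x" "D1 x" "D2 y x"])
    (rule Mr_partial D1_partial D2_cont | assumption)+
 from DERIV_unique[OF D1_partial[OF q] this] show ?thesis .
qed

abbreviation K where "K \<equiv> K0 P Y"
definition k1 where "k1 x q = D1 x q / Mr q"
definition k2 where "k2 x y q = D2 x y q / Mr q - D1 x q * D1 y q / (Mr q)\<^sup>2"

lemma K_eq: "K q = ln (Mr q)"
 by (cases q) (simp add: K0_def Mr_eq emb_def)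

lemma Mr_cont: "continuous_on S Mr"
proof -
 have "(Mr has_derivative (%v. SUM b:Basis. (v \<bullet> b) *\<^sub>R (D1 (inv dir b) q))) (at q)" if q: "q \<in> S" for q
 proof (rule has_derivative_from_partials[OF open_S q, where D="%b. D1 (inv dir b)"])
  fix b z assume b: "b \<in> (Basis :: ((real ^ 'd) \<times> (real ^ 'p)) set)" and z: "z \<in> S"
  then obtain x where "b = dir x" using bij_dir by (auto simp: bij_betw_def)
  moreover have "inv dir (dir x :: (real ^ 'd) \<times> (real ^ 'p)) = x" using bij_dir by (auto simp: bij_betw_def intro: inv_f_f)
  ultimately show "((%t. Mr (z + t *\<^sub>R b)) has_vector_derivative D1 (inv dir b) z) (at 0)"
   using Mr_partial[OF z, of x] by (simp add: has_real_derivative_iff_has_vector_derivative)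
 qed (rule D1_cont)
 thus ?thesis using has_derivative_continuous by (intro continuous_at_imp_continuous_on) blast
qed

lemma K_partial:
 assumes "q \<in> S"
 shows "((%t. K (q + t *\<^sub>R dir x)) has_real_derivative k1 x q) (at 0)"
 unfolding K_eq using Mr_pos[OF assms]
 by (intro DERIV_cong[OF DERIV_ln_divide[THEN DERIV_chain2, OF _ Mr_partial[OF assms]]]) (auto simp: k1_def)

lemma k1_partial:
 assumes q: "q \<in> S"
 shows "((%t. k1 y (q + t *\<^sub>R dir x)) has_real_derivative k2 x y q) (at 0)"
 unfolding k1_def using Mr_pos[OF q]
 by (intro DERIV_cong[OF DERIV_divide[OF D1_partial[OF q] Mr_partial[OF q]]])
   (auto simp: k2_def diff_divide_distrib power2_eq_square mult_ac)

lemma k1_cont: "continuous_on S (k1 x)"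
 unfolding k1_def[abs_def] using Mr_pos by (intro continuous_intros D1_cont Mr_cont) force

lemma k2_cont: "continuous_on S (k2 x y)"
 unfolding k2_def[abs_def] using Mr_pos by (intro continuous_intros D1_cont D2_cont Mr_cont) force+

lemma k2_sym: "q \<in> S ==> k2 x y q = k2 y x q"
 using D2_sym[of q x y] by (simp add: k2_def mult.commute)

lemma partial_K: "q \<in> S ==> partial (dir x) K q = k1 x q"
 by (intro partial_eqI) (simp add: K_partial flip: has_real_derivative_iff_has_vector_derivative)

lemma partial2_K:
 assumes q: "q \<in> S"
 shows "partial (dir x) (partial (dir y) K) q = k2 x y q"
proof (rule partial_eqI)
 have "((%t. partial (dir y) K (q + t *\<^sub>R dir x)) has_real_derivative k2 x y q) (at 0)"
  by (subst has_real_derivative_line_cong[OF open_S q partial_K]) (auto intro: k1_partial q)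
 thus "((%t. partial (dir y) K (q + t *\<^sub>R dir x)) has_vector_derivative k2 x y q) (at 0)"
  by (simp add: has_real_derivative_iff_has_vector_derivative)
qed

lemma K0_derivatives:
 assumes q: "q \<in> S"
 shows "grad_s K q = (\<chi> j. k1 (Inl j) q)" "grad_th K q = (\<chi> i. k1 (Inr i) q)"
  "hess_s K q = (\<chi> i j. k2 (Inl i) (Inl j) q)" "hess_th K q = (\<chi> i j. k2 (Inr i) (Inr j) q)"
  "mixed_s_th K q = (\<chi> i j. k2 (Inl i) (Inr j) q)"
 using partial_K[OF q] partial2_K[OF q] unfolding dir_def
 by (auto simp: grad_s_def grad_th_def hess_s_def hess_th_def mixed_s_th_def vec_eq_iff split: sum.splits)
   (metis (no_types) sum.simps(5,6))+

lemma inv_dir [simp]: "inv dir (dir x :: (real ^ 'd) \<times> (real ^ 'p)) = x"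
 using bij_dir by (auto simp: bij_betw_def intro: inv_f_f)

lemma K_has_derivative:
 assumes q: "q \<in> S"
 shows "(K has_derivative (%v. SUM x:UNIV. (v \<bullet> dir x) * k1 x q)) (at q)"
proof -
 have "(K has_derivative (%v. SUM b:Basis. (v \<bullet> b) *\<^sub>R (k1 (inv dir b) q))) (at q)"
 proof (rule has_derivative_from_partials[OF open_S q, where D="%b. k1 (inv dir b)"])
  fix b z assume b: "b \<in> (Basis :: ((real ^ 'd) \<times> (real ^ 'p)) set)" and z: "z \<in> S"
  then obtain x where "b = dir x" using bij_dir by (auto simp: bij_betw_def)
  thus "((%t. K (z + t *\<^sub>R b)) has_vector_derivative k1 (inv dir b) z) (at 0)"
   using K_partial[OF z, of x] by (simp add: has_real_derivative_iff_has_vector_derivative)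
 qed (rule k1_cont)
 thus ?thesis by (simp add: sum_Basis_dir)
qed

lemma k1_strict:
 assumes q: "q \<in> S" and e: "e > 0"
 shows "EX r>0. ALL a:ball q r. ALL b:ball q r.
  \<bar>k1 y b - k1 y a - (SUM x:UNIV. ((b - a) \<bullet> dir x) * k2 x y q)\<bar> <= e * norm (b - a)"
proof -
 have "EX r>0. ALL a:ball q r. ALL b:ball q r.
  norm (k1 y b - k1 y a - (SUM c:Basis. ((b - a) \<bullet> c) *\<^sub>R (k2 (inv dir c) y q))) <= e * norm (b - a)"
 proof (rule strictly_differentiable_from_partials[OF open_S q _ _ e, where D="%b. k2 (inv dir b) y"])
  fix b z assume b: "b \<in> (Basis :: ((real ^ 'd) \<times> (real ^ 'p)) set)" and z: "z \<in> S"
  then obtain x where "b = dir x" using bij_dir by (auto simp: bij_betw_def)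
  thus "((%t. k1 y (z + t *\<^sub>R b)) has_vector_derivative k2 (inv dir b) y z) (at 0)"
   using k1_partial[OF z, of y x] by (simp add: has_real_derivative_iff_has_vector_derivative)
 qed (rule k2_cont)
 thus ?thesis by (simp add: sum_Basis_dir)
qed

lemma k1_has_derivative:
 assumes q: "q \<in> S"
 shows "(k1 y has_derivative (%v. SUM x:UNIV. (v \<bullet> dir x) * k2 x y q)) (at q)"
proof -
 have "(k1 y has_derivative (%v. SUM b:Basis. (v \<bullet> b) *\<^sub>R (k2 (inv dir b) y q))) (at q)"
 proof (rule has_derivative_from_partials[OF open_S q, where D="%b. k2 (inv dir b) y"])
  fix b z assume b: "b \<in> (Basis :: ((real ^ 'd) \<times> (real ^ 'p)) set)" and z: "z \<in> S"
  then obtain x where "b = dir x" using bij_dir by (auto simp: bij_betw_def)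
  thus "((%t. k1 y (z + t *\<^sub>R b)) has_vector_derivative k2 (inv dir b) y z) (at 0)"
   using k1_partial[OF z, of y x] by (simp add: has_real_derivative_iff_has_vector_derivative)
 qed (rule k2_cont)
 thus ?thesis by (simp add: sum_Basis_dir)
qed

text \<open>A parameter derivative of functions holomorphic in \<open>t\<close>: the map
  \<open>\<xi>\<close> joins complex \<open>t\<close> and real parameter increment \<open>h\<close>,
  and \<open>parameter_derivative_holomorphic\<close> applies near each point.\<close>

lemma th_partial_slice_holomorphic:
 "(%t. partial (th_dir i) M (z0 + t *s w, th)) holomorphic_on {t. (z0 + t *s w, th) \<in> CD}"
 unfolding holomorphic_on_def
proof
 fix t1 assume "t1 \<in> {t. (z0 + t *s w, th) \<in> CD}"
 hence t1: "(z0 + t1 *s w, th) \<in> CD" by simp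
 define \<xi> where "\<xi> = (%p :: complex \<times> real. (z0 + fst p *s w, th + snd p *\<^sub>R axis i 1))"
 have \<xi>c: "continuous_on A \<xi>" for A
  unfolding \<xi>_def vector_scalar_mult_def by (intro continuous_intros)
 have "open (\<xi> -` CD)" by (rule open_vimage[OF open_CD \<xi>c])
 moreover have "(t1, 0) \<in> \<xi> -` CD" using t1 by (simp add: \<xi>_def)
 ultimately obtain d where d: "d > 0" "ball (t1, 0) d \<subseteq> \<xi> -` CD" using open_contains_ball by blast
 have box: "\<xi> (t, h) \<in> CD" if "t \<in> ball t1 (d/2)" "\<bar>h\<bar> < d/2" for t h
 proof -
  have "dist (t1, 0) (t, h) <= dist t1 t + \<bar>h\<bar>"
   unfolding dist_Pair_Pair by (rule order_trans[OF sqrt_sum_squares_le_sum]) (auto simp: dist_real_def)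
  also have "... < d" using that by simp
  finally show ?thesis using d by auto
 qed
 have "(%t. (%t h. partial (th_dir i) M (\<xi> (t, h))) t 0) holomorphic_on ball t1 (d/2)"
 proof (rule parameter_derivative_holomorphic[where F="%t h. M (\<xi> (t, h))" and d="d/2"])
  show "(%t. M (\<xi> (t, h))) holomorphic_on ball t1 (d/2)" if h: "\<bar>h\<bar> < d/2" for h
  proof (rule holomorphic_on_subset)
   show "(%t. M (\<xi> (t, h))) holomorphic_on {t. \<xi> (t, h) \<in> CD}"
    using M_slice_holomorphic[of z0 w "th + h *\<^sub>R axis i 1"] by (simp add: \<xi>_def)
   show "ball t1 (d/2) \<subseteq> {t. \<xi> (t, h) \<in> CD}" using box[OF _ h] by auto
  qed
  show "((%h. M (\<xi> (t, h))) has_vector_derivative partial (th_dir i) M (\<xi> (t, h))) (at h)"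
   if "t \<in> ball t1 (d/2)" "\<bar>h\<bar> < d/2" for t h
  proof -
   have 1: "((%s. M (\<xi> (t, h) + s *\<^sub>R dir (Inr i))) has_vector_derivative partial (dir (Inr i)) M (\<xi> (t, h))) (at 0)"
    by (rule M_partial[OF box[OF that]])
   have 2: "((%s. s - h) has_vector_derivative 1) (at h)" by (auto intro!: derivative_eq_intros)
   have "((%s. M (\<xi> (t, h) + s *\<^sub>R dir (Inr i))) \<circ> (%s. s - h) has_vector_derivative 1 *\<^sub>R partial (dir (Inr i)) M (\<xi> (t, h))) (at h)"
    by (rule vector_diff_chain_at[OF 2]) (use 1 in simp)
   moreover have "(%s. M (\<xi> (t, h) + s *\<^sub>R dir (Inr i))) \<circ> (%s. s - h) = (%s. M (\<xi> (t, s)))"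
    by (auto simp: \<xi>_def th_dir_def fun_eq_iff scaleR_diff_left)
   ultimately show ?thesis by simp
  qed
  show "continuous_on (ball t1 (d/2) \<times> {-(d/2)<..<d/2}) (%(t, h). partial (th_dir i) M (\<xi> (t, h)))"
  proof -
   have "continuous_on (ball t1 (d/2) \<times> {-(d/2)<..<d/2}) (%p. partial (dir (Inr i)) M (\<xi> p))"
    by (rule continuous_on_compose2[OF M_partial_cont \<xi>c]) (use box in auto)
   thus ?thesis by (simp add: case_prod_beta)
  qed
 qed (use d in auto)
 hence "(%t. partial (th_dir i) M (z0 + t *s w, th)) holomorphic_on ball t1 (d/2)" by (simp add: \<xi>_def)
 hence "(%t. partial (th_dir i) M (z0 + t *s w, th)) field_differentiable at t1"
  using d by (intro holomorphic_on_imp_differentiable_at) auto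
 thus "(%t. partial (th_dir i) M (z0 + t *s w, th)) field_differentiable at t1 within {t. (z0 + t *s w, th) \<in> CD}"
  by (rule field_differentiable_at_within)
qed

end

section \<open>Second-order limits along complex lines\<close>

lemma line_has_real_derivative:
 fixes f :: "'a::real_normed_vector => real"
 assumes "(f has_derivative f') (at (q + \<tau> *\<^sub>R v))"
 shows "((%t. f (q + t *\<^sub>R v)) has_real_derivative f' v) (at \<tau>)"
proof -
 have 1: "((%t. q + t *\<^sub>R v) has_derivative (%h. h *\<^sub>R v)) (at \<tau>)"
  by (auto intro!: derivative_eq_intros)
 have "((%t. f (q + t *\<^sub>R v)) has_derivative (%h. f' (h *\<^sub>R v))) (at \<tau>)"
  using diff_chain_at[OF 1 assms] by (simp add: o_def)
 moreover have "f' (h *\<^sub>R v) = f' v * h" for h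
  using linear_scale[OF has_derivative_linear[OF assms]] by simp
 ultimately show ?thesis by (simp add: has_field_derivative_def)
qed

text \<open>Identifies derivatives of the holomorphic slices of \<open>M\<close> with the real
  derivatives of \<open>Mr\<close>; applied twice, it reaches the second derivative.\<close>

lemma deriv_on_real_line:
 fixes F :: "complex => complex"
 assumes hol: "F holomorphic_on ball 0 d" and F: "!!\<tau>. \<bar>\<tau>\<bar> < d ==> F (of_real \<tau>) = of_real (g \<tau>)"
  and g: "(g has_real_derivative g') (at \<tau>)" and \<tau>: "\<bar>\<tau>\<bar> < d"
 shows "deriv F (of_real \<tau>) = of_real g'"
proof -
 have "(F has_field_derivative deriv F (of_real \<tau>)) (at (of_real \<tau>))"
  by (rule holomorphic_derivI[OF hol open_ball]) (use \<tau> in simp)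
 hence 1: "((%x. F (of_real x)) has_vector_derivative deriv F (of_real \<tau>)) (at \<tau>)"
  by (rule has_vector_derivative_real_field)
 have "((%x. complex_of_real (g x)) has_vector_derivative of_real g') (at \<tau>)"
  using g by (intro has_vector_derivative_of_real) (simp add: has_real_derivative_iff_has_vector_derivative)
 hence 2: "((%x. F (of_real x)) has_vector_derivative of_real g') (at \<tau>)"
  by (rule has_vector_derivative_transform_within_open[of _ _ _ "{-d<..<d}"]) (use \<tau> F in \<open>auto simp: abs_less_iff\<close>)
 from vector_derivative_unique_at[OF 1 2] show ?thesis .
qed

lemma holomorphic_quadratic_limit:
 fixes F :: "complex => complex"
 assumes hol: "F holomorphic_on ball 0 d" and d: "d > 0"
 shows "((%t. (F t - F 0 - deriv F 0 * t) / t\<^sup>2) \<longlongrightarrow> deriv (deriv F) 0 / 2) (at 0)"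
proof -
 have "compact (F ` cball 0 (d/2))" using d
  by (intro compact_continuous_image holomorphic_on_imp_continuous_on holomorphic_on_subset[OF hol]) auto
 from compact_imp_bounded[OF this] obtain B where "ALL x:F ` cball 0 (d/2). norm x <= B"
  unfolding bounded_iff by blast
 hence B: "norm (F t) <= B" if "norm t <= d/2" for t using that by simp
 have hol': "F holomorphic_on ball 0 (d/2)" using d by (intro holomorphic_on_subset[OF hol]) auto
 have E: "norm ((F t - F 0 - deriv F 0 * t) / t\<^sup>2 - deriv (deriv F) 0 / 2) <= 2 * B / (d/2) ^ 3 * norm t"
  if t: "t ~= 0" "norm t <= d/2/2" for t
 proof -
  have "norm (F t - (\<Sum>k<3. (deriv ^^ k) F 0 / fact k * t ^ k)) <= 2 * B * (norm t / (d/2)) ^ 3"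
   using B d t by (intro holomorphic_taylor_bound[OF hol']) auto
  hence "norm (F t - F 0 - deriv F 0 * t - deriv (deriv F) 0 / 2 * t\<^sup>2) / norm t ^ 2 <= 2 * B * (norm t / (d/2)) ^ 3 / norm t ^ 2"
   by (intro divide_right_mono) (simp_all add: eval_nat_numeral algebra_simps)
  also have "... = 2 * B / (d/2) ^ 3 * norm t" using t by (simp add: power3_eq_cube power2_eq_square)
  also have "norm (F t - F 0 - deriv F 0 * t - deriv (deriv F) 0 / 2 * t\<^sup>2) / norm t ^ 2
    = norm ((F t - F 0 - deriv F 0 * t) / t\<^sup>2 - deriv (deriv F) 0 / 2)"
   unfolding norm_power[symmetric] norm_divide[symmetric] using t by (simp add: diff_divide_distrib)
  finally show ?thesis .
 qed
 show ?thesis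
 proof (rule LIM_zero_cancel, rule Lim_null_comparison)
  have "\<forall>\<^sub>F t in at 0. t ~= 0 & norm (t::complex) <= d/2/2"
   unfolding eventually_at using d by (intro exI[of _ "d/2/2"]) auto
  thus "\<forall>\<^sub>F t in at 0. norm ((F t - F 0 - deriv F 0 * t) / t\<^sup>2 - deriv (deriv F) 0 / 2) <= 2 * B / (d/2) ^ 3 * norm t"
   by eventually_elim (use E in auto)
  show "((%t::complex. 2 * B / (d/2) ^ 3 * norm t) \<longlongrightarrow> 0) (at 0)"
   using tendsto_mult_right_zero[OF tendsto_norm_zero[OF tendsto_ident_at[of "0::complex" UNIV]], of "2 * B / (d/2) ^ 3"] by simp
 qed
qed

text \<open>The linear terms -ct and ct cancel in the sum, and their product leaves -c^2.\<close>

lemma product_quadratic_limit: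
 fixes A B :: "complex => complex"
 assumes A: "((%t. (A t - 1 + c * t) / t\<^sup>2) \<longlongrightarrow> \<alpha>) (at 0)" and B: "((%t. (B t - 1 - c * t) / t\<^sup>2) \<longlongrightarrow> \<beta>) (at 0)"
 shows "((%t. (A t * B t - 1) / t\<^sup>2) \<longlongrightarrow> \<alpha> + \<beta> - c\<^sup>2) (at 0)"
proof -
 let ?a = "%t. (A t - 1 + c * t) / t\<^sup>2" and ?b = "%t. (B t - 1 - c * t) / t\<^sup>2"
 have "((%t. ?a t + ?b t - c\<^sup>2 + t * (c * ?a t - c * ?b t) + t\<^sup>2 * (?a t * ?b t)) \<longlongrightarrow>
   \<alpha> + \<beta> - c\<^sup>2 + 0 * (c * \<alpha> - c * \<beta>) + 0\<^sup>2 * (\<alpha> * \<beta>)) (at 0)"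
  by (intro tendsto_intros A B)
 hence "((%t. ?a t + ?b t - c\<^sup>2 + t * (c * ?a t - c * ?b t) + t\<^sup>2 * (?a t * ?b t)) \<longlongrightarrow> \<alpha> + \<beta> - c\<^sup>2) (at 0)" by simp
 thus ?thesis
 proof (rule Lim_transform_eventually)
  have "?a t + ?b t - c\<^sup>2 + t * (c * ?a t - c * ?b t) + t\<^sup>2 * (?a t * ?b t) = (A t * B t - 1) / t\<^sup>2" if t: "t ~= 0" for t
  proof -
   define a b where "a = ?a t" and "b = ?b t"
   have AB: "A t = 1 - c * t + a * t\<^sup>2" "B t = 1 + c * t + b * t\<^sup>2" using t by (simp_all add: a_def b_def)
   show ?thesis unfolding a_def[symmetric] b_def[symmetric] AB using t
    by (simp add: field_simps power2_eq_square)
  qed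
  thus "\<forall>\<^sub>F t in at 0. ?a t + ?b t - c\<^sup>2 + t * (c * ?a t - c * ?b t) + t\<^sup>2 * (?a t * ?b t) = (A t * B t - 1) / t\<^sup>2"
   by (auto simp: eventually_at_filter)
 qed
qed

definition Im_vec :: "complex ^ 'd => real ^ 'd" where
 "Im_vec z = (\<chi> j. Im (z $ j))"

lemma norm_Re_Im_vec_le: "norm (Re_vec z) <= norm z" "norm (Im_vec z) <= norm z"
 unfolding norm_vec_def by (auto intro!: L2_set_mono simp: Re_vec_def Im_vec_def abs_Re_le_cmod abs_Im_le_cmod)

lemma Im_vec_add: "Im_vec (z + w) = Im_vec z + Im_vec w"
 by (simp add: Im_vec_def vec_eq_iff)

lemma Re_Im_vec_i [simp]: "Re_vec (\<i> *s z) = - Im_vec z" "Im_vec (\<i> *s z) = Re_vec z"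
 by (simp_all add: Re_vec_def Im_vec_def vec_eq_iff)

lemma Re_Im_vec_cvec [simp]: "Im_vec (cvec s \<phi>) = \<phi>"
 by (simp add: Im_vec_def cvec_def vec_eq_iff)

lemma cvec_Re_Im: "cvec (Re_vec z) (Im_vec z) = z"
 by (simp add: cvec_def Re_vec_def Im_vec_def vec_eq_iff)

lemma norm_vec_scalar_mult: "norm (t *s (z :: complex ^ 'd)) = norm t * norm z"
 unfolding norm_vec_def by (simp add: norm_mult L2_set_right_distrib)

lemma norm_cvec_0: "norm (cvec s 0) = norm s"
 unfolding norm_vec_def cvec_def by (simp add: complex_of_real_def[symmetric])

lemma cline_alt: "cline t u = t *s cvec u 0"
 by (simp add: cline_def cvec_def vec_eq_iff complex_of_real_def[symmetric])

section \<open>Integrands normalised at the saddlepoint\<close>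

context cgf_model
begin

lemma S_has_derivative:
 fixes f :: "(real ^ 'd) \<times> (real ^ 'p) => real"
 assumes d: "!!x z. z \<in> S ==> ((%t. f (z + t *\<^sub>R dir x)) has_real_derivative Df x z) (at 0)"
  and c: "!!x. continuous_on S (Df x)" and q: "q \<in> S"
 shows "(f has_derivative (%v. SUM x:UNIV. (v \<bullet> dir x) * Df x q)) (at q)"
proof -
 have "(f has_derivative (%v. SUM b:Basis. (v \<bullet> b) *\<^sub>R (Df (inv dir b) q))) (at q)"
 proof (rule has_derivative_from_partials[OF open_S q, where D="%b. Df (inv dir b)"])
  fix b z assume b: "b \<in> (Basis :: ((real ^ 'd) \<times> (real ^ 'p)) set)" and z: "z \<in> S"
  then obtain x where "b = dir x" using bij_dir by (auto simp: bij_betw_def)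
  thus "((%t. f (z + t *\<^sub>R b)) has_vector_derivative Df (inv dir b) z) (at 0)"
   using d[OF z, of x] by (simp add: has_real_derivative_iff_has_vector_derivative)
 qed (rule c)
 thus ?thesis by (simp add: sum_Basis_dir)
qed

lemma Mr_has_derivative: "q \<in> S ==> (Mr has_derivative (%v. SUM x:UNIV. (v \<bullet> dir x) * D1 x q)) (at q)"
 by (rule S_has_derivative[OF Mr_partial D1_cont])

lemma D1_has_derivative: "q \<in> S ==> (D1 y has_derivative (%v. SUM x:UNIV. (v \<bullet> dir x) * D2 x y q)) (at q)"
 by (rule S_has_derivative[OF D1_partial D2_cont])

definition yq :: "(real ^ 'd) \<times> (real ^ 'p) => real ^ 'd" where
 "yq q = (\<chi> j. k1 (Inl j) q)"

text \<open>
 On the contour \<open>Re z = s\<close> the function \<open>mq\<close> is \<open>M\<close>, normalised to be 1 at the saddlepoint with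
 vanishing linear term; \<open>fq i\<close> is the derivative of \<open>M\<close> with respect to the \<open>i\<close>-th parameter in the same normalisation, minus its value at the
 saddlepoint.  Up to a common factor the likelihood is the integral of \<open>mq ^ n\<close> and its derivative that of
 \<open>n * (fq i + k1 (Inr i) q * mq) * mq ^ (n - 1)\<close>.
\<close>

definition mq :: "(real ^ 'd) \<times> (real ^ 'p) => complex ^ 'd => complex" where
 "mq q \<zeta> = M (cvec (fst q) 0 + \<i> *s \<zeta>, snd q) * (1 / of_real (Mr q)) * exp (- \<i> * zdot \<zeta> (yq q))"

definition fq :: "'p => (real ^ 'd) \<times> (real ^ 'p) => complex ^ 'd => complex" where
 "fq i q \<zeta> = partial (th_dir i) M (cvec (fst q) 0 + \<i> *s \<zeta>, snd q) * (1 / of_real (Mr q)) * exp (- \<i> * zdot \<zeta> (yq q))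
   - of_real (k1 (Inr i) q) * mq q \<zeta>"

definition \<sigma>q :: "(real ^ 'd) \<times> (real ^ 'p) => real ^ 'd => real" where
 "\<sigma>q q u = (SUM i:UNIV. SUM j:UNIV. u $ i * u $ j * k2 (Inl i) (Inl j) q)"

lemma mq_0: "q \<in> S ==> mq q 0 = 1"
 using M_emb[of q] Mr_pos[of q] by (simp add: mq_def emb_def zdot_def vector_scalar_mult_def zero_vec_def[symmetric])

lemma th_partial_emb:
 assumes "q \<in> S"
 shows "partial (th_dir i) M (emb q) = of_real (D1 (Inr i) q)"
proof -
 have "((%t. M (emb (q + t *\<^sub>R dir (Inr i)))) has_vector_derivative partial (dir (Inr i)) M (emb q)) (at 0)"
  unfolding emb_add using assms by (intro M_partial) (simp add: emb_in_CD)
 moreover have "((%t. M (emb (q + t *\<^sub>R dir (Inr i)))) has_vector_derivative of_real (D1 (Inr i) q)) (at 0)"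
  unfolding M_emb using Mr_partial[OF assms, of "Inr i"]
  by (intro has_vector_derivative_of_real) (simp add: has_real_derivative_iff_has_vector_derivative)
 ultimately show ?thesis using vector_derivative_unique_at by fastforce
qed

lemma fq_0: "q \<in> S ==> fq i q 0 = 0"
 using th_partial_emb[of q i] mq_0[of q]
 by (simp add: fq_def emb_def zdot_def vector_scalar_mult_def zero_vec_def[symmetric] k1_def)

text \<open>The slice of \<open>M\<close> is expanded to second order through its real derivatives.
  The exponential factor, whose frequency is the mean \<open>yq q\<close>, removes the linear
  term.\<close>

lemma mq_limit:
 assumes q: "q \<in> S"
 shows "((%t. (mq q (cline t u) - 1) / t\<^sup>2) \<longlongrightarrow> - of_real (\<sigma>q q u) / 2) (at 0)"
proof -
 obtain s th where qe: "q = (s, th)" by (cases q)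
 define v :: "(real ^ 'd) \<times> (real ^ 'p)" where "v = (u, 0)"
 define F where "F t = M (cvec s 0 + t *s cvec u 0, th)" for t
 define g1 where "g1 \<tau> = (SUM j:UNIV. u $ j * D1 (Inl j) (q + \<tau> *\<^sub>R v))" for \<tau>
 define g2 where "g2 = (SUM i:UNIV. SUM j:UNIV. u $ i * u $ j * D2 (Inl i) (Inl j) q)"
 have lin: "F (of_real \<tau>) = of_real (Mr (q + \<tau> *\<^sub>R v))" for \<tau>
 proof -
  have "(cvec s 0 + of_real \<tau> *s cvec u 0, th) = emb (q + \<tau> *\<^sub>R v)"
   by (simp add: emb_def qe v_def cvec_def vec_eq_iff complex_eq_iff)
  thus ?thesis unfolding F_def by (simp only: M_emb)
 qed
 obtain e where e: "e > 0" "ball q e \<subseteq> S" using q open_S open_contains_ball by blast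
 define d where "d = e / (1 + norm u)"
 have u1: "1 + norm u > 0" by (simp add: add_pos_nonneg)
 have d: "d > 0" using e u1 by (simp add: d_def)
 have du: "a * norm u < e" if "a < d" "a >= 0" for a
 proof -
  have "a * norm u <= a * (1 + norm u)" using that by (intro mult_left_mono) auto
  also have "... < d * (1 + norm u)" using that u1 by (intro mult_strict_right_mono) auto
  also have "... = e" using u1 by (simp add: d_def)
  finally show ?thesis .
 qed
 have inS: "q + \<tau> *\<^sub>R v \<in> S" if "\<bar>\<tau>\<bar> < d" for \<tau>
  using du[OF that] e(2) by (auto simp: qe v_def dist_Pair_Pair dist_norm subset_iff)
 have F_hol: "F holomorphic_on ball 0 d"
  unfolding F_def
 proof (rule holomorphic_on_subset[OF M_slice_holomorphic], rule subsetI, rule CollectI)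
  fix t :: complex assume "t \<in> ball 0 d"
  hence t: "norm t < d" by simp
  have "Re_vec (cvec s 0 + t *s cvec u 0) = s + Re_vec (t *s cvec u 0)" by (simp add: Re_vec_add)
  moreover have "norm (Re_vec (t *s cvec u 0)) < e"
   using du[OF t] order_le_less_trans[OF norm_Re_Im_vec_le(1), of "t *s cvec u 0" e] by (simp add: norm_vec_scalar_mult norm_cvec_0)
  ultimately have "(Re_vec (cvec s 0 + t *s cvec u 0), th) \<in> ball q e"
   by (simp add: qe dist_Pair_Pair dist_norm)
  thus "(cvec s 0 + t *s cvec u 0, th) \<in> CD" using e(2) by (auto simp: in_CD_iff)
 qed
 have dF_hol: "deriv F holomorphic_on ball 0 d" by (rule holomorphic_deriv[OF F_hol open_ball])
 have dF: "deriv F (of_real \<tau>) = of_real (g1 \<tau>)" if "\<bar>\<tau>\<bar> < d" for \<tau>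
 proof (rule deriv_on_real_line[OF F_hol lin _ that])
  have "((%t. Mr (q + t *\<^sub>R v)) has_real_derivative (SUM x:UNIV. (v \<bullet> dir x) * D1 x (q + \<tau> *\<^sub>R v))) (at \<tau>)"
   by (rule line_has_real_derivative[OF Mr_has_derivative[OF inS[OF that]]])
  thus "((%t. Mr (q + t *\<^sub>R v)) has_real_derivative g1 \<tau>) (at \<tau>)"
   by (simp add: sum_UNIV_Plus v_def g1_def)
 qed
 have ddF: "deriv (deriv F) (of_real 0) = of_real g2"
 proof (rule deriv_on_real_line[OF dF_hol dF])
  have "((%t. D1 (Inl j) (q + t *\<^sub>R v)) has_real_derivative (SUM x:UNIV. (v \<bullet> dir x) * D2 x (Inl j) (q + 0 *\<^sub>R v))) (at 0)" for j
   by (rule line_has_real_derivative[OF D1_has_derivative]) (use q in simp)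
  hence "((%t. D1 (Inl j) (q + t *\<^sub>R v)) has_real_derivative (SUM i:UNIV. u $ i * D2 (Inl i) (Inl j) q)) (at 0)" for j
   by (simp add: sum_UNIV_Plus v_def zero_prod_def[symmetric])
  hence "(g1 has_real_derivative (SUM j:UNIV. u $ j * (SUM i:UNIV. u $ i * D2 (Inl i) (Inl j) q))) (at 0)"
   unfolding g1_def by (intro DERIV_sum DERIV_cmult)
  also have "(SUM j:UNIV. u $ j * (SUM i:UNIV. u $ i * D2 (Inl i) (Inl j) q)) = g2"
   unfolding g2_def sum_distrib_left by (subst sum.swap) (simp add: mult_ac)
  finally show "(g1 has_real_derivative g2) (at 0)" .
 qed (use d in auto)
 define yu where "yu = u \<bullet> yq q"
 have M0: "Mr q > 0" by (rule Mr_pos[OF q])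
 have g1M: "g1 0 / Mr q = yu"
  by (simp add: g1_def yu_def yq_def inner_vec_def k1_def sum_divide_distrib)
 have sig: "\<sigma>q q u = g2 / Mr q - yu\<^sup>2"
 proof -
  have "yu\<^sup>2 = (SUM i:UNIV. SUM j:UNIV. u $ i * u $ j * (D1 (Inl i) q * D1 (Inl j) q / (Mr q)\<^sup>2))"
   unfolding power2_eq_square g1M[symmetric] g1_def by (simp add: sum_product sum_divide_distrib mult_ac)
  thus ?thesis
   by (simp add: \<sigma>q_def k2_def g2_def right_diff_distrib sum_subtractf sum_divide_distrib)
 qed
 have L1: "((%t. (F t - F 0 - deriv F 0 * t) / t\<^sup>2) \<longlongrightarrow> of_real g2 / 2) (at 0)"
  using holomorphic_quadratic_limit[OF F_hol d] ddF by simp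
 \<comment> \<open>Replacing \<open>t\<close> by \<open>\<i> * t\<close> turns the expansion in real
   tilts into one along the contour; the square of \<open>\<i>\<close> gives the minus sign in the
   limit.\<close>
 have fl: "filterlim (%t. \<i> * t) (at 0) (at (0::complex))"
  unfolding filterlim_at by (auto intro!: tendsto_eq_intros simp: eventually_at_filter)
 have L2: "((%t. (F (\<i> * t) - F 0 - deriv F 0 * (\<i> * t)) / (\<i> * t)\<^sup>2) \<longlongrightarrow> of_real g2 / 2) (at 0)"
  by (rule filterlim_compose[OF L1 fl])
 have "((%t. - ((F (\<i> * t) - F 0 - deriv F 0 * (\<i> * t)) / (\<i> * t)\<^sup>2) / of_real (Mr q)) \<longlongrightarrow> - (of_real g2 / 2) / of_real (Mr q)) (at 0)"
  by (intro tendsto_divide tendsto_minus L2 tendsto_const) (use M0 in auto)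
 moreover have "- ((F (\<i> * t) - F 0 - deriv F 0 * (\<i> * t)) / (\<i> * t)\<^sup>2) / of_real (Mr q)
   = (F (\<i> * t) / of_real (Mr q) - 1 + (- \<i> * of_real yu) * t) / t\<^sup>2" for t
 proof -
  have F0: "F 0 = of_real (Mr q)" using lin[of 0] by simp
  have dF0: "deriv F 0 = of_real (Mr q) * of_real yu" using dF[of 0] d g1M M0 by (simp flip: g1M)
  have alg: "- ((A - m - m * w * (\<i> * t)) / (\<i> * t)\<^sup>2) / m = (A / m - 1 + (- \<i> * w) * t) / t\<^sup>2" if "m ~= 0" for A m w :: complex
  proof -
   have "- ((A - m - m * w * (\<i> * t)) / (\<i> * t)\<^sup>2) / m = ((A - m - m * w * (\<i> * t)) / m) / t\<^sup>2"
    by (simp only: power_mult_distrib i_squared) simp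
   also have "(A - m - m * w * (\<i> * t)) / m = A / m - 1 + (- \<i> * w) * t"
    using that by (simp add: diff_divide_distrib)
   finally show ?thesis .
  qed
  show ?thesis unfolding F0 dF0 by (rule alg) (use M0 in simp)
 qed
 ultimately have A: "((%t. (F (\<i> * t) / of_real (Mr q) - 1 + (- \<i> * of_real yu) * t) / t\<^sup>2) \<longlongrightarrow> - (of_real g2 / 2) / of_real (Mr q)) (at 0)"
  by simp
 define c where "c = - \<i> * complex_of_real yu"
 have B: "((%t. (exp (c * t) - 1 - c * t) / t\<^sup>2) \<longlongrightarrow> c\<^sup>2 / 2) (at 0)"
 proof -
  have d1: "deriv (%t. exp (c * t)) = (%t. c * exp (c * t))"
   by (intro ext DERIV_imp_deriv) (auto intro!: derivative_eq_intros)
  have d2: "deriv (%t. c * exp (c * t)) 0 = c\<^sup>2"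
   by (intro DERIV_imp_deriv) (auto intro!: derivative_eq_intros simp: power2_eq_square)
  have "(%t. exp (c * t)) holomorphic_on ball 0 1" by (intro holomorphic_intros)
  from holomorphic_quadratic_limit[OF this] show ?thesis by (simp add: d1 d2)
 qed
 have "((%t. (F (\<i> * t) / of_real (Mr q) * exp (c * t) - 1) / t\<^sup>2) \<longlongrightarrow> - (of_real g2 / 2) / of_real (Mr q) + c\<^sup>2 / 2 - c\<^sup>2) (at 0)"
  by (rule product_quadratic_limit[OF _ B]) (use A in \<open>simp add: c_def\<close>)
 moreover have "F (\<i> * t) / of_real (Mr q) * exp (c * t) = mq q (cline t u)" for t
 proof -
  have "\<i> *s cline t u = (\<i> * t) *s cvec u 0" by (simp add: cline_alt vec_eq_iff)
  moreover have "zdot (cline t u) (yq q) = t * of_real yu"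
   by (simp add: cline_alt zdot_scale zdot_real yu_def)
  ultimately show ?thesis by (simp add: mq_def F_def qe c_def mult_ac)
 qed
 \<comment> \<open>As \<open>c\<^sup>2\<close> is \<open>- yu\<^sup>2\<close>, the exponential
   contributes the squared mean that turns the second moment into a variance.\<close>
 moreover have "- (of_real g2 / 2) / of_real (Mr q) + c\<^sup>2 / 2 - c\<^sup>2 = - of_real (\<sigma>q q u) / 2"
  unfolding sig c_def using M0 by (simp add: power_mult_distrib field_simps)
 ultimately show ?thesis by simp
qed

lemma cvec_split: "cvec s 0 + \<i> *s cline 1 \<phi> = cvec s \<phi>"
 by (simp add: cvec_def cline_def vec_eq_iff complex_eq_iff)

lemma norm_exp_zdot_real: "norm (exp (- \<i> * zdot (cline 1 \<phi>) y)) = 1"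
proof -
 have "zdot (cline 1 \<phi>) y = of_real (\<phi> \<bullet> y)" by (simp add: cline_alt zdot_scale zdot_real)
 thus ?thesis by simp
qed

lemma norm_mq_real:
 assumes "q \<in> S"
 shows "norm (mq q (cline 1 \<phi>)) = norm (M (cvec (fst q) \<phi>, snd q) / M (cvec (fst q) 0, snd q))"
 using M_emb[of q] Mr_pos[OF assms]
 by (simp only: mq_def cvec_split norm_mult norm_exp_zdot_real) (simp add: norm_divide emb_def)

lemma decay_D:
 obtains \<delta> where "continuous_on S \<delta>" "!!q. q \<in> S ==> \<delta> q > 0"
  "!!q \<phi>. q \<in> S ==> norm (mq q (cline 1 \<phi>)) <= (1 + \<delta> q * (norm \<phi>)\<^sup>2) powr (- \<delta> q)"
proof -
 from decay obtain \<delta> where \<delta>: "continuous_on S \<delta>" "ALL q:S. \<delta> q > 0"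
  "ALL s th \<phi>. (s, th) \<in> S --> norm (M (cvec s \<phi>, th) / M (cvec s 0, th)) <= (1 + \<delta> (s, th) * (norm \<phi>)\<^sup>2) powr (- \<delta> (s, th))"
  unfolding decay_condition_def by blast
 show ?thesis
 proof (rule that[OF \<delta>(1)])
  show "!!q. q \<in> S ==> \<delta> q > 0" using \<delta>(2) by blast
  fix q \<phi> assume "q \<in> S"
  thus "norm (mq q (cline 1 \<phi>)) <= (1 + \<delta> q * (norm \<phi>)\<^sup>2) powr (- \<delta> q)"
   using \<delta>(3) by (cases q) (simp only: norm_mq_real fst_conv snd_conv)
 qed
qed

text \<open>Both sides of the decay bound equal 1 at 0, so it survives for the second-order
  coefficients: 1 - \<sigma> t^2 / 2 on the left against 1 - \<delta>^2 t^2 |u|^2 on the right. This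
  is the source of positive definiteness of the Hessian in \<open>s\<close>.\<close>

lemma \<sigma>q_lower:
 assumes q: "q \<in> S" and \<delta>: "\<delta> > 0"
  and dec: "!!\<phi>. norm (mq q (cline 1 \<phi>)) <= (1 + \<delta> * (norm \<phi>)\<^sup>2) powr (- \<delta>)"
 shows "\<sigma>q q u >= 2 * \<delta>\<^sup>2 * (norm u)\<^sup>2"
proof -
 have fl: "filterlim (%t. complex_of_real t) (at 0) (at_right (0::real))"
  unfolding filterlim_at by (auto intro!: tendsto_eq_intros simp: eventually_at_filter)
 have 1: "((%t::real. Re ((mq q (cline (of_real t) u) - 1) / (of_real t)\<^sup>2)) \<longlongrightarrow> Re (- of_real (\<sigma>q q u) / 2)) (at_right 0)"
  by (intro tendsto_Re filterlim_compose[OF mq_limit[OF q] fl])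
 have fl2: "filterlim (%t::real. t\<^sup>2) (at 0) (at_right (0::real))"
  unfolding filterlim_at by (auto intro!: tendsto_eq_intros simp: eventually_at_filter)
 have "((%x. (1 + \<delta> * x * (norm u)\<^sup>2) powr (- \<delta>)) has_real_derivative - \<delta>\<^sup>2 * (norm u)\<^sup>2) (at 0)"
  by (auto intro!: derivative_eq_intros simp: power2_eq_square)
 hence "((%x. ((1 + \<delta> * x * (norm u)\<^sup>2) powr (- \<delta>) - 1) / x) \<longlongrightarrow> - \<delta>\<^sup>2 * (norm u)\<^sup>2) (at 0)"
  by (simp add: has_field_derivative_iff)
 from filterlim_compose[OF this fl2]
 have 2: "((%t::real. ((1 + \<delta> * t\<^sup>2 * (norm u)\<^sup>2) powr (- \<delta>) - 1) / t\<^sup>2) \<longlongrightarrow> - \<delta>\<^sup>2 * (norm u)\<^sup>2) (at_right 0)" .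
 have "Re (- of_real (\<sigma>q q u) / 2) <= - \<delta>\<^sup>2 * (norm u)\<^sup>2"
 proof (rule tendsto_le[OF _ 2 1])
  have "Re ((mq q (cline (of_real t) u) - 1) / (of_real t)\<^sup>2) <= ((1 + \<delta> * t\<^sup>2 * (norm u)\<^sup>2) powr (- \<delta>) - 1) / t\<^sup>2" if t: "t > 0" for t :: real
  proof -
   have "Re ((mq q (cline (of_real t) u) - 1) / (of_real t)\<^sup>2) = (Re (mq q (cline (of_real t) u)) - 1) / t\<^sup>2"
    by (simp flip: of_real_power)
   also have "... <= ((1 + \<delta> * t\<^sup>2 * (norm u)\<^sup>2) powr (- \<delta>) - 1) / t\<^sup>2"
   proof (intro divide_right_mono diff_right_mono)
    have "cline (of_real t) u = cline 1 (t *\<^sub>R u)" by (simp add: cline_scaleR)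
    thus "Re (mq q (cline (of_real t) u)) <= (1 + \<delta> * t\<^sup>2 * (norm u)\<^sup>2) powr (- \<delta>)"
     using order_trans[OF complex_Re_le_cmod dec[of "t *\<^sub>R u"]] by (simp add: power_mult_distrib mult.assoc)
   qed simp
   finally show ?thesis .
  qed
  thus "\<forall>\<^sub>F t in at_right 0. Re ((mq q (cline (of_real t) u) - 1) / (of_real t)\<^sup>2) <= ((1 + \<delta> * t\<^sup>2 * (norm u)\<^sup>2) powr (- \<delta>) - 1) / t\<^sup>2"
   by (auto simp: eventually_at_filter)
 qed simp
 thus ?thesis by simp
qed

lemma \<sigma>q_pos:
 assumes q: "q \<in> S" and u: "u ~= 0"
 shows "\<sigma>q q u > 0"
proof (rule decay_D)
 fix \<delta> assume "continuous_on S \<delta>" and \<delta>: "!!q. q \<in> S ==> \<delta> q > 0"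
  "!!q \<phi>. q \<in> S ==> norm (mq q (cline 1 \<phi>)) <= (1 + \<delta> q * (norm \<phi>)\<^sup>2) powr (- \<delta> q)"
 have "0 < 2 * (\<delta> q)\<^sup>2 * (norm u)\<^sup>2" using \<delta>(1)[OF q] u by simp
 also have "... <= \<sigma>q q u" by (rule \<sigma>q_lower[OF q \<delta>(1)[OF q] \<delta>(2)[OF q]])
 finally show ?thesis .
qed

end

section \<open>Bounds on compact sets and from partial derivatives\<close>

lemma compact_bounded_above:
 fixes f :: "'a::topological_space => real"
 assumes "compact C" "continuous_on C f"
 obtains B where "B >= 0" "!!x. x \<in> C ==> f x <= B"
proof -
 have "bounded (f ` C)" by (intro compact_imp_bounded compact_continuous_image assms)
 then obtain B where "ALL y:f ` C. norm y <= B" unfolding bounded_iff by blast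
 thus ?thesis by (intro that[of "max B 0"]) (auto simp: abs_le_iff le_max_iff_disj)
qed

lemma has_derivative_from_axis_partials:
 fixes f :: "real ^ 'n => 'b::real_normed_vector"
 assumes A: "open A" and x: "x \<in> A"
  and D: "!!i z. z \<in> A ==> ((%t. f (z + t *\<^sub>R axis i 1)) has_vector_derivative D i z) (at 0)"
  and c: "!!i. continuous_on A (D i)"
 shows "(f has_derivative (%v. SUM i:UNIV. v $ i *\<^sub>R D i x)) (at x)"
proof -
 define j where "j b = (SOME i. b = axis i (1::real))" for b :: "real ^ 'n"
 have j: "b = axis (j b) 1" if "b \<in> Basis" for b :: "real ^ 'n"
  unfolding j_def by (rule someI_ex) (use that in \<open>auto simp: Basis_vec_def\<close>)
 have "(f has_derivative (%v. SUM b:Basis. (v \<bullet> b) *\<^sub>R D (j b) x)) (at x)"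
 proof (rule has_derivative_from_partials[OF A x, where D="%b. D (j b)"])
  fix b z assume b: "b \<in> (Basis :: (real ^ 'n) set)" and z: "z \<in> A"
  show "((%t. f (z + t *\<^sub>R b)) has_vector_derivative D (j b) z) (at 0)"
   by (subst (1) j[OF b]) (rule D[OF z])
 qed (rule c)
 moreover have "(SUM b:Basis. (v \<bullet> b) *\<^sub>R D (j b) x) = (SUM i:UNIV. v $ i *\<^sub>R D i x)" for v
 proof (rule sum.reindex_bij_witness[where i="%i. axis i 1" and j=j])
  fix b :: "real ^ 'n" assume b: "b \<in> Basis"
  show "axis (j b) 1 = b" using j[OF b] by simp
  show "v $ j b *\<^sub>R D (j b) x = (v \<bullet> b) *\<^sub>R D (j b) x" by (subst (3) j[OF b]) (simp add: inner_axis)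
 next
  fix i :: 'n
  have "axis i 1 = axis (j (axis i 1)) (1::real)" by (rule j) (auto simp: Basis_vec_def)
  thus "j (axis i 1) = i" by (simp add: axis_eq_axis)
 qed (auto simp: Basis_vec_def)
 ultimately show ?thesis by simp
qed

lemma has_derivative_axis_bound:
 fixes f :: "real ^ 'n => 'b::real_normed_vector"
 assumes A: "open A" and x: "cball a r \<subseteq> A"
  and D: "!!i z. z \<in> A ==> ((%t. f (z + t *\<^sub>R axis i 1)) has_vector_derivative D i z) (at 0)"
  and c: "!!i. continuous_on A (D i)" and B: "!!i z. z \<in> cball a r ==> norm (D i z) <= B"
  and xy: "x \<in> cball a r" "y \<in> cball a r"
 shows "norm (f x - f y) <= real CARD('n) * B * norm (x - y)"
proof (rule differentiable_bound[OF convex_cball _ _ xy])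
 fix z assume z: "z \<in> cball a r"
 hence zA: "z \<in> A" using x by blast
 show "(f has_derivative (%v. SUM i:UNIV. v $ i *\<^sub>R D i z)) (at z within cball a r)"
  by (rule has_derivative_at_withinI[OF has_derivative_from_axis_partials[OF A zA D c]])
 show "onorm (%v. SUM i:UNIV. v $ i *\<^sub>R D i z) <= real CARD('n) * B"
 proof (rule onorm_le)
  fix v :: "real ^ 'n"
  have "norm (SUM i:UNIV. v $ i *\<^sub>R D i z) <= (SUM i:(UNIV :: 'n set). norm v * B)"
   using B[OF z] by (intro order_trans[OF norm_sum] sum_mono) (auto intro!: mult_mono component_le_norm_cart)
  thus "norm (SUM i:UNIV. v $ i *\<^sub>R D i z) <= real CARD('n) * B * norm v" by (simp add: mult_ac)
 qed
qed

section \<open>Uniform expansions near the base point\<close>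

text \<open>The factor 5 is room for real parts: \<open>\<rho>\<close> for the tilt,
  \<open>\<rho>\<close> for the imaginary part of the contour variable, and
  \<open>3 * \<rho>\<close> for the discs of Cauchy's estimate.\<close>

locale local_cgf = cgf_model R P Y
 for R :: "(real ^ 'p) set" and P :: "real ^ 'p => 'w measure" and Y :: "real ^ 'p => 'w => real ^ 'd" +
 fixes s0 :: "real ^ 'd" and th0 :: "real ^ 'p" and \<rho> :: real
 assumes \<rho>: "\<rho> > 0" and box: "cball s0 (5 * \<rho>) \<times> cball th0 (5 * \<rho>) \<subseteq> S"
begin

abbreviation Q where "Q \<equiv> cball s0 \<rho> \<times> cball th0 \<rho>"
text \<open>Complex arguments near 0 for Cauchy's estimates, and real arguments of every size for
  the contour integral.\<close>

abbreviation Z :: "(complex ^ 'd) set" where "Z \<equiv> ball 0 \<rho> \<union> range (cline 1)"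

lemma Q_S: "q \<in> Q ==> q \<in> S" using box \<rho> by auto

lemma Q_compact: "compact Q" by (intro compact_Times compact_cball)
lemma Q_convex: "convex Q" by (intro convex_Times convex_cball)

lemma box_CD: "Re_vec z \<in> cball s0 (5 * \<rho>) ==> th \<in> cball th0 (5 * \<rho>) ==> (z, th) \<in> CD"
 using box by (auto simp: in_CD_iff)

lemma Im_Z: "\<zeta> \<in> Z ==> norm (Im_vec \<zeta>) <= \<rho>"
proof (erule UnE)
 assume "\<zeta> \<in> ball 0 \<rho>"
 thus ?thesis using norm_Re_Im_vec_le(2)[of \<zeta>] by simp
next
 assume "\<zeta> \<in> range (cline 1)"
 hence "Im_vec \<zeta> = 0" by (auto simp: Im_vec_def cline_def vec_eq_iff)
 thus ?thesis using \<rho> by simp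
qed

text \<open>What \<open>M\<close> and its first parameter derivatives share: holomorphic slices, a
  continuous parameter derivative, and polynomial growth along contours with one constant for the
  whole box.\<close>

definition good :: "((complex ^ 'd) \<times> (real ^ 'p) => complex) => real => nat => bool" where
 "good F G g \<longleftrightarrow> G >= 0 &
  (ALL z0 w th. (%t. F (z0 + t *s w, th)) holomorphic_on {t. (z0 + t *s w, th) \<in> CD}) &
  (ALL i. ALL q:CD. ((%t. F (q + t *\<^sub>R th_dir i)) has_vector_derivative partial (th_dir i) F q) (at 0)) &
  (ALL i. continuous_on CD (partial (th_dir i) F)) &
  (ALL s:cball s0 (5 * \<rho>). ALL th:cball th0 (5 * \<rho>). ALL \<phi>. norm (F (cvec s \<phi>, th)) <= G * (1 + norm \<phi>) ^ g &
   (ALL i. norm (partial (th_dir i) F (cvec s \<phi>, th)) <= G * (1 + norm \<phi>) ^ g))"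

lemma good_D:
 assumes "good F G g"
 shows "G >= 0" "(%t. F (z0 + t *s w, th)) holomorphic_on {t. (z0 + t *s w, th) \<in> CD}"
  "q \<in> CD ==> ((%t. F (q + t *\<^sub>R th_dir i)) has_vector_derivative partial (th_dir i) F q) (at 0)"
  "continuous_on CD (partial (th_dir i) F)"
 using assms unfolding good_def by blast+

lemma good_bound:
 assumes "good F G g" "Re_vec z \<in> cball s0 (5 * \<rho>)" "th \<in> cball th0 (5 * \<rho>)"
 shows "norm (F (z, th)) <= G * (1 + norm (Im_vec z)) ^ g" "norm (partial (th_dir i) F (z, th)) <= G * (1 + norm (Im_vec z)) ^ g"
proof -
 have "ALL \<phi>. norm (F (cvec (Re_vec z) \<phi>, th)) <= G * (1 + norm \<phi>) ^ g &
   (ALL i. norm (partial (th_dir i) F (cvec (Re_vec z) \<phi>, th)) <= G * (1 + norm \<phi>) ^ g)"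
  using assms unfolding good_def by blast
 from this[rule_format, of "Im_vec z"]
 show "norm (F (z, th)) <= G * (1 + norm (Im_vec z)) ^ g" "norm (partial (th_dir i) F (z, th)) <= G * (1 + norm (Im_vec z)) ^ g"
  by (auto simp: cvec_Re_Im)
qed

text \<open>Cauchy's estimate on the line through \<open>z\<close> in direction \<open>w\<close>.
  The disc of radius \<open>3 * \<rho> / norm w\<close> contains 1 and keeps real parts inside the
  box.\<close>

lemma good_z_lipschitz:
 assumes F: "good F G g" and z: "Re_vec z \<in> cball s0 (2 * \<rho>)" and th: "th \<in> cball th0 (5 * \<rho>)" and w: "norm w <= 2 * \<rho>"
 shows "norm (F (z + w, th) - F (z, th)) <= 2 * G * (1 + 3 * \<rho>) ^ g / \<rho> * (1 + norm (Im_vec z)) ^ g * norm w"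
proof (cases "w = 0")
 case False
 define R where "R = 3 * \<rho> / norm w"
 define B where "B = G * ((1 + 3 * \<rho>) * (1 + norm (Im_vec z))) ^ g"
 have R: "R > 1" using False w \<rho> by (simp add: R_def field_simps)
 have tw: "norm (t *s w) <= 3 * \<rho>" if "norm t < R" for t
  using that False by (simp add: norm_vec_scalar_mult R_def field_simps)
 have box': "Re_vec (z + t *s w) \<in> cball s0 (5 * \<rho>)" if "norm t < R" for t
 proof -
  have "norm (Re_vec (t *s w)) <= 3 * \<rho>" using norm_Re_Im_vec_le(1)[of "t *s w"] tw[OF that] by linarith
  moreover have "dist s0 (Re_vec z + Re_vec (t *s w)) <= dist s0 (Re_vec z) + norm (Re_vec (t *s w))"
   using dist_triangle[of s0 "Re_vec z + Re_vec (t *s w)" "Re_vec z"] by (simp add: dist_norm)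
  ultimately show ?thesis using z by (simp add: Re_vec_add)
 qed
 let ?f = "%t. F (z + t *s w, th)"
 have B: "norm (?f t) <= B" if t: "norm t < R" for t
 proof -
  have "norm (?f t) <= G * (1 + norm (Im_vec (z + t *s w))) ^ g"
   by (rule good_bound(1)[OF F box'[OF t] th])
  also have "... <= B" unfolding B_def
  proof (intro mult_left_mono power_mono)
   have "norm (Im_vec (z + t *s w)) <= norm (Im_vec z) + 3 * \<rho>"
    using norm_triangle_ineq[of "Im_vec z" "Im_vec (t *s w)"] norm_Re_Im_vec_le(2)[of "t *s w"] tw[OF t] by (simp add: Im_vec_add)
   moreover have "0 <= 3 * \<rho> * norm (Im_vec z)" using \<rho> by simp
   ultimately show "1 + norm (Im_vec (z + t *s w)) <= (1 + 3 * \<rho>) * (1 + norm (Im_vec z))"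
    by (simp add: algebra_simps)
  qed (use good_D(1)[OF F] in auto)
  finally show ?thesis .
 qed
 have "norm (?f 1 - ?f 0) <= 4 * B / R"
 proof (rule holomorphic_segment_lipschitz)
  show "?f holomorphic_on ball 0 R"
   by (rule holomorphic_on_subset[OF good_D(2)[OF F]]) (use box' box_CD th in auto)
  show "norm (F (z + 1 *s w, th)) <= B" by (rule B) (use R in simp)
 qed (use R B in auto)
 also have "... = 4 / 3 * (B / \<rho> * norm w)" using \<rho> by (simp add: R_def)
 also have "... <= 2 * (B / \<rho> * norm w)"
  using \<rho> good_D(1)[OF F] by (intro mult_right_mono) (auto simp: B_def)
 finally show ?thesis by (simp add: B_def power_mult_distrib mult_ac)
qed simp

lemma good_th_lipschitz:
 assumes F: "good F G g" and z: "Re_vec z \<in> cball s0 (5 * \<rho>)" and th: "th1 \<in> cball th0 (5 * \<rho>)" "th2 \<in> cball th0 (5 * \<rho>)"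
 shows "norm (F (z, th1) - F (z, th2)) <= real CARD('p) * G * (1 + norm (Im_vec z)) ^ g * norm (th1 - th2)"
proof -
 have c: "continuous_on A (%th::real^'p. (z, th))" for A by (intro continuous_intros)
 have "norm (F (z, th1) - F (z, th2)) <= real CARD('p) * (G * (1 + norm (Im_vec z)) ^ g) * norm (th1 - th2)"
 proof (rule has_derivative_axis_bound[OF _ _ _ _ _ th, where A="(%th. (z, th)) -` CD" and D="%i th. partial (th_dir i) F (z, th)"])
  show "open ((%th. (z, th)) -` CD)" by (rule open_vimage[OF open_CD c])
  show "cball th0 (5 * \<rho>) \<subseteq> (%th. (z, th)) -` CD" using box_CD[OF z] by auto
  show "((%t. F (z, th + t *\<^sub>R axis i 1)) has_vector_derivative partial (th_dir i) F (z, th)) (at 0)"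
   if "th \<in> (%th. (z, th)) -` CD" for i th
   using good_D(3)[OF F, of "(z, th)" i] that by (simp add: th_dir_def)
  show "continuous_on ((%th. (z, th)) -` CD) (%th. partial (th_dir i) F (z, th))" for i
   by (rule continuous_on_compose2[OF good_D(4)[OF F] c]) auto
  show "norm (partial (th_dir i) F (z, th)) <= G * (1 + norm (Im_vec z)) ^ g" if "th \<in> cball th0 (5 * \<rho>)" for i th
   by (rule good_bound(2)[OF F z that])
 qed
 thus ?thesis by (simp add: mult_ac)
qed

text \<open>Compactness of the box replaces \<open>\<gamma>\<close> by a constant, and its exponent
  is rounded up to a natural number so that ordinary powers suffice.\<close>

lemma good_M: "EX G g. good M G g & (ALL i. good (partial (th_dir i) M) G g)"
proof (rule growth_bound)
 fix \<gamma> assume \<gamma>: "continuous_on S \<gamma>" "!!q. q \<in> S ==> \<gamma> q > 0"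
  and gb: "!!is js s th \<phi>. (length is, length js) \<in> growth_orders ==> (s, th) \<in> S ==>
   norm (partials (map th_dir is @ map s_dir js) M (cvec s \<phi>, th)) <= \<gamma> (s, th) * (1 + norm \<phi>) powr \<gamma> (s, th)"
 let ?C = "cball s0 (5 * \<rho>) \<times> cball th0 (5 * \<rho>)"
 have C: "compact ?C" by (intro compact_Times compact_cball)
 obtain G1 where G1: "G1 >= 0" "!!q. q \<in> ?C ==> \<gamma> q <= G1"
  using compact_bounded_above[OF C continuous_on_subset[OF \<gamma>(1) box]] by blast
 obtain G2 where G2: "G2 >= 0" "!!q. q \<in> ?C ==> Mr q <= G2"
  using compact_bounded_above[OF C continuous_on_subset[OF Mr_cont box]] by blast
 define g where "g = nat \<lceil>G1\<rceil>"
 define G where "G = max G1 G2"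
 have G: "G >= 0" "G1 <= G" "G2 <= G" using G1 by (auto simp: G_def)
 have g: "G1 <= real g" unfolding g_def by (rule real_nat_ceiling_ge)
 have b: "norm (partials (map th_dir is @ map s_dir js) M (cvec s \<phi>, th)) <= G * (1 + norm \<phi>) ^ g"
  if o: "(length is, length js) \<in> growth_orders" and s: "s \<in> cball s0 (5 * \<rho>)" "th \<in> cball th0 (5 * \<rho>)" for "is" js s th \<phi>
 proof -
  have q: "(s, th) \<in> ?C" using s by simp
  hence qS: "(s, th) \<in> S" using box by blast
  have "norm (partials (map th_dir is @ map s_dir js) M (cvec s \<phi>, th)) <= \<gamma> (s, th) * (1 + norm \<phi>) powr \<gamma> (s, th)"
   by (rule gb[OF o qS])
  also have "... <= G1 * (1 + norm \<phi>) powr real g"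
   using G1(2)[OF q] \<gamma>(2)[OF qS] g by (intro mult_mono powr_mono) auto
  also have "(1 + norm \<phi>) powr real g = (1 + norm \<phi>) ^ g" by (rule powr_realpow) (simp add: add_pos_nonneg)
  also have "G1 * (1 + norm \<phi>) ^ g <= G * (1 + norm \<phi>) ^ g" using G by (intro mult_right_mono) auto
  finally show ?thesis .
 qed
 \<comment> \<open>The growth condition starts at order one; \<open>M\<close> itself is bounded on a
   contour by its value at the real point.\<close>
 have b0: "norm (M (cvec s \<phi>, th)) <= G * (1 + norm \<phi>) ^ g" if s: "s \<in> cball s0 (5 * \<rho>)" "th \<in> cball th0 (5 * \<rho>)" for s th \<phi>
 proof -
  have "norm (M (cvec s \<phi>, th)) <= Mr (s, th)" using M_norm_le[of "cvec s \<phi>" th] by simp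
  also have "... <= G * 1" using G2(2)[of "(s, th)"] s G by auto
  also have "... <= G * (1 + norm \<phi>) ^ g" using G by (intro mult_left_mono one_le_power) auto
  finally show ?thesis .
 qed
 have "good M G g"
  unfolding good_def
 proof (intro conjI allI ballI)
  show "((%t. M (q + t *\<^sub>R th_dir i)) has_vector_derivative partial (th_dir i) M q) (at 0)" if "q \<in> CD" for i q
   using M_partial[OF that, of "Inr i"] by simp
  show "continuous_on CD (partial (th_dir i) M)" for i using M_partial_cont[of "Inr i"] by simp
  show "norm (partial (th_dir i) M (cvec s \<phi>, th)) <= G * (1 + norm \<phi>) ^ g"
   if "s \<in> cball s0 (5 * \<rho>)" "th \<in> cball th0 (5 * \<rho>)" for s th \<phi> i
   using b[of "[i]" "[]", OF _ that] by (simp add: growth_orders_def)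
 qed (use G b0 M_slice_holomorphic in auto)
 moreover have "good (partial (th_dir i) M) G g" for i
  unfolding good_def
 proof (intro conjI allI ballI)
  have m: "\<not> mixed_order (Inr j) (Inr i)" for j by (simp add: mixed_order_def)
  show "((%t. partial (th_dir i) M (q + t *\<^sub>R th_dir j)) has_vector_derivative partial (th_dir j) (partial (th_dir i) M) q) (at 0)" if "q \<in> CD" for j q
   using M_partial2(1)[OF m that] by simp
  show "continuous_on CD (partial (th_dir j) (partial (th_dir i) M))" for j using M_partial2(2)[OF m] by simp
  show "norm (partial (th_dir j) (partial (th_dir i) M) (cvec s \<phi>, th)) <= G * (1 + norm \<phi>) ^ g"
   if "s \<in> cball s0 (5 * \<rho>)" "th \<in> cball th0 (5 * \<rho>)" for s th \<phi> j
   using b[of "[j, i]" "[]", OF _ that] by (simp add: growth_orders_def)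
  show "norm (partial (th_dir i) M (cvec s \<phi>, th)) <= G * (1 + norm \<phi>) ^ g"
   if "s \<in> cball s0 (5 * \<rho>)" "th \<in> cball th0 (5 * \<rho>)" for s th \<phi>
   using b[of "[i]" "[]", OF _ that] by (simp add: growth_orders_def)
 qed (use G th_partial_slice_holomorphic in auto)
 ultimately show ?thesis by blast
qed

text \<open>Polynomial growth together with a Lipschitz estimate in \<open>q\<close> of the same
  growth. The class is closed under products and differences, so it passes from the factors of
  \<open>mq\<close> and \<open>fq\<close> to these functions.\<close>

definition tame :: "((real ^ 'd) \<times> (real ^ 'p) => complex ^ 'd => complex) => real => nat => bool" where
 "tame F A k \<longleftrightarrow> A >= 0 & (ALL q:Q. ALL \<zeta>:Z. norm (F q \<zeta>) <= A * (1 + norm \<zeta>) ^ k &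
  (ALL q':Q. norm (F q \<zeta> - F q' \<zeta>) <= A * (1 + norm \<zeta>) ^ k * dist q q'))"

lemma tameI:
 assumes "A >= 0" "!!q \<zeta>. q \<in> Q ==> \<zeta> \<in> Z ==> norm (F q \<zeta>) <= A * (1 + norm \<zeta>) ^ k"
  "!!q q' \<zeta>. q \<in> Q ==> q' \<in> Q ==> \<zeta> \<in> Z ==> norm (F q \<zeta> - F q' \<zeta>) <= A * (1 + norm \<zeta>) ^ k * dist q q'"
 shows "tame F A k"
 using assms unfolding tame_def by blast

lemma tameD:
 assumes "tame F A k"
 shows "A >= 0" "q \<in> Q ==> \<zeta> \<in> Z ==> norm (F q \<zeta>) <= A * (1 + norm \<zeta>) ^ k"
  "q \<in> Q ==> q' \<in> Q ==> \<zeta> \<in> Z ==> norm (F q \<zeta> - F q' \<zeta>) <= A * (1 + norm \<zeta>) ^ k * dist q q'"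
 using assms unfolding tame_def by blast+

lemma tame_mono:
 assumes F: "tame F A k" and "A <= A'" "k <= k'"
 shows "tame F A' k'"
proof -
 have b: "A * (1 + norm \<zeta>) ^ k <= A' * (1 + norm \<zeta>) ^ k'" for \<zeta> :: "complex ^ 'd"
  using assms tameD(1)[OF F] by (intro mult_mono power_increasing) auto
 show ?thesis
 proof (rule tameI)
  show "A' >= 0" using tameD(1)[OF F] assms by simp
  fix q q' \<zeta> assume q: "q \<in> Q" "\<zeta> \<in> Z"
  show "norm (F q \<zeta>) <= A' * (1 + norm \<zeta>) ^ k'" using tameD(2)[OF F q] b[of \<zeta>] by linarith
  assume q': "q' \<in> Q"
  show "norm (F q \<zeta> - F q' \<zeta>) <= A' * (1 + norm \<zeta>) ^ k' * dist q q'"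
   using tameD(3)[OF F q(1) q' q(2)] mult_right_mono[OF b[of \<zeta>] zero_le_dist[of q q']] by linarith
 qed
qed

lemma tame_mult:
 assumes F: "tame F A k" and G: "tame G B l"
 shows "tame (%q \<zeta>. F q \<zeta> * G q \<zeta>) (2 * A * B) (k + l)"
proof (rule tameI)
 show "2 * A * B >= 0" using tameD(1)[OF F] tameD(1)[OF G] by simp
 fix q q' \<zeta> assume q: "q \<in> Q" "\<zeta> \<in> Z"
 let ?x = "1 + norm \<zeta>"
 have "norm (F q \<zeta> * G q \<zeta>) <= (A * ?x ^ k) * (B * ?x ^ l)"
  unfolding norm_mult using tameD(1)[OF F] by (intro mult_mono tameD(2)[OF F q] tameD(2)[OF G q]) auto
 also have "... <= 2 * ((A * ?x ^ k) * (B * ?x ^ l))" using tameD(1)[OF F] tameD(1)[OF G] by simp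
 also have "... = 2 * A * B * ?x ^ (k + l)" by (simp add: power_add)
 finally show "norm (F q \<zeta> * G q \<zeta>) <= 2 * A * B * ?x ^ (k + l)" .
 assume q': "q' \<in> Q"
 have "F q \<zeta> * G q \<zeta> - F q' \<zeta> * G q' \<zeta> = (F q \<zeta> - F q' \<zeta>) * G q \<zeta> + F q' \<zeta> * (G q \<zeta> - G q' \<zeta>)"
  by (simp add: algebra_simps)
 also have "norm ... <= (A * ?x ^ k * dist q q') * (B * ?x ^ l) + (A * ?x ^ k) * (B * ?x ^ l * dist q q')"
 proof (rule norm_triangle_mono; unfold norm_mult)
  show "norm (F q \<zeta> - F q' \<zeta>) * norm (G q \<zeta>) <= (A * ?x ^ k * dist q q') * (B * ?x ^ l)"
   using tameD(1)[OF F] by (intro mult_mono tameD(3)[OF F q(1) q' q(2)] tameD(2)[OF G q]) auto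
  show "norm (F q' \<zeta>) * norm (G q \<zeta> - G q' \<zeta>) <= (A * ?x ^ k) * (B * ?x ^ l * dist q q')"
   using tameD(1)[OF F] by (intro mult_mono tameD(2)[OF F q' q(2)] tameD(3)[OF G q(1) q' q(2)]) auto
 qed
 also have "... = 2 * A * B * ?x ^ (k + l) * dist q q'" by (simp add: power_add)
 finally show "norm (F q \<zeta> * G q \<zeta> - F q' \<zeta> * G q' \<zeta>) <= 2 * A * B * ?x ^ (k + l) * dist q q'" .
qed

lemma tame_diff:
 assumes F: "tame F A k" and G: "tame G B l"
 shows "tame (%q \<zeta>. F q \<zeta> - G q \<zeta>) (A + B) (k + l)"
proof (rule tameI)
 show AB: "A + B >= 0" using tameD(1)[OF F] tameD(1)[OF G] by simp
 have F': "tame F A (k + l)" and G': "tame G B (k + l)" using F G by (auto elim!: tame_mono)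
 fix q q' \<zeta> assume q: "q \<in> Q" "\<zeta> \<in> Z"
 show "norm (F q \<zeta> - G q \<zeta>) <= (A + B) * (1 + norm \<zeta>) ^ (k + l)"
  using norm_triangle_ineq4[of "F q \<zeta>" "G q \<zeta>"] tameD(2)[OF F' q] tameD(2)[OF G' q] unfolding distrib_right by linarith
 assume q': "q' \<in> Q"
 have "norm ((F q \<zeta> - F q' \<zeta>) - (G q \<zeta> - G q' \<zeta>)) <= A * (1 + norm \<zeta>) ^ (k + l) * dist q q' + B * (1 + norm \<zeta>) ^ (k + l) * dist q q'"
  by (rule norm_triangle_le_diff[OF add_mono[OF tameD(3)[OF F' q(1) q' q(2)] tameD(3)[OF G' q(1) q' q(2)]]])
 thus "norm (F q \<zeta> - G q \<zeta> - (F q' \<zeta> - G q' \<zeta>)) <= (A + B) * (1 + norm \<zeta>) ^ (k + l) * dist q q'"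
  by (simp add: algebra_simps)
qed

lemma dist_fst_snd_le:
 fixes a b :: "'x::metric_space \<times> 'y::metric_space"
 shows "dist (fst a) (fst b) <= dist a b" "dist (snd a) (snd b) <= dist a b"
 unfolding dist_prod_def by (auto intro: real_le_rsqrt)

lemma good_tame:
 assumes F: "good F G g"
 shows "EX A. tame (%q \<zeta>. F (cvec (fst q) 0 + \<i> *s \<zeta>, snd q)) A g"
proof -
 define L where "L = 2 * G * (1 + 3 * \<rho>) ^ g / \<rho>"
 have G: "G >= 0" by (rule good_D(1)[OF F])
 have L: "L >= 0" using G \<rho> by (simp add: L_def)
 have Im: "(1 + norm (Im_vec (cvec s 0 + \<i> *s \<zeta>))) ^ g <= (1 + norm \<zeta>) ^ g" for s \<zeta>
  using norm_Re_Im_vec_le(1)[of \<zeta>] by (intro power_mono) (auto simp: Im_vec_add)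
 have Re: "Re_vec (cvec s 0 + \<i> *s \<zeta>) \<in> cball s0 (2 * \<rho>)" if "s \<in> cball s0 \<rho>" "\<zeta> \<in> Z" for s \<zeta>
 proof -
  have "dist s0 (s - Im_vec \<zeta>) <= dist s0 s + norm (Im_vec \<zeta>)"
   using dist_triangle[of s0 "s - Im_vec \<zeta>" s] by (simp add: dist_norm)
  also have "... <= \<rho> + \<rho>" using that Im_Z[OF that(2)] by (intro add_mono) auto
  finally show ?thesis by (simp add: Re_vec_add)
 qed
 have Re5: "Re_vec (cvec s 0 + \<i> *s \<zeta>) \<in> cball s0 (5 * \<rho>)" if "s \<in> cball s0 \<rho>" "\<zeta> \<in> Z" for s \<zeta>
  using Re[OF that] \<rho> by simp
 have T5: "th \<in> cball th0 (5 * \<rho>)" if "th \<in> cball th0 \<rho>" for th using that \<rho> by simp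
 have "tame (%q \<zeta>. F (cvec (fst q) 0 + \<i> *s \<zeta>, snd q)) (G + (real CARD('p) * G + L)) g"
 proof (rule tameI)
  show "0 <= G + (real CARD('p) * G + L)" using G L by simp
  fix q q' :: "(real ^ 'd) \<times> (real ^ 'p)" and \<zeta> assume q: "q \<in> Q" and \<zeta>: "\<zeta> \<in> Z"
  hence q1: "fst q \<in> cball s0 \<rho>" "snd q \<in> cball th0 \<rho>" by auto
  have x0: "0 <= (1 + norm \<zeta>) ^ g" by simp
  have "norm (F (cvec (fst q) 0 + \<i> *s \<zeta>, snd q)) <= G * (1 + norm \<zeta>) ^ g"
   using good_bound(1)[OF F Re5[OF q1(1) \<zeta>] T5[OF q1(2)]] mult_left_mono[OF Im G] order_trans by blast
  also have "... <= (G + (real CARD('p) * G + L)) * (1 + norm \<zeta>) ^ g" using G L by (intro mult_right_mono x0) auto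
  finally show "norm (F (cvec (fst q) 0 + \<i> *s \<zeta>, snd q)) <= (G + (real CARD('p) * G + L)) * (1 + norm \<zeta>) ^ g" .
  assume q': "q' \<in> Q"
  hence q2: "fst q' \<in> cball s0 \<rho>" "snd q' \<in> cball th0 \<rho>" by auto
  let ?z = "%q. cvec (fst q) 0 + \<i> *s \<zeta>"
  have w: "?z q = ?z q' + cvec (fst q - fst q') 0" by (simp add: cvec_def vec_eq_iff complex_eq_iff)
  have nw: "norm (cvec (fst q - fst q') 0) <= 2 * \<rho>"
   using q1(1) q2(1) dist_triangle2[of "fst q" "fst q'" s0] by (simp add: norm_cvec_0 dist_norm norm_minus_commute)
  have "norm (F (?z q, snd q) - F (?z q, snd q')) <= real CARD('p) * G * (1 + norm (Im_vec (?z q))) ^ g * norm (snd q - snd q')"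
   by (rule good_th_lipschitz[OF F Re5[OF q1(1) \<zeta>] T5[OF q1(2)] T5[OF q2(2)]])
  also have "... <= real CARD('p) * G * (1 + norm \<zeta>) ^ g * dist q q'"
   using G Im dist_fst_snd_le(2)[of q q'] by (intro mult_mono) (auto simp: dist_norm)
  finally have 1: "norm (F (?z q, snd q) - F (?z q, snd q')) <= real CARD('p) * G * (1 + norm \<zeta>) ^ g * dist q q'" .
  have "norm (F (?z q, snd q') - F (?z q', snd q')) <= L * (1 + norm (Im_vec (?z q'))) ^ g * norm (cvec (fst q - fst q') 0)"
   unfolding w L_def by (rule good_z_lipschitz[OF F Re[OF q2(1) \<zeta>] T5[OF q2(2)] nw])
  also have "... <= L * (1 + norm \<zeta>) ^ g * dist q q'"
   using L Im dist_fst_snd_le(1)[of q q'] by (intro mult_mono) (auto simp: dist_norm norm_cvec_0)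
  finally have 2: "norm (F (?z q, snd q') - F (?z q', snd q')) <= L * (1 + norm \<zeta>) ^ g * dist q q'" .
  have "norm (F (?z q, snd q) - F (?z q', snd q')) <= real CARD('p) * G * (1 + norm \<zeta>) ^ g * dist q q' + L * (1 + norm \<zeta>) ^ g * dist q q'"
   using norm_triangle_mono[OF 1 2] by simp
  also have "... = (real CARD('p) * G + L) * ((1 + norm \<zeta>) ^ g * dist q q')" by (simp add: algebra_simps)
  also have "... <= (G + (real CARD('p) * G + L)) * ((1 + norm \<zeta>) ^ g * dist q q')"
   using G by (intro mult_right_mono) auto
  finally show "norm (F (?z q, snd q) - F (?z q', snd q')) <= (G + (real CARD('p) * G + L)) * (1 + norm \<zeta>) ^ g * dist q q'"
   by (simp add: mult.assoc)
 qed
 thus ?thesis by blast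
qed

lemma C1_lipschitz:
 assumes d: "!!x z. z \<in> S ==> ((%t. f (z + t *\<^sub>R dir x)) has_real_derivative Df x z) (at 0)"
  and c: "!!x. continuous_on S (Df x)"
 shows "EX B>=0. ALL q:Q. \<bar>f q\<bar> <= B & (ALL q':Q. \<bar>f q - f q'\<bar> <= B * dist q q')"
proof -
 have der: "q \<in> S ==> (f has_derivative (%v. SUM x:UNIV. (v \<bullet> dir x) * Df x q)) (at q)" for q
  by (rule S_has_derivative[OF d c])
 have QS: "Q \<subseteq> S" using Q_S by blast
 have "continuous_on Q (%q. SUM x:UNIV. \<bar>Df x q\<bar>)" by (intro continuous_intros continuous_on_subset[OF c QS])
 from compact_bounded_above[OF Q_compact this] obtain B where B: "B >= 0" "!!q. q \<in> Q ==> (SUM x:UNIV. \<bar>Df x q\<bar>) <= B" by blast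
 have "continuous_on S f" using der has_derivative_continuous by (intro continuous_at_imp_continuous_on) blast
 hence "continuous_on Q (%q. \<bar>f q\<bar>)" by (intro continuous_intros continuous_on_subset[OF _ QS])
 from compact_bounded_above[OF Q_compact this] obtain B' where B': "B' >= 0" "!!q. q \<in> Q ==> \<bar>f q\<bar> <= B'" by blast
 have "\<bar>f q - f q'\<bar> <= B * dist q q'" if q: "q \<in> Q" "q' \<in> Q" for q q'
 proof -
  have "norm (f q - f q') <= B * norm (q - q')"
  proof (rule differentiable_bound[OF Q_convex _ _ q])
   fix z assume z: "z \<in> Q"
   show "(f has_derivative (%v. SUM x:UNIV. (v \<bullet> dir x) * Df x z)) (at z within Q)"
    by (rule has_derivative_at_withinI[OF der[OF Q_S[OF z]]])
   show "onorm (%v :: (real ^ 'd) \<times> (real ^ 'p). SUM x:UNIV. (v \<bullet> dir x) * Df x z) <= B"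
   proof (rule onorm_le)
    fix v :: "(real ^ 'd) \<times> (real ^ 'p)"
    have "norm (SUM x:UNIV. (v \<bullet> dir x) * Df x z) <= (SUM x:UNIV. norm v * \<bar>Df x z\<bar>)"
    proof (rule order_trans[OF norm_sum sum_mono])
     fix x :: "'d + 'p"
     have "(dir x :: (real ^ 'd) \<times> (real ^ 'p)) \<in> Basis" using bij_dir by (auto simp: bij_betw_def)
     thus "norm ((v \<bullet> dir x) * Df x z) <= norm v * \<bar>Df x z\<bar>"
      unfolding real_norm_def abs_mult by (intro mult_right_mono Basis_le_norm) auto
    qed
    also have "... = norm v * (SUM x:UNIV. \<bar>Df x z\<bar>)" by (simp add: sum_distrib_left)
    also have "... <= norm v * B" by (intro mult_left_mono B z) auto
    finally show "norm (SUM x:UNIV. (v \<bullet> dir x) * Df x z) <= B * norm v" by (simp add: mult.commute)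
   qed
  qed
  thus ?thesis by (simp add: dist_norm)
 qed
 note lip = this
 show ?thesis
 proof (intro exI[of _ "B + B'"] conjI ballI)
  fix q q' assume q: "q \<in> Q"
  show "\<bar>f q\<bar> <= B + B'" using B'(2)[OF q] B(1) by simp
  assume q': "q' \<in> Q"
  have "B * dist q q' <= (B + B') * dist q q'" using B'(1) by (intro mult_right_mono) auto
  thus "\<bar>f q - f q'\<bar> <= (B + B') * dist q q'" using lip[OF q q'] by linarith
 qed (use B B' in simp)
qed

lemma yq_lipschitz: "EX B>=0. ALL q:Q. norm (yq q) <= B & (ALL q':Q. norm (yq q - yq q') <= B * dist q q')"
proof -
 have "ALL j. EX B. B >= 0 & (ALL q:Q. \<bar>k1 (Inl j) q\<bar> <= B & (ALL q':Q. \<bar>k1 (Inl j) q - k1 (Inl j) q'\<bar> <= B * dist q q'))"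
  using C1_lipschitz[OF k1_partial k2_cont] by blast
 then obtain B where B: "!!j. B j >= 0" "!!j q. q \<in> Q ==> \<bar>k1 (Inl j) q\<bar> <= B j"
  "!!j q q'. q \<in> Q ==> q' \<in> Q ==> \<bar>k1 (Inl j) q - k1 (Inl j) q'\<bar> <= B j * dist q q'"
  by (subst (asm) choice_iff) blast
 show ?thesis
 proof (intro exI[of _ "SUM j:UNIV. B j"] conjI ballI)
  fix q q' assume q: "q \<in> Q"
  show "norm (yq q) <= (SUM j:UNIV. B j)"
   using B(2)[OF q] by (intro order_trans[OF norm_le_l1_cart] sum_mono) (simp add: yq_def)
  assume q': "q' \<in> Q"
  show "norm (yq q - yq q') <= (SUM j:UNIV. B j) * dist q q'"
   unfolding sum_distrib_right using B(3)[OF q q'] by (intro order_trans[OF norm_le_l1_cart] sum_mono) (simp add: yq_def)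
 qed (use B(1) in \<open>simp add: sum_nonneg\<close>)
qed

text \<open>The exponential has norm exp of the inner product of \<open>Im_vec \<zeta>\<close> and
  \<open>yq q\<close>, which is bounded because imaginary parts on \<open>Z\<close> stay within
  \<open>\<rho>\<close>.\<close>

lemma tame_exp: "EX A. tame (%q \<zeta>. exp (- \<i> * zdot \<zeta> (yq q))) A 1"
proof -
 obtain B where B: "B >= 0" "!!q. q \<in> Q ==> norm (yq q) <= B"
  "!!q q'. q \<in> Q ==> q' \<in> Q ==> norm (yq q - yq q') <= B * dist q q'"
  using yq_lipschitz by blast
 define E where "E = exp (\<rho> * B)"
 define A where "A = E * (1 + real CARD('d) * B)"
 have E: "E >= 1" "E >= 0" using \<rho> B by (auto simp: E_def)
 have re: "Re (- \<i> * zdot \<zeta> (yq q)) <= \<rho> * B" if "q \<in> Q" "\<zeta> \<in> Z" for q \<zeta>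
 proof -
  have "Re (- \<i> * zdot \<zeta> (yq q)) = Im_vec \<zeta> \<bullet> yq q"
   by (simp add: zdot_def Im_vec_def inner_vec_def)
  also have "... <= norm (Im_vec \<zeta>) * norm (yq q)" by (rule norm_cauchy_schwarz)
  also have "... <= \<rho> * B" using \<rho> by (intro mult_mono Im_Z B that) auto
  finally show ?thesis .
 qed
 have "tame (%q \<zeta>. exp (- \<i> * zdot \<zeta> (yq q))) A 1"
 proof (rule tameI)
  show A0: "A >= 0" using E B by (simp add: A_def)
  fix q q' and \<zeta> :: "complex ^ 'd" assume q: "q \<in> Q" "\<zeta> \<in> Z"
  have "norm (exp (- \<i> * zdot \<zeta> (yq q))) <= E" unfolding norm_exp_eq_Re E_def using re[OF q] by simp
  also have "... <= A" using E B by (simp add: A_def mult_le_cancel_left1)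
  also have "A * 1 <= A * (1 + norm \<zeta>) ^ 1" using A0 by (intro mult_left_mono) auto
  finally show "norm (exp (- \<i> * zdot \<zeta> (yq q))) <= A * (1 + norm \<zeta>) ^ 1" by simp
  assume q': "q' \<in> Q"
  have lin: "zdot \<zeta> (yq q) - zdot \<zeta> (yq q') = zdot \<zeta> (yq q - yq q')"
   by (simp add: zdot_def sum_subtractf right_diff_distrib)
  have "(SUM j:UNIV. norm (\<zeta> $ j)) <= (SUM j:(UNIV::'d set). norm \<zeta>)" by (intro sum_mono Finite_Cartesian_Product.norm_nth_le)
  hence s: "(SUM j:UNIV. norm (\<zeta> $ j)) <= real CARD('d) * norm \<zeta>" by simp
  have "norm (exp (- \<i> * zdot \<zeta> (yq q)) - exp (- \<i> * zdot \<zeta> (yq q'))) <= E * norm (- \<i> * zdot \<zeta> (yq q) - - \<i> * zdot \<zeta> (yq q'))"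
   unfolding E_def by (intro cmod_exp_diff_le re q q')
  also have "norm (- \<i> * zdot \<zeta> (yq q) - - \<i> * zdot \<zeta> (yq q')) = norm (zdot \<zeta> (yq q - yq q'))"
   unfolding lin[symmetric] by (simp add: norm_mult flip: right_diff_distrib) (metis norm_minus_commute)
  also have "E * norm (zdot \<zeta> (yq q - yq q')) <= E * ((real CARD('d) * norm \<zeta>) * (B * dist q q'))"
   by (rule mult_left_mono[OF order_trans[OF norm_zdot_le mult_mono[OF s B(3)[OF q(1) q']]]]) (use E in auto)
  also have "E * ((real CARD('d) * norm \<zeta>) * (B * dist q q')) = (E * (real CARD('d) * B)) * (norm \<zeta> * dist q q')" by simp
  also have "... <= A * ((1 + norm \<zeta>) * dist q q')"
   unfolding A_def using E B by (intro mult_mono mult_left_mono mult_right_mono) auto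
  finally show "norm (exp (- \<i> * zdot \<zeta> (yq q)) - exp (- \<i> * zdot \<zeta> (yq q'))) <= A * (1 + norm \<zeta>) ^ 1 * dist q q'"
   using E(2) by (simp add: mult.assoc)
 qed
 thus ?thesis by blast
qed

lemma tame_real:
 assumes "EX B>=0. ALL q:Q. \<bar>f q\<bar> <= B & (ALL q':Q. \<bar>f q - f q'\<bar> <= B * dist q q')"
 shows "EX A. tame (%q \<zeta>. complex_of_real (f q)) A 0"
proof -
 obtain B where B: "B >= 0" "!!q. q \<in> Q ==> \<bar>f q\<bar> <= B"
  "!!q q'. q \<in> Q ==> q' \<in> Q ==> \<bar>f q - f q'\<bar> <= B * dist q q'"
  using assms by blast
 have "tame (%q \<zeta>. complex_of_real (f q)) B 0"
  by (rule tameI) (use B in \<open>auto simp flip: of_real_diff\<close>)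
 thus ?thesis by blast
qed

lemma Mr_inverse_lipschitz: "EX B>=0. ALL q:Q. \<bar>1 / Mr q\<bar> <= B & (ALL q':Q. \<bar>1 / Mr q - 1 / Mr q'\<bar> <= B * dist q q')"
proof -
 obtain B where B: "B >= 0" "!!q q'. q \<in> Q ==> q' \<in> Q ==> \<bar>Mr q - Mr q'\<bar> <= B * dist q q'"
  using C1_lipschitz[OF Mr_partial D1_cont] by blast
 have QS: "Q \<subseteq> S" using Q_S by blast
 have "continuous_on Q (%q. 1 / Mr q)" using Mr_pos Q_S
  by (intro continuous_intros continuous_on_subset[OF Mr_cont QS]) force
 from compact_bounded_above[OF Q_compact this] obtain N where N: "N >= 0" "!!q. q \<in> Q ==> 1 / Mr q <= N" by blast
 have "\<bar>1 / Mr q - 1 / Mr q'\<bar> <= (N * N * B) * dist q q'" if q: "q \<in> Q" "q' \<in> Q" for q q'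
 proof -
  have p: "Mr q > 0" "Mr q' > 0" using Mr_pos Q_S q by auto
  have "1 / Mr q - 1 / Mr q' = (1 / Mr q) * (1 / Mr q') * (Mr q' - Mr q)" using p by (simp add: field_simps)
  hence "\<bar>1 / Mr q - 1 / Mr q'\<bar> = (1 / Mr q) * (1 / Mr q') * \<bar>Mr q' - Mr q\<bar>" using p by (simp add: abs_mult)
  also have "... <= N * N * (B * dist q q')"
   using p N(1) N(2)[OF q(1)] N(2)[OF q(2)] B(2)[OF q] by (intro mult_mono) (auto simp: abs_minus_commute)
  finally show ?thesis by (simp add: mult_ac)
 qed
 note lip = this
 show ?thesis
 proof (intro exI[of _ "N + N * N * B"] conjI ballI)
  fix q q' assume q: "q \<in> Q"
  have "\<bar>1 / Mr q\<bar> = 1 / Mr q" using Mr_pos[OF Q_S[OF q]] by simp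
  thus "\<bar>1 / Mr q\<bar> <= N + N * N * B" using N(2)[OF q] N(1) B(1) by (simp add: add_increasing2)
  assume q': "q' \<in> Q"
  have "(N * N * B) * dist q q' <= (N + N * N * B) * dist q q'" using N(1) by (intro mult_right_mono) auto
  thus "\<bar>1 / Mr q - 1 / Mr q'\<bar> <= (N + N * N * B) * dist q q'" using lip[OF q q'] by linarith
 qed (use N B in simp)
qed

lemma tame_mq_fq: "EX A k. tame mq A k & (ALL i. tame (fq i) A k)"
proof -
 obtain G g where G: "good M G g" "!!i. good (partial (th_dir i) M) G g" using good_M by blast
 obtain A1 where A1: "tame (%q \<zeta>. M (cvec (fst q) 0 + \<i> *s \<zeta>, snd q)) A1 g" using good_tame[OF G(1)] by blast
 obtain A2 where A2: "tame (%q \<zeta>. complex_of_real (1 / Mr q)) A2 0" using tame_real[OF Mr_inverse_lipschitz] by blast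
 obtain A3 where A3: "tame (%q \<zeta>. exp (- \<i> * zdot \<zeta> (yq q))) A3 1" using tame_exp by blast
 have "tame (%q \<zeta>. M (cvec (fst q) 0 + \<i> *s \<zeta>, snd q) * complex_of_real (1 / Mr q) * exp (- \<i> * zdot \<zeta> (yq q))) (2 * (2 * A1 * A2) * A3) (g + 0 + 1)"
  by (intro tame_mult A1 A2 A3)
 moreover have "(%q \<zeta>. M (cvec (fst q) 0 + \<i> *s \<zeta>, snd q) * complex_of_real (1 / Mr q) * exp (- \<i> * zdot \<zeta> (yq q))) = mq"
  by (simp add: mq_def fun_eq_iff)
 ultimately obtain B k where mt: "tame mq B k" by auto
 have "EX A k. tame (fq i) A k" for i
 proof -
  obtain A4 where A4: "tame (%q \<zeta>. partial (th_dir i) M (cvec (fst q) 0 + \<i> *s \<zeta>, snd q)) A4 g" using good_tame[OF G(2)] by blast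
  obtain A5 where A5: "tame (%q \<zeta>. complex_of_real (k1 (Inr i) q)) A5 0"
   using tame_real[OF C1_lipschitz[OF k1_partial k2_cont]] by blast
  have "tame (%q \<zeta>. partial (th_dir i) M (cvec (fst q) 0 + \<i> *s \<zeta>, snd q) * complex_of_real (1 / Mr q) * exp (- \<i> * zdot \<zeta> (yq q))
    - complex_of_real (k1 (Inr i) q) * mq q \<zeta>) (2 * (2 * A4 * A2) * A3 + 2 * A5 * B) (g + 0 + 1 + (0 + k))"
   by (intro tame_diff tame_mult A4 A2 A3 A5 mt)
  moreover have "(%q \<zeta>. partial (th_dir i) M (cvec (fst q) 0 + \<i> *s \<zeta>, snd q) * complex_of_real (1 / Mr q) * exp (- \<i> * zdot \<zeta> (yq q))
    - complex_of_real (k1 (Inr i) q) * mq q \<zeta>) = fq i"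
   by (simp add: fq_def fun_eq_iff)
  ultimately show ?thesis by metis
 qed
 then obtain Af kf where f: "!!i. tame (fq i) (Af i) (kf i)" by metis
 have Af: "Af i >= 0" for i by (rule tameD(1)[OF f])
 show ?thesis
 proof (intro exI conjI allI)
  show "tame mq (B + (SUM i:UNIV. Af i)) (k + (SUM i:UNIV. kf i))"
   using Af by (intro tame_mono[OF mt]) (auto simp: sum_nonneg)
  show "tame (fq i) (B + (SUM i:UNIV. Af i)) (k + (SUM i:UNIV. kf i))" for i
  proof (rule tame_mono[OF f])
   have "Af i <= (SUM i:UNIV. Af i)" using Af by (intro member_le_sum) auto
   thus "Af i <= B + (SUM i:UNIV. Af i)" using tameD(1)[OF mt] by simp
   have "kf i <= (SUM i:UNIV. kf i)" by (intro member_le_sum) auto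
   thus "kf i <= k + (SUM i:UNIV. kf i)" by simp
  qed
 qed
qed

lemma good_continuous:
 assumes F: "good F G g" and s: "s \<in> cball s0 (2 * \<rho>)" and th: "th \<in> cball th0 (5 * \<rho>)"
 shows "continuous_on UNIV (%\<phi>. F (cvec s \<phi>, th))"
proof (rule continuous_at_imp_continuous_on, rule ballI)
 fix \<phi>0 :: "real ^ 'd"
 define c where "c = 2 * G * (1 + 3 * \<rho>) ^ g / \<rho> * (1 + norm \<phi>0) ^ g"
 have "((%\<phi>. F (cvec s \<phi>, th) - F (cvec s \<phi>0, th)) \<longlongrightarrow> 0) (at \<phi>0)"
 proof (rule Lim_null_comparison)
  have "\<forall>\<^sub>F \<phi> in at \<phi>0. dist \<phi> \<phi>0 < 2 * \<rho>" using \<rho> by (auto simp: eventually_at)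
  thus "\<forall>\<^sub>F \<phi> in at \<phi>0. norm (F (cvec s \<phi>, th) - F (cvec s \<phi>0, th)) <= c * norm (\<phi> - \<phi>0)"
  proof eventually_elim
   case (elim \<phi>)
   have n: "norm (cvec 0 (\<phi> - \<phi>0)) = norm (\<phi> - \<phi>0)" by (simp add: cvec_def norm_vec_def L2_set_def cmod_def)
   have "cvec s \<phi> = cvec s \<phi>0 + cvec 0 (\<phi> - \<phi>0)" by (simp add: cvec_def vec_eq_iff complex_eq_iff)
   thus ?case using good_z_lipschitz[OF F _ th, of "cvec s \<phi>0" "cvec 0 (\<phi> - \<phi>0)"] elim s
    by (simp add: n dist_norm c_def)
  qed
  have "((%\<phi>. c * norm (\<phi> - \<phi>0)) \<longlongrightarrow> c * norm (\<phi>0 - \<phi>0)) (at \<phi>0)" by (intro tendsto_intros)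
  thus "((%\<phi>. c * norm (\<phi> - \<phi>0)) \<longlongrightarrow> 0) (at \<phi>0)" by simp
 qed
 thus "isCont (%\<phi>. F (cvec s \<phi>, th)) \<phi>0" unfolding isCont_def by (rule LIM_zero_cancel)
qed

lemma Q_D: "q \<in> Q ==> fst q \<in> cball s0 (2 * \<rho>)" "q \<in> Q ==> snd q \<in> cball th0 (5 * \<rho>)"
 using \<rho> by auto

lemma zdot_cline_continuous: "continuous_on UNIV (%\<phi>. zdot (cline 1 \<phi>) y)"
 unfolding zdot_def cline_def by (auto intro!: continuous_intros)

lemma mq_fq_continuous:
 assumes q: "q \<in> Q"
 shows "continuous_on UNIV (%\<phi>. mq q (cline 1 \<phi>))" "continuous_on UNIV (%\<phi>. fq i q (cline 1 \<phi>))"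
proof -
 obtain G g where G: "good M G g" "!!i. good (partial (th_dir i) M) G g" using good_M by blast
 show m: "continuous_on UNIV (%\<phi>. mq q (cline 1 \<phi>))"
  unfolding mq_def cvec_split
  by (intro continuous_intros good_continuous[OF G(1)] zdot_cline_continuous Q_D q)
 show "continuous_on UNIV (%\<phi>. fq i q (cline 1 \<phi>))"
  unfolding fq_def cvec_split
  by (intro continuous_intros good_continuous[OF G(2)] zdot_cline_continuous Q_D q m)
qed

lemma mq_fq_holomorphic:
 assumes q: "q \<in> Q" and A: "!!t. t \<in> A ==> norm (t *s w) < \<rho>"
 shows "(%t. mq q (t *s w)) holomorphic_on A" "(%t. fq i q (t *s w)) holomorphic_on A"
proof -
 have sc: "cvec (fst q) 0 + \<i> *s (t *s w) = cvec (fst q) 0 + t *s (\<i> *s w)" for t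
  by (simp add: vec_eq_iff mult_ac)
 have sub: "A \<subseteq> {t. (cvec (fst q) 0 + t *s (\<i> *s w), snd q) \<in> CD}"
 proof
  fix t assume "t \<in> A"
  hence n: "norm (Im_vec (t *s w)) < \<rho>" using A norm_Re_Im_vec_le(2)[of "t *s w"] by fastforce
  have q': "dist s0 (fst q) <= \<rho>" "snd q \<in> cball th0 (5 * \<rho>)" using q \<rho> by auto
  have "dist s0 (fst q - Im_vec (t *s w)) <= dist s0 (fst q) + norm (Im_vec (t *s w))"
   using dist_triangle[of s0 "fst q - Im_vec (t *s w)" "fst q"] by (simp add: dist_norm)
  also have "... <= 5 * \<rho>" using n q' \<rho> by linarith
  finally have "Re_vec (cvec (fst q) 0 + \<i> *s (t *s w)) \<in> cball s0 (5 * \<rho>)"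
   by (simp only: Re_vec_add Re_vec_cvec Re_Im_vec_i) simp
  thus "t \<in> {t. (cvec (fst q) 0 + t *s (\<i> *s w), snd q) \<in> CD}" using box_CD q'(2) unfolding sc by simp
 qed
 show m: "(%t. mq q (t *s w)) holomorphic_on A"
  unfolding mq_def sc zdot_scale
  by (intro holomorphic_intros holomorphic_on_subset[OF M_slice_holomorphic sub]) (use Mr_pos[OF Q_S[OF q]] in auto)
 show "(%t. fq i q (t *s w)) holomorphic_on A"
  unfolding fq_def
 proof (rule holomorphic_on_diff)
  show "(%t. partial (th_dir i) M (cvec (fst q) 0 + \<i> *s (t *s w), snd q) * (1 / of_real (Mr q)) * exp (- \<i> * zdot (t *s w) (yq q))) holomorphic_on A"
   unfolding sc zdot_scale
   by (intro holomorphic_intros holomorphic_on_subset[OF th_partial_slice_holomorphic sub]) (use Mr_pos[OF Q_S[OF q]] in auto)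
  show "(%t. of_real (k1 (Inr i) q) * mq q (t *s w)) holomorphic_on A"
   by (intro holomorphic_on_mult holomorphic_on_const m)
 qed
qed

lemma mq_fq_cline_holomorphic:
 assumes q: "q \<in> Q" and u: "u ~= 0" and r: "r <= \<rho>"
 shows "(%t. mq q (cline t u)) holomorphic_on ball 0 (r / norm u)"
  "(%t. fq i q (cline t u)) holomorphic_on ball 0 (r / norm u)"
proof -
 have "norm (t *s cvec u 0) < \<rho>" if "t \<in> ball 0 (r / norm u)" for t
  using that u r by (simp add: norm_vec_scalar_mult norm_cvec_0 field_simps)
 note mq_fq_holomorphic[OF q this]
 thus "(%t. mq q (cline t u)) holomorphic_on ball 0 (r / norm u)"
  "(%t. fq i q (cline t u)) holomorphic_on ball 0 (r / norm u)" unfolding cline_alt by blast+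
qed

text \<open>The envelope decreases in \<delta> through the base as well as through the exponent, so
  the minimum of \<delta> over the compact set \<open>Q\<close> serves for all of it.\<close>

lemma uniform_decay:
 obtains \<delta> where "\<delta> > 0" "!!q \<phi>. q \<in> Q ==> norm (mq q (cline 1 \<phi>)) <= (1 + \<delta> * (norm \<phi>)\<^sup>2) powr (- \<delta>)"
proof (rule decay_D)
 fix \<delta> assume \<delta>: "continuous_on S \<delta>" "!!q. q \<in> S ==> \<delta> q > 0"
  "!!q \<phi>. q \<in> S ==> norm (mq q (cline 1 \<phi>)) <= (1 + \<delta> q * (norm \<phi>)\<^sup>2) powr (- \<delta> q)"
 have QS: "Q \<subseteq> S" using Q_S by blast
 have "(s0, th0) \<in> Q" using \<rho> by simp
 then obtain q0 where q0: "q0 \<in> Q" "!!q. q \<in> Q ==> \<delta> q0 <= \<delta> q"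
  using continuous_attains_inf[OF Q_compact _ continuous_on_subset[OF \<delta>(1) QS]] by blast
 show ?thesis
 proof (rule that)
  show d0: "\<delta> q0 > 0" by (rule \<delta>(2)[OF Q_S[OF q0(1)]])
  fix q \<phi> assume q: "q \<in> Q"
  have le: "\<delta> q0 <= \<delta> q" by (rule q0(2)[OF q])
  have "norm (mq q (cline 1 \<phi>)) <= (1 + \<delta> q * (norm \<phi>)\<^sup>2) powr (- \<delta> q)" by (rule \<delta>(3)[OF Q_S[OF q]])
  also have "... <= (1 + \<delta> q * (norm \<phi>)\<^sup>2) powr (- \<delta> q0)" using le d0 by (intro powr_mono) auto
  also have "... <= (1 + \<delta> q0 * (norm \<phi>)\<^sup>2) powr (- \<delta> q0)"
   using le d0 by (intro powr_mono2' add_left_mono mult_right_mono) (auto intro: add_pos_nonneg)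
  finally show "norm (mq q (cline 1 \<phi>)) <= (1 + \<delta> q0 * (norm \<phi>)\<^sup>2) powr (- \<delta> q0)" .
 qed
qed

lemma laplace_mq:
 "EX r \<kappa> \<delta> C g. laplace_family Q mq \<sigma>q r \<kappa> \<delta> C g & laplace_family.amplitude Q r C g mq &
   (ALL i. laplace_family.amplitude Q r C g (fq i))"
proof -
 obtain A k where A: "tame mq A k" "!!i. tame (fq i) A k" using tame_mq_fq by blast
 obtain \<delta> where \<delta>: "\<delta> > 0" "!!q \<phi>. q \<in> Q ==> norm (mq q (cline 1 \<phi>)) <= (1 + \<delta> * (norm \<phi>)\<^sup>2) powr (- \<delta>)"
  using uniform_decay by blast
 have A0: "A >= 0" by (rule tameD(1)[OF A(1)])
 define B where "B = A * (1 + \<rho>) ^ k + 1"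
 \<comment> \<open>Since \<open>16 * B * r\<close> is \<open>\<rho>\<close>, the segment estimate
   \<open>4 * B * r / \<rho>\<close> is exactly the tolerance 1/4 of \<open>m_near\<close>.\<close>
 define r where "r = \<rho> / (16 * B)"
 have B: "B >= 1" using A0 \<rho> by (simp add: B_def)
 have r: "r > 0" "r <= \<rho>" "16 * B * r = \<rho>" using B \<rho> by (auto simp: r_def field_simps intro: order_trans[of _ "\<rho> * B"])
 have rZ: "\<zeta> \<in> ball 0 r \<union> range (cline 1) ==> \<zeta> \<in> Z" for \<zeta> :: "complex ^ 'd" using r(2) by auto
 have near: "norm (mq q \<zeta> - 1) <= 1 / 4" if q: "q \<in> Q" and \<zeta>: "norm \<zeta> < r" for q \<zeta>
 proof (cases "\<zeta> = 0")
  case False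
  define T where "T = \<rho> / norm \<zeta>"
  have T: "T > 1" using False \<zeta> r(2) by (simp add: T_def)
  have tz: "norm (t *s \<zeta>) < \<rho>" if "norm t < T" for t
   using that False by (simp add: T_def norm_vec_scalar_mult field_simps)
  have bd: "norm (mq q (t *s \<zeta>)) <= B" if "norm t < T" for t
  proof -
   have "norm (mq q (t *s \<zeta>)) <= A * (1 + norm (t *s \<zeta>)) ^ k"
    by (rule tameD(2)[OF A(1) q]) (use tz[OF that] in simp)
   also have "... <= A * (1 + \<rho>) ^ k" using tz[OF that] A0 by (intro mult_left_mono power_mono) auto
   finally show ?thesis by (simp add: B_def)
  qed
  have "norm (mq q (1 *s \<zeta>) - mq q (0 *s \<zeta>)) <= 4 * B / T"
  proof (rule holomorphic_segment_lipschitz)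
   show "(%t. mq q (t *s \<zeta>)) holomorphic_on ball 0 T"
    by (rule mq_fq_holomorphic(1)[OF q]) (use tz in simp)
   show "norm (mq q (1 *s \<zeta>)) <= B" by (rule bd) (use T in simp)
  qed (use T bd in auto)
  also have "4 * B / T = 4 * B * norm \<zeta> / \<rho>" by (simp add: T_def)
  also have "... <= 4 * B * r / \<rho>" using B \<zeta> \<rho> by (intro divide_right_mono mult_left_mono) auto
  also have "... = 1 / 4" using r(3) \<rho> by (simp add: field_simps)
  finally show ?thesis using mq_0[OF Q_S[OF q]] by simp
 qed (use mq_0[OF Q_S[OF q]] in simp)
 \<comment> \<open>With \<open>\<delta>\<^sup>2 / 2\<close> for \<kappa>, the required bound
   \<open>4 * \<kappa>\<close> is the constant of \<open>\<sigma>q_lower\<close>.\<close>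
 have lf: "laplace_family Q mq \<sigma>q r (\<delta>\<^sup>2 / 2) \<delta> A k"
 proof
  show "\<sigma>q q u >= 4 * (\<delta>\<^sup>2 / 2) * (norm u)\<^sup>2" if "q \<in> Q" for q u
   using \<sigma>q_lower[OF Q_S[OF that] \<delta>(1) \<delta>(2)[OF that], of u] by simp
  show "(%\<phi>. mq q (cline 1 \<phi>)) \<in> borel_measurable borel" if "q \<in> Q" for q
   by (rule borel_measurable_continuous_onI[OF mq_fq_continuous(1)[OF that]])
  show "(%t. mq q (cline t u)) holomorphic_on ball 0 (r / norm u)" if "q \<in> Q" "u ~= 0" for q u
   by (rule mq_fq_cline_holomorphic[OF that r(2)])
  show "((%t. (mq q (cline t u) - 1) / t\<^sup>2) \<longlongrightarrow> - of_real (\<sigma>q q u) / 2) (at 0)" if "q \<in> Q" for q u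
   by (rule mq_limit[OF Q_S[OF that]])
  show "norm (mq q1 \<zeta> - mq q2 \<zeta>) <= A * (1 + norm \<zeta>) ^ k * dist q1 q2"
   if "q1 \<in> Q" "q2 \<in> Q" "\<zeta> \<in> ball 0 r \<union> range (cline 1)" for q1 q2 \<zeta>
   by (rule tameD(3)[OF A(1) that(1,2) rZ[OF that(3)]])
 qed (use r A0 \<delta> near in auto)
 then interpret lf: laplace_family Q mq \<sigma>q r "\<delta>\<^sup>2 / 2" \<delta> A k .
 have "lf.amplitude mq"
  unfolding lf.amplitude_def
  by (intro conjI ballI allI impI mq_fq_cline_holomorphic borel_measurable_continuous_onI mq_fq_continuous tameD[OF A(1)] rZ r(2))
 moreover have "lf.amplitude (fq i)" for i
  unfolding lf.amplitude_def
  by (intro conjI ballI allI impI mq_fq_cline_holomorphic borel_measurable_continuous_onI mq_fq_continuous tameD[OF A(2)] rZ r(2))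
 ultimately show ?thesis using lf by blast
qed

text \<open>With \<open>J_n\<close>, restates the integrand and the integral of
  \<open>laplace_family\<close> free of the constants of that locale, which are known only to
  exist.\<close>

definition I_n :: "((real ^ 'd) \<times> (real ^ 'p) => complex ^ 'd => complex) => nat => (real ^ 'd) \<times> (real ^ 'p) => real ^ 'd => complex" where
 "I_n f n q \<phi> = f q (cline 1 \<phi>) * mq q (cline 1 \<phi>) ^ (n - 1)"

definition J_n :: "((real ^ 'd) \<times> (real ^ 'p) => complex ^ 'd => complex) => nat => (real ^ 'd) \<times> (real ^ 'p) => complex" where
 "J_n f n q = (LINT u|lborel. I_n f n q (u /\<^sub>R sqrt n))"

lemma \<sigma>q_hess: "q \<in> S ==> \<sigma>q q u = u \<bullet> (hess_s K q *v u)"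
 by (simp add: \<sigma>q_def K0_derivatives inner_vec_def matrix_vector_mult_def sum_distrib_left mult_ac)

lemma hess_s_posdef:
 obtains k where "k > 0" "!!q u. q \<in> Q ==> u \<bullet> (hess_s K q *v u) >= k * (norm u)\<^sup>2"
proof -
 obtain \<delta> where \<delta>: "\<delta> > 0" "!!q \<phi>. q \<in> Q ==> norm (mq q (cline 1 \<phi>)) <= (1 + \<delta> * (norm \<phi>)\<^sup>2) powr (- \<delta>)"
  using uniform_decay by blast
 show ?thesis
 proof (rule that)
  show "2 * \<delta>\<^sup>2 > 0" using \<delta>(1) by simp
  show "u \<bullet> (hess_s K q *v u) >= 2 * \<delta>\<^sup>2 * (norm u)\<^sup>2" if "q \<in> Q" for q u
   using \<sigma>q_lower[OF Q_S[OF that] \<delta>(1) \<delta>(2)[OF that], of u] \<sigma>q_hess[OF Q_S[OF that]] by simp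
 qed
qed

lemma hess_s_symmetric: "q \<in> S ==> transpose (hess_s K q) = hess_s K q"
 by (simp add: K0_derivatives transpose_def vec_eq_iff k2_sym)

end

section \<open>The density of the sum and its gradient\<close>

lemma continuous_AE_eq:
 fixes f g :: "'a::euclidean_space => real"
 assumes "continuous_on UNIV f" "continuous_on UNIV g" and ae: "AE x in lborel. f x = g x"
 shows "f = g"
proof (rule ccontr)
 assume "f ~= g"
 then obtain a where a: "f a ~= g a" by blast
 have op: "open {x. f x ~= g x}" by (intro open_Collect_neq assms)
 have "{x. f x ~= g x} \<in> null_sets lborel"
  using ae op by (subst (asm) AE_iff_null) auto
 hence "negligible {x. f x ~= g x}"
  by (simp add: negligible_iff_null_sets null_sets_completionI)
 thus False using open_not_negligible[OF op] a by blast
qed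

lemma continuous_density_unique:
 assumes f: "continuous_density_of_sum P Ys n th f" and g: "continuous_density_of_sum P Ys n th g"
 shows "f = g"
proof (rule continuous_AE_eq)
 show c: "continuous_on UNIV f" "continuous_on UNIV g" using f g by (simp_all add: continuous_density_of_sum_def)
 have m: "(%x. ennreal (f x)) \<in> borel_measurable lborel" "(%x. ennreal (g x)) \<in> borel_measurable lborel"
  using c by (auto intro!: measurable_compose[OF borel_measurable_continuous_onI measurable_ennreal])
 have "density lborel (%x. ennreal (f x)) = density lborel (%x. ennreal (g x))"
  using f g by (simp add: continuous_density_of_sum_def distributed_def)
 hence "AE x in lborel. ennreal (f x) = ennreal (g x)"
  using sigma_finite_measure.density_unique_iff[OF lborel.sigma_finite_measure_axioms m] by simp
 thus "AE x in lborel. f x = g x"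
  by (rule AE_mp) (use f g in \<open>auto simp: continuous_density_of_sum_def\<close>)
qed

lemma L_eqI:
 assumes "continuous_density_of_sum P Ys n th f"
 shows "L P Ys n th x = f x"
 unfolding L_def using assms continuous_density_unique by (metis (no_types, lifting) theI)

section \<open>Exponential tilting and the density of the sum\<close>

locale iid_cgf = local_cgf R P Y s0 th0 \<rho>
 for R :: "(real ^ 'p) set" and P :: "real ^ 'p => 'w measure" and Y :: "real ^ 'p => 'w => real ^ 'd"
  and s0 :: "real ^ 'd" and th0 :: "real ^ 'p" and \<rho> :: real +
 fixes Ys :: "real ^ 'p => nat => 'w => real ^ 'd"
 assumes indep: "!!th. th \<in> R ==> prob_space.indep_vars (P th) (%_. borel) (Ys th) {1..}"
  and distr_Ys: "!!th i. th \<in> R ==> i >= 1 ==> distr (P th) borel (Ys th i) = distr (P th) borel (Y th)"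
begin

abbreviation X where "X th n om \<equiv> SUM i:{1..n}. Ys th i om"

lemma Ys_measurable:
 assumes th: "th \<in> R" and i: "i >= 1"
 shows "Ys th i \<in> borel_measurable (P th)"
 using indep[OF th] i unfolding prob_space.indep_vars_def[OF prob[OF th]] by simp

lemma X_measurable: "th \<in> R ==> X th n \<in> borel_measurable (P th)"
 by (rule borel_measurable_sum) (simp add: Ys_measurable)

lemma zdot_sum: "zdot z (SUM i:A. f i) = (SUM i:A. zdot z (f i))"
 by (induction A rule: infinite_finite_induct) (auto simp: zdot_def distrib_left sum.distrib)

lemma exp_sum_integral:
 assumes q: "(Re_vec z, th) \<in> S"
 shows "integrable (P th) (%om. exp (zdot z (X th n om)))" "(\<integral>om. exp (zdot z (X th n om)) \<partial>P th) = M (z, th) ^ n"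
proof -
 have th: "th \<in> R" by (rule S_D(1)[OF q])
 interpret prob_space "P th" by (rule prob[OF th])
 let ?E = "%y :: real ^ 'd. exp (zdot z y)"
 have E: "?E \<in> borel_measurable borel" by measurable
 have mY: "Y th \<in> borel_measurable (P th)" by (rule Y_meas[OF th])
 have iY: "integrable (P th) (%om. ?E (Y th om))"
 proof (rule Bochner_Integration.integrable_bound[OF S_D(2)[OF q]])
  show "(%om. ?E (Y th om)) \<in> borel_measurable (P th)" by (rule measurable_compose[OF mY E])
 qed (simp add: norm_exp_eq_Re Re_zdot)
 have ind: "indep_vars (%_. borel) (%i om. ?E (Ys th i om)) {1..n}"
  by (rule indep_vars_compose2[OF indep_vars_subset[OF indep[OF th]] E]) auto
 have i1: "integrable (P th) (%om. ?E (Ys th i om))" and e1: "(\<integral>om. ?E (Ys th i om) \<partial>P th) = M (z, th)" if "i >= 1" for i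
 proof -
  have mi: "Ys th i \<in> borel_measurable (P th)" by (rule Ys_measurable[OF th that])
  have "integrable (distr (P th) borel (Y th)) ?E" using iY mY E by (simp add: integrable_distr_eq)
  thus "integrable (P th) (%om. ?E (Ys th i om))"
   using mi E by (simp add: integrable_distr_eq flip: distr_Ys[OF th that])
  have "(\<integral>om. ?E (Ys th i om) \<partial>P th) = (\<integral>y. ?E y \<partial>distr (P th) borel (Ys th i))"
   by (rule integral_distr[OF mi E, symmetric])
  also have "... = (\<integral>om. ?E (Y th om) \<partial>P th)" unfolding distr_Ys[OF th that] by (rule integral_distr[OF mY E])
  finally show "(\<integral>om. ?E (Ys th i om) \<partial>P th) = M (z, th)" by (simp add: M_eq)
 qed
 have eq: "exp (zdot z (X th n om)) = (\<Prod>i\<in>{1..n}. ?E (Ys th i om))" for om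
  by (simp add: zdot_sum exp_sum)
 show "integrable (P th) (%om. exp (zdot z (X th n om)))"
  unfolding eq by (rule indep_vars_integrable[OF finite_atLeastAtMost ind i1]) simp
 have "(\<integral>om. (\<Prod>i\<in>{1..n}. ?E (Ys th i om)) \<partial>P th) = (\<Prod>i\<in>{1..n}. \<integral>om. ?E (Ys th i om) \<partial>P th)"
  by (rule indep_vars_lebesgue_integral[OF finite_atLeastAtMost ind i1]) simp
 also have "... = M (z, th) ^ n" using e1 by simp
 finally show "(\<integral>om. exp (zdot z (X th n om)) \<partial>P th) = M (z, th) ^ n" unfolding eq .
qed

lemma M_mq:
 assumes "q \<in> S"
 shows "M (cvec (fst q) \<phi>, snd q) = of_real (Mr q) * mq q (cline 1 \<phi>) * cis (\<phi> \<bullet> yq q)"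
proof -
 have "zdot (cline 1 \<phi>) (yq q) = of_real (\<phi> \<bullet> yq q)" by (simp add: zdot_def cline_def inner_vec_def)
 hence "mq q (cline 1 \<phi>) = M (cvec (fst q) \<phi>, snd q) * (1 / of_real (Mr q)) * cis (- (\<phi> \<bullet> yq q))"
  unfolding mq_def cvec_split by (simp add: cis_conv_exp)
 thus ?thesis using Mr_pos[OF assms] by (simp add: cis_mult)
qed

text \<open>Fourier inversion for the law of the sum weighted by exp of the tilt, divided by that
  weight again.\<close>

definition tilted_density :: "nat => (real ^ 'd) \<times> (real ^ 'p) => real ^ 'd => real" where
 "tilted_density n q x = exp (- (fst q \<bullet> x)) * (Re (LINT t|lborel. M (cvec (fst q) t, snd q) ^ n * cis (- (t \<bullet> x))) / (2 * pi) ^ CARD('d))"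

lemma M_power_integrable:
 assumes q: "q \<in> Q" and n: "n >= 1" and int: "integrable lborel (I_n mq n q)"
 shows "integrable lborel (%t. M (cvec (fst q) t, snd q) ^ n)"
proof (rule Bochner_Integration.integrable_bound[OF integrable_mult_right[OF int, of "of_real (Mr q ^ n)"]])
 obtain G g where G: "good M G g" using good_M by blast
 show "(%t. M (cvec (fst q) t, snd q) ^ n) \<in> borel_measurable lborel"
  using borel_measurable_continuous_onI[OF good_continuous[OF G Q_D[OF q]]] by simp
 have "norm (M (cvec (fst q) t, snd q) ^ n) = norm (of_real (Mr q ^ n) * I_n mq n q t)" for t
  using n Mr_pos[OF Q_S[OF q]] unfolding M_mq[OF Q_S[OF q]] I_n_def
  by (simp add: norm_mult norm_power power_mult_distrib flip: power_Suc)
 thus "AE t in lborel. norm (M (cvec (fst q) t, snd q) ^ n) <= norm (of_real (Mr q ^ n) * I_n mq n q t)" by simp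
qed

text \<open>The law weighted by exp(s x) has Fourier transform M(s + it)^n, integrable along the
  contour, so \<open>inversion\<close> gives it a continuous density. As continuous densities are
  unique, every admissible tilt yields the same function \<open>L\<close>.\<close>

lemma tilted_density:
 assumes q: "q \<in> Q" and n: "n >= 1" and int: "integrable lborel (I_n mq n q)"
 shows "continuous_density_of_sum P Ys n (snd q) (tilted_density n q)"
proof -
 obtain s th where qe: "q = (s, th)" by (cases q)
 have qS: "(s, th) \<in> S" using Q_S[OF q] qe by simp
 have th: "th \<in> R" by (rule S_D(1)[OF qS])
 interpret prob_space "P th" by (rule prob[OF th])
 have mX[measurable]: "X th n \<in> borel_measurable (P th)" by (rule X_measurable[OF th])
 define \<mu> where "\<mu> = distr (P th) borel (X th n)"
 \<comment> \<open>The tilted law is left unnormalised: its total mass is the \<open>n\<close>-th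
   power of \<open>Mr q\<close>.\<close>
 define \<nu> where "\<nu> = density \<mu> (%x. ennreal (exp (s \<bullet> x)))"
 have s\<mu>[measurable_cong]: "sets \<mu> = sets borel" by (simp add: \<mu>_def)
 have s\<nu>: "sets \<nu> = sets borel" by (simp add: \<nu>_def s\<mu>)
 have re: "integrable (P th) (%om. exp (s \<bullet> X th n om))"
  using exp_sum_integral(1)[of "cvec s 0" th n] qS unfolding zdot_real exp_of_real complex_of_real_integrable_eq by simp
 have "emeasure \<nu> (space \<nu>) = (\<integral>\<^sup>+x. ennreal (exp (s \<bullet> x)) \<partial>\<mu>)"
  by (simp add: \<nu>_def emeasure_density cong: nn_integral_cong)
 also have "... = (\<integral>\<^sup>+om. ennreal (exp (s \<bullet> X th n om)) \<partial>P th)" unfolding \<mu>_def by (rule nn_integral_distr) measurable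
 also have "... < \<infinity>" using nn_integral_eq_integral[OF re] by simp
 finally have fin: "finite_measure \<nu>" by (intro finite_measureI) simp
 have psi: "M (cvec s t, th) ^ n = (\<integral>w. cis (t \<bullet> w) \<partial>\<nu>)" for t
 proof -
  have "(\<integral>w. cis (t \<bullet> w) \<partial>\<nu>) = (\<integral>w. exp (s \<bullet> w) *\<^sub>R cis (t \<bullet> w) \<partial>\<mu>)"
   unfolding \<nu>_def by (rule integral_density) auto
  also have "... = (\<integral>om. exp (s \<bullet> X th n om) *\<^sub>R cis (t \<bullet> X th n om) \<partial>P th)" unfolding \<mu>_def by (rule integral_distr) measurable
  also have "(%om. exp (s \<bullet> X th n om) *\<^sub>R cis (t \<bullet> X th n om)) = (%om. exp (zdot (cvec s t) (X th n om)))"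
  proof
   fix om
   have "zdot (cvec s t) w = of_real (s \<bullet> w) + \<i> * of_real (t \<bullet> w)" for w
    by (simp add: zdot_def cvec_def inner_vec_def sum_distrib_left sum.distrib complex_eq_iff)
   thus "exp (s \<bullet> X th n om) *\<^sub>R cis (t \<bullet> X th n om) = exp (zdot (cvec s t) (X th n om))"
    by (simp add: exp_add cis_conv_exp scaleR_conv_of_real exp_of_real)
  qed
  also have "(\<integral>om. exp (zdot (cvec s t) (X th n om)) \<partial>P th) = M (cvec s t, th) ^ n"
   by (rule exp_sum_integral) (use qS in simp)
  finally show ?thesis by simp
 qed
 interpret ft: integrable_fourier \<nu> "%t. M (cvec s t, th) ^ n"
  by (rule integrable_fourier.intro[OF fin], unfold_locales)
    (use s\<nu> psi M_power_integrable[OF q n int] qe in auto)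
 have td: "tilted_density n q x = exp (- (s \<bullet> x)) * (Re (ft.F x) / (2 * pi) ^ CARD('d))" for x
  by (simp add: tilted_density_def qe ft.F_def)
 have ct: "continuous_on UNIV (tilted_density n q)"
  unfolding td[abs_def] by (intro continuous_intros ft.F_continuous) auto
 have pos: "tilted_density n q x >= 0" for x unfolding td using ft.F_nonneg by simp
 have mF[measurable]: "(%x. Re (ft.F x)) \<in> borel_measurable borel"
  by (intro borel_measurable_continuous_onI continuous_intros ft.F_continuous)
 have "\<mu> = density \<nu> (%x. ennreal (exp (- (s \<bullet> x))))"
 proof -
  have "density \<nu> (%x. ennreal (exp (- (s \<bullet> x)))) = density \<mu> (%x. ennreal (exp (s \<bullet> x)) * ennreal (exp (- (s \<bullet> x))))"
   unfolding \<nu>_def by (rule density_density_eq) measurable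
  also have "... = density \<mu> (%x. 1)" by (simp flip: ennreal_mult exp_add)
  finally show ?thesis by (simp add: density_1)
 qed
 also have "... = density (density lborel (%x. ennreal (Re (ft.F x) / (2 * pi) ^ CARD('d)))) (%x. ennreal (exp (- (s \<bullet> x))))"
  using ft.inversion by simp
 also have "... = density lborel (%x. ennreal (Re (ft.F x) / (2 * pi) ^ CARD('d)) * ennreal (exp (- (s \<bullet> x))))"
  by (rule density_density_eq) measurable
 also have "... = density lborel (%x. ennreal (tilted_density n q x))"
  unfolding td using ft.F_nonneg by (intro arg_cong[where f="density lborel"] ext) (simp add: mult.commute flip: ennreal_mult)
 finally have "distr (P th) lborel (X th n) = density lborel (%x. ennreal (tilted_density n q x))"
  unfolding \<mu>_def by (simp cong: distr_cong)
 moreover have "(%x. ennreal (tilted_density n q x)) \<in> borel_measurable lborel"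
  using borel_measurable_continuous_onI[OF ct] by simp
 ultimately show ?thesis
  unfolding continuous_density_of_sum_def distributed_def using ct pos mX by (simp add: qe)
qed

lemma L_tilted: "q \<in> Q ==> n >= 1 ==> integrable lborel (I_n mq n q) ==> L P Ys n (snd q) x = tilted_density n q x"
 by (rule L_eqI[OF tilted_density])

lemma integral_I_n:
 assumes n: "n >= 1" and int: "integrable lborel (I_n f n q)"
 shows "(LINT \<phi>|lborel. I_n f n q \<phi>) = of_real ((1 / sqrt n) ^ CARD('d)) * J_n f n q"
proof -
 have m: "I_n f n q \<in> borel_measurable borel" using borel_measurable_integrable[OF int] by simp
 have "(LINT \<phi>|lborel. I_n f n q \<phi>) = (1 / sqrt n) ^ DIM(real ^ 'd) *\<^sub>R (LINT \<phi>|lborel. I_n f n q ((1 / sqrt n) *\<^sub>R \<phi>))"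
  by (rule lborel_integral_scaleR[OF _ m]) (use n in simp)
 thus ?thesis by (simp add: J_n_def scaleR_conv_of_real[of "(1 / sqrt n) ^ CARD('d)"] inverse_eq_divide)
qed

text \<open>The common positive factor of the likelihood and its parameter derivative; it cancels in
  the logarithmic derivative.\<close>

definition L_scale :: "nat => (real ^ 'd) \<times> (real ^ 'p) => real" where
 "L_scale n q = exp (real n * (K q - fst q \<bullet> yq q)) * (1 / sqrt n) ^ CARD('d) / (2 * pi) ^ CARD('d)"

lemma L_value:
 assumes q: "q \<in> Q" and n: "n >= 1" and int: "integrable lborel (I_n mq n q)"
 shows "L P Ys n (snd q) (real n *\<^sub>R yq q) = L_scale n q * Re (J_n mq n q)"
proof -
 have qS: "q \<in> S" by (rule Q_S[OF q])
 have eq: "M (cvec (fst q) t, snd q) ^ n * cis (- (t \<bullet> (real n *\<^sub>R yq q))) = of_real (Mr q ^ n) * I_n mq n q t" for t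
 proof -
  have "cis (t \<bullet> yq q) ^ n * cis (- (t \<bullet> (real n *\<^sub>R yq q))) = 1"
   unfolding Complex.DeMoivre by (simp add: cis_mult)
  moreover have "mq q (cline 1 t) * mq q (cline 1 t) ^ (n - 1) = mq q (cline 1 t) ^ n" using n by (simp flip: power_Suc)
  ultimately show ?thesis unfolding M_mq[OF qS] I_n_def power_mult_distrib by simp
 qed
 have "exp (real n * K q) = Mr q ^ n" unfolding K_eq using Mr_pos[OF qS] by (simp add: exp_of_nat_mult)
 hence E: "exp (real n * (K q - fst q \<bullet> yq q)) = Mr q ^ n * exp (- (fst q \<bullet> (real n *\<^sub>R yq q)))"
  by (simp add: right_diff_distrib exp_diff exp_minus field_simps)
 show ?thesis
  unfolding L_tilted[OF assms] tilted_density_def eq integral_mult_right_zero integral_I_n[OF n int] L_scale_def E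
  by (simp add: mult_ac flip: of_real_power of_real_mult)
qed

end

context iid_cgf
begin

lemma M_theta_derivative:
 assumes "(z, th + h *\<^sub>R v) \<in> CD"
 shows "((%h. M (z, th + h *\<^sub>R v)) has_derivative (%k. k *\<^sub>R (SUM i:UNIV. v $ i *\<^sub>R partial (th_dir i) M (z, th + h *\<^sub>R v)))) (at h)"
proof -
 have c: "continuous_on A (%th::real^'p. (z, th))" for A by (intro continuous_intros)
 have "((%th. M (z, th)) has_derivative (%v. SUM i:UNIV. v $ i *\<^sub>R partial (th_dir i) M (z, th + h *\<^sub>R v'))) (at (th + h *\<^sub>R v'))"
  if "(z, th + h *\<^sub>R v') \<in> CD" for v'
 proof (rule has_derivative_from_axis_partials[where A="(%th. (z, th)) -` CD"])
  show "open ((%th. (z, th)) -` CD)" by (rule open_vimage[OF open_CD c])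
  show "th + h *\<^sub>R v' \<in> (%th. (z, th)) -` CD" using that by simp
  show "((%t. M (z, th + t *\<^sub>R axis i 1)) has_vector_derivative partial (th_dir i) M (z, th)) (at 0)"
   if "th \<in> (%th. (z, th)) -` CD" for i th
   using M_partial[of "(z, th)" "Inr i"] that by (simp add: th_dir_def)
  show "continuous_on ((%th. (z, th)) -` CD) (%th. partial (th_dir i) M (z, th))" for i
   using continuous_on_compose2[OF M_partial_cont[of "Inr i"] c, of "(%th. (z, th)) -` CD"] by auto
 qed
 from this[OF assms] have D: "((%th. M (z, th)) has_derivative (%w. SUM i:UNIV. w $ i *\<^sub>R partial (th_dir i) M (z, th + h *\<^sub>R v))) (at (th + h *\<^sub>R v))" .
 have L: "((%h. th + h *\<^sub>R v) has_derivative (%k. k *\<^sub>R v)) (at h)" by (auto intro!: derivative_eq_intros)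
 show ?thesis using has_derivative_compose[OF L D] by (simp add: scaleR_sum_right)
qed

lemma th_partial_fq:
 assumes "q \<in> S"
 shows "partial (th_dir i) M (cvec (fst q) \<phi>, snd q) = of_real (Mr q) * (fq i q (cline 1 \<phi>) + of_real (k1 (Inr i) q) * mq q (cline 1 \<phi>)) * cis (\<phi> \<bullet> yq q)"
proof -
 have "zdot (cline 1 \<phi>) (yq q) = of_real (\<phi> \<bullet> yq q)" by (simp add: zdot_def cline_def inner_vec_def)
 hence "fq i q (cline 1 \<phi>) + of_real (k1 (Inr i) q) * mq q (cline 1 \<phi>)
   = partial (th_dir i) M (cvec (fst q) \<phi>, snd q) * (1 / of_real (Mr q)) * cis (- (\<phi> \<bullet> yq q))"
  unfolding fq_def cvec_split by (simp add: cis_conv_exp)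
 thus ?thesis using Mr_pos[OF assms] by (simp add: cis_mult)
qed

definition dL :: "nat => (real ^ 'd) \<times> (real ^ 'p) => 'p => real" where
 "dL n q i = Re (J_n (fq i) n q) + k1 (Inr i) q * Re (J_n mq n q)"

lemma L_integrand_derivative:
 assumes CD: "(cvec s t, th + h *\<^sub>R v) \<in> CD"
 shows "((%h. Re (M (cvec s t, th + h *\<^sub>R v) ^ n * c)) has_real_derivative
  Re (of_nat n * (SUM i:UNIV. v $ i *\<^sub>R partial (th_dir i) M (cvec s t, th + h *\<^sub>R v)) * M (cvec s t, th + h *\<^sub>R v) ^ (n - 1) * c)) (at h)"
proof -
 note has_derivative_power[OF M_theta_derivative[OF CD], of n]
 note bounded_linear.has_derivative[OF bounded_linear_mult_left this, of c]
 note bounded_linear.has_derivative[OF bounded_linear_Re this]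
 thus ?thesis by (rule has_derivative_imp_has_field_derivative) (simp only: mult_scaleR_left mult_scaleR_right scaleR_complex.sel)
qed

end

text \<open>Fixes the constants whose existence \<open>laplace\<close> asserts. Of the coefficients
  \<open>c\<close> nothing but their existence is recorded; bounds, and the identity with a
  gradient, are recovered afterwards.\<close>

locale iid_asymptotics = iid_cgf R P Y s0 th0 \<rho> Ys
 for R :: "(real ^ 'p) set" and P :: "real ^ 'p => 'w measure" and Y :: "real ^ 'p => 'w => real ^ 'd"
  and s0 :: "real ^ 'd" and th0 :: "real ^ 'p" and \<rho> :: real and Ys :: "real ^ 'p => nat => 'w => real ^ 'd" +
 fixes C :: real and n0 :: nat and c :: "'p => (real ^ 'd) \<times> (real ^ 'p) => complex"
 assumes C: "C >= 0" and n0: "n0 >= 1"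
  and im: "!!n q. n >= n0 ==> q \<in> Q ==> integrable lborel (I_n mq n q)"
  and iff: "!!n q i. n >= n0 ==> q \<in> Q ==> integrable lborel (I_n (fq i) n q)"
  and Jm: "!!n q. n >= n0 ==> q \<in> Q ==> norm (J_n mq n q - of_real (gauss_integral (hess_s K q))) <= C / real n"
  and Jm_lip: "!!n q q'. n >= n0 ==> q \<in> Q ==> q' \<in> Q ==> norm (J_n mq n q - J_n mq n q') <= C * dist q q'"
  and Jf_lip: "!!n q q' i. n >= n0 ==> q \<in> Q ==> q' \<in> Q ==> norm (J_n (fq i) n q - J_n (fq i) n q') <= C * dist q q' / real n"
  and Jf: "!!n q i. n >= n0 ==> q \<in> Q ==> norm (J_n (fq i) n q - c i q / of_nat n) <= C / (real n)\<^sup>2"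

lemma (in iid_cgf) iid_asymptotics_exist: "EX C n0 c. iid_asymptotics R P Y s0 th0 \<rho> Ys C n0 c"
proof -
 obtain r \<kappa> \<delta> A k where lf: "laplace_family Q mq \<sigma>q r \<kappa> \<delta> A k"
  and am: "laplace_family.amplitude Q r A k mq" and af: "!!i. laplace_family.amplitude Q r A k (fq i)"
  using laplace_mq by blast
 interpret lf: laplace_family Q mq \<sigma>q r \<kappa> \<delta> A k by (rule lf)
 have I: "lf.integrand f = I_n f" for f by (intro ext) (simp add: I_n_def lf.integrand_def)
 have J: "lf.J f = J_n f" for f by (intro ext) (simp add: J_n_def lf.J_def I)
 have \<Gamma>: "lf.\<Gamma> q = gauss_integral (hess_s K q)" if "q \<in> Q" for q
  by (simp add: lf.\<Gamma>_def gauss_integral_def gauss_def \<sigma>q_hess[OF Q_S[OF that]])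
 obtain C n0 where C: "C >= 0" "n0 >= 1" and lap: "!!f. lf.amplitude f ==>
  (ALL n>=n0.
   (ALL q:Q. integrable lborel (I_n f n q) & norm (J_n f n q - f q 0 * of_real (lf.\<Gamma> q)) <= C / real n) &
   (ALL q1:Q. ALL q2:Q. norm (J_n f n q1 - J_n f n q2) <= C * dist q1 q2 &
    ((ALL q:Q. f q 0 = 0) --> norm (J_n f n q1 - J_n f n q2) <= C * dist q1 q2 / real n))) &
  ((ALL q:Q. f q 0 = 0) --> (EX c. ALL n>=n0. ALL q:Q. norm (J_n f n q - c q / of_nat n) <= C / (real n)\<^sup>2))"
  using lf.laplace unfolding I J by blast
 have f0: "ALL q:Q. fq i q 0 = 0" for i using fq_0 Q_S by blast
 have "ALL i. EX c. ALL n>=n0. ALL q:Q. norm (J_n (fq i) n q - c q / of_nat n) <= C / (real n)\<^sup>2"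
  using lap[OF af] f0 by blast
 then obtain c where c: "!!i n q. n >= n0 ==> q \<in> Q ==> norm (J_n (fq i) n q - c i q / of_nat n) <= C / (real n)\<^sup>2"
  by (subst (asm) choice_iff) blast
 have "iid_asymptotics R P Y s0 th0 \<rho> Ys C n0 c"
 proof
  show "norm (J_n mq n q - of_real (gauss_integral (hess_s K q))) <= C / real n" if "n >= n0" "q \<in> Q" for n q
  proof -
   have "norm (J_n mq n q - mq q 0 * of_real (lf.\<Gamma> q)) <= C / real n" using lap[OF am] that by blast
   thus ?thesis by (simp only: mq_0[OF Q_S[OF that(2)]] \<Gamma>[OF that(2)] mult_1_left)
  qed
  show "integrable lborel (I_n mq n q)" if "n >= n0" "q \<in> Q" for n q using lap[OF am] that by blast
  show "integrable lborel (I_n (fq i) n q)" if "n >= n0" "q \<in> Q" for n q i using lap[OF af[of i]] that by blast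
  show "norm (J_n mq n q - J_n mq n q') <= C * dist q q'" if "n >= n0" "q \<in> Q" "q' \<in> Q" for n q q'
   using lap[OF am] that by blast
  show "norm (J_n (fq i) n q - J_n (fq i) n q') <= C * dist q q' / real n" if "n >= n0" "q \<in> Q" "q' \<in> Q" for n q q' i
   using lap[OF af[of i]] f0[of i] that by blast
 qed (use C c in auto)
 thus ?thesis by blast
qed

context iid_asymptotics
begin

text \<open>
 The tilted density does not depend on the tilt, so \<open>s\<close> can be frozen at its saddlepoint value while the
 parameter varies.
\<close>

lemma L_derivative:
 obtains n1 where "n1 >= 1"
  "!!n q v. n >= n1 ==> fst q \<in> cball s0 \<rho> ==> snd q \<in> ball th0 \<rho> ==>
   ((%h. L P Ys n (snd q + h *\<^sub>R v) (real n *\<^sub>R yq q)) has_real_derivative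
    L_scale n q * (real n * (SUM i:UNIV. v $ i * dL n q i))) (at 0)"
proof -
 obtain \<delta> where \<delta>: "\<delta> > 0" "!!q \<phi>. q \<in> Q ==> norm (mq q (cline 1 \<phi>)) <= (1 + \<delta> * (norm \<phi>)\<^sup>2) powr (- \<delta>)"
  using uniform_decay by blast
 obtain G g where G: "good M G g" "!!i. good (partial (th_dir i) M) G g" using good_M by blast
 have G0: "G >= 0" by (rule good_D(1)[OF G(1)])
 have QS: "Q \<subseteq> S" using Q_S by blast
 obtain B where B: "B >= 0" "!!q. q \<in> Q ==> Mr q <= B"
  using compact_bounded_above[OF Q_compact continuous_on_subset[OF Mr_cont QS]] by blast
 define e where "e \<phi> = (1 + \<delta> * (norm \<phi>)\<^sup>2) powr (- \<delta>)" for \<phi> :: "real ^ 'd"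
 have one: "1 <= 1 + \<delta> * (norm \<phi>)\<^sup>2" for \<phi> :: "real ^ 'd" using \<delta>(1) by simp
 have e01: "0 <= e \<phi>" "e \<phi> <= 1" for \<phi>
 proof -
  show "0 <= e \<phi>" by (simp add: e_def)
  have "e \<phi> <= (1 + \<delta> * (norm \<phi>)\<^sup>2) powr 0" unfolding e_def using \<delta>(1) one by (intro powr_mono) auto
  thus "e \<phi> <= 1" using one[of \<phi>] by (simp add: powr_zero_eq_one split: if_splits)
 qed
 have e_c: "continuous_on UNIV e" unfolding e_def
  using one by (intro continuous_intros) (auto simp: add_nonneg_eq_0_iff)
 obtain n2 K0 where tail: "ALL n>=n2. ALL A>=0. \<forall>F::real ^ 'd => complex. F \<in> borel_measurable borel -->
   (ALL \<phi>. norm (F \<phi>) <= A * real n * (1 + norm \<phi>) ^ g * ((1 + \<delta> * (norm \<phi>)\<^sup>2) powr (- \<delta>)) ^ (n - 2)) -->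
   integrable lborel F & integrable lborel (%u. F (u /\<^sub>R sqrt n)) &
   (LINT u|lborel. norm (F (u /\<^sub>R sqrt n)) * indicator {u. norm u > 1 * sqrt n} u) <= K0 * A / (real n)\<^sup>2"
  using decay_tail[OF \<delta>(1) zero_less_one, of g, where ?'d = 'd] by (elim exE conjE) (rule that)
 have n2: "integrable lborel F" if "n >= n2" "F \<in> borel_measurable borel" "A >= 0"
   "ALL \<phi>. norm (F \<phi>) <= A * real n * (1 + norm \<phi>) ^ g * e \<phi> ^ (n - 2)" for n A and F :: "real ^ 'd => complex"
  using tail[rule_format, OF that(1,3,2)] that(4) unfolding e_def by blast
 show ?thesis
 proof (rule that[of "max n0 n2"])
  show "max n0 n2 >= 1" using n0 by simp
  fix n and q :: "(real ^ 'd) \<times> (real ^ 'p)" and v :: "real ^ 'p"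
  assume n: "n >= max n0 n2" and s': "fst q \<in> cball s0 \<rho>" and th': "snd q \<in> ball th0 \<rho>"
  obtain s th where qe: "q = (s, th)" by (cases q)
  have s: "s \<in> cball s0 \<rho>" and th: "th \<in> ball th0 \<rho>" using s' th' qe by auto
  have n1: "n >= 1" and nn0: "n >= n0" and nn2: "n >= n2" using n n0 by auto
  have qQ: "q \<in> Q" using s th qe by auto
  have qS: "q \<in> S" by (rule Q_S[OF qQ])
  define x where "x = real n *\<^sub>R yq q"
  define d where "d = (\<rho> - dist th0 th) / (norm v + 1)"
  have d: "d > 0" using th by (simp add: d_def add_nonneg_pos)
  have hQ: "(s, th + h *\<^sub>R v) \<in> Q" if "\<bar>h\<bar> < d" for h
  proof -
   have "\<bar>h\<bar> * norm v <= \<bar>h\<bar> * (norm v + 1)" by (intro mult_left_mono) auto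
   also have "... < \<rho> - dist th0 th" using that by (simp add: d_def pos_less_divide_eq add_nonneg_pos)
   finally have "dist th0 (th + h *\<^sub>R v) <= \<rho>"
    using dist_triangle[of th0 "th + h *\<^sub>R v" th] by (simp add: dist_norm)
   thus ?thesis using s by simp
  qed
  define D where "D h t = (SUM i:UNIV. v $ i *\<^sub>R partial (th_dir i) M (cvec s t, th + h *\<^sub>R v))" for h t
  define F where "F h t = Re (M (cvec s t, th + h *\<^sub>R v) ^ n * cis (- (t \<bullet> x)))" for h t
  define F' where "F' h t = Re (of_nat n * D h t * M (cvec s t, th + h *\<^sub>R v) ^ (n - 1) * cis (- (t \<bullet> x)))" for h t
  \<comment> \<open>The derivative of the integrand consists of a polynomially growing parameter
    derivative and \<open>n - 1\<close> powers of \<open>M\<close>; one envelope factor is given up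
    to match \<open>decay_tail\<close>.\<close>
  define A where "A = (SUM i:UNIV. \<bar>v $ i\<bar>) * G * B ^ (n - 1)"
  define W where "W t = A * real n * (1 + norm t) ^ g * e t ^ (n - 2)" for t :: "real ^ 'd"
  have A: "A >= 0" using G0 B by (simp add: A_def sum_nonneg)
  have "continuous_on UNIV W" unfolding W_def by (intro continuous_intros e_c)
  hence mW: "W \<in> borel_measurable borel" by (rule borel_measurable_continuous_onI)
  have "integrable lborel (%t. complex_of_real (W t))"
  proof (rule n2[OF nn2 _ A])
   show "(%t. complex_of_real (W t)) \<in> borel_measurable borel" using mW by simp
   have "W t >= 0" for t unfolding W_def using A e01 by simp
   thus "ALL \<phi>. norm (complex_of_real (W \<phi>)) <= A * real n * (1 + norm \<phi>) ^ g * e \<phi> ^ (n - 2)"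
    unfolding norm_of_real by (metis W_def abs_of_nonneg order_refl)
  qed
  hence iW: "integrable lborel W" by (simp add: complex_of_real_integrable_eq)
  have bM: "norm (M (cvec s t, th + h *\<^sub>R v)) <= B * e t" if h: "\<bar>h\<bar> < d" for h t
  proof -
   note hq = hQ[OF h]
   have "norm (M (cvec s t, th + h *\<^sub>R v)) = Mr (s, th + h *\<^sub>R v) * norm (mq (s, th + h *\<^sub>R v) (cline 1 t))"
    using M_mq[OF Q_S[OF hq], of t] Mr_pos[OF Q_S[OF hq]] by (simp add: norm_mult)
   also have "... <= B * e t" unfolding e_def
    by (rule mult_mono[OF B(2)[OF hq] \<delta>(2)[OF hq]]) (use B in auto)
   finally show ?thesis .
  qed
  have bD: "norm (D h t) <= (SUM i:UNIV. \<bar>v $ i\<bar>) * (G * (1 + norm t) ^ g)" if h: "\<bar>h\<bar> < d" for h t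
   unfolding D_def sum_distrib_right
  proof (rule order_trans[OF norm_sum sum_mono])
   fix i :: 'p
   have "norm (partial (th_dir i) M (cvec s t, th + h *\<^sub>R v)) <= G * (1 + norm (Im_vec (cvec s t))) ^ g"
    by (rule good_bound(1)[OF G(2)]) (use hQ[OF h] s \<rho> in auto)
   thus "norm (v $ i *\<^sub>R partial (th_dir i) M (cvec s t, th + h *\<^sub>R v)) <= \<bar>v $ i\<bar> * (G * (1 + norm t) ^ g)"
    by (simp add: mult_left_mono)
  qed
  have bF': "\<bar>F' h t\<bar> <= W t" if h: "\<bar>h\<bar> < d" for h t
  proof -
   have "\<bar>F' h t\<bar> <= norm (of_nat n * D h t * M (cvec s t, th + h *\<^sub>R v) ^ (n - 1) * cis (- (t \<bullet> x)))"
    unfolding F'_def by (rule abs_Re_le_cmod)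
   also have "... = real n * norm (D h t) * norm (M (cvec s t, th + h *\<^sub>R v)) ^ (n - 1)"
    by (simp add: norm_mult norm_power)
   also have "... <= real n * ((SUM i:UNIV. \<bar>v $ i\<bar>) * (G * (1 + norm t) ^ g)) * (B * e t) ^ (n - 1)"
    using bD[OF h] bM[OF h] G0 by (intro mult_mono power_mono mult_left_mono mult_nonneg_nonneg sum_nonneg) auto
   also have "... <= real n * ((SUM i:UNIV. \<bar>v $ i\<bar>) * (G * (1 + norm t) ^ g)) * (B ^ (n - 1) * e t ^ (n - 2))"
    unfolding power_mult_distrib using e01[of t] B(1) G0
    by (intro mult_left_mono power_decreasing mult_nonneg_nonneg sum_nonneg) auto
   also have "... = W t" by (simp add: W_def A_def mult_ac)
   finally show ?thesis .
  qed
  have cM: "continuous_on UNIV (%t. M (cvec s t, th + h *\<^sub>R v))" "continuous_on UNIV (%t. partial (th_dir i) M (cvec s t, th + h *\<^sub>R v))"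
   if "\<bar>h\<bar> < d" for h i
   by (rule good_continuous[OF G(1)] good_continuous[OF G(2)]; use hQ[OF that] \<rho> in auto)+
  have ccis: "continuous_on UNIV (%t. cis (- (t \<bullet> x)))" by (intro continuous_intros)
  have icis: "integrable lborel (%t. M (cvec s t, th + h *\<^sub>R v) ^ n * cis (- (t \<bullet> x)))" if h: "\<bar>h\<bar> < d" for h
  proof (rule Bochner_Integration.integrable_bound)
   show "integrable lborel (%t. M (cvec s t, th + h *\<^sub>R v) ^ n)"
    using M_power_integrable[OF hQ[OF h] n1 im[OF nn0 hQ[OF h]]] by simp
   show "(%t. M (cvec s t, th + h *\<^sub>R v) ^ n * cis (- (t \<bullet> x))) \<in> borel_measurable lborel"
    using borel_measurable_continuous_onI[OF continuous_on_mult[OF continuous_on_power[OF cM(1)[OF h]] ccis]] by simp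
  qed (simp add: norm_mult)
  have der: "((%h. \<integral>t. F h t \<partial>lborel) has_real_derivative (LINT t|lborel. F' 0 t)) (at 0)"
  proof (rule has_real_derivative_integral[OF d])
   show "integrable lborel (F h)" if "\<bar>h\<bar> < d" for h
    using integrable_Re[OF icis[OF that]] by (simp add: F_def[abs_def])
   have "continuous_on UNIV (F' 0)"
    unfolding F'_def[abs_def] D_def using d by (intro continuous_intros cM ccis) auto
   thus "F' 0 \<in> borel_measurable lborel" using borel_measurable_continuous_onI by simp
   show "((%h. F h t) has_real_derivative F' h t) (at h)" if "\<bar>h\<bar> < d" for h t
    unfolding F_def F'_def D_def
    by (rule L_integrand_derivative) (use Q_S[OF hQ[OF that]] in \<open>simp add: in_CD_iff\<close>)
  qed (use bF' iW in auto)
  define c0 where "c0 = exp (- (s \<bullet> x)) / (2 * pi) ^ CARD('d)"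
  have Leq: "L P Ys n (th + h *\<^sub>R v) x = c0 * (LINT t|lborel. F h t)" if h: "\<bar>h\<bar> < d" for h
   using L_tilted[OF hQ[OF h] n1 im[OF nn0 hQ[OF h]], of x] integral_Re[OF icis[OF h]]
   by (simp add: tilted_density_def c0_def F_def)
  have F'0: "F' 0 t = real n * Mr q ^ n * (SUM i:UNIV. v $ i * (Re (I_n (fq i) n q t) + k1 (Inr i) q * Re (I_n mq n q t)))" for t
  proof -
   \<comment> \<open>At \<open>x = n * yq q\<close> the phases introduced by the normalisation of
     \<open>mq\<close> and \<open>fq\<close> cancel the Fourier kernel.\<close>
   have cc: "cis (t \<bullet> yq q) * cis (t \<bullet> yq q) ^ (n - 1) * cis (- (t \<bullet> x)) = 1"
   proof -
    have "cis (t \<bullet> yq q) * cis (t \<bullet> yq q) ^ (n - 1) = cis (t \<bullet> yq q) ^ n" using n1 by (simp flip: power_Suc)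
    thus ?thesis unfolding Complex.DeMoivre by (simp add: cis_mult x_def)
   qed
   have MM: "complex_of_real (Mr q) * complex_of_real (Mr q) ^ (n - 1) = of_real (Mr q ^ n)" using n1 by (simp flip: power_Suc)
   have D0: "D 0 t = (SUM i:UNIV. v $ i *\<^sub>R (fq i q (cline 1 t) + of_real (k1 (Inr i) q) * mq q (cline 1 t))) * (of_real (Mr q) * cis (t \<bullet> yq q))"
    using th_partial_fq[OF qS, of _ t] by (simp add: D_def qe sum_distrib_left mult_ac)
   have M0: "M (cvec s t, th + 0 *\<^sub>R v) = of_real (Mr q) * mq q (cline 1 t) * cis (t \<bullet> yq q)"
    using M_mq[OF qS, of t] by (simp add: qe)
   have "of_nat n * D 0 t * M (cvec s t, th + 0 *\<^sub>R v) ^ (n - 1) * cis (- (t \<bullet> x))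
    = of_nat n * (SUM i:UNIV. v $ i *\<^sub>R (fq i q (cline 1 t) + of_real (k1 (Inr i) q) * mq q (cline 1 t))) * mq q (cline 1 t) ^ (n - 1)
     * (complex_of_real (Mr q) * complex_of_real (Mr q) ^ (n - 1)) * (cis (t \<bullet> yq q) * cis (t \<bullet> yq q) ^ (n - 1) * cis (- (t \<bullet> x)))"
    unfolding D0 M0 power_mult_distrib by (simp only: mult_ac)
   also have "... = of_real (real n * Mr q ^ n) * (SUM i:UNIV. v $ i *\<^sub>R (I_n (fq i) n q t + of_real (k1 (Inr i) q) * I_n mq n q t))"
    unfolding cc MM I_n_def by (simp add: sum_distrib_left sum_distrib_right algebra_simps)
   finally show ?thesis unfolding F'_def by (simp flip: of_real_mult of_real_power)
  qed
  have iI: "integrable lborel (I_n mq n q)" "integrable lborel (I_n (fq i) n q)" for i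
   by (rule im[OF nn0 qQ] iff[OF nn0 qQ])+
  have iR': "Re (integral\<^sup>L lborel (I_n f n q)) = (1 / sqrt n) ^ CARD('d) * Re (J_n f n q)" if "integrable lborel (I_n f n q)" for f
   using integral_I_n[OF n1 that] by (simp flip: of_real_power)
  have "(LINT t|lborel. F' 0 t) = real n * Mr q ^ n * (SUM i:UNIV. v $ i * (1 / sqrt n) ^ CARD('d) * dL n q i)"
   unfolding F'0
   by (subst integral_mult_right_zero, subst Bochner_Integration.integral_sum)
     (auto simp: iI integrable_Re iR' dL_def algebra_simps intro!: sum.cong)
  also have "... = (real n * (SUM i:UNIV. v $ i * dL n q i)) * (Mr q ^ n * (1 / sqrt n) ^ CARD('d))"
   by (simp add: sum_distrib_left sum_distrib_right mult_ac)
  finally have iF': "(LINT t|lborel. F' 0 t) = (real n * (SUM i:UNIV. v $ i * dL n q i)) * (Mr q ^ n * (1 / sqrt n) ^ CARD('d))" .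
  have "exp (real n * K q) = Mr q ^ n" unfolding K_eq using Mr_pos[OF qS] by (simp add: exp_of_nat_mult)
  hence "exp (real n * (K q - fst q \<bullet> yq q)) = Mr q ^ n * exp (- (s \<bullet> x))"
   by (simp add: right_diff_distrib exp_diff exp_minus field_simps x_def qe)
  hence sc: "c0 * (Mr q ^ n * (1 / sqrt n) ^ CARD('d)) = L_scale n q"
   by (simp add: c0_def L_scale_def)
  have "((%h. c0 * (LINT t|lborel. F h t)) has_real_derivative c0 * (LINT t|lborel. F' 0 t)) (at 0)"
   by (rule DERIV_cmult[OF der])
  also have "c0 * (LINT t|lborel. F' 0 t) = L_scale n q * (real n * (SUM i:UNIV. v $ i * dL n q i))"
   unfolding iF' sc[symmetric] by (simp only: mult_ac)
  finally have fin: "((%h. c0 * (LINT t|lborel. F h t)) has_real_derivative L_scale n q * (real n * (SUM i:UNIV. v $ i * dL n q i))) (at 0)" .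
  show "((%h. L P Ys n (snd q + h *\<^sub>R v) (real n *\<^sub>R yq q)) has_real_derivative
    L_scale n q * (real n * (SUM i:UNIV. v $ i * dL n q i))) (at 0)"
  proof (rule has_field_derivative_transform_within[OF fin d])
   fix h :: real assume "dist h 0 < d"
   thus "c0 * (LINT t|lborel. F h t) = L P Ys n (snd q + h *\<^sub>R v) (real n *\<^sub>R yq q)"
    using Leq[of h] by (simp add: qe x_def)
  qed simp
 qed
qed

end

section \<open>The saddlepoint as a function of parameter and observation\<close>

context cgf_model
begin

text \<open>Convexity of exp makes each slice of the domain convex. It passes to slices of the
  interior because a full ball of perturbations, in tilt and parameter, is carried along.\<close>

lemma S_slice_convex: "convex {s. (s, th) \<in> S}"
proof (rule convexI)
 fix s s' :: "real ^ 'd" and a b :: real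
 assume s: "s \<in> {s. (s, th) \<in> S}" "s' \<in> {s. (s, th) \<in> S}" and ab: "0 <= a" "0 <= b" "a + b = 1"
 have "(s, th) \<in> S" "(s', th) \<in> S" using s by auto
 then obtain e1 e2 where e: "e1 > 0" "ball (s, th) e1 \<subseteq> S_dom R P Y" "e2 > 0" "ball (s', th) e2 \<subseteq> S_dom R P Y"
  unfolding mem_interior by blast
 define e where "e = min e1 e2"
 have e0: "e > 0" using e by (simp add: e_def)
 have "ball (a *\<^sub>R s + b *\<^sub>R s', th) e \<subseteq> S_dom R P Y"
 proof
  fix x assume x: "x \<in> ball (a *\<^sub>R s + b *\<^sub>R s', th) e"
  obtain w th' where xe: "x = (a *\<^sub>R s + b *\<^sub>R s' + w, th')"
  proof
   show "x = (a *\<^sub>R s + b *\<^sub>R s' + (fst x - (a *\<^sub>R s + b *\<^sub>R s')), snd x)" by simp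
  qed
  \<comment> \<open>The perturbation of the convex combination is applied unchanged to both end
    points.\<close>
  have "dist (s + w, th') (s, th) < e" "dist (s' + w, th') (s', th) < e"
   using x by (simp_all add: xe dist_prod_def dist_norm norm_minus_commute)
  hence "(s + w, th') \<in> S_dom R P Y" "(s' + w, th') \<in> S_dom R P Y"
   using e by (auto simp: e_def dist_commute)
  hence th': "th' \<in> R" and fin: "(\<integral>\<^sup>+om. ennreal (exp ((s + w) \<bullet> Y th' om)) \<partial>P th') < \<infinity>"
   "(\<integral>\<^sup>+om. ennreal (exp ((s' + w) \<bullet> Y th' om)) \<partial>P th') < \<infinity>"
   by (auto simp: S_dom_def S_at_def)
  have [measurable]: "Y th' \<in> borel_measurable (P th')" by (rule Y_meas[OF th'])
  have le: "exp ((a *\<^sub>R s + b *\<^sub>R s' + w) \<bullet> y) <= exp ((s + w) \<bullet> y) + exp ((s' + w) \<bullet> y)" for y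
  proof -
   have "a *\<^sub>R s + b *\<^sub>R s' + w = a *\<^sub>R (s + w) + b *\<^sub>R (s' + w)"
    using ab(3) by (simp add: scaleR_add_right flip: scaleR_add_left)
   hence "(a *\<^sub>R s + b *\<^sub>R s' + w) \<bullet> y = a * ((s + w) \<bullet> y) + b * ((s' + w) \<bullet> y)" by (simp add: inner_add_left)
   also have "... <= max ((s + w) \<bullet> y) ((s' + w) \<bullet> y)" by (rule convex_bound_le) (use ab in auto)
   finally have "exp ((a *\<^sub>R s + b *\<^sub>R s' + w) \<bullet> y) <= exp (max ((s + w) \<bullet> y) ((s' + w) \<bullet> y))" by simp
   also have "... <= exp ((s + w) \<bullet> y) + exp ((s' + w) \<bullet> y)" by (simp add: max_def)
   finally show ?thesis .
  qed
  have "(\<integral>\<^sup>+om. ennreal (exp ((a *\<^sub>R s + b *\<^sub>R s' + w) \<bullet> Y th' om)) \<partial>P th')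
    <= (\<integral>\<^sup>+om. ennreal (exp ((s + w) \<bullet> Y th' om)) + ennreal (exp ((s' + w) \<bullet> Y th' om)) \<partial>P th')"
   by (intro nn_integral_mono) (use le in \<open>simp flip: ennreal_plus\<close>)
  also have "... < \<infinity>" using fin by (subst nn_integral_add) auto
  finally show "x \<in> S_dom R P Y" using th' by (simp add: xe S_dom_def S_at_def)
 qed
 thus "a *\<^sub>R s + b *\<^sub>R s' \<in> {s. (s, th) \<in> S}" using e0 by (auto simp: mem_interior)
qed

lemma yq_line_derivative:
 assumes "(s + t *\<^sub>R v, th) \<in> S"
 shows "((%t. yq (s + t *\<^sub>R v, th) \<bullet> v) has_real_derivative \<sigma>q (s + t *\<^sub>R v, th) v) (at t)"
proof -
 have "((%t. SUM j:UNIV. k1 (Inl j) ((s, th) + t *\<^sub>R (v, 0)) * v $ j) has_real_derivative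
   (SUM j:UNIV. (SUM x:UNIV. ((v, 0) \<bullet> dir x) * k2 x (Inl j) ((s, th) + t *\<^sub>R (v, 0))) * v $ j)) (at t)"
  by (intro DERIV_sum DERIV_cmult_right line_has_real_derivative k1_has_derivative) (use assms in simp)
 moreover have "(SUM j:UNIV. (SUM x:UNIV. ((v, 0 :: real ^ 'p) \<bullet> dir x) * k2 x (Inl j) (s + t *\<^sub>R v, th)) * v $ j) = \<sigma>q (s + t *\<^sub>R v, th) v"
  unfolding \<sigma>q_def sum_UNIV_Plus sum_distrib_right by (subst sum.swap) (simp add: mult_ac sum_distrib_left)
 ultimately show ?thesis by (simp add: yq_def inner_vec_def)
qed

lemma yq_strictly_monotone:
 assumes s: "(s, th) \<in> S" "(s', th) \<in> S" and ne: "s ~= s'" and k: "!!z. z \<in> closed_segment s s' ==> \<sigma>q (z, th) (s' - s) >= k"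
 shows "(yq (s', th) - yq (s, th)) \<bullet> (s' - s) > 0" "(yq (s', th) - yq (s, th)) \<bullet> (s' - s) >= k"
proof -
 let ?v = "s' - s"
 have seg: "s + t *\<^sub>R ?v \<in> closed_segment s s'" if "0 <= t" "t <= 1" for t
  unfolding closed_segment_def using that by (auto intro!: exI[of _ t] simp: algebra_simps)
 have inS: "(s + t *\<^sub>R ?v, th) \<in> S" if "0 <= t" "t <= 1" for t
  using seg[OF that] closed_segment_subset[OF _ _ S_slice_convex[of th], of s s'] s by auto
 obtain t where t: "0 < t" "t < 1"
  "yq (s + 1 *\<^sub>R ?v, th) \<bullet> ?v - yq (s + 0 *\<^sub>R ?v, th) \<bullet> ?v = (1 - 0) * \<sigma>q (s + t *\<^sub>R ?v, th) ?v"
  using MVT2[OF zero_less_one, of "%t. yq (s + t *\<^sub>R ?v, th) \<bullet> ?v" "%t. \<sigma>q (s + t *\<^sub>R ?v, th) ?v"]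
   yq_line_derivative[OF inS] by blast
 hence eq: "(yq (s', th) - yq (s, th)) \<bullet> ?v = \<sigma>q (s + t *\<^sub>R ?v, th) ?v" by (simp add: inner_diff_left)
 show "(yq (s', th) - yq (s, th)) \<bullet> ?v > 0" unfolding eq
  by (rule \<sigma>q_pos[OF inS]) (use t ne in auto)
 show "(yq (s', th) - yq (s, th)) \<bullet> ?v >= k" unfolding eq by (rule k[OF seg]) (use t in auto)
qed

lemma yq_injective:
 assumes s: "(s, th) \<in> S" "(s', th) \<in> S" and eq: "yq (s, th) = yq (s', th)"
 shows "s = s'"
proof (rule ccontr)
 assume ne: "s ~= s'"
 have sg: "\<sigma>q (z, th) (s' - s) >= 0" if "z \<in> closed_segment s s'" for z
  using that closed_segment_subset[OF _ _ S_slice_convex[of th], of s s'] s ne by (intro less_imp_le \<sigma>q_pos) auto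
 show False using yq_strictly_monotone(1)[OF s ne sg] eq by simp
qed

lemma grad_s_yq: "q \<in> S ==> grad_s K q = yq q"
 by (simp add: K0_derivatives yq_def)

lemma s_hat_eqI:
 assumes "(s, th) \<in> S" "yq (s, th) = y"
 shows "s_hat R P Y th y = s"
 unfolding s_hat_def by (rule the_equality) (use assms yq_injective in \<open>auto simp: grad_s_yq\<close>)

end

context local_cgf
begin

lemma yq_strongly_monotone:
 obtains k where "k > 0" "!!s s' th. (s, th) \<in> Q ==> (s', th) \<in> Q ==>
  (yq (s', th) - yq (s, th)) \<bullet> (s' - s) >= k * (norm (s' - s))\<^sup>2"
proof -
 obtain k where k: "k > 0" "!!q u. q \<in> Q ==> u \<bullet> (hess_s K q *v u) >= k * (norm u)\<^sup>2" using hess_s_posdef by blast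
 show ?thesis
 proof (rule that[OF k(1)])
  fix s s' th assume q: "(s, th) \<in> Q" "(s', th) \<in> Q"
  have Qz: "(z, th) \<in> Q" if "z \<in> closed_segment s s'" for z
   using that closed_segment_subset[OF _ _ convex_cball, of s s0 \<rho> s'] q by auto
  show "(yq (s', th) - yq (s, th)) \<bullet> (s' - s) >= k * (norm (s' - s))\<^sup>2"
  proof (cases "s = s'")
   case False
   show ?thesis
   proof (rule yq_strictly_monotone(2)[OF Q_S[OF q(1)] Q_S[OF q(2)] False])
    fix z assume "z \<in> closed_segment s s'"
    note Qz = Qz[OF this]
    show "k * (norm (s' - s))\<^sup>2 <= \<sigma>q (z, th) (s' - s)" unfolding \<sigma>q_hess[OF Q_S[OF Qz]] by (rule k(2)[OF Qz])
   qed
  qed simp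
 qed
qed

text \<open>For fixed parameter the saddlepoint maximises the concave function s y - K(s), whose
  gradient \<open>y - yq\<close> is strongly monotone, so it exists near the base point without an
  implicit function theorem. Comparing two saddlepoints at one common parameter gives the Lipschitz
  bound.\<close>

lemma s_hat_local:
 obtains r B where "r > 0" "r <= \<rho>" "B >= 0"
  "!!th y. th \<in> ball th0 r ==> y \<in> ball (yq (s0, th0)) r ==> s_hat R P Y th y \<in> ball s0 \<rho> & yq (s_hat R P Y th y, th) = y"
  "!!th th' y y'. th \<in> ball th0 r ==> th' \<in> ball th0 r ==> y \<in> ball (yq (s0, th0)) r ==> y' \<in> ball (yq (s0, th0)) r ==>
   norm (s_hat R P Y th y - s_hat R P Y th' y') <= B * (norm (y - y') + norm (th - th'))"
proof -
 let ?y0 = "yq (s0, th0)"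
 obtain k where k: "k > 0" and mono: "!!s s' th. (s, th) \<in> Q ==> (s', th) \<in> Q ==>
  (yq (s', th) - yq (s, th)) \<bullet> (s' - s) >= k * (norm (s' - s))\<^sup>2" using yq_strongly_monotone by blast
 obtain B where B: "B >= 0" "!!q q'. q \<in> Q ==> q' \<in> Q ==> norm (yq q - yq q') <= B * dist q q'"
  using yq_lipschitz by blast
 \<comment> \<open>Moving the observation and the parameter by less than \<open>r\<close> changes
   the gradient at \<open>s0\<close> by less than \<open>r * (1 + B)\<close>, which must stay below
   the threshold \<open>k * \<rho>\<close>.\<close>
 define r where "r = min \<rho> (k * \<rho> / (1 + B))"
 have r: "r > 0" "r <= \<rho>" using k \<rho> B by (auto simp: r_def)
 have rk: "r * (1 + B) <= k * \<rho>"
 proof -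
  have "r * (1 + B) <= k * \<rho> / (1 + B) * (1 + B)" using B by (intro mult_right_mono) (auto simp: r_def)
  thus ?thesis using B by simp
 qed
 have sh: "s_hat R P Y th y \<in> ball s0 \<rho> & yq (s_hat R P Y th y, th) = y"
  if th: "th \<in> ball th0 r" and y: "y \<in> ball ?y0 r" for th y
 proof -
  have thQ: "(s, th) \<in> Q" if "s \<in> cball s0 \<rho>" for s using that th r by simp
  have "EX z:ball s0 \<rho>. y - yq (z, th) = 0 & (ALL s:cball s0 \<rho>. s \<bullet> y - K (s, th) <= z \<bullet> y - K (z, th))"
  proof (rule strongly_monotone_gradient_maximiser[OF \<rho>])
   fix s v :: "real ^ 'd" assume s: "s \<in> cball s0 \<rho>"
   have "((%t. K ((s, th) + t *\<^sub>R (v, 0))) has_real_derivative (SUM x:UNIV. ((v, 0) \<bullet> dir x) * k1 x (s, th))) (at 0)"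
    by (rule line_has_real_derivative) (use K_has_derivative[OF Q_S[OF thQ[OF s]]] in simp)
   moreover have "(SUM x:UNIV. ((v, 0 :: real ^ 'p) \<bullet> dir x) * k1 x (s, th)) = yq (s, th) \<bullet> v"
    by (simp add: sum_UNIV_Plus yq_def inner_vec_def mult.commute)
   ultimately have dK: "((%t. K (s + t *\<^sub>R v, th)) has_real_derivative yq (s, th) \<bullet> v) (at 0)" by simp
   have "((%t. (s + t *\<^sub>R v) \<bullet> y - K (s + t *\<^sub>R v, th)) has_real_derivative (v \<bullet> y - yq (s, th) \<bullet> v)) (at 0)"
    by (rule DERIV_diff[OF _ dK]) (auto intro!: derivative_eq_intros simp: inner_add_left)
   thus "((%t. (s + t *\<^sub>R v) \<bullet> y - K (s + t *\<^sub>R v, th)) has_real_derivative (y - yq (s, th)) \<bullet> v) (at 0)"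
    by (simp add: inner_diff_left inner_diff_right inner_commute)
  next
   have "continuous_on (cball s0 \<rho>) (%s. k1 (Inl j) (s, th))" for j
    by (rule continuous_on_compose2[OF k1_cont]) (use Q_S[OF thQ] in \<open>auto intro!: continuous_intros\<close>)
   thus "continuous_on (cball s0 \<rho>) (%s. y - yq (s, th))" unfolding yq_def
    by (intro continuous_intros) auto
  next
   fix s s' assume s: "s \<in> cball s0 \<rho>" "s' \<in> cball s0 \<rho>"
   have "((y - yq (s, th)) - (y - yq (s', th))) \<bullet> (s - s') = - ((yq (s, th) - yq (s', th)) \<bullet> (s - s'))"
    by (simp add: inner_diff_left)
   thus "((y - yq (s, th)) - (y - yq (s', th))) \<bullet> (s - s') <= - k * (norm (s - s'))\<^sup>2"
    using mono[OF thQ[OF s(2)] thQ[OF s(1)]] by linarith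
  next
   have q0: "(s0, th0) \<in> Q" "(s0, th) \<in> Q" using \<rho> th r by auto
   have "dist (s0, th0) (s0, th) = dist th0 th" by (simp add: dist_prod_def)
   hence "norm (?y0 - yq (s0, th)) <= B * dist th0 th" using B(2)[OF q0] by simp
   also have "... <= B * r" using th B by (intro mult_left_mono) auto
   finally have 1: "norm (?y0 - yq (s0, th)) <= B * r" .
   have "norm (y - yq (s0, th)) <= norm (y - ?y0) + norm (?y0 - yq (s0, th))"
    using norm_triangle_ineq[of "y - ?y0" "?y0 - yq (s0, th)"] by simp
   also have "... < r + B * r" using y 1 by (intro add_less_le_mono) (auto simp: dist_norm norm_minus_commute)
   also have "... <= k * \<rho>" using rk by (simp add: algebra_simps)
   finally show "norm (y - yq (s0, th)) < k * \<rho>" .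
  qed
  then obtain z where z: "z \<in> ball s0 \<rho>" "yq (z, th) = y" by auto
  have "s_hat R P Y th y = z" by (rule s_hat_eqI[OF Q_S[OF thQ] z(2)]) (use z in auto)
  thus ?thesis using z by simp
 qed
 show ?thesis
 proof (rule that[OF r, of "(1 + B) / k"])
  show "(1 + B) / k >= 0" using B k by simp
  fix th th' y y' assume th: "th \<in> ball th0 r" "th' \<in> ball th0 r" and y: "y \<in> ball ?y0 r" "y' \<in> ball ?y0 r"
  define s s' where "s = s_hat R P Y th y" and "s' = s_hat R P Y th' y'"
  have s: "s \<in> ball s0 \<rho>" "yq (s, th) = y" "s' \<in> ball s0 \<rho>" "yq (s', th') = y'"
   using sh[OF th(1) y(1)] sh[OF th(2) y(2)] by (auto simp: s_def s'_def)
  have q: "(s, th) \<in> Q" "(s', th) \<in> Q" "(s', th') \<in> Q" using s th r by auto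
  have "dist (s', th') (s', th) = norm (th - th')" by (simp add: dist_prod_def dist_norm norm_minus_commute)
  hence d: "norm (y' - yq (s', th)) <= B * norm (th - th')" using B(2)[OF q(3,2)] s by simp
  have "k * (norm (s - s'))\<^sup>2 <= (yq (s, th) - yq (s', th)) \<bullet> (s - s')" by (rule mono[OF q(2,1)])
  also have "... <= norm (yq (s, th) - yq (s', th)) * norm (s - s')" by (rule norm_cauchy_schwarz)
  also have "norm (yq (s, th) - yq (s', th)) <= norm (y - y') + B * norm (th - th')"
   using norm_triangle_ineq[of "y - y'" "y' - yq (s', th)"] d s by simp
  also have "... <= (1 + B) * (norm (y - y') + norm (th - th'))" using B by (simp add: algebra_simps)
  finally have "k * (norm (s - s'))\<^sup>2 <= (1 + B) * (norm (y - y') + norm (th - th')) * norm (s - s')"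
   by (simp add: mult_right_mono)
  hence "(k * norm (s - s')) * norm (s - s') <= ((1 + B) * (norm (y - y') + norm (th - th'))) * norm (s - s')"
   by (simp add: power2_eq_square mult.assoc)
  hence "k * norm (s - s') <= (1 + B) * (norm (y - y') + norm (th - th'))"
   using B by (cases "norm (s - s') = 0") (auto dest: mult_right_le_imp_le)
  thus "norm (s_hat R P Y th y - s_hat R P Y th' y') <= (1 + B) / k * (norm (y - y') + norm (th - th'))"
   using k by (simp add: s_def s'_def field_simps)
 qed (use sh in auto)
qed

end

section \<open>The Schur complement and the profile gradient\<close>

lemma negative_definite_bound:
 fixes N :: "real ^ 'n ^ 'n"
 assumes N: "negative_definite N"
 obtains k where "k > 0" "!!v. v \<bullet> (N *v v) <= - k * (norm v)\<^sup>2"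
proof -
 have "axis undefined 1 \<in> sphere (0 :: real ^ 'n) 1" by simp
 then obtain w where w: "w \<in> sphere 0 1" "!!v. v \<in> sphere 0 1 ==> v \<bullet> (N *v v) <= w \<bullet> (N *v w)"
  using continuous_attains_sup[OF compact_sphere _ continuous_on_subset[OF continuous_on_quadratic_form[of N]], of 0 1] by blast
 show ?thesis
 proof (rule that[of "- (w \<bullet> (N *v w))"])
  have "w ~= 0" using w(1) by auto
  thus "- (w \<bullet> (N *v w)) > 0" using N by (simp add: negative_definite_def)
  fix v :: "real ^ 'n"
  show "v \<bullet> (N *v v) <= - (- (w \<bullet> (N *v w))) * (norm v)\<^sup>2"
  proof (cases "v = 0")
   case False
   define c where "c = norm v"
   define u where "u = (1 / c) *\<^sub>R v"
   have c: "c > 0" using False by (simp add: c_def)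
   have u: "u \<in> sphere 0 1" and v: "v = c *\<^sub>R u" using c by (simp_all add: u_def c_def)
   have "v \<bullet> (N *v v) = c\<^sup>2 * (u \<bullet> (N *v u))" unfolding v by (simp add: matrix_vector_mult_scaleR power2_eq_square)
   also have "... <= c\<^sup>2 * (w \<bullet> (N *v w))" by (intro mult_left_mono w(2)[OF u]) auto
   finally show ?thesis by (simp add: c_def mult.commute)
  qed simp
 qed
qed

text \<open>The constraint expresses \<sigma> through \<Delta>, and substitution turns the quadratic
  form into that of the Schur complement. The vectors \<open>a\<close> and \<open>b\<close> stand
  for linearisation errors, which cost only terms linear in \<Delta>.\<close>

lemma schur_complement_bound:
 fixes H H' :: "real ^ 'd ^ 'd" and A :: "real ^ 'p ^ 'd" and T :: "real ^ 'p ^ 'p"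
 assumes H': "H' ** H = mat 1" and N: "negative_definite (T - transpose A ** H' ** A)"
 obtains k C where "k > 0" "C >= 0" "!!\<sigma> \<Delta> a b. H *v \<sigma> + A *v \<Delta> = a ==>
  (transpose A *v \<sigma> + T *v \<Delta> + b) \<bullet> \<Delta> <= - k * (norm \<Delta>)\<^sup>2 + (C * norm a + norm b) * norm \<Delta>"
proof -
 obtain k where k: "k > 0" "!!v. v \<bullet> ((T - transpose A ** H' ** A) *v v) <= - k * (norm v)\<^sup>2"
  using negative_definite_bound[OF N] by blast
 have "bounded_linear (%a. (transpose A ** H') *v a)" by (rule matrix_vector_mul_bounded_linear)
 then obtain C where C: "C > 0" "!!a. norm ((transpose A ** H') *v a) <= norm a * C"
  using bounded_linear.pos_bounded by blast
 show ?thesis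
 proof (rule that[OF k(1) less_imp_le[OF C(1)]])
  fix \<sigma> \<Delta> a b assume e: "H *v \<sigma> + A *v \<Delta> = a"
  have "\<sigma> = H' *v (H *v \<sigma>)" by (simp add: matrix_vector_mul_assoc H')
  also have "H *v \<sigma> = a - A *v \<Delta>" using e by (simp add: algebra_simps)
  finally have \<sigma>: "transpose A *v \<sigma> = (transpose A ** H') *v a - (transpose A ** H' ** A) *v \<Delta>"
   by (simp add: matrix_vector_mult_diff_distrib matrix_vector_mul_assoc matrix_mul_assoc)
  have "(transpose A *v \<sigma> + T *v \<Delta> + b) \<bullet> \<Delta>
   = \<Delta> \<bullet> ((T - transpose A ** H' ** A) *v \<Delta>) + ((transpose A ** H') *v a + b) \<bullet> \<Delta>"
   unfolding \<sigma> by (simp add: matrix_vector_mult_diff_rdistrib inner_add_left inner_add_right inner_diff_left inner_diff_right inner_commute)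
  also have "... <= - k * (norm \<Delta>)\<^sup>2 + norm ((transpose A ** H') *v a + b) * norm \<Delta>"
   by (intro add_mono k(2) norm_cauchy_schwarz)
  also have "... <= - k * (norm \<Delta>)\<^sup>2 + (C * norm a + norm b) * norm \<Delta>"
   using C(2)[of a] by (intro add_left_mono mult_right_mono order_trans[OF norm_triangle_ineq]) (auto simp: mult.commute)
  finally show "(transpose A *v \<sigma> + T *v \<Delta> + b) \<bullet> \<Delta> <= - k * (norm \<Delta>)\<^sup>2 + (C * norm a + norm b) * norm \<Delta>" .
 qed
qed

context local_cgf
begin

text \<open>By the envelope principle, at the saddlepoint this partial gradient is the full gradient
  of the profile.\<close>

definition g0 :: "(real ^ 'd) \<times> (real ^ 'p) => real ^ 'p" where "g0 q = (\<chi> i. k1 (Inr i) q)"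

lemma hess_s_left_inverse:
 assumes q: "q \<in> Q"
 shows "matrix_inv (hess_s K q) ** hess_s K q = mat 1"
proof -
 obtain k where k: "k > 0" "!!q u. q \<in> Q ==> u \<bullet> (hess_s K q *v u) >= k * (norm u)\<^sup>2" using hess_s_posdef by blast
 have "u = 0" if "hess_s K q *v u = 0" for u
 proof -
  have "k * (norm u)\<^sup>2 <= 0" using k(2)[OF q, of u] that by simp
  thus ?thesis using k(1) by (simp add: mult_le_0_iff)
 qed
 hence "EX B. B ** hess_s K q = mat 1" by (simp add: matrix_left_invertible_ker)
 hence "invertible (hess_s K q)" by (simp add: invertible_left_inverse)
 thus ?thesis unfolding invertible_def matrix_inv_def by (rule someI2_ex) simp
qed

text \<open>Two saddlepoints of the same observation have equal \<open>yq\<close>; linearised at the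
  base point this is the constraint of \<open>schur_complement_bound\<close>, while the difference
  of \<open>g0\<close> is its quadratic part. Neither point is the base point, which is why strict
  differentiability is used.\<close>

lemma profile_gradient_monotone:
 assumes N: "negative_definite (hess_th K (s0, th0) - transpose (mixed_s_th K (s0, th0)) ** matrix_inv (hess_s K (s0, th0)) ** mixed_s_th K (s0, th0))"
  and B: "B >= 0"
 obtains k e where "k > 0" "e > 0" "!!s th s' th'. (s, th) \<in> ball (s0, th0) e ==> (s', th') \<in> ball (s0, th0) e ==>
  yq (s, th) = yq (s', th') ==> norm (s - s') <= B * norm (th - th') ==>
  (g0 (s, th) - g0 (s', th')) \<bullet> (th - th') <= - k * (norm (th - th'))\<^sup>2"
proof -
 let ?q0 = "(s0, th0)"
 define H where "H = hess_s K ?q0"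
 define A where "A = mixed_s_th K ?q0"
 define T where "T = hess_th K ?q0"
 have q0: "?q0 \<in> Q" "?q0 \<in> S" using \<rho> Q_S[of ?q0] by auto
 obtain k C where k: "k > 0" "C >= 0" and schur: "!!\<sigma> \<Delta> a b. H *v \<sigma> + A *v \<Delta> = a ==>
  (transpose A *v \<sigma> + T *v \<Delta> + b) \<bullet> \<Delta> <= - k * (norm \<Delta>)\<^sup>2 + (C * norm a + norm b) * norm \<Delta>"
  using schur_complement_bound[OF hess_s_left_inverse[OF q0(1)] N] unfolding H_def A_def T_def by blast
 \<comment> \<open>\<open>c * eps\<close> bounds all linearisation errors: the cardinalities come
   from passing to coordinates, \<open>B + 1\<close> from the joint displacement. \<open>eps\<close>
   is chosen so that half of \<open>k\<close> survives.\<close>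
 define c where "c = (C * real CARD('d) + real CARD('p)) * (B + 1)"
 define eps where "eps = k / (2 * (c + 1))"
 have c: "c >= 0" using k(2) B by (simp add: c_def)
 have eps: "eps > 0" "c * eps <= k / 2" using k c by (auto simp: eps_def field_simps)
 have "ALL y. EX r>0. ALL a:ball ?q0 r. ALL b:ball ?q0 r.
  \<bar>k1 y b - k1 y a - (SUM x:UNIV. ((b - a) \<bullet> dir x) * k2 x y ?q0)\<bar> <= eps * norm (b - a)"
  using k1_strict[OF q0(2) eps(1)] by blast
 then obtain r where r: "!!y. r y > 0" and strict: "!!y a b. a \<in> ball ?q0 (r y) ==> b \<in> ball ?q0 (r y) ==>
  \<bar>k1 y b - k1 y a - (SUM x:UNIV. ((b - a) \<bullet> dir x) * k2 x y ?q0)\<bar> <= eps * norm (b - a)"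
  by (subst (asm) choice_iff) blast
 define e where "e = Min (range r)"
 have e: "e > 0" "!!y. e <= r y" using r by (auto simp: e_def)
 show ?thesis
 proof (rule that[of "k / 2" e])
  show "k / 2 > 0" using k by simp
  fix s s' :: "real ^ 'd" and th th' :: "real ^ 'p"
  assume q: "(s, th) \<in> ball ?q0 e" "(s', th') \<in> ball ?q0 e" and eq: "yq (s, th) = yq (s', th')"
   and lip: "norm (s - s') <= B * norm (th - th')"
  define \<sigma> where "\<sigma> = s - s'"
  define \<Delta> where "\<Delta> = th - th'"
  have in_r: "(s, th) \<in> ball ?q0 (r y)" "(s', th') \<in> ball ?q0 (r y)" for y using q e(2)[of y] by auto
  have nq: "norm ((s, th) - (s', th')) <= (B + 1) * norm \<Delta>"
  proof -
   have "norm ((s, th) - (s', th')) <= norm \<sigma> + norm \<Delta>" by (simp add: \<sigma>_def \<Delta>_def norm_Pair_le)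
   thus ?thesis using lip by (simp add: \<sigma>_def \<Delta>_def algebra_simps)
  qed
  have bd: "\<bar>k1 y (s, th) - k1 y (s', th') - (SUM x:UNIV. ((\<sigma>, \<Delta>) \<bullet> dir x) * k2 x y ?q0)\<bar> <= eps * ((B + 1) * norm \<Delta>)" for y
   using strict[OF in_r(2) in_r(1), of y] mult_left_mono[OF nq less_imp_le[OF eps(1)]]
   by (simp add: \<sigma>_def \<Delta>_def)
  define a where "a = H *v \<sigma> + A *v \<Delta>"
  define b where "b = g0 (s, th) - g0 (s', th') - (transpose A *v \<sigma> + T *v \<Delta>)"
  have aj: "a $ j = (SUM x:UNIV. ((\<sigma>, \<Delta>) \<bullet> dir x) * k2 x (Inl j) ?q0)" for j
   using k2_sym[OF q0(2)] by (simp add: a_def H_def A_def K0_derivatives[OF q0(2)] matrix_vector_mult_def sum_UNIV_Plus mult.commute)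
  have bi: "b $ i = k1 (Inr i) (s, th) - k1 (Inr i) (s', th') - (SUM x:UNIV. ((\<sigma>, \<Delta>) \<bullet> dir x) * k2 x (Inr i) ?q0)" for i
   using k2_sym[OF q0(2), of "Inr i"]
   by (simp add: b_def g0_def T_def A_def K0_derivatives[OF q0(2)] matrix_vector_mult_def transpose_def sum_UNIV_Plus mult.commute)
  have "\<bar>a $ j\<bar> <= eps * ((B + 1) * norm \<Delta>)" for j
  proof -
   have "k1 (Inl j) (s, th) = k1 (Inl j) (s', th')" using eq by (simp add: yq_def vec_eq_iff)
   thus ?thesis using bd[of "Inl j"] unfolding aj by simp
  qed
  hence na: "norm a <= real CARD('d) * (eps * ((B + 1) * norm \<Delta>))"
   using order_trans[OF norm_le_l1_cart sum_mono[of UNIV "%j. \<bar>a $ j\<bar>" "%_. eps * ((B + 1) * norm \<Delta>)"]] by simp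
  have "\<bar>b $ i\<bar> <= eps * ((B + 1) * norm \<Delta>)" for i unfolding bi by (rule bd)
  hence nb: "norm b <= real CARD('p) * (eps * ((B + 1) * norm \<Delta>))"
   using order_trans[OF norm_le_l1_cart sum_mono[of UNIV "%j. \<bar>b $ j\<bar>" "%_. eps * ((B + 1) * norm \<Delta>)"]] by simp
  have "g0 (s, th) - g0 (s', th') = transpose A *v \<sigma> + T *v \<Delta> + b" by (simp add: b_def)
  hence "(g0 (s, th) - g0 (s', th')) \<bullet> \<Delta> <= - k * (norm \<Delta>)\<^sup>2 + (C * norm a + norm b) * norm \<Delta>"
   using schur[OF a_def[symmetric], of b] by simp
  also have "C * norm a + norm b <= C * (real CARD('d) * (eps * ((B + 1) * norm \<Delta>))) + real CARD('p) * (eps * ((B + 1) * norm \<Delta>))"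
   by (intro add_mono mult_left_mono na nb k(2))
  also have "... = (c * eps) * norm \<Delta>" by (simp add: c_def algebra_simps)
  also have "... <= (k / 2) * norm \<Delta>" by (intro mult_right_mono eps(2)) simp
  finally have "(g0 (s, th) - g0 (s', th')) \<bullet> \<Delta> <= - k * (norm \<Delta>)\<^sup>2 + (k / 2) * norm \<Delta> * norm \<Delta>"
   by (simp add: mult_right_mono)
  also have "... = - (k / 2) * (norm \<Delta>)\<^sup>2" by (simp add: power2_eq_square algebra_simps)
  finally show "(g0 (s, th) - g0 (s', th')) \<bullet> (th - th') <= - (k / 2) * (norm (th - th'))\<^sup>2" by (simp add: \<Delta>_def)
 qed (rule e(1))
qed

lemma quotient_diff_bound:
 fixes a b a' b' :: real
 assumes "g > 0" "b >= g" "b' >= g"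
 shows "\<bar>a / b - a' / b'\<bar> <= \<bar>a - a'\<bar> / g + \<bar>a'\<bar> * \<bar>b - b'\<bar> / g\<^sup>2"
proof -
 have pos: "b > 0" "b' > 0" using assms by auto
 have "a / b - a' / b' = (a - a') / b + a' * (b' - b) / (b * b')" using pos by (simp add: field_simps)
 also have "\<bar>...\<bar> <= \<bar>a - a'\<bar> / b + \<bar>a'\<bar> * \<bar>b - b'\<bar> / (b * b')"
  using pos by (intro order_trans[OF abs_triangle_ineq]) (simp add: abs_mult abs_minus_commute)
 also have "... <= \<bar>a - a'\<bar> / g + \<bar>a'\<bar> * \<bar>b - b'\<bar> / g\<^sup>2"
  unfolding power2_eq_square using assms pos by (intro add_mono divide_left_mono mult_mono mult_pos_pos mult_nonneg_nonneg) auto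
 finally show ?thesis .
qed

end

section \<open>Limits of derivatives, determinants and logarithms\<close>

lemma has_real_derivative_uniform_limit:
 fixes f f' :: "nat => real => real"
 assumes d: "d > 0"
  and der: "!!n h. n >= n0 ==> \<bar>h\<bar> < d ==> (f n has_real_derivative f' n h) (at h)"
  and bd: "!!n h. n >= n0 ==> \<bar>h\<bar> < d ==> \<bar>f' n h - g h\<bar> <= C / real n"
  and lim: "!!h. \<bar>h\<bar> < d ==> (%n. f n h) \<longlonglongrightarrow> F h"
 shows "(F has_real_derivative g 0) (at 0)"
proof -
 let ?S = "{-d<..<d}"
 have "EX G. ALL x:?S. (%n. f (n + n0) x) \<longlonglongrightarrow> G x & (G has_derivative (%h. h * g x)) (at x within ?S)"
 proof (rule has_derivative_sequence)
  show "(f (n + n0) has_derivative (%h. h * f' (n + n0) x)) (at x within ?S)" if "x \<in> ?S" for n x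
  proof (rule has_derivative_at_withinI)
   have "(f (n + n0) has_real_derivative f' (n + n0) x) (at x)" by (rule der) (use that in \<open>auto simp: abs_less_iff\<close>)
   moreover have "(%h. h * f' (n + n0) x) = (*) (f' (n + n0) x)" by (simp add: fun_eq_iff)
   ultimately show "(f (n + n0) has_derivative (%h. h * f' (n + n0) x)) (at x)" by (simp only: has_field_derivative_def)
  qed
  show "\<forall>\<^sub>F n in sequentially. ALL x:?S. ALL h. norm (h * f' (n + n0) x - h * g x) <= e * norm h" if e: "e > 0" for e
  proof -
   have "(%n. C / real (n + n0)) \<longlonglongrightarrow> 0"
    by (rule LIMSEQ_ignore_initial_segment) (rule lim_const_over_n)
   hence "\<forall>\<^sub>F n in sequentially. C / real (n + n0) < e" using e by (rule order_tendstoD)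
   thus ?thesis
   proof eventually_elim
    case (elim n)
    show ?case
    proof (intro ballI allI)
     fix x h assume "x \<in> ?S"
     hence "\<bar>f' (n + n0) x - g x\<bar> <= e" using bd[of "n + n0" x] elim by (auto simp: abs_less_iff)
     hence "\<bar>h\<bar> * \<bar>f' (n + n0) x - g x\<bar> <= \<bar>h\<bar> * e" by (intro mult_left_mono) auto
     thus "norm (h * f' (n + n0) x - h * g x) <= e * norm h"
      by (simp add: abs_mult mult.commute flip: right_diff_distrib)
    qed
   qed
  qed
  show "(%n. f (n + n0) 0) \<longlonglongrightarrow> F 0" by (rule LIMSEQ_ignore_initial_segment[OF lim]) (use d in simp)
 qed (use d in auto)
 then obtain G where G: "!!x. x \<in> ?S ==> (%n. f (n + n0) x) \<longlonglongrightarrow> G x"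
  "!!x. x \<in> ?S ==> (G has_derivative (%h. h * g x)) (at x within ?S)" by blast
 have FG: "F x = G x" if "x \<in> ?S" for x
  by (rule LIMSEQ_unique[OF LIMSEQ_ignore_initial_segment[OF lim] G(1)[OF that]]) (use that in auto)
 have S0: "at 0 within ?S = at 0" by (rule at_within_open) (use d in auto)
 have "(%h. h * g 0) = (*) (g 0)" by (simp add: fun_eq_iff)
 hence "(G has_real_derivative g 0) (at 0)" using G(2)[of 0] d unfolding S0 has_field_derivative_def by simp
 thus ?thesis by (rule has_field_derivative_transform_within[OF _ d]) (auto simp: FG abs_less_iff dist_real_def)
qed

lemma det_scaleR:
 fixes A :: "real ^ 'n ^ 'n"
 shows "det (c *\<^sub>R A) = c ^ CARD('n) * det A"
proof -
 have "c *\<^sub>R A = (\<chi> i. c *s A $ i)" by (simp add: vec_eq_iff)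
 hence "det (c *\<^sub>R A) = (\<Prod>i\<in>(UNIV :: 'n set). c) * det (\<chi> i. A $ i)" by (simp only: det_rows_mul)
 thus ?thesis by simp
qed

lemma abs_ln_diff_le:
 fixes a b :: real
 assumes "g > 0" "a >= g" "b >= g"
 shows "\<bar>ln a - ln b\<bar> <= \<bar>a - b\<bar> / g"
proof -
 have *: "ln a - ln b <= \<bar>a - b\<bar> / g" if "a >= g" "b >= g" for a b
 proof -
  have pos: "a > 0" "b > 0" using assms(1) that by auto
  have "ln a - ln b = ln (a / b)" using pos by (simp add: ln_div)
  also have "... <= a / b - 1" using pos by (intro ln_le_minus_one) simp
  also have "... = (a - b) / b" using pos by (simp add: field_simps)
  also have "... <= \<bar>a - b\<bar> / b" using pos by (intro divide_right_mono) auto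
  also have "... <= \<bar>a - b\<bar> / g" using assms(1) that pos by (intro divide_left_mono) auto
  finally show ?thesis .
 qed
 show ?thesis using *[of a b] *[of b a] assms by (simp add: abs_le_iff abs_minus_commute)
qed

context iid_cgf
begin

text \<open>The excess of the gradient of the logarithm of \<open>L\<close>, divided by
  \<open>n\<close>, over \<open>g0\<close>.\<close>

definition N_n :: "nat => (real ^ 'd) \<times> (real ^ 'p) => real ^ 'p" where
 "N_n n q = (\<chi> i. Re (J_n (fq i) n q) / Re (J_n mq n q))"

end

abbreviation (in local_cgf) y0 where "y0 \<equiv> yq (s0, th0)"

abbreviation (in local_cgf) \<gamma> where "\<gamma> q \<equiv> gauss_integral (hess_s K q)"

text \<open>Everything about the integrals that the comparison of maximisers uses:
  \<open>N_n\<close> is of order 1/n in size and in the Lipschitz sense, with coefficient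
  \<open>e\<close> up to 1/n^2. The saddlepoint estimates near the base point are added.\<close>

locale gradient_expansion = iid_cgf R P Y s0 th0 \<rho> Ys
 for R :: "(real ^ 'p) set" and P :: "real ^ 'p => 'w measure" and Y :: "real ^ 'p => 'w => real ^ 'd"
  and s0 :: "real ^ 'd" and th0 :: "real ^ 'p" and \<rho> :: real and Ys :: "real ^ 'p => nat => 'w => real ^ 'd" +
 fixes C :: real and n1 :: nat and e :: "(real ^ 'd) \<times> (real ^ 'p) => real ^ 'p" and r1 B :: real
 assumes C: "C >= 0" and n1: "n1 >= 1"
  and im: "!!n q. n >= n1 ==> q \<in> Q ==> integrable lborel (I_n mq n q)"
  and Jpos: "!!n q. n >= n1 ==> q \<in> Q ==> Re (J_n mq n q) > 0"
  and lnJ: "!!n q. n >= n1 ==> q \<in> Q ==> \<bar>ln (Re (J_n mq n q)) - ln (\<gamma> q)\<bar> <= C / real n"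
  and N_le: "!!n q. n >= n1 ==> q \<in> Q ==> norm (N_n n q) <= C / real n"
  and N_lip: "!!n q q'. n >= n1 ==> q \<in> Q ==> q' \<in> Q ==> norm (N_n n q - N_n n q') <= C * dist q q' / real n"
  and N_e: "!!n q. n >= n1 ==> q \<in> Q ==> norm (real n *\<^sub>R N_n n q - e q) <= C / real n"
  and e_le: "!!q. q \<in> Q ==> norm (e q) <= C"
  and e_lip: "!!q q'. q \<in> Q ==> q' \<in> Q ==> norm (e q - e q') <= C * dist q q'"
  and L_deriv: "!!n q v. n >= n1 ==> fst q \<in> cball s0 \<rho> ==> snd q \<in> ball th0 \<rho> ==>
   ((%h. L P Ys n (snd q + h *\<^sub>R v) (real n *\<^sub>R yq q)) has_real_derivative
    L_scale n q * (real n * (SUM i:UNIV. v $ i * dL n q i))) (at 0)"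
  and r1: "r1 > 0" "r1 <= \<rho>" and B: "B >= 0"
  and sh: "!!th y. th \<in> ball th0 r1 ==> y \<in> ball (y0) r1 ==> s_hat R P Y th y \<in> ball s0 \<rho> & yq (s_hat R P Y th y, th) = y"
  and s_lip: "!!th th' y y'. th \<in> ball th0 r1 ==> th' \<in> ball th0 r1 ==> y \<in> ball (y0) r1 ==> y' \<in> ball (y0) r1 ==>
   norm (s_hat R P Y th y - s_hat R P Y th' y') <= B * (norm (y - y') + norm (th - th'))"

context iid_asymptotics
begin

lemma gradient_expansion_exists: "EX C n0 e r B. gradient_expansion R P Y s0 th0 \<rho> Ys C n0 e r B"
proof -
 let ?q0 = "(s0, th0)"
 have q0: "?q0 \<in> Q" using \<rho> by simp
 obtain k where k: "k > 0" "!!q u. q \<in> Q ==> u \<bullet> (hess_s K q *v u) >= k * (norm u)\<^sup>2" using hess_s_posdef by blast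
 have \<gamma>pos: "\<gamma> q > 0" if "q \<in> Q" for q by (rule gauss_integral_pos[OF k(1) k(2)[OF that]])
 have J_lim: "(%n. J_n mq n q) \<longlonglongrightarrow> of_real (\<gamma> q)" if "q \<in> Q" for q
 proof (rule LIM_zero_cancel, rule Lim_null_comparison)
  show "\<forall>\<^sub>F n in sequentially. norm (J_n mq n q - of_real (\<gamma> q)) <= C / real n"
   using Jm[OF _ that] by (auto intro: eventually_sequentiallyI)
  show "(%n. C / real n) \<longlonglongrightarrow> 0" by (rule lim_const_over_n)
 qed
 \<comment> \<open>The Gaussian factor inherits the Lipschitz bound as the limit of
   \<open>J_n\<close>; no derivative of the Hessian is taken.\<close>
 have \<gamma>lip: "\<bar>\<gamma> q - \<gamma> q'\<bar> <= C * dist q q'" if "q \<in> Q" "q' \<in> Q" for q q'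
 proof -
  have "norm (complex_of_real (\<gamma> q) - of_real (\<gamma> q')) <= C * dist q q'"
   by (rule tendsto_upperbound[OF tendsto_norm[OF tendsto_diff[OF J_lim[OF that(1)] J_lim[OF that(2)]]]])
     (use Jm_lip[OF _ that] in \<open>auto intro: eventually_sequentiallyI\<close>)
  thus ?thesis by (simp flip: of_real_diff)
 qed
 have "continuous_on Q \<gamma>"
  by (rule lipschitz_on_continuous_on[of C]) (use C \<gamma>lip in \<open>auto simp: lipschitz_on_def dist_real_def\<close>)
 then obtain q1 where q1: "q1 \<in> Q" "!!q. q \<in> Q ==> \<gamma> q1 <= \<gamma> q"
  using continuous_attains_inf[OF Q_compact _ \<open>continuous_on Q \<gamma>\<close>] q0 by blast
 \<comment> \<open>Half of the minimum of the Gaussian factor on \<open>Q\<close>: once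
   \<open>C / n\<close> is below \<open>g\<close>, the real part of \<open>J_n mq\<close> is bounded
   away from 0 and can serve as a denominator.\<close>
 define g where "g = \<gamma> q1 / 2"
 have g: "g > 0" "!!q. q \<in> Q ==> 2 * g <= \<gamma> q" using \<gamma>pos[OF q1(1)] q1(2) by (auto simp: g_def)
 obtain n1 :: nat where n1: "n1 >= n0" "C / g <= real n1" using real_arch_simple[of "max (C / g) (real n0)"] by auto
 have n1': "n1 >= 1" using n1 n0 by simp
 have Jg: "Re (J_n mq n q) >= g" if n: "n >= n1" and q: "q \<in> Q" for n q
 proof -
  have "C <= g * real n1" using n1(2) g by (simp add: field_simps)
  also have "... <= g * real n" using g n by (intro mult_left_mono) auto
  finally have "C / real n <= g" using n n1' by (simp add: field_simps)
  moreover have "\<bar>Re (J_n mq n q - of_real (\<gamma> q))\<bar> <= C / real n"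
   using abs_Re_le_cmod[of "J_n mq n q - of_real (\<gamma> q)"] Jm[of n q] n n1 q by simp
  ultimately show ?thesis using g(2)[OF q] by (simp add: abs_le_iff)
 qed
 \<comment> \<open>No bound on \<open>c\<close> over \<open>Q\<close> is known yet. The size of
   \<open>J_n (fq i)\<close> is controlled at the base point and carried over \<open>Q\<close> by
   the Lipschitz estimate, distances to the base point being at most
   \<open>2 * \<rho>\<close>.\<close>
 define C1 where "C1 = (SUM i:UNIV. norm (c i ?q0)) + C + C * (2 * \<rho>)"
 have C1: "C1 >= 0" "C1 >= C" using C \<rho> by (auto simp: C1_def sum_nonneg)
 have tri: "norm a <= norm (a - b) + norm (b - c) + norm c" for a b c :: complex
  using norm_triangle_ineq[of "(a - b) + (b - c)" c] norm_triangle_ineq[of "a - b" "b - c"] by simp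
 have Jf_le: "norm (J_n (fq i) n q) <= C1 / real n" if n: "n >= n1" and q: "q \<in> Q" for n q i
 proof -
  have np: "real n >= 1" using n n1' by simp
  have n': "n >= n0" using n n1 by simp
  have "dist q ?q0 <= dist (fst q) s0 + dist (snd q) th0"
   by (cases q) (simp add: dist_prod_def sqrt_sum_squares_le_sum)
  hence dq: "dist q ?q0 <= 2 * \<rho>" using q by (auto simp: dist_commute)
  have "norm (c i ?q0 / of_nat n) <= (SUM i:UNIV. norm (c i ?q0)) / real n"
   unfolding norm_divide norm_of_nat by (intro divide_right_mono member_le_sum) auto
  moreover have "C / (real n)\<^sup>2 <= C / real n" using np C by (intro divide_left_mono) (auto simp: power2_eq_square)
  moreover have "C * dist q ?q0 / real n <= C * (2 * \<rho>) / real n" using C dq by (intro divide_right_mono mult_left_mono) auto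
  moreover have "norm (J_n (fq i) n q) <= norm (J_n (fq i) n q - J_n (fq i) n ?q0) + norm (J_n (fq i) n ?q0 - c i ?q0 / of_nat n) + norm (c i ?q0 / of_nat n)"
   by (rule tri)
  ultimately show ?thesis using Jf_lip[OF n' q q0, of i] Jf[OF n' q0, of i]
   by (simp add: C1_def add_divide_distrib)
 qed
 \<comment> \<open>The coefficient does not depend on \<open>n\<close>, so it is bounded by
   evaluating its expansion at the single index \<open>n1\<close>.\<close>
 have c_le: "norm (c i q) <= C1 + C" if q: "q \<in> Q" for i q
 proof -
  have np: "real n1 >= 1" using n1' by simp
  have "norm (c i q / of_nat n1) <= norm (J_n (fq i) n1 q) + norm (J_n (fq i) n1 q - c i q / of_nat n1)"
   using norm_triangle_ineq4[of "J_n (fq i) n1 q" "J_n (fq i) n1 q - c i q / of_nat n1"] by simp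
  also have "... <= C1 / real n1 + C / (real n1)\<^sup>2" by (intro add_mono Jf_le Jf) (use n1 q in auto)
  also have "... <= C1 / real n1 + C / real n1" using np C by (intro add_left_mono divide_left_mono) (auto simp: power2_eq_square)
  finally have "norm (c i q) / real n1 <= (C1 + C) / real n1" by (simp add: norm_divide add_divide_distrib)
  thus ?thesis using np by (simp add: divide_le_cancel)
 qed
 \<comment> \<open>Collects the constants that \<open>quotient_diff_bound\<close> and the lower
   bound \<open>g\<close> produce in the estimates for \<open>N_n\<close> and
   \<open>e\<close>.\<close>
 define C2 where "C2 = C1 / g + C1 * C / g\<^sup>2 + C / g + (C1 + C) * C / g\<^sup>2 + (C1 + C) / g"
 define W where "W = real CARD('p)"
 have W: "W >= 1" by (simp add: W_def Suc_leI)
 have t: "C1 / g >= 0" "C1 * C / g\<^sup>2 >= 0" "C / g >= 0" "(C1 + C) * C / g\<^sup>2 >= 0" "(C1 + C) / g >= 0" using g C C1 by auto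
 have C2: "C2 >= 0" "C / g <= C2" "C1 / g <= C2" "C / g + C1 * C / g\<^sup>2 <= C2" "C / g + (C1 + C) * C / g\<^sup>2 <= C2" "(C1 + C) / g <= C2"
  using t by (auto simp: C2_def)
 define e :: "(real ^ 'd) \<times> (real ^ 'p) => real ^ 'p" where "e q = (\<chi> i. Re (c i q) / \<gamma> q)" for q
 have vec: "norm v <= W * B" if "!!i. \<bar>v $ i\<bar> <= B" for v :: "real ^ 'p" and B
  using order_trans[OF norm_le_l1_cart sum_mono[of UNIV "%i. \<bar>v $ i\<bar>" "%_. B"]] that by (simp add: W_def)
 have N_le: "norm (N_n n q) <= W * C2 / real n" if n: "n >= n1" and q: "q \<in> Q" for n q
 proof -
  have "\<bar>N_n n q $ i\<bar> <= C2 / real n" for i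
  proof -
   have "\<bar>Re (J_n (fq i) n q)\<bar> <= C1 / real n" by (rule order_trans[OF abs_Re_le_cmod Jf_le[OF n q]])
   hence "\<bar>Re (J_n (fq i) n q)\<bar> / Re (J_n mq n q) <= (C1 / real n) / g"
    using Jg[OF n q] g C1 by (intro frac_le) auto
   also have "... = (C1 / g) / real n" by simp
   also have "... <= C2 / real n" by (intro divide_right_mono C2) simp
   finally show ?thesis using Jg[OF n q] g by (simp add: N_n_def)
  qed
  from vec[OF this] show ?thesis by simp
 qed
 have N_lip: "norm (N_n n q - N_n n q') <= W * C2 * dist q q' / real n" if n: "n >= n1" and q: "q \<in> Q" "q' \<in> Q" for n q q'
 proof -
  have n': "n >= n0" using n n1 by simp
  have "\<bar>(N_n n q - N_n n q') $ i\<bar> <= C2 * dist q q' / real n" for i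
  proof -
   have "\<bar>Re (J_n (fq i) n q) - Re (J_n (fq i) n q')\<bar> <= C * dist q q' / real n"
    using order_trans[OF abs_Re_le_cmod Jf_lip[OF n' q]] by simp
   moreover have "\<bar>Re (J_n mq n q) - Re (J_n mq n q')\<bar> <= C * dist q q'"
    using order_trans[OF abs_Re_le_cmod Jm_lip[OF n' q]] by simp
   moreover have "\<bar>Re (J_n (fq i) n q')\<bar> <= C1 / real n" by (rule order_trans[OF abs_Re_le_cmod Jf_le[OF n q(2)]])
   ultimately have "\<bar>Re (J_n (fq i) n q) - Re (J_n (fq i) n q')\<bar> / g + \<bar>Re (J_n (fq i) n q')\<bar> * \<bar>Re (J_n mq n q) - Re (J_n mq n q')\<bar> / g\<^sup>2
     <= (C * dist q q' / real n) / g + (C1 / real n) * (C * dist q q') / g\<^sup>2"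
    using g C1 by (intro add_mono divide_right_mono mult_mono) auto
   also have "... = (C / g + C1 * C / g\<^sup>2) * (dist q q' / real n)" by (simp add: algebra_simps)
   also have "... <= C2 * (dist q q' / real n)" by (intro mult_right_mono C2) auto
   finally show ?thesis
    using quotient_diff_bound[OF g(1) Jg[OF n q(1)] Jg[OF n q(2)], of "Re (J_n (fq i) n q)" "Re (J_n (fq i) n q')"]
    by (simp add: N_n_def)
  qed
  from vec[OF this] show ?thesis by (simp add: mult.assoc)
 qed
 have N_e: "norm (real n *\<^sub>R N_n n q - e q) <= W * C2 / real n" if n: "n >= n1" and q: "q \<in> Q" for n q
 proof -
  have n': "n >= n0" and np: "real n > 0" using n n1 n1' by auto
  have gq: "\<gamma> q >= g" using g(2)[OF q] g(1) by simp
  have "\<bar>(real n *\<^sub>R N_n n q - e q) $ i\<bar> <= C2 / real n" for i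
  proof -
   have "norm (of_nat n * (J_n (fq i) n q - c i q / of_nat n)) <= real n * (C / (real n)\<^sup>2)"
    unfolding norm_mult norm_of_nat by (intro mult_left_mono Jf n' q) simp
   also have "real n * (C / (real n)\<^sup>2) = C / real n" using np by (simp add: power2_eq_square)
   finally have "\<bar>Re (of_nat n * (J_n (fq i) n q - c i q / of_nat n))\<bar> <= C / real n"
    by (rule order_trans[OF abs_Re_le_cmod])
   hence "\<bar>real n * Re (J_n (fq i) n q) - Re (c i q)\<bar> <= C / real n"
    using np by (simp add: right_diff_distrib)
   moreover have "\<bar>Re (J_n mq n q) - \<gamma> q\<bar> <= C / real n" using order_trans[OF abs_Re_le_cmod Jm[OF n' q]] by simp
   moreover have "\<bar>Re (c i q)\<bar> <= C1 + C" by (rule order_trans[OF abs_Re_le_cmod c_le[OF q]])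
   ultimately have "\<bar>real n * Re (J_n (fq i) n q) - Re (c i q)\<bar> / g + \<bar>Re (c i q)\<bar> * \<bar>Re (J_n mq n q) - \<gamma> q\<bar> / g\<^sup>2
     <= (C / real n) / g + (C1 + C) * (C / real n) / g\<^sup>2"
    using g C1 C by (intro add_mono divide_right_mono mult_mono) auto
   also have "... = (C / g + (C1 + C) * C / g\<^sup>2) / real n" by (simp add: add_divide_distrib mult.commute)
   also have "... <= C2 / real n" by (intro divide_right_mono C2) auto
   finally show ?thesis
    using quotient_diff_bound[OF g(1) Jg[OF n q] gq, of "real n * Re (J_n (fq i) n q)" "Re (c i q)"]
    by (simp add: N_n_def e_def)
  qed
  from vec[OF this] show ?thesis by simp
 qed
 have e_le: "norm (e q) <= W * C2" if q: "q \<in> Q" for q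
 proof (rule vec)
  fix i
  have "\<bar>Re (c i q)\<bar> / \<gamma> q <= (C1 + C) / g"
   using order_trans[OF abs_Re_le_cmod c_le[OF q]] g(2)[OF q] g(1) C C1 by (intro frac_le) auto
  thus "\<bar>e q $ i\<bar> <= C2" using C2 \<gamma>pos[OF q] by (simp add: e_def)
 qed
 have e_lim: "(%n. real n *\<^sub>R N_n n q) \<longlonglongrightarrow> e q" if "q \<in> Q" for q
 proof (rule LIM_zero_cancel, rule Lim_null_comparison)
  show "\<forall>\<^sub>F n in sequentially. norm (real n *\<^sub>R N_n n q - e q) <= W * C2 / real n"
   using N_e[OF _ that] by (auto intro: eventually_sequentiallyI)
  show "(%n. W * C2 / real n) \<longlonglongrightarrow> 0" by (rule lim_const_over_n)
 qed
 \<comment> \<open>\<open>e\<close> is the limit of \<open>n * N_n\<close>, whose Lipschitz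
   constants do not depend on \<open>n\<close>.\<close>
 have e_lip: "norm (e q - e q') <= W * C2 * dist q q'" if q: "q \<in> Q" "q' \<in> Q" for q q'
 proof (rule tendsto_upperbound[OF tendsto_norm[OF tendsto_diff[OF e_lim[OF q(1)] e_lim[OF q(2)]]]])
  have "norm (real n *\<^sub>R N_n n q - real n *\<^sub>R N_n n q') <= W * C2 * dist q q'" if n: "n >= n1" for n
  proof -
   have "norm (real n *\<^sub>R N_n n q - real n *\<^sub>R N_n n q') = real n * norm (N_n n q - N_n n q')"
    by (simp flip: scaleR_diff_right)
   also have "... <= real n * (W * C2 * dist q q' / real n)" by (intro mult_left_mono N_lip n q) simp
   also have "... = W * C2 * dist q q'" using n n1' by simp
   finally show ?thesis .
  qed
  thus "\<forall>\<^sub>F n in sequentially. norm (real n *\<^sub>R N_n n q - real n *\<^sub>R N_n n q') <= W * C2 * dist q q'"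
   by (rule eventually_sequentiallyI)
 qed simp
 have ln_le: "\<bar>ln (Re (J_n mq n q)) - ln (\<gamma> q)\<bar> <= W * C2 / real n" if n: "n >= n1" and q: "q \<in> Q" for n q
 proof -
  have n': "n >= n0" and gq: "\<gamma> q >= g" using n n1 g(2)[OF q] g(1) by auto
  have "\<bar>ln (Re (J_n mq n q)) - ln (\<gamma> q)\<bar> <= \<bar>Re (J_n mq n q) - \<gamma> q\<bar> / g" by (rule abs_ln_diff_le[OF g(1) Jg[OF n q] gq])
  also have "... <= (C / real n) / g" using order_trans[OF abs_Re_le_cmod Jm[OF n' q]] g(1) by (intro divide_right_mono) auto
  also have "... = (C / g) / real n" by simp
  also have "... <= C2 / real n" by (intro divide_right_mono C2) simp
  also have "... <= W * C2 / real n" using W C2(1) by (intro divide_right_mono) (auto simp: mult_le_cancel_right1)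
  finally show ?thesis .
 qed
 obtain n2 where n2: "n2 >= 1" and DL: "!!n q v. n >= n2 ==> fst q \<in> cball s0 \<rho> ==> snd q \<in> ball th0 \<rho> ==>
   ((%h. L P Ys n (snd q + h *\<^sub>R v) (real n *\<^sub>R yq q)) has_real_derivative
    L_scale n q * (real n * (SUM i:UNIV. v $ i * dL n q i))) (at 0)"
  by (rule L_derivative) (rule that, assumption+)
 show ?thesis
 proof (rule s_hat_local)
  fix r B assume *: "r > 0" "r <= \<rho>" "B >= 0"
   "!!th y. th \<in> ball th0 r ==> y \<in> ball (yq (s0, th0)) r ==> s_hat R P Y th y \<in> ball s0 \<rho> & yq (s_hat R P Y th y, th) = y"
   "!!th th' y y'. th \<in> ball th0 r ==> th' \<in> ball th0 r ==> y \<in> ball (yq (s0, th0)) r ==> y' \<in> ball (yq (s0, th0)) r ==>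
    norm (s_hat R P Y th y - s_hat R P Y th' y') <= B * (norm (y - y') + norm (th - th'))"
  have "gradient_expansion R P Y s0 th0 \<rho> Ys (W * C2) (max n1 n2) e r B"
  proof
   show "W * C2 >= 0" using W C2 by simp
   show "integrable lborel (I_n mq n q)" if "n >= max n1 n2" "q \<in> Q" for n q using im[OF _ that(2)] that n1 by simp
   show "Re (J_n mq n q) > 0" if "n >= max n1 n2" "q \<in> Q" for n q using Jg[OF _ that(2), of n] that(1) g by simp
  qed (use * n1' in \<open>auto intro!: ln_le N_le N_lip N_e e_le e_lip DL\<close>)
  thus ?thesis by blast
 qed
qed

end

section \<open>Logarithms of the exact and the saddlepoint likelihood\<close>

context iid_cgf
begin

definition qh :: "real ^ 'd => real ^ 'p => (real ^ 'd) \<times> (real ^ 'p)" where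
 "qh y th = (s_hat R P Y th y, th)"

definition \<Psi> :: "real ^ 'd => real ^ 'p => real" where
 "\<Psi> y th = K (qh y th) - fst (qh y th) \<bullet> y"

abbreviation lnL where "lnL n y th \<equiv> ln (L P Ys n th (real n *\<^sub>R y))"
abbreviation lnLh where "lnLh n y th \<equiv> ln (L_hat R P Y n th (real n *\<^sub>R y))"

lemma log_L_eq:
 assumes q: "qh y th \<in> Q" "yq (qh y th) = y" and n: "n >= 1" and int: "integrable lborel (I_n mq n (qh y th))"
  and J: "Re (J_n mq n (qh y th)) > 0"
 shows "L P Ys n th (real n *\<^sub>R y) > 0"
  "lnL n y th = real n * \<Psi> y th + ln ((1 / sqrt n) ^ CARD('d) / (2 * pi) ^ CARD('d)) + ln (Re (J_n mq n (qh y th)))"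
proof -
 have sc: "L_scale n (qh y th) = exp (real n * \<Psi> y th) * ((1 / sqrt n) ^ CARD('d) / (2 * pi) ^ CARD('d))"
  using q(2) by (simp add: L_scale_def \<Psi>_def)
 have pos: "(1 / sqrt n) ^ CARD('d) / (2 * pi) ^ CARD('d) > 0" using n by simp
 have L: "L P Ys n th (real n *\<^sub>R y) = exp (real n * \<Psi> y th) * ((1 / sqrt n) ^ CARD('d) / (2 * pi) ^ CARD('d)) * Re (J_n mq n (qh y th))"
  using L_value[OF q(1) n int] unfolding sc q(2) by (simp add: qh_def)
 show "L P Ys n th (real n *\<^sub>R y) > 0" unfolding L by (intro mult_pos_pos exp_gt_zero pos J)
 show "lnL n y th = real n * \<Psi> y th + ln ((1 / sqrt n) ^ CARD('d) / (2 * pi) ^ CARD('d)) + ln (Re (J_n mq n (qh y th)))"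
  unfolding L using pos J by (simp only: ln_mult_pos mult_pos_pos exp_gt_zero ln_exp)
qed

text \<open>Trading the root of the determinant for the Gaussian integral, at the price of a term
  free of the parameter, makes the saddlepoint likelihood contain the very limit of
  \<open>J_n mq\<close>.\<close>

lemma log_L_hat_eq:
 assumes q: "qh y th \<in> Q" and n: "n >= 1"
 shows "L_hat R P Y n th (real n *\<^sub>R y) > 0"
  "lnLh n y th = real n * \<Psi> y th + ln (\<gamma> (qh y th))
   - ln (gauss_integral (mat 1 :: real ^ 'd ^ 'd) * sqrt ((2 * pi * real n) ^ CARD('d)))"
proof -
 let ?H = "hess_s K (qh y th)" and ?g1 = "gauss_integral (mat 1 :: real ^ 'd ^ 'd)"
 obtain k where k: "k > 0" "!!q u. q \<in> Q ==> u \<bullet> (hess_s K q *v u) >= k * (norm u)\<^sup>2" using hess_s_posdef by blast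
 have det: "det ?H > 0" "\<gamma> (qh y th) = ?g1 / sqrt (det ?H)"
  using gauss_integral_det[OF k(1) k(2)[OF q] hess_s_symmetric[OF Q_S[OF q]]] by auto
 have g1: "?g1 > 0" by (rule gauss_integral_pos[of 1]) (auto simp: dot_square_norm)
 have \<gamma>0: "\<gamma> (qh y th) > 0" using det g1 by simp
 let ?s = "sqrt ((2 * pi * real n) ^ CARD('d))"
 have s: "?s > 0" using n by simp
 have "sqrt (det ((2 * pi * real n) *\<^sub>R ?H)) = ?s * sqrt (det ?H)" by (simp add: det_scaleR real_sqrt_mult)
 also have "sqrt (det ?H) = ?g1 / \<gamma> (qh y th)" using det g1 by simp
 finally have sd: "sqrt (det ((2 * pi * real n) *\<^sub>R ?H)) = (?g1 * ?s) / \<gamma> (qh y th)" by simp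
 have "(real n *\<^sub>R y) /\<^sub>R real n = y" using n by simp
 hence L: "L_hat R P Y n th (real n *\<^sub>R y) = exp (real n * \<Psi> y th) * \<gamma> (qh y th) / (?g1 * ?s)"
  unfolding L_hat_def Let_def \<Psi>_def using sd by (simp add: qh_def)
 show "L_hat R P Y n th (real n *\<^sub>R y) > 0" unfolding L by (intro divide_pos_pos mult_pos_pos exp_gt_zero \<gamma>0 g1 s)
 have "ln (exp (real n * \<Psi> y th) * \<gamma> (qh y th) / (?g1 * ?s)) = ln (exp (real n * \<Psi> y th)) + ln (\<gamma> (qh y th)) - ln (?g1 * ?s)"
  using \<gamma>0 g1 s by (simp only: ln_divide_pos ln_mult_pos mult_pos_pos exp_gt_zero)
 thus "lnLh n y th = real n * \<Psi> y th + ln (\<gamma> (qh y th)) - ln (?g1 * ?s)" unfolding L by simp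
qed

lemma line_in_ball:
 fixes th v :: "real ^ 'p"
 assumes "th \<in> ball th0 r"
 obtains d where "d > 0" "!!h. \<bar>h\<bar> < d ==> th + h *\<^sub>R v \<in> ball th0 r"
proof -
 have "\<forall>\<^sub>F h in nhds 0. th + h *\<^sub>R v \<in> ball th0 r" by (rule eventually_line_in_open) (use assms in auto)
 thus ?thesis using that unfolding eventually_nhds_metric dist_real_def by auto
qed

end

context gradient_expansion
begin

lemma qh:
 assumes "th \<in> ball th0 r1" "y \<in> ball y0 r1"
 shows "qh y th \<in> Q" "yq (qh y th) = y"
 using sh[OF assms] assms(1) r1 by (auto simp: qh_def)

abbreviation log_const :: "nat => real ^ 'd => real" where
 "log_const n y \<equiv> ln ((1 / sqrt n) ^ CARD('d) / (2 * pi) ^ CARD('d))"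

lemma L_pos_log:
 assumes n: "n >= n1" and th: "th \<in> ball th0 r1" and y: "y \<in> ball y0 r1"
 shows "L P Ys n th (real n *\<^sub>R y) > 0"
  "lnL n y th = real n * \<Psi> y th + log_const n y + ln (Re (J_n mq n (qh y th)))"
 by (rule log_L_eq[OF qh[OF th y]]; use n n1 in \<open>auto intro!: im Jpos qh[OF th y]\<close>)+

lemma DlnL:
 assumes n: "n >= n1" and th: "th \<in> ball th0 r1" and y: "y \<in> ball y0 r1"
 shows "((%t. lnL n y (th + t *\<^sub>R v) / real n) has_real_derivative (g0 (qh y th) + N_n n (qh y th)) \<bullet> v) (at 0)"
proof -
 define q where "q = qh y th"
 have q: "q \<in> Q" "yq q = y" "snd q = th" using qh[OF th y] by (auto simp: q_def) (simp add: qh_def)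
 have nn: "n >= n1" "n >= 1" using n n1 by auto
 have D: "((%h. L P Ys n (th + h *\<^sub>R v) (real n *\<^sub>R y)) has_real_derivative
   L_scale n q * (real n * (SUM i:UNIV. v $ i * dL n q i))) (at 0)"
  using L_deriv[OF nn(1), of q v] q th r1 by auto
 define a where "a = L_scale n q"
 define b where "b = Re (J_n mq n q)"
 have b: "b > 0" unfolding b_def by (rule Jpos[OF nn(1) q(1)])
 have a: "a > 0" unfolding a_def L_scale_def using nn(2) by simp
 have L0: "L P Ys n (th + 0 *\<^sub>R v) (real n *\<^sub>R y) = a * b"
  using L_value[OF q(1) nn(2) im[OF nn(1) q(1)]] by (simp add: q a_def b_def)
 have ab: "a * b > 0" using a b by simp
 have dln: "(ln has_real_derivative inverse (a * b)) (at (L P Ys n (th + 0 *\<^sub>R v) (real n *\<^sub>R y)))"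
  unfolding L0 by (rule DERIV_ln[OF ab])
 note DERIV_cdivide[OF DERIV_chain2[OF dln D], of "real n"]
 moreover have "inverse (a * b) * (L_scale n q * (real n * (SUM i:UNIV. v $ i * dL n q i))) / real n = (SUM i:UNIV. v $ i * dL n q i) / b"
  using a b nn(2) unfolding a_def[symmetric] by (simp add: field_simps)
 moreover have "(SUM i:UNIV. v $ i * dL n q i) / b = (g0 q + N_n n q) \<bullet> v"
  using b by (simp add: dL_def b_def[symmetric] g0_def N_n_def inner_vec_def sum_divide_distrib add_divide_distrib distrib_left mult.commute add.commute)
 ultimately show ?thesis by (simp add: q_def)
qed

lemma Jlim:
 assumes "q \<in> Q"
 shows "(%n. ln (Re (J_n mq n q))) \<longlonglongrightarrow> ln (\<gamma> q)"
proof (rule LIM_zero_cancel, rule Lim_null_comparison)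
 show "\<forall>\<^sub>F n in sequentially. norm (ln (Re (J_n mq n q)) - ln (\<gamma> q)) <= C / real n"
  using lnJ[OF _ assms] by (auto intro: eventually_sequentiallyI)
 show "(%n. C / real n) \<longlonglongrightarrow> 0" by (rule lim_const_over_n)
qed

text \<open>Differentiating the profile directly would require a derivative of \<open>s_hat\<close>.
  Instead the profile is the limit of the logarithm of \<open>L\<close> divided by \<open>n\<close>,
  up to constants, and the gradients \<open>g0 + N_n\<close> converge uniformly to
  \<open>g0\<close>.\<close>

lemma D\<Psi>:
 assumes th: "th \<in> ball th0 r1" and y: "y \<in> ball y0 r1"
 shows "((%t. \<Psi> y (th + t *\<^sub>R v)) has_real_derivative g0 (qh y th) \<bullet> v) (at 0)"
proof -
 obtain d where d: "d > 0" "!!h. \<bar>h\<bar> < d ==> th + h *\<^sub>R v \<in> ball th0 r1" using line_in_ball[OF th] by blast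
 let ?q = "%h. qh y (th + h *\<^sub>R v)"
 have "((%t. \<Psi> y (th + t *\<^sub>R v)) has_real_derivative g0 (qh y (th + 0 *\<^sub>R v)) \<bullet> v) (at 0)"
 proof (rule has_real_derivative_uniform_limit[OF d(1), where ?n0.0=n1
   and f="%n h. lnL n y (th + h *\<^sub>R v) / real n - log_const n y / real n"
   and f'="%n h. (g0 (?q h) + N_n n (?q h)) \<bullet> v"
   and g="%h. g0 (?q h) \<bullet> v" and C="C * norm v"])
  fix n :: nat and h :: real assume n: "n >= n1" and h: "\<bar>h\<bar> < d"
  note th = d(2)[OF h]
  have "((%h. lnL n y (th + h *\<^sub>R v) / real n) has_real_derivative
    (g0 (?q h) + N_n n (?q h)) \<bullet> v) (at h)"
   by (rule has_real_derivative_shift[where f="%th. lnL n y th / real n"]) (rule DlnL[OF n th y])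
  from DERIV_diff[OF this DERIV_const]
  show "((%h. lnL n y (th + h *\<^sub>R v) / real n - log_const n y / real n) has_real_derivative
    (g0 (?q h) + N_n n (?q h)) \<bullet> v) (at h)" by simp
  have "\<bar>N_n n (?q h) \<bullet> v\<bar> <= norm (N_n n (?q h)) * norm v" by (rule Cauchy_Schwarz_ineq2)
  also have "... <= C / real n * norm v" using n n1 by (intro mult_right_mono N_le qh th y) auto
  finally show "\<bar>(g0 (?q h) + N_n n (?q h)) \<bullet> v - g0 (?q h) \<bullet> v\<bar> <= C * norm v / real n"
   by (simp add: inner_add_left)
 next
  fix h :: real assume h: "\<bar>h\<bar> < d"
  note th = d(2)[OF h]
  have "(%n. ln (Re (J_n mq n (?q h))) * (1 / real n)) \<longlonglongrightarrow> ln (\<gamma> (?q h)) * 0"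
   by (intro tendsto_mult Jlim qh th y lim_const_over_n)
  hence l: "(%n. \<Psi> y (th + h *\<^sub>R v) + ln (Re (J_n mq n (?q h))) * (1 / real n)) \<longlonglongrightarrow> \<Psi> y (th + h *\<^sub>R v) + ln (\<gamma> (?q h)) * 0"
   by (intro tendsto_add tendsto_const)
  have "\<forall>\<^sub>F n in sequentially. \<Psi> y (th + h *\<^sub>R v) + ln (Re (J_n mq n (?q h))) * (1 / real n)
    = lnL n y (th + h *\<^sub>R v) / real n - log_const n y / real n"
  proof (rule eventually_sequentiallyI)
   fix n assume n: "n >= n1"
   hence "real n > 0" using n1 by simp
   thus "\<Psi> y (th + h *\<^sub>R v) + ln (Re (J_n mq n (?q h))) * (1 / real n)
    = lnL n y (th + h *\<^sub>R v) / real n - log_const n y / real n"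
    unfolding L_pos_log(2)[OF n th y] by (simp add: add_divide_distrib)
  qed
  from Lim_transform_eventually[OF l this]
  show "(%n. lnL n y (th + h *\<^sub>R v) / real n - log_const n y / real n) \<longlonglongrightarrow> \<Psi> y (th + h *\<^sub>R v)" by simp
 qed
 thus ?thesis by simp
qed

text \<open>
 The coefficient \<open>e\<close> need not be computed: letting \<open>n\<close> tend to infinity in the log-likelihood, with
 its leading terms removed, identifies it as the gradient of \<open>ln \<gamma>\<close>.
\<close>

lemma D\<gamma>:
 assumes th: "th \<in> ball th0 r1" and y: "y \<in> ball y0 r1"
 shows "((%t. ln (\<gamma> (qh y (th + t *\<^sub>R v)))) has_real_derivative e (qh y th) \<bullet> v) (at 0)"
proof -
 obtain d where d: "d > 0" "!!h. \<bar>h\<bar> < d ==> th + h *\<^sub>R v \<in> ball th0 r1" using line_in_ball[OF th] by blast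
 let ?q = "%h. qh y (th + h *\<^sub>R v)"
 have "((%t. ln (\<gamma> (qh y (th + t *\<^sub>R v)))) has_real_derivative e (qh y (th + 0 *\<^sub>R v)) \<bullet> v) (at 0)"
 proof (rule has_real_derivative_uniform_limit[OF d(1), where ?n0.0=n1
   and f="%n h. real n * (lnL n y (th + h *\<^sub>R v) / real n - \<Psi> y (th + h *\<^sub>R v)) - log_const n y"
   and f'="%n h. real n * ((g0 (?q h) + N_n n (?q h)) \<bullet> v - g0 (?q h) \<bullet> v)"
   and g="%h. e (?q h) \<bullet> v" and C="C * norm v"])
  fix n :: nat and h :: real assume n: "n >= n1" and h: "\<bar>h\<bar> < d"
  note th = d(2)[OF h]
  have 1: "((%h. lnL n y (th + h *\<^sub>R v) / real n) has_real_derivative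
    (g0 (?q h) + N_n n (?q h)) \<bullet> v) (at h)"
   by (rule has_real_derivative_shift[where f="%th. lnL n y th / real n"]) (rule DlnL[OF n th y])
  have 2: "((%h. \<Psi> y (th + h *\<^sub>R v)) has_real_derivative g0 (?q h) \<bullet> v) (at h)"
   by (rule has_real_derivative_shift[where f="\<Psi> y"]) (rule D\<Psi>[OF th y])
  from DERIV_diff[OF DERIV_cmult[OF DERIV_diff[OF 1 2], of "real n"] DERIV_const]
  show "((%h. real n * (lnL n y (th + h *\<^sub>R v) / real n - \<Psi> y (th + h *\<^sub>R v)) - log_const n y) has_real_derivative
    real n * ((g0 (?q h) + N_n n (?q h)) \<bullet> v - g0 (?q h) \<bullet> v)) (at h)" by simp
  have "\<bar>(real n *\<^sub>R N_n n (?q h) - e (?q h)) \<bullet> v\<bar> <= norm (real n *\<^sub>R N_n n (?q h) - e (?q h)) * norm v"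
   by (rule Cauchy_Schwarz_ineq2)
  also have "... <= C / real n * norm v" using n n1 by (intro mult_right_mono N_e qh th y) auto
  finally show "\<bar>real n * ((g0 (?q h) + N_n n (?q h)) \<bullet> v - g0 (?q h) \<bullet> v) - e (?q h) \<bullet> v\<bar> <= C * norm v / real n"
   by (simp add: inner_add_left inner_diff_left)
 next
  fix h :: real assume h: "\<bar>h\<bar> < d"
  note th = d(2)[OF h]
  have "\<forall>\<^sub>F n in sequentially. ln (Re (J_n mq n (?q h)))
    = real n * (lnL n y (th + h *\<^sub>R v) / real n - \<Psi> y (th + h *\<^sub>R v)) - log_const n y"
  proof (rule eventually_sequentiallyI)
   fix n assume n: "n >= n1"
   hence "real n > 0" using n1 by simp
   hence "real n * (lnL n y (th + h *\<^sub>R v) / real n - \<Psi> y (th + h *\<^sub>R v)) = lnL n y (th + h *\<^sub>R v) - real n * \<Psi> y (th + h *\<^sub>R v)"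
    by (simp add: right_diff_distrib)
   thus "ln (Re (J_n mq n (?q h)))
    = real n * (lnL n y (th + h *\<^sub>R v) / real n - \<Psi> y (th + h *\<^sub>R v)) - log_const n y"
    using L_pos_log(2)[OF n th y] by linarith
  qed
  from Lim_transform_eventually[OF Jlim[OF qh(1)[OF th y]] this]
  show "(%n. real n * (lnL n y (th + h *\<^sub>R v) / real n - \<Psi> y (th + h *\<^sub>R v)) - log_const n y) \<longlonglongrightarrow> ln (\<gamma> (?q h))" .
 qed
 thus ?thesis by simp
qed

text \<open>For the saddlepoint likelihood the expansion is exact: the gradient is
  \<open>g0 + e / n\<close> with no remainder.\<close>

lemma DlnLh:
 assumes n: "n >= n1" and th: "th \<in> ball th0 r1" and y: "y \<in> ball y0 r1"
 shows "((%t. lnLh n y (th + t *\<^sub>R v) / real n) has_real_derivative (g0 (qh y th) + (1 / real n) *\<^sub>R e (qh y th)) \<bullet> v) (at 0)"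
proof -
 have np: "n >= 1" "real n > 0" using n n1 by auto
 obtain d where d: "d > 0" "!!h. \<bar>h\<bar> < d ==> th + h *\<^sub>R v \<in> ball th0 r1" using line_in_ball[OF th] by blast
 define c where "c = ln (gauss_integral (mat 1 :: real ^ 'd ^ 'd) * sqrt ((2 * pi * real n) ^ CARD('d)))"
 have "((%t. \<Psi> y (th + t *\<^sub>R v) + ln (\<gamma> (qh y (th + t *\<^sub>R v))) / real n - c / real n) has_real_derivative
   g0 (qh y th) \<bullet> v + (e (qh y th) \<bullet> v) / real n - 0) (at 0)"
  by (intro DERIV_diff DERIV_add DERIV_cdivide D\<Psi>[OF th y] D\<gamma>[OF th y] DERIV_const)
 hence D: "((%t. \<Psi> y (th + t *\<^sub>R v) + ln (\<gamma> (qh y (th + t *\<^sub>R v))) / real n - c / real n) has_real_derivative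
   (g0 (qh y th) + (1 / real n) *\<^sub>R e (qh y th)) \<bullet> v) (at 0)" by (simp add: inner_add_left)
 show ?thesis
 proof (rule has_field_derivative_transform_within[OF D d(1)])
  fix t :: real assume "dist t 0 < d"
  hence th: "th + t *\<^sub>R v \<in> ball th0 r1" using d(2) by simp
  show "\<Psi> y (th + t *\<^sub>R v) + ln (\<gamma> (qh y (th + t *\<^sub>R v))) / real n - c / real n = lnLh n y (th + t *\<^sub>R v) / real n"
   unfolding log_L_hat_eq(2)[OF qh(1)[OF th y] np(1)] c_def[symmetric] using np by (simp add: add_divide_distrib diff_divide_distrib)
 qed simp
qed

end

section \<open>Maximisers\<close>

text \<open>Passing to the logarithm is monotone, so local maximisers correspond. A local maximiser
  in the open ball is a zero of \<open>G\<close>, and strong monotonicity admits only one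
  zero.\<close>

lemma unique_local_maximiser:
 fixes f :: "'a::euclidean_space => real"
 assumes r: "r > 0" and c: "c > 0" and k: "k > 0" and pos: "!!x. x \<in> cball a r ==> f x > 0"
  and D: "!!x v. x \<in> cball a r ==> ((%t. ln (f (x + t *\<^sub>R v)) / c) has_real_derivative G x \<bullet> v) (at 0)"
  and cG: "continuous_on (cball a r) G"
  and mono: "!!x y. x \<in> cball a r ==> y \<in> cball a r ==> (G x - G y) \<bullet> (x - y) <= - k * (norm (x - y))\<^sup>2"
  and Ga: "norm (G a) < k * r"
 obtains z where "z \<in> ball a r" "G z = 0" "!!t. local_maximiser_in (ball a r) f t \<longleftrightarrow> t = z"
proof -
 obtain z where z: "z \<in> ball a r" "G z = 0" and mx: "!!y. y \<in> cball a r ==> ln (f y) / c <= ln (f z) / c"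
  using strongly_monotone_gradient_maximiser[OF r D cG mono Ga] by blast
 show ?thesis
 proof (rule that[OF z])
  fix t
  show "local_maximiser_in (ball a r) f t \<longleftrightarrow> t = z"
  proof
   assume t: "local_maximiser_in (ball a r) f t"
   hence tb: "t \<in> ball a r" and ev: "\<forall>\<^sub>F y in at t within ball a r. f y <= f t" by (auto simp: local_maximiser_in_def)
   have tc: "t \<in> cball a r" and zc: "z \<in> cball a r" using tb z by auto
   have "\<forall>\<^sub>F y in at t within ball a r. y \<in> ball a r" by (auto simp: eventually_at_filter)
   hence "\<forall>\<^sub>F y in at t within ball a r. ln (f y) / c <= ln (f t) / c"
    using ev
   proof eventually_elim
    case (elim y)
    have "f y > 0" by (rule pos) (use elim in auto)
    thus ?case using elim(2) c by (intro divide_right_mono) auto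
   qed
   hence "G t = 0" by (rule gradient_zero_at_local_maximum[OF D[OF tc] open_ball tb])
   hence "k * (norm (t - z))\<^sup>2 <= 0" using mono[OF tc zc] z(2) by simp
   thus "t = z" using k by (simp add: mult_le_0_iff)
  next
   assume t: "t = z"
   have "f y <= f z" if y: "y \<in> ball a r" for y
   proof -
    have yc: "y \<in> cball a r" and zc: "z \<in> cball a r" using y z by auto
    have "ln (f y) <= ln (f z)" using mx[OF yc] c by (simp add: divide_le_cancel)
    thus ?thesis using pos[OF yc] pos[OF zc] by simp
   qed
   thus "local_maximiser_in (ball a r) f t"
    unfolding t local_maximiser_in_def using z(1) by (auto simp: eventually_at_filter)
  qed
 qed
qed

lemma the_local_maximiser_eqI:
 assumes "!!t. local_maximiser_in U f t \<longleftrightarrow> t = z"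
 shows "\<exists>!t. local_maximiser_in U f t" "the_local_maximiser_in U f = z"
 unfolding the_local_maximiser_in_def using assms by auto

context local_cgf
begin

lemma g0_lipschitz: "EX B>=0. ALL q:Q. ALL q':Q. norm (g0 q - g0 q') <= B * dist q q'"
proof -
 have "ALL j. EX B. B >= 0 & (ALL q:Q. \<bar>k1 (Inr j) q\<bar> <= B & (ALL q':Q. \<bar>k1 (Inr j) q - k1 (Inr j) q'\<bar> <= B * dist q q'))"
  using C1_lipschitz[OF k1_partial k2_cont] by blast
 then obtain B where B: "!!j. B j >= 0" "!!j q q'. q \<in> Q ==> q' \<in> Q ==> \<bar>k1 (Inr j) q - k1 (Inr j) q'\<bar> <= B j * dist q q'"
  by (subst (asm) choice_iff) blast
 show ?thesis
 proof (intro exI[of _ "SUM j:UNIV. B j"] conjI ballI)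
  fix q q' assume q: "q \<in> Q" "q' \<in> Q"
  show "norm (g0 q - g0 q') <= (SUM j:UNIV. B j) * dist q q'"
   unfolding sum_distrib_right using B(2)[OF q] by (intro order_trans[OF norm_le_l1_cart] sum_mono) (simp add: g0_def)
 qed (use B(1) in \<open>simp add: sum_nonneg\<close>)
qed

end

context gradient_expansion
begin

lemma likelihood_maximisers:
 assumes crit: "g0 (s0, th0) = 0"
  and neg: "negative_definite (hess_th K (s0, th0) - transpose (mixed_s_th K (s0, th0)) ** matrix_inv (hess_s K (s0, th0)) ** mixed_s_th K (s0, th0))"
 shows "EX n0 U V. n0 >= 1 & open U & th0 \<in> U & U \<subseteq> R & open V & y0 \<in> V &
  (ALL th:U. ALL y:V. (y, th) \<in> Y_dom R P Y) &
  (ALL n>=n0. ALL th:U. EX f. continuous_density_of_sum P Ys n th f) &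
  (ALL n>=n0. ALL y:V.
    (\<exists>!th. local_maximiser_in U (%th. L_hat R P Y n th (real n *\<^sub>R y)) th) &
    (\<exists>!th. local_maximiser_in U (%th. L P Ys n th (real n *\<^sub>R y)) th)) &
  (EX C. ALL n>=n0. ALL y:V.
    norm (the_local_maximiser_in U (%th. L_hat R P Y n th (real n *\<^sub>R y))
       - the_local_maximiser_in U (%th. L P Ys n th (real n *\<^sub>R y)))
     <= C / (real n)\<^sup>2)"
proof -
 let ?q0 = "(s0, th0)"
 obtain k d where k: "k > 0" and d: "d > 0" and gmono: "!!s th s' th'. (s, th) \<in> ball ?q0 d ==> (s', th') \<in> ball ?q0 d ==>
  yq (s, th) = yq (s', th') ==> norm (s - s') <= B * norm (th - th') ==>
  (g0 (s, th) - g0 (s', th')) \<bullet> (th - th') <= - k * (norm (th - th'))\<^sup>2"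
  using profile_gradient_monotone[OF neg B] by blast
 obtain B' where B': "B' >= 0" and g_lip: "!!q q'. q \<in> Q ==> q' \<in> Q ==> norm (g0 q - g0 q') <= B' * dist q q'"
  using g0_lipschitz by blast
 \<comment> \<open>The first bound keeps the closed ball inside the domain of \<open>s_hat\<close>;
   the second keeps the saddlepoint pair, displaced by at most \<open>(2 * B + 1) * r\<close>, in
   the ball where the profile gradient is monotone.\<close>
 define r where "r = min (r1 / 2) (d / (2 * (2 * B + 1)))"
 \<comment> \<open>Observations are restricted further: at \<open>th0\<close> the profile gradient
   is at most \<open>B' * B * r3\<close> and must not exceed \<open>k * r / 8\<close>.\<close>
 define r3 where "r3 = min r (k * r / (8 * (B' * B + 1)))"
 have r: "r > 0" "r < r1" using r1 d B by (auto simp: r_def)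
 have rd: "(2 * B + 1) * r < d"
 proof -
  have "(2 * B + 1) * r <= (2 * B + 1) * (d / (2 * (2 * B + 1)))" using B by (intro mult_left_mono) (auto simp: r_def)
  also have "... = d / 2" using B by (simp add: field_simps)
  finally show ?thesis using d by simp
 qed
 have BB: "0 <= B' * B" using B B' by simp
 have r3: "r3 > 0" "r3 <= r" using r k BB by (auto simp: r3_def intro!: divide_pos_pos mult_pos_pos add_nonneg_pos)
 have r3k: "B' * B * r3 <= k * r / 8"
 proof -
  have "B' * B * r3 <= (B' * B + 1) * (k * r / (8 * (B' * B + 1)))"
   using BB k r r3 by (intro mult_mono) (auto simp: r3_def)
  also have "... = k * r / 8" using BB by (simp add: field_simps)
  finally show ?thesis .
 qed
 \<comment> \<open>For such \<open>n\<close> a perturbation with constants \<open>C / n\<close> has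
   size at most \<open>k * r / 8\<close> and, through \<open>s_hat\<close>, Lipschitz constant at
   most \<open>k / 2\<close>, so half of the monotonicity is left.\<close>
 obtain n2 :: nat where n2: "max (8 * C / (k * r)) (2 * C * (B + 1) / k) <= real n2" using real_arch_simple by blast
 define n0 where "n0 = max n1 n2"
 have n0: "n0 >= 1" using n1 by (simp add: n0_def)
 have big: "n >= n1" "real n > 0" "C / real n <= k * r / 8" "C * (B + 1) / real n <= k / 2" if n: "n >= n0" for n
 proof -
  show n': "n >= n1" using n by (simp add: n0_def)
  show np: "real n > 0" using n n0 by simp
  have "8 * C / (k * r) <= real n" "2 * C * (B + 1) / k <= real n" using n2 n by (auto simp: n0_def)
  thus "C / real n <= k * r / 8" "C * (B + 1) / real n <= k / 2" using k r np by (auto simp: field_simps)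
 qed
 let ?U = "ball th0 r" and ?V = "ball y0 r3"
 have th: "th \<in> ball th0 r1" if "th \<in> cball th0 r" for th using that r by auto
 have yV: "y \<in> ball y0 r1" if "y \<in> ?V" for y using that r r3 by auto
 have th0: "th0 \<in> ball th0 r1" "th0 \<in> cball th0 r" and y0: "y0 \<in> ball y0 r1" using r r1 by auto
 have q0Q: "?q0 \<in> Q" using \<rho> by simp
 have sh0: "s_hat R P Y th0 y0 = s0" by (rule s_hat_eqI[OF Q_S[OF q0Q] refl])
 have dq: "dist (qh y th) (qh y th') <= (B + 1) * norm (th - th')" if "th \<in> cball th0 r" "th' \<in> cball th0 r" "y \<in> ?V" for th th' y
 proof -
  have "dist (qh y th) (qh y th') <= norm (s_hat R P Y th y - s_hat R P Y th' y) + norm (th - th')"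
   unfolding qh_def dist_norm by (simp add: norm_Pair_le)
  thus ?thesis using s_lip[OF th[OF that(1)] th[OF that(2)] yV[OF that(3)] yV[OF that(3)]] by (simp add: algebra_simps)
 qed
 have dq0: "dist (qh y th) ?q0 <= B * (norm (y - y0) + norm (th - th0)) + norm (th - th0)" if "th \<in> cball th0 r" "y \<in> ?V" for th y
 proof -
  have "dist (qh y th) ?q0 <= norm (s_hat R P Y th y - s0) + norm (th - th0)"
   unfolding qh_def dist_norm by (simp add: norm_Pair_le)
  thus ?thesis using s_lip[OF th[OF that(1)] th0(1) yV[OF that(2)] y0] unfolding sh0 by simp
 qed
 have qd: "qh y th \<in> ball ?q0 d" if "th \<in> cball th0 r" "y \<in> ?V" for th y
 proof -
  have 1: "norm (y - y0) <= r" "norm (th - th0) <= r" using that r3 by (auto simp: dist_norm norm_minus_commute)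
  have "dist (qh y th) ?q0 <= B * (r + r) + r"
   using 1 B by (intro order_trans[OF dq0[OF that]] add_mono mult_left_mono) auto
  also have "... < d" using rd by (simp add: algebra_simps)
  finally show ?thesis by (simp add: dist_commute)
 qed
 \<comment> \<open>The perturbation \<open>E\<close> is \<open>N_n\<close> for the exact likelihood
   and \<open>e / n\<close> for the saddlepoint likelihood; both satisfy the same two
   bounds.\<close>
 have field: "continuous_on (cball th0 r) (%th. g0 (qh y th) + E (qh y th))"
   "!!th th'. th \<in> cball th0 r ==> th' \<in> cball th0 r ==>
    ((g0 (qh y th) + E (qh y th)) - (g0 (qh y th') + E (qh y th'))) \<bullet> (th - th') <= - (k / 2) * (norm (th - th'))\<^sup>2"
   "norm (g0 (qh y th0) + E (qh y th0)) < (k / 2) * r"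
  if y: "y \<in> ?V" and n: "n >= n0" and E': "ALL q:Q. norm (E q) <= C / real n"
   "ALL q:Q. ALL q':Q. norm (E q - E q') <= C * dist q q' / real n" for y n and E :: "(real ^ 'd) \<times> (real ^ 'p) => real ^ 'p"
 proof -
  note n = big[OF n] and E = E'[rule_format]
  have qQ: "qh y th \<in> Q" "yq (qh y th) = y" if "th \<in> cball th0 r" for th using qh[OF th[OF that] yV[OF y]] by auto
  have El: "norm (E (qh y th) - E (qh y th')) <= (k / 2) * norm (th - th')" if t: "th \<in> cball th0 r" "th' \<in> cball th0 r" for th th'
  proof -
   have "norm (E (qh y th) - E (qh y th')) <= C * dist (qh y th) (qh y th') / real n" by (rule E(2)[OF qQ(1)[OF t(1)] qQ(1)[OF t(2)]])
   also have "... <= C * ((B + 1) * norm (th - th')) / real n" using C n by (intro divide_right_mono mult_left_mono dq t y) auto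
   also have "... = C * (B + 1) / real n * norm (th - th')" by simp
   also have "... <= (k / 2) * norm (th - th')" by (intro mult_right_mono n(4)) simp
   finally show ?thesis .
  qed
  show "continuous_on (cball th0 r) (%th. g0 (qh y th) + E (qh y th))"
  proof (rule lipschitz_on_continuous_on, rule lipschitz_onI)
   fix th th' assume t: "th \<in> cball th0 r" "th' \<in> cball th0 r"
   have "norm (g0 (qh y th) - g0 (qh y th')) <= B' * ((B + 1) * norm (th - th'))"
    using B' by (intro order_trans[OF g_lip[OF qQ(1)[OF t(1)] qQ(1)[OF t(2)]]] mult_left_mono dq t y)
   from add_mono[OF this El[OF t]]
   have "norm (g0 (qh y th) - g0 (qh y th')) + norm (E (qh y th) - E (qh y th')) <= (B' * (B + 1) + k / 2) * norm (th - th')"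
    by (simp add: algebra_simps)
   thus "dist (g0 (qh y th) + E (qh y th)) (g0 (qh y th') + E (qh y th')) <= (B' * (B + 1) + k / 2) * dist th th'"
    using norm_triangle_ineq[of "g0 (qh y th) - g0 (qh y th')" "E (qh y th) - E (qh y th')"] by (simp add: dist_norm add_diff_add)
  qed (use B B' k in simp)
  show "((g0 (qh y th) + E (qh y th)) - (g0 (qh y th') + E (qh y th'))) \<bullet> (th - th') <= - (k / 2) * (norm (th - th'))\<^sup>2"
   if t: "th \<in> cball th0 r" "th' \<in> cball th0 r" for th th'
  proof -
   have ye: "yq (s_hat R P Y th y, th) = yq (s_hat R P Y th' y, th')" using qQ(2)[OF t(1)] qQ(2)[OF t(2)] by (simp add: qh_def)
   have sl: "norm (s_hat R P Y th y - s_hat R P Y th' y) <= B * norm (th - th')"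
    using s_lip[OF th[OF t(1)] th[OF t(2)] yV[OF y] yV[OF y]] by simp
   have 1: "(g0 (qh y th) - g0 (qh y th')) \<bullet> (th - th') <= - k * (norm (th - th'))\<^sup>2"
    using gmono[OF qd[OF t(1) y, unfolded qh_def] qd[OF t(2) y, unfolded qh_def] ye sl] by (simp add: qh_def)
   have "(E (qh y th) - E (qh y th')) \<bullet> (th - th') <= norm (E (qh y th) - E (qh y th')) * norm (th - th')" by (rule norm_cauchy_schwarz)
   also have "... <= (k / 2) * norm (th - th') * norm (th - th')" by (intro mult_right_mono El t) simp
   finally have 2: "(E (qh y th) - E (qh y th')) \<bullet> (th - th') <= (k / 2) * (norm (th - th'))\<^sup>2" by (simp add: power2_eq_square)
   have "((g0 (qh y th) + E (qh y th)) - (g0 (qh y th') + E (qh y th'))) \<bullet> (th - th')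
     = (g0 (qh y th) - g0 (qh y th')) \<bullet> (th - th') + (E (qh y th) - E (qh y th')) \<bullet> (th - th')"
    by (simp add: inner_add_left inner_diff_left)
   thus ?thesis using 1 2 by simp
  qed
  have "norm (g0 (qh y th0)) <= B' * dist (qh y th0) ?q0" using g_lip[OF qQ(1)[OF th0(2)] q0Q] crit by simp
  also have "... <= B' * (B * r3)"
  proof (intro mult_left_mono B')
   have "dist (qh y th0) ?q0 <= B * norm (y - y0)" using dq0[OF th0(2) y] by simp
   also have "... <= B * r3" using y B by (intro mult_left_mono) (auto simp: dist_norm norm_minus_commute)
   finally show "dist (qh y th0) ?q0 <= B * r3" .
  qed
  also have "... <= k * r / 8" using r3k by (simp add: mult.assoc)
  finally have "norm (g0 (qh y th0)) + norm (E (qh y th0)) <= k * r / 8 + k * r / 8"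
   by (intro add_mono order_trans[OF E(1)[OF qQ(1)[OF th0(2)]] n(3)])
  hence "norm (g0 (qh y th0) + E (qh y th0)) <= k * r / 4"
   using norm_triangle_ineq[of "g0 (qh y th0)" "E (qh y th0)"] by linarith
  thus "norm (g0 (qh y th0) + E (qh y th0)) < (k / 2) * r" using mult_pos_pos[OF k r(1)] by linarith
 qed
 have main: "(\<exists>!th. local_maximiser_in ?U (%th. L_hat R P Y n th (real n *\<^sub>R y)) th) &
    (\<exists>!th. local_maximiser_in ?U (%th. L P Ys n th (real n *\<^sub>R y)) th) &
    norm (the_local_maximiser_in ?U (%th. L_hat R P Y n th (real n *\<^sub>R y))
       - the_local_maximiser_in ?U (%th. L P Ys n th (real n *\<^sub>R y)))
     <= (2 * C / k) / (real n)\<^sup>2" if n: "n >= n0" and y: "y \<in> ?V" for n y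
 proof -
  note nb = big[OF n]
  let ?e = "%q. (1 / real n) *\<^sub>R e q"
  have k2: "k / 2 > 0" using k by simp
  have n1n: "n >= 1" using nb(1) n1 by simp
  have e1: "ALL q:Q. norm (?e q) <= C / real n"
  proof
   fix q assume "q \<in> Q"
   from divide_right_mono[OF e_le[OF this], of "real n"] show "norm (?e q) <= C / real n" using nb(2) by simp
  qed
  have e2: "ALL q:Q. ALL q':Q. norm (?e q - ?e q') <= C * dist q q' / real n"
  proof (intro ballI)
   fix q q' assume "q \<in> Q" "q' \<in> Q"
   from divide_right_mono[OF e_lip[OF this], of "real n"]
   show "norm (?e q - ?e q') <= C * dist q q' / real n" using nb(2) by (simp flip: scaleR_diff_right)
  qed
  have N1: "ALL q:Q. norm (N_n n q) <= C / real n" "ALL q:Q. ALL q':Q. norm (N_n n q - N_n n q') <= C * dist q q' / real n"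
   using N_le[OF nb(1)] N_lip[OF nb(1)] by blast+
  note fN = field[OF y n N1]
  note fe = field[OF y n e1 e2]
  obtain z where z: "z \<in> ?U" "g0 (qh y z) + N_n n (qh y z) = 0" "!!t. local_maximiser_in ?U (%th. L P Ys n th (real n *\<^sub>R y)) t \<longleftrightarrow> t = z"
   by (rule unique_local_maximiser[OF r(1) nb(2) k2 _ DlnL[OF nb(1) th yV[OF y]] fN])
     (use L_pos_log(1)[OF nb(1) th yV[OF y]] log_L_hat_eq(1)[OF qh(1)[OF th yV[OF y]] n1n] that in blast)+
  obtain z' where z': "z' \<in> ?U" "g0 (qh y z') + ?e (qh y z') = 0" "!!t. local_maximiser_in ?U (%th. L_hat R P Y n th (real n *\<^sub>R y)) t \<longleftrightarrow> t = z'"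
   by (rule unique_local_maximiser[OF r(1) nb(2) k2 _ DlnLh[OF nb(1) th yV[OF y]] fe])
     (use L_pos_log(1)[OF nb(1) th yV[OF y]] log_L_hat_eq(1)[OF qh(1)[OF th yV[OF y]] n1n] that in blast)+
  have zc: "z \<in> cball th0 r" "z' \<in> cball th0 r" using z(1) z'(1) by auto
  have qQ: "qh y z' \<in> Q" using qh[OF th[OF zc(2)] yV[OF y]] by blast
  define \<Delta> where "\<Delta> = z' - z"
  have "norm (N_n n (qh y z') - ?e (qh y z')) = norm ((1 / real n) *\<^sub>R (real n *\<^sub>R N_n n (qh y z') - e (qh y z')))"
   using nb(2) by (simp add: scaleR_diff_right)
  also have "... <= (1 / real n) * (C / real n)" unfolding norm_scaleR using N_e[OF nb(1) qQ] by (intro mult_mono) auto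
  finally have ne: "norm (N_n n (qh y z') - ?e (qh y z')) <= C / (real n)\<^sup>2" by (simp add: power2_eq_square)
  \<comment> \<open>At the zero \<open>z'\<close> of one gradient the other equals
    \<open>N_n - e / n\<close>, which is of order 1/n^2; strong monotonicity between
    \<open>z\<close> and \<open>z'\<close> turns this into a bound on their distance.\<close>
  have "g0 (qh y z') = - ?e (qh y z')" using z'(2) by (simp only: eq_neg_iff_add_eq_0)
  hence eqN: "(g0 (qh y z') + N_n n (qh y z')) - (g0 (qh y z) + N_n n (qh y z)) = N_n n (qh y z') - ?e (qh y z')"
   unfolding z(2) by simp
  have "(N_n n (qh y z') - ?e (qh y z')) \<bullet> \<Delta> <= - (k / 2) * (norm \<Delta>)\<^sup>2"
   using fN(2)[OF zc(2,1)] unfolding eqN \<Delta>_def .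
  hence "(k / 2) * (norm \<Delta>)\<^sup>2 <= - ((N_n n (qh y z') - ?e (qh y z')) \<bullet> \<Delta>)" by simp
  also have "... <= \<bar>(N_n n (qh y z') - ?e (qh y z')) \<bullet> \<Delta>\<bar>" by simp
  also have "... <= norm (N_n n (qh y z') - ?e (qh y z')) * norm \<Delta>" by (rule Cauchy_Schwarz_ineq2)
  also have "... <= C / (real n)\<^sup>2 * norm \<Delta>" by (intro mult_right_mono ne) simp
  finally have fin: "((k / 2) * norm \<Delta>) * norm \<Delta> <= C / (real n)\<^sup>2 * norm \<Delta>" by (simp add: power2_eq_square mult.assoc)
  have "(k / 2) * norm \<Delta> <= C / (real n)\<^sup>2"
  proof (cases "norm \<Delta> = 0")
   case False
   hence "norm \<Delta> > 0" by simp
   from mult_right_le_imp_le[OF fin this] show ?thesis .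
  qed (use C in simp)
  hence "norm \<Delta> <= (2 * C / k) / (real n)\<^sup>2" using k nb(2) by (simp add: field_simps)
  thus ?thesis
   using the_local_maximiser_eqI[OF z(3)] the_local_maximiser_eqI[OF z'(3)] by (simp add: \<Delta>_def)
 qed
 have "(s0, th) \<in> Q" if "th \<in> ?U" for th using that r r1 \<rho> by auto
 note sQ = this
 show ?thesis
 proof (intro exI[of _ n0] exI[of _ ?U] exI[of _ ?V] conjI ballI allI impI)
  show "?U \<subseteq> R" using S_D(1)[OF Q_S[OF sQ]] by blast
  show "(y, th) \<in> Y_dom R P Y" if "th \<in> ?U" "y \<in> ?V" for th y
  proof -
   have t: "th \<in> cball th0 r" using that(1) by auto
   have "qh y th \<in> S" "yq (qh y th) = y" using qh[OF th[OF t] yV[OF that(2)]] Q_S by auto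
   thus ?thesis unfolding Y_dom_def using grad_s_yq[of "qh y th"] by (auto simp: qh_def)
  qed
  show "EX f. continuous_density_of_sum P Ys n th f" if "n >= n0" "th \<in> ?U" for n th
   using tilted_density[OF sQ[OF that(2)] _ im[OF big(1)[OF that(1)] sQ[OF that(2)]]] that(1) n0 by auto
  show "EX C. ALL n>=n0. ALL y:?V.
    norm (the_local_maximiser_in ?U (%th. L_hat R P Y n th (real n *\<^sub>R y))
       - the_local_maximiser_in ?U (%th. L P Ys n th (real n *\<^sub>R y))) <= C / (real n)\<^sup>2"
   using main by blast
  show "\<exists>!th. local_maximiser_in ?U (%th. L_hat R P Y n th (real n *\<^sub>R y)) th" if "n >= n0" "y \<in> ?V" for n y
   using main[OF that] by blast
  show "\<exists>!th. local_maximiser_in ?U (%th. L P Ys n th (real n *\<^sub>R y)) th" if "n >= n0" "y \<in> ?V" for n y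
   using main[OF that] by blast
 qed (use n0 r r3 in auto)
qed

end

theorem theorem2:
 fixes R :: "(real ^ 'p) set"
  and P :: "real ^ 'p \<Rightarrow> 'w measure"
  and Y :: "real ^ 'p \<Rightarrow> 'w \<Rightarrow> real ^ 'd"
  and Ys :: "real ^ 'p \<Rightarrow> nat \<Rightarrow> 'w \<Rightarrow> real ^ 'd"
  and s0 y0 :: "real ^ 'd" and \<theta>0 :: "real ^ 'p"
 assumes "open R"
  and "\<And>\<theta>. \<theta> \<in> R \<Longrightarrow> prob_space (P \<theta>)"
  and "\<And>\<theta>. \<theta> \<in> R \<Longrightarrow> Y \<theta> \<in> borel_measurable (P \<theta>)"
  and "\<And>\<theta>. \<theta> \<in> R \<Longrightarrow> prob_space.indep_vars (P \<theta>) (\<lambda>_. borel) (Ys \<theta>) {1..}"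
  and "\<And>\<theta> i. \<theta> \<in> R \<Longrightarrow> i \<ge> 1 \<Longrightarrow> distr (P \<theta>) borel (Ys \<theta> i) = distr (P \<theta>) borel (Y \<theta>)"
  and "decay_condition R P Y"
  and "growth_condition R P Y"
  and "(s0, \<theta>0) \<in> interior (S_dom R P Y)"
  and "y0 = grad_s (K0 P Y) (s0, \<theta>0)"
  and "grad_th (K0 P Y) (s0, \<theta>0) = 0"
  and "negative_definite
      (hess_th (K0 P Y) (s0, \<theta>0)
       - transpose (mixed_s_th (K0 P Y) (s0, \<theta>0))
         ** matrix_inv (hess_s (K0 P Y) (s0, \<theta>0))
         ** mixed_s_th (K0 P Y) (s0, \<theta>0))"
 shows "\<exists>n0 U V. n0 \<ge> 1 \<and> open U \<and> \<theta>0 \<in> U \<and> U \<subseteq> R \<and> open V \<and> y0 \<in> V \<and>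
  (\<forall>\<theta>\<in>U. \<forall>y\<in>V. (y, \<theta>) \<in> Y_dom R P Y) \<and>
  (\<forall>n\<ge>n0. \<forall>\<theta>\<in>U. \<exists>f. continuous_density_of_sum P Ys n \<theta> f) \<and>
  (\<forall>n\<ge>n0. \<forall>y\<in>V.
    (\<exists>!\<theta>. local_maximiser_in U (\<lambda>\<theta>. L_hat R P Y n \<theta> (real n *\<^sub>R y)) \<theta>) \<and>
    (\<exists>!\<theta>. local_maximiser_in U (\<lambda>\<theta>. L P Ys n \<theta> (real n *\<^sub>R y)) \<theta>)) \<and>
  (\<exists>C. \<forall>n\<ge>n0. \<forall>y\<in>V.
    norm (the_local_maximiser_in U (\<lambda>\<theta>. L_hat R P Y n \<theta> (real n *\<^sub>R y))
       - the_local_maximiser_in U (\<lambda>\<theta>. L P Ys n \<theta> (real n *\<^sub>R y)))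
     \<le> C / (real n)\<^sup>2)"
proof -
 interpret cgf_model R P Y by (rule cgf_model.intro) (fact assms)+
 have q0: "(s0, \<theta>0) \<in> S" by (rule assms(8))
 obtain A B where AB: "open A" "open B" "(s0, \<theta>0) \<in> A \<times> B" "A \<times> B \<subseteq> S"
  using open_prod_elim[OF open_S q0] by blast
 obtain a b where ab: "a > 0" "cball s0 a \<subseteq> A" "b > 0" "cball \<theta>0 b \<subseteq> B"
 proof -
  have "s0 \<in> A" "\<theta>0 \<in> B" using AB(3) by auto
  hence "\<exists>a>0. cball s0 a \<subseteq> A" "\<exists>b>0. cball \<theta>0 b \<subseteq> B" using AB(1,2) unfolding open_contains_cball by blast+
  thus thesis using that by blast
 qed
 \<comment> \<open>The division by 5 provides the box of side \<open>5 * \<rho>\<close> that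
   \<open>local_cgf\<close> demands.\<close>
 define \<rho> where "\<rho> = min a b / 5"
 have \<rho>: "\<rho> > 0" "5 * \<rho> \<le> a" "5 * \<rho> \<le> b" using ab by (auto simp: \<rho>_def)
 have "cball s0 (5 * \<rho>) \<subseteq> A" "cball \<theta>0 (5 * \<rho>) \<subseteq> B" using ab \<rho> subset_cball order_trans by metis+
 hence box: "cball s0 (5 * \<rho>) \<times> cball \<theta>0 (5 * \<rho>) \<subseteq> S" using AB(4) by blast
 interpret iid_cgf R P Y s0 \<theta>0 \<rho> Ys
  by unfold_locales (fact \<rho>(1) box assms(4,5))+
 have "g0 (s0, \<theta>0) = 0" using assms(10) by (simp add: g0_def K0_derivatives[OF q0])
 moreover have "y0 = yq (s0, \<theta>0)" using assms(9) grad_s_yq[OF q0] by simp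
 moreover obtain C n1 c where "iid_asymptotics R P Y s0 \<theta>0 \<rho> Ys C n1 c" using iid_asymptotics_exist by blast
 then obtain C n1 e r B where "gradient_expansion R P Y s0 \<theta>0 \<rho> Ys C n1 e r B"
  using iid_asymptotics.gradient_expansion_exists by blast
 ultimately show ?thesis using gradient_expansion.likelihood_maximisers[OF _ _ assms(11)] by simp
qed

end
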